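(* Let $\phi:\Sigma^n\to\mathbb{S}^{n+1}$ (resp. $\phi:\Sigma^n\to\mathbb{H}^{n+1}$) be an immersed oriented hypersurface in the round unit sphere (resp. in hyperbolic space of curvature $-1$), with unit normal $N$ and principal curvatures $k_1,\dots,k_n$, and let $\Phi=\phi\wedge N$ be its Gauss map into the space of oriented geodesics $\mathbb{L}(\mathbb{S}^{n+1})$ (resp. $\mathbb{L}(\mathbb{H}^{n+1})$), assumed to be an immersion with non-degenerate induced metric $\Phi^*G$. Then $\Phi$ is a Hamiltonian minimal submanifold with respect to the Kähler (resp. para-Kähler) Einstein structure $(G,\mathbb{J})$ if and only if $\phi$ is a critical point of the functional $$\mathcal{W}(\phi)=\int_\Sigma\sqrt{\prod_{i=1}^n(1+k_i^2)}\;dV\qquad\Big(\text{resp. } \mathcal{W}(\phi)=\int_\Sigma\sqrt{\prod_{i=1}^n|1-k_i^2|}\;dV\Big),$$ where $dV$ is the volume element of the induced metric.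
   Context: Ambient model: for $0\le p\le n+2$ let $\langle\cdot,\cdot\rangle_p=-\sum_{i=1}^p dx_i^2+\sum_{i=p+1}^{n+2}dx_i^2$ on $\mathbb{R}^{n+2}$ and $\mathbb{S}^{n+1}_{p,1}=\{x:\langle x,x\rangle_p=1\}$. Then $\mathbb{S}^{n+1}=\mathbb{S}^{n+1}_{0,1}$, and $\mathbb{H}^{n+1}$ is a connected component of $\mathbb{S}^{n+1}_{n+1,1}$, whose induced metric is minus the hyperbolic metric. Put $p=0$, $\epsilon=1$ in the spherical case and $p=n+1$, $\epsilon=-1$ in the hyperbolic case. Space of oriented geodesics: it is the set of $x\wedge y\in\Lambda^2(\mathbb{R}^{n+2})$ with $x$ in $\mathbb{S}^{n+1}$ (resp. $\mathbb{H}^{n+1}$), $y$ tangent at $x$ and $\langle y,y\rangle_p=\epsilon$. The metric $G$ is the one induced by $\langle\langle x_1\wedge y_1,x_2\wedge y_2\rangle\rangle=\langle x_1,x_2\rangle_p\langle y_1,y_2\rangle_p-\langle x_1,y_2\rangle_p\langle x_2,y_1\rangle_p$. Tangent vectors at $x\wedge y$ (with $\langle x,x\rangle_p=1$, $\langle y,y\rangle_p=\epsilon$, $\langle x,y\rangle_p=0$) are $x\wedge X+y\wedge Y$ with $X,Y$ orthogonal to the plane spanned by $x,y$; the complex ($\epsilon=1$) or paracomplex ($\epsilon=-1$) structure is $\mathbb{J}(x\wedge X+y\wedge Y)=y\wedge X-\epsilon\,x\wedge Y$, and the symplectic form is $\Omega(\cdot,\cdot)=\epsilon G(\mathbb{J}\cdot,\cdot)$.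 $(G,\mathbb{J},\Omega)$ is Kähler Einstein (resp. para-Kähler Einstein). Gauss map: $\Phi=\phi\wedge N$, where $N$ is the unit normal, viewed in $\mathbb{R}^{n+2}$; it is Lagrangian for $\Omega$ when it is an immersion. Principal curvatures are the eigenvalues of the shape operator $A=-dN$. Hamiltonian minimality: a compactly supported variation $(\Phi_t)$ of a Lagrangian immersion $\Phi$ with non-degenerate $\Phi^*G$ is Hamiltonian if the normal component of $\partial_t\Phi_t|_{t=0}$ equals $\mathbb{J}\,d\Phi(\nabla u)$ for some compactly supported $u\in C^\infty(\Sigma)$, with $\nabla$ the gradient of $\Phi^*G$. $\Phi$ is Hamiltonian minimal if $\frac{d}{dt}\big|_{t=0}\mathrm{Vol}(\Phi_t)=0$ for every Hamiltonian variation, where $\mathrm{Vol}$ is the volume for $|\det\Phi_t^*G|^{1/2}$ (computed on a compact set containing the support of the variation). Equivalently $\operatorname{div}(\mathbb{J}H)=0$, with $H$ the mean curvature vector. Critical point: $\phi$ is a critical point of $\mathcal{W}$ if its first variation at $\phi$ vanishes along every compactly supported smooth variation of $\phi$ through immersions (integrals taken over a compact set containing the support). *)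

theory Defs
  imports "HOL-Analysis.Analysis"
begin

section \<open>Smooth functions on open subsets of Euclidean spaces\<close>

fun Ck_on :: "nat \<Rightarrow> ('a::euclidean_space \<Rightarrow> 'b::euclidean_space) \<Rightarrow> 'a set \<Rightarrow> bool" where
  "Ck_on 0 f S \<longleftrightarrow> continuous_on S f"
| "Ck_on (Suc k) f S \<longleftrightarrow>
     (\<forall>x\<in>S. f differentiable (at x)) \<and> (\<forall>v. Ck_on k (\<lambda>x. frechet_derivative f (at x) v) S)"

definition smooth_on :: "'a::euclidean_space set \<Rightarrow> ('a \<Rightarrow> 'b::euclidean_space) \<Rightarrow> bool" where
  "smooth_on S f \<longleftrightarrow> open S \<and> (\<forall>k. Ck_on k f S)"


section \<open>Oriented smooth manifolds\<close>

text \<open>The manifold is the whole type \<open>'m\<close> (Hausdorff and second countable by its type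
  classes), with an atlas of charts in \<open>real ^ 'n\<close>. A chart is a pair of its domain and the
  coordinate map.\<close>

type_synonym ('m, 'n) chart = "'m set \<times> ('m \<Rightarrow> real ^ 'n)"

abbreviation chart_dom :: "('m, 'n) chart \<Rightarrow> 'm set" where
  "chart_dom \<equiv> fst"

abbreviation coords :: "('m, 'n) chart \<Rightarrow> 'm \<Rightarrow> real ^ 'n" where
  "coords \<equiv> snd"

definition chart_inv :: "('m, 'n) chart \<Rightarrow> real ^ 'n \<Rightarrow> 'm" where
  "chart_inv c = inv_into (chart_dom c) (coords c)"

definition is_chart :: "('m::topological_space, 'n::finite) chart \<Rightarrow> bool" where
  "is_chart c \<longleftrightarrow> open (chart_dom c) \<and> open (coords c ` chart_dom c) \<and>
     homeomorphism (chart_dom c) (coords c ` chart_dom c) (coords c) (chart_inv c)"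

definition smooth_atlas :: "('m::topological_space, 'n::finite) chart set \<Rightarrow> bool" where
  "smooth_atlas A \<longleftrightarrow> (\<forall>c\<in>A. is_chart c) \<and> (\<Union>c\<in>A. chart_dom c) = UNIV \<and>
     (\<forall>c\<in>A. \<forall>d\<in>A. smooth_on (coords c ` (chart_dom c \<inter> chart_dom d)) (coords d \<circ> chart_inv c))"

definition oriented_atlas :: "('m::topological_space, 'n::finite) chart set \<Rightarrow> bool" where
  "oriented_atlas A \<longleftrightarrow> smooth_atlas A \<and>
     (\<forall>c\<in>A. \<forall>d\<in>A. \<forall>y\<in>coords c ` (chart_dom c \<inter> chart_dom d).
        0 < det (matrix (frechet_derivative (coords d \<circ> chart_inv c) (at y))))"

definition smooth_map ::
    "('m::topological_space, 'n::finite) chart set \<Rightarrow> ('m \<Rightarrow> 'e::euclidean_space) \<Rightarrow> bool" where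
  "smooth_map A f \<longleftrightarrow> (\<forall>c\<in>A. smooth_on (coords c ` chart_dom c) (f \<circ> chart_inv c))"

text \<open>The tangent space at \<open>x\<close> is identified with \<open>real ^ 'n\<close> through one chart around \<open>x\<close>,
  chosen once and for all. The pointwise notions below do not depend on this choice
  (the orientation of the unit normal because the atlas is oriented).\<close>

definition chart_at :: "('m, 'n) chart set \<Rightarrow> 'm \<Rightarrow> ('m, 'n) chart" where
  "chart_at A x = (SOME c. c \<in> A \<and> x \<in> chart_dom c)"

definition tangent_map ::
    "('m, 'n::finite) chart set \<Rightarrow> ('m \<Rightarrow> 'e::euclidean_space) \<Rightarrow> 'm \<Rightarrow> real ^ 'n \<Rightarrow> 'e" where
  "tangent_map A f x =
     frechet_derivative (f \<circ> chart_inv (chart_at A x)) (at (coords (chart_at A x) x))"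

definition immersion ::
    "('m::topological_space, 'n::finite) chart set \<Rightarrow> ('m \<Rightarrow> 'e::euclidean_space) \<Rightarrow> bool" where
  "immersion A f \<longleftrightarrow> smooth_map A f \<and> (\<forall>x. inj (tangent_map A f x))"


section \<open>Induced metrics and their volume\<close>

text \<open>\<open>b\<close> is a symmetric bilinear form on the target vector space; the induced metric is the
  pull-back of \<open>b\<close> by the map \<open>f\<close>.\<close>

definition gram :: "('e::euclidean_space \<Rightarrow> 'e \<Rightarrow> real) \<Rightarrow> ('m, 'n::finite) chart \<Rightarrow> ('m \<Rightarrow> 'e)
    \<Rightarrow> real ^ 'n \<Rightarrow> real ^ 'n ^ 'n" where
  "gram b c f y =
     (let D = frechet_derivative (f \<circ> chart_inv c) (at y)
      in (\<chi> i j. b (D (axis i 1)) (D (axis j 1))))"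

text \<open>The measure on the manifold with density \<open>|det f\<^sup>*b|\<^sup>1\<^sup>/\<^sup>2\<close> in every chart.\<close>

definition volume_measure :: "('m::{t2_space,second_countable_topology}, 'n::finite) chart set
    \<Rightarrow> ('e::euclidean_space \<Rightarrow> 'e \<Rightarrow> real) \<Rightarrow> ('m \<Rightarrow> 'e) \<Rightarrow> 'm measure" where
  "volume_measure A b f = (THE M. sets M = sets borel \<and>
     (\<forall>c\<in>A. \<forall>B\<in>sets borel. B \<subseteq> chart_dom c \<longrightarrow>
        emeasure M B = (\<integral>\<^sup>+ y\<in>coords c ` B. ennreal (sqrt \<bar>det (gram b c f y)\<bar>) \<partial>lborel)))"

definition nondegenerate_metric ::
    "('m, 'n::finite) chart set \<Rightarrow> ('e::euclidean_space \<Rightarrow> 'e \<Rightarrow> real) \<Rightarrow> ('m \<Rightarrow> 'e) \<Rightarrow> bool" where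
  "nondegenerate_metric A b f \<longleftrightarrow>
     (\<forall>x v. (\<forall>w. b (tangent_map A f x v) (tangent_map A f x w) = 0) \<longrightarrow> v = 0)"

definition metric_gradient :: "('m, 'n::finite) chart set \<Rightarrow> ('e::euclidean_space \<Rightarrow> 'e \<Rightarrow> real)
    \<Rightarrow> ('m \<Rightarrow> 'e) \<Rightarrow> ('m \<Rightarrow> real) \<Rightarrow> 'm \<Rightarrow> real ^ 'n" where
  "metric_gradient A b f u x =
     (THE w. \<forall>v. b (tangent_map A f x w) (tangent_map A f x v) = tangent_map A u x v)"

definition normal_component :: "('m, 'n::finite) chart set \<Rightarrow> ('e::euclidean_space \<Rightarrow> 'e \<Rightarrow> real)
    \<Rightarrow> ('m \<Rightarrow> 'e) \<Rightarrow> 'm \<Rightarrow> 'e \<Rightarrow> 'e" where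
  "normal_component A b f x V =
     (THE \<nu>. V - \<nu> \<in> range (tangent_map A f x) \<and> (\<forall>v. b \<nu> (tangent_map A f x v) = 0))"


section \<open>Compactly supported variations\<close>

text \<open>\<open>F t\<close> is relevant only for \<open>\<bar>t\<bar> < \<delta>\<close>; \<open>K\<close> is a compact set containing the support.\<close>

definition variation :: "('m::topological_space, 'n::finite) chart set \<Rightarrow> 'e::euclidean_space set
    \<Rightarrow> ('m \<Rightarrow> 'e) \<Rightarrow> real \<Rightarrow> 'm set \<Rightarrow> (real \<Rightarrow> 'm \<Rightarrow> 'e) \<Rightarrow> bool" where
  "variation A S f \<delta> K F \<longleftrightarrow> 0 < \<delta> \<and> compact K \<and> F 0 = f \<and>
     (\<forall>c\<in>A. smooth_on ({-\<delta><..<\<delta>} \<times> coords c ` chart_dom c) (\<lambda>(t, y). F t (chart_inv c y))) \<and>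
     (\<forall>t x. \<bar>t\<bar> < \<delta> \<longrightarrow> F t x \<in> S) \<and>
     (\<forall>t x. \<bar>t\<bar> < \<delta> \<longrightarrow> x \<notin> K \<longrightarrow> F t x = f x)"


section \<open>The two space forms\<close>

text \<open>\<open>\<real>\<^sup>n\<^sup>+\<^sup>2\<close> is \<open>real ^ ('n + 2)\<close>, where \<open>'n + 2\<close> is the disjoint sum of \<open>'n\<close> and the two-element
  numeral type; \<open>Inr 1\<close> is the last coordinate. Hyperbolic space is the sheet of
  \<open>\<langle>x,x\<rangle> = 1\<close>, for the form with one plus sign, on which the last coordinate is positive; its
  hyperbolic metric is minus the induced one, so that \<open>\<epsilon>\<close> times the form restricts to the
  Riemannian metric in both cases.\<close>

datatype space_form = Spherical | Hyperbolic

fun eps :: "space_form \<Rightarrow> real" where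
  "eps Spherical = 1"
| "eps Hyperbolic = -1"

fun signature :: "space_form \<Rightarrow> 'n::finite + 2 \<Rightarrow> real" where
  "signature Spherical i = 1"
| "signature Hyperbolic i = (if i = Inr 1 then 1 else -1)"

definition pinner :: "space_form \<Rightarrow> real ^ ('n::finite + 2) \<Rightarrow> real ^ ('n + 2) \<Rightarrow> real" where
  "pinner sf x y = (\<Sum>i\<in>UNIV. signature sf i * x $ i * y $ i)"

fun model_space :: "space_form \<Rightarrow> (real ^ ('n::finite + 2)) set" where
  "model_space Spherical = {x. pinner Spherical x x = 1}"
| "model_space Hyperbolic = {x. pinner Hyperbolic x x = 1 \<and> 0 < x $ Inr 1}"


section \<open>The space of oriented geodesics\<close>

text \<open>\<open>\<Lambda>\<^sup>2\<close> is realised as the space of skew-symmetric matrices.\<close>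

definition wedge :: "real ^ ('n::finite + 2) \<Rightarrow> real ^ ('n + 2) \<Rightarrow> real ^ ('n + 2) ^ ('n + 2)"
    (infixl \<open>\<^bold>\<and>\<close> 70) where
  "x \<^bold>\<and> y = (\<chi> i j. x $ i * y $ j - x $ j * y $ i)"

definition wedge_inner :: "space_form \<Rightarrow> real ^ ('n::finite + 2) ^ ('n + 2)
    \<Rightarrow> real ^ ('n + 2) ^ ('n + 2) \<Rightarrow> real" where
  "wedge_inner sf \<xi> \<zeta> =
     (\<Sum>i\<in>UNIV. \<Sum>j\<in>UNIV. signature sf i * signature sf j * \<xi> $ i $ j * \<zeta> $ i $ j) / 2"

lemma wedge_inner_wedge:
  fixes x1 y1 x2 y2 :: "real ^ ('n::finite + 2)"
  shows "wedge_inner sf (x1 \<^bold>\<and> y1) (x2 \<^bold>\<and> y2) =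
    pinner sf x1 x2 * pinner sf y1 y2 - pinner sf x1 y2 * pinner sf x2 y1"
proof -
  let ?s = "signature sf :: 'n + 2 \<Rightarrow> real"
  have prod: "pinner sf a b * pinner sf c d =
      (\<Sum>i\<in>UNIV. \<Sum>j\<in>UNIV. (?s i * a $ i * b $ i) * (?s j * c $ j * d $ j))"
    for a b c d :: "real ^ ('n + 2)"
    by (simp add: pinner_def sum_product)
  have "2 * wedge_inner sf (x1 \<^bold>\<and> y1) (x2 \<^bold>\<and> y2) =
      pinner sf x1 x2 * pinner sf y1 y2 - pinner sf x1 y2 * pinner sf y1 x2
      - pinner sf y1 x2 * pinner sf x1 y2 + pinner sf y1 y2 * pinner sf x1 x2"
    unfolding prod wedge_inner_def wedge_def
    by (simp add: sum.distrib[symmetric] sum_subtractf[symmetric] algebra_simps)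
  moreover have "pinner sf y1 x2 = pinner sf x2 y1"
    by (simp add: pinner_def mult.commute mult.left_commute)
  ultimately show ?thesis
    by (simp add: algebra_simps)
qed

definition geodesic_space :: "space_form \<Rightarrow> (real ^ ('n::finite + 2) ^ ('n + 2)) set" where
  "geodesic_space sf =
     {x \<^bold>\<and> y |x y. x \<in> model_space sf \<and> pinner sf x y = 0 \<and> pinner sf y y = eps sf}"

text \<open>\<open>\<xi>\<close> is a point of the space of oriented geodesics and \<open>Z\<close> a tangent vector at \<open>\<xi>\<close>.\<close>

definition J_structure :: "space_form \<Rightarrow> real ^ ('n::finite + 2) ^ ('n + 2)
    \<Rightarrow> real ^ ('n + 2) ^ ('n + 2) \<Rightarrow> real ^ ('n + 2) ^ ('n + 2)" where
  "J_structure sf \<xi> Z = (THE W. \<exists>x y X Y.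
     x \<in> model_space sf \<and> pinner sf x y = 0 \<and> pinner sf y y = eps sf \<and> \<xi> = x \<^bold>\<and> y \<and>
     pinner sf x X = 0 \<and> pinner sf y X = 0 \<and> pinner sf x Y = 0 \<and> pinner sf y Y = 0 \<and>
     Z = x \<^bold>\<and> X + y \<^bold>\<and> Y \<and> W = y \<^bold>\<and> X - eps sf *\<^sub>R (x \<^bold>\<and> Y))"

definition Omega :: "space_form \<Rightarrow> real ^ ('n::finite + 2) ^ ('n + 2)
    \<Rightarrow> real ^ ('n + 2) ^ ('n + 2) \<Rightarrow> real ^ ('n + 2) ^ ('n + 2) \<Rightarrow> real" where
  "Omega sf \<xi> Z Z' = eps sf * wedge_inner sf (J_structure sf \<xi> Z) Z'"

text \<open>The dimension condition for Lagrangian immersions is built into the types: the manifold has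
  dimension \<open>CARD('n)\<close> and the space of oriented geodesics has dimension \<open>2 * CARD('n)\<close>.\<close>

definition lagrangian_immersion :: "('m::topological_space, 'n::finite) chart set \<Rightarrow> space_form
    \<Rightarrow> ('m \<Rightarrow> real ^ ('n + 2) ^ ('n + 2)) \<Rightarrow> bool" where
  "lagrangian_immersion A sf \<Phi> \<longleftrightarrow> immersion A \<Phi> \<and> range \<Phi> \<subseteq> geodesic_space sf \<and>
     (\<forall>x v w. Omega sf (\<Phi> x) (tangent_map A \<Phi> x v) (tangent_map A \<Phi> x w) = 0)"

definition hamiltonian_variation :: "('m::topological_space, 'n::finite) chart set \<Rightarrow> space_form
    \<Rightarrow> ('m \<Rightarrow> real ^ ('n + 2) ^ ('n + 2)) \<Rightarrow> real \<Rightarrow> 'm set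
    \<Rightarrow> (real \<Rightarrow> 'm \<Rightarrow> real ^ ('n + 2) ^ ('n + 2)) \<Rightarrow> bool" where
  "hamiltonian_variation A sf \<Phi> \<delta> K F \<longleftrightarrow> variation A (geodesic_space sf) \<Phi> \<delta> K F \<and>
     (\<exists>u::'m \<Rightarrow> real. smooth_map A u \<and> (\<exists>C. compact C \<and> (\<forall>x. x \<notin> C \<longrightarrow> u x = 0)) \<and>
        (\<forall>x. normal_component A (wedge_inner sf) \<Phi> x (vector_derivative (\<lambda>t. F t x) (at 0)) =
             J_structure sf (\<Phi> x)
               (tangent_map A \<Phi> x (metric_gradient A (wedge_inner sf) \<Phi> u x))))"

definition hamiltonian_minimal :: "('m::{t2_space,second_countable_topology}, 'n::finite) chart set
    \<Rightarrow> space_form \<Rightarrow> ('m \<Rightarrow> real ^ ('n + 2) ^ ('n + 2)) \<Rightarrow> bool" where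
  "hamiltonian_minimal A sf \<Phi> \<longleftrightarrow>
     lagrangian_immersion A sf \<Phi> \<and> nondegenerate_metric A (wedge_inner sf) \<Phi> \<and>
     (\<forall>\<delta> K F. hamiltonian_variation A sf \<Phi> \<delta> K F \<longrightarrow>
        ((\<lambda>t. measure (volume_measure A (wedge_inner sf) (F t)) K) has_real_derivative 0) (at 0))"


section \<open>Oriented hypersurfaces of the space forms\<close>

definition immersed_hypersurface :: "('m::topological_space, 'n::finite) chart set \<Rightarrow> space_form
    \<Rightarrow> ('m \<Rightarrow> real ^ ('n + 2)) \<Rightarrow> bool" where
  "immersed_hypersurface A sf \<phi> \<longleftrightarrow> immersion A \<phi> \<and> range \<phi> \<subseteq> model_space sf"

text \<open>The unit normal is tangent to the space form, unit for its Riemannian metric \<open>\<epsilon>\<langle>\<cdot>,\<cdot>\<rangle>\<close>, and chosen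
  so that \<open>(d\<phi>(e\<^sub>1), \<dots>, d\<phi>(e\<^sub>n), \<phi>, N)\<close> is a positive basis for \<open>(e\<^sub>1, \<dots>, e\<^sub>n)\<close> positive. Rows
  and columns carry the same index type, so the sign of the determinant needs no order on \<open>'n\<close>.\<close>

definition unit_normal :: "('m, 'n::finite) chart set \<Rightarrow> space_form
    \<Rightarrow> ('m \<Rightarrow> real ^ ('n + 2)) \<Rightarrow> 'm \<Rightarrow> real ^ ('n + 2)" where
  "unit_normal A sf \<phi> x = (THE \<nu>.
     pinner sf (\<phi> x) \<nu> = 0 \<and> (\<forall>v. pinner sf (tangent_map A \<phi> x v) \<nu> = 0) \<and>
     pinner sf \<nu> \<nu> = eps sf \<and>
     0 < det (\<chi> r s. case s of
           Inl i \<Rightarrow> tangent_map A \<phi> x (axis i 1) $ r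
         | Inr j \<Rightarrow> (if j = 0 then \<phi> x $ r else \<nu> $ r)))"

definition gauss_map :: "('m, 'n::finite) chart set \<Rightarrow> space_form
    \<Rightarrow> ('m \<Rightarrow> real ^ ('n + 2)) \<Rightarrow> 'm \<Rightarrow> real ^ ('n + 2) ^ ('n + 2)" where
  "gauss_map A sf \<phi> x = \<phi> x \<^bold>\<and> unit_normal A sf \<phi> x"

definition shape_operator :: "('m, 'n::finite) chart set \<Rightarrow> space_form
    \<Rightarrow> ('m \<Rightarrow> real ^ ('n + 2)) \<Rightarrow> 'm \<Rightarrow> real ^ 'n \<Rightarrow> real ^ 'n" where
  "shape_operator A sf \<phi> x v =
     (THE w. tangent_map A \<phi> x w = - tangent_map A (unit_normal A sf \<phi>) x v)"

definition principal_curvatures :: "('m, 'n::finite) chart set \<Rightarrow> space_form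
    \<Rightarrow> ('m \<Rightarrow> real ^ ('n + 2)) \<Rightarrow> 'm \<Rightarrow> real set" where
  "principal_curvatures A sf \<phi> x = {k. \<exists>v. v \<noteq> 0 \<and> shape_operator A sf \<phi> x v = k *\<^sub>R v}"

definition curvature_multiplicity :: "('m, 'n::finite) chart set \<Rightarrow> space_form
    \<Rightarrow> ('m \<Rightarrow> real ^ ('n + 2)) \<Rightarrow> 'm \<Rightarrow> real \<Rightarrow> nat" where
  "curvature_multiplicity A sf \<phi> x k = dim {v. shape_operator A sf \<phi> x v = k *\<^sub>R v}"

fun W_factor :: "space_form \<Rightarrow> real \<Rightarrow> real" where
  "W_factor Spherical k = 1 + k\<^sup>2"
| "W_factor Hyperbolic k = \<bar>1 - k\<^sup>2\<bar>"

text \<open>The contribution of the compact set \<open>K\<close> to the functional; the product over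
  \<open>k\<^sub>1, \<dots>, k\<^sub>n\<close> is taken over the distinct principal curvatures, with multiplicities as exponents.\<close>

definition W_functional :: "('m::{t2_space,second_countable_topology}, 'n::finite) chart set
    \<Rightarrow> space_form \<Rightarrow> 'm set \<Rightarrow> ('m \<Rightarrow> real ^ ('n + 2)) \<Rightarrow> real" where
  "W_functional A sf K \<phi> =
     (LINT x:K|volume_measure A (\<lambda>v w. eps sf * pinner sf v w) \<phi>.
        sqrt (\<Prod>k\<in>principal_curvatures A sf \<phi> x.
                W_factor sf k ^ curvature_multiplicity A sf \<phi> x k))"

definition W_critical :: "('m::{t2_space,second_countable_topology}, 'n::finite) chart set
    \<Rightarrow> space_form \<Rightarrow> ('m \<Rightarrow> real ^ ('n + 2)) \<Rightarrow> bool" where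
  "W_critical A sf \<phi> \<longleftrightarrow>
     (\<forall>\<delta> K F. variation A (model_space sf) \<phi> \<delta> K F \<and> (\<forall>t. \<bar>t\<bar> < \<delta> \<longrightarrow> immersion A (F t)) \<longrightarrow>
        ((\<lambda>t. W_functional A sf K (F t)) has_real_derivative 0) (at 0))"

end

theory Submission imports Defs begin

text \<open>With the induced Riemannian metric \<open>g\<close> and the shape operator \<open>A\<close> of \<open>\<phi>\<close>, the metric induced by
  the Gauss map is \<open>g + \<epsilon> g(A\<cdot>, A\<cdot>)\<close>, so that \<open>Vol(\<Phi>) = \<W>(\<phi>)\<close>. If \<open>\<phi>\<^sub>t\<close> is a variation of \<open>\<phi>\<close> through immersions,
  then its Gauss maps form a Hamiltonian variation whose Hamiltonian is, up to sign, the normal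
  speed of \<open>\<phi>\<^sub>t\<close>; and every compactly supported function is the normal speed of such a variation.
  An arbitrary Hamiltonian variation of \<open>\<Phi>\<close> has the same normal velocity as one of these, and the
  first variation of the volume depends on the normal part of the velocity only, because a tangential
  velocity changes the volume density by a divergence.\<close>

text \<open>The metric induced by \<open>\<Phi>\<close> may be indefinite, and a Hamiltonian
  variation of \<open>\<Phi>\<close> need not consist of Gauss maps. So no Euler-Lagrange equation
  is computed: the two first variations are compared as derivatives of integrals of chart densities.
  The functionals agree because the shape operator is self-adjoint for the positive definite metric
  of the hypersurface, which makes \<open>1 + eps A^2\<close> diagonal with entries
  \<open>1 + eps k^2\<close>. The gradient is right because differentiating
  \<open><N_t, d\<phi>_t> = 0\<close> in t expresses the differential of the normal speed by the
  velocities of \<open>\<phi>_t\<close> and \<open>N_t\<close>. The divergence integrates to zero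
  after localisation by functions \<rho> that sum to 1 near the support: each localised divergence
  has integral zero, and the remaining terms d\<rho>(Z) add up to the differential of a constant.
  Only one derivative falls on \<rho>, so class C^1 suffices. Since the Hamiltonian is
  \<open>- <velocity, N>\<close> and \<open><N, N> = eps\<close>, a function u is realised by the
  normal speed \<open>- eps u\<close>.\<close>

section \<open>Maps of class C^k between Euclidean spaces\<close>

lemma frechet_derivative_apply:
  assumes "(f has_derivative f') (at x)"
  shows "frechet_derivative f (at x) = f'"
  using frechet_derivative_at[OF assms] by simp

lemma Ck_on_cong:
  assumes "open S" "\<And>x. x \<in> S \<Longrightarrow> f x = g x"
  shows "Ck_on k f S \<longleftrightarrow> Ck_on k g S"
  using assms(2)
proof (induction k arbitrary: f g)
  case 0
  then show ?case by (simp cong: continuous_on_cong)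
next
  case (Suc k)
  have ev: "\<forall>\<^sub>F y in nhds x. f y = g y" if "x \<in> S" for x
    using Suc.prems assms(1) that by (auto simp: eventually_nhds)
  have der: "(f has_derivative D) (at x) \<longleftrightarrow> (g has_derivative D) (at x)" if "x \<in> S" for x D
    using that Suc.prems assms(1) by (metis has_derivative_transform_within_open)
  have d: "f differentiable (at x) \<longleftrightarrow> g differentiable (at x)" if "x \<in> S" for x
    using der[OF that] by (auto simp: differentiable_def)
  have "frechet_derivative f (at x) = frechet_derivative g (at x)" if "x \<in> S" for x
    using der[OF that] by (simp add: frechet_derivative_def)
  then have "Ck_on k (\<lambda>x. frechet_derivative f (at x) v) S
      \<longleftrightarrow> Ck_on k (\<lambda>x. frechet_derivative g (at x) v) S" for v
    by (intro Suc.IH) auto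
  with d show ?case by auto
qed

lemma Ck_on_subset: "Ck_on k f S \<Longrightarrow> T \<subseteq> S \<Longrightarrow> Ck_on k f T"
  by (induction k arbitrary: f) (auto intro: continuous_on_subset)

lemma Ck_on_imp_continuous_on: "Ck_on k f S \<Longrightarrow> continuous_on S f"
  by (cases k) (auto intro!: differentiable_imp_continuous_within continuous_at_imp_continuous_on)

lemma Ck_on_Suc_imp: "Ck_on (Suc k) f S \<Longrightarrow> Ck_on k f S"
proof (induction k arbitrary: f)
  case 0
  then show ?case using Ck_on_imp_continuous_on[OF 0] by simp
next
  case (Suc k)
  then show ?case by (metis Ck_on.simps(2))
qed

text \<open>Induction on k closes as soon as an explicit derivative is built from functions already
  covered by the induction hypothesis; the closure rules below are proved in this form.\<close>

lemma Ck_on_SucI: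
  assumes "open S"
    and "\<And>x. x \<in> S \<Longrightarrow> (f has_derivative f' x) (at x)"
    and "\<And>v. Ck_on k (\<lambda>x. f' x v) S"
  shows "Ck_on (Suc k) f S"
proof -
  have "Ck_on k (\<lambda>x. frechet_derivative f (at x) v) S" for v
    using assms(3)[of v] frechet_derivative_apply[OF assms(2)]
    by (subst Ck_on_cong[OF assms(1), of _ "\<lambda>x. f' x v"]) auto
  then show ?thesis using assms(2) by (auto simp: differentiable_def)
qed

lemma Ck_on_const: "Ck_on k (\<lambda>x. c) S"
  by (induction k arbitrary: c) (auto simp: frechet_derivative_const)

lemma Ck_on_bounded_linear:
  assumes "open S" "Ck_on k f S" "bounded_linear L"
  shows "Ck_on k (\<lambda>x. L (f x)) S"
  using assms(2)
proof (induction k arbitrary: f)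
  case 0
  then show ?case using assms(3) by (auto intro: bounded_linear.continuous_on)
next
  case (Suc k)
  show ?case
  proof (rule Ck_on_SucI[OF assms(1)])
    show "((\<lambda>x. L (f x)) has_derivative (\<lambda>v. L (frechet_derivative f (at x) v))) (at x)" if "x \<in> S" for x
      using Suc.prems that
      by (auto intro!: bounded_linear.has_derivative[OF assms(3)] simp: frechet_derivative_works)
    show "Ck_on k (\<lambda>x. L (frechet_derivative f (at x) v)) S" for v
      using Suc by auto
  qed
qed

lemma Ck_on_id: "open S \<Longrightarrow> Ck_on k (\<lambda>x. x) S"
  by (cases k) (auto intro!: Ck_on_SucI[where f'="\<lambda>x v. v"] Ck_on_const simp del: Ck_on.simps(2))

lemma Ck_on_linear: "open S \<Longrightarrow> bounded_linear L \<Longrightarrow> Ck_on k L S"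
  using Ck_on_bounded_linear[OF _ Ck_on_id] by blast

lemma Ck_on_add:
  assumes "open S" "Ck_on k f S" "Ck_on k g S"
  shows "Ck_on k (\<lambda>x. f x + g x) S"
  using assms(2,3)
proof (induction k arbitrary: f g)
  case 0
  then show ?case by (auto intro: continuous_intros)
next
  case (Suc k)
  show ?case
  proof (rule Ck_on_SucI[OF assms(1)])
    show "((\<lambda>x. f x + g x) has_derivative
        (\<lambda>v. frechet_derivative f (at x) v + frechet_derivative g (at x) v)) (at x)" if "x \<in> S" for x
      using Suc.prems that by (auto intro!: has_derivative_add simp: frechet_derivative_works)
  qed (use Suc in auto)
qed

lemma Ck_on_sum:
  assumes "open S" "\<And>i. i \<in> I \<Longrightarrow> Ck_on k (f i) S"
  shows "Ck_on k (\<lambda>x. \<Sum>i\<in>I. f i x) S"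
  using assms(2)
  by (induction I rule: infinite_finite_induct) (auto intro: Ck_on_add[OF assms(1)] Ck_on_const)

lemma Ck_on_bilinear:
  assumes "open S" "bounded_bilinear B" "Ck_on k f S" "Ck_on k g S"
  shows "Ck_on k (\<lambda>x. B (f x) (g x)) S"
  using assms(3,4)
proof (induction k arbitrary: f g)
  case 0
  then show ?case using assms(2) by (auto intro: bounded_bilinear.continuous_on)
next
  case (Suc k)
  have k: "Ck_on k f S" "Ck_on k g S" using Suc.prems Ck_on_Suc_imp by blast+
  show ?case
  proof (rule Ck_on_SucI[OF assms(1)])
    show "((\<lambda>x. B (f x) (g x)) has_derivative
        (\<lambda>v. B (f x) (frechet_derivative g (at x) v) + B (frechet_derivative f (at x) v) (g x))) (at x)"
      if "x \<in> S" for x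
      using Suc.prems that
      by (auto intro!: bounded_bilinear.FDERIV[OF assms(2)] simp: frechet_derivative_works)
    show "Ck_on k (\<lambda>x. B (f x) (frechet_derivative g (at x) v) + B (frechet_derivative f (at x) v) (g x)) S" for v
      using Suc k by (intro Ck_on_add[OF assms(1)]) auto
  qed
qed

lemma Ck_on_compose:
  assumes "open S" "open T" "Ck_on k f S" "Ck_on k g T" "f ` S \<subseteq> T"
  shows "Ck_on k (\<lambda>x. g (f x)) S"
  using assms(3,4)
proof (induction k arbitrary: g)
  case 0
  then show ?case using continuous_on_compose2 assms(5) by auto
next
  case (Suc k)
  have k: "Ck_on k f S" using Suc.prems Ck_on_Suc_imp by blast
  define G where "G = (\<lambda>x b. frechet_derivative g (at (f x)) b)"
  \<comment> \<open>\<open>Ck_on\<close> controls derivatives in fixed directions only, while the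
    chain rule evaluates the derivative of g in the moving direction Df(x)v. Expanding that
    direction in \<open>Basis\<close> leaves fixed directions with coefficients of class
    C^k.\<close>
  define D where "D = (\<lambda>x v. \<Sum>b\<in>Basis. (frechet_derivative f (at x) v \<bullet> b) *\<^sub>R G x b)"
  have 1: "((\<lambda>x. g (f x)) has_derivative D x) (at x)" if x: "x \<in> S" for x
  proof -
    from x have fx: "f x \<in> T" using assms by blast
    have f: "(f has_derivative frechet_derivative f (at x)) (at x)"
      and g: "(g has_derivative G x) (at (f x))"
      using Suc.prems x fx by (auto simp: frechet_derivative_works G_def)
    have lin: "linear (G x)"
      using g has_derivative_linear by blast
    have D: "D x v = G x (frechet_derivative f (at x) v)" for v
      unfolding D_def linear_scale[OF lin, symmetric] linear_sum[OF lin, symmetric]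
        euclidean_representation ..
    have "D x = G x \<circ> frechet_derivative f (at x)"
      by (rule ext) (simp add: D)
    with diff_chain_at[OF f g] show ?thesis by (simp add: o_def)
  qed
  have 2: "Ck_on k (\<lambda>x. D x v) S" for v
    unfolding D_def
  proof (rule Ck_on_sum[OF assms(1)], rule Ck_on_bilinear[OF assms(1) bounded_bilinear_scaleR])
    show "Ck_on k (\<lambda>x. frechet_derivative f (at x) v \<bullet> b) S" for b
      using Suc.prems by (intro Ck_on_bounded_linear[OF assms(1) _ bounded_linear_inner_left]) auto
    show "Ck_on k (\<lambda>x. G x b) S" for b
      unfolding G_def using Suc.prems by (auto intro!: Suc.IH[OF k, of "\<lambda>y. frechet_derivative g (at y) b"])
  qed
  from Ck_on_SucI[OF assms(1) 1 2] show ?case .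
qed

text \<open>The derivative is a polynomial in \<open>inverse\<close> itself, so the induction
  reproduces its own hypothesis.\<close>

lemma Ck_on_inverse_pos:
  fixes S :: "real set"
  assumes "open S" "0 \<notin> S"
  shows "Ck_on k inverse S"
proof (induction k)
  case 0
  then show ?case using assms by (auto intro!: continuous_intros)
next
  case (Suc k)
  show ?case
  proof (rule Ck_on_SucI[OF assms(1)])
    show "(inverse has_derivative (\<lambda>v. - (inverse x * v * inverse x))) (at x)" if "x \<in> S" for x
      using that assms by (intro has_derivative_inverse') auto
    have "Ck_on k (\<lambda>x. (-v) *\<^sub>R (inverse x * inverse x)) S" for v
      by (rule Ck_on_bounded_linear[OF assms(1) Ck_on_bilinear[OF assms(1) bounded_bilinear_mult Suc Suc]
            bounded_linear_scaleR_right])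
    then show "Ck_on k (\<lambda>x. - (inverse x * v * inverse x)) S" for v
      by (simp add: mult_ac)
  qed
qed

text \<open>The derivative is \<open>inverse\<close> composed with \<open>sqrt\<close>, hence of
  class C^k by the induction hypothesis and the previous lemma.\<close>

lemma Ck_on_sqrt_pos:
  fixes S :: "real set"
  assumes "open S" "\<And>x. x \<in> S \<Longrightarrow> 0 < x"
  shows "Ck_on k sqrt S"
proof (induction k)
  case 0
  then show ?case by (auto intro!: continuous_intros)
next
  case (Suc k)
  show ?case
  proof (rule Ck_on_SucI[OF assms(1)])
    show "(sqrt has_derivative (\<lambda>v. (inverse (sqrt x) / 2) * v)) (at x)" if "x \<in> S" for x
      using DERIV_real_sqrt[of x] assms(2)[OF that] unfolding has_field_derivative_def by blast
    have "Ck_on k (\<lambda>x. inverse (sqrt x)) S"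
      by (rule Ck_on_compose[OF assms(1) _ Suc Ck_on_inverse_pos[of "{0<..}"]]) (use assms in auto)
    from Ck_on_bounded_linear[OF assms(1) this bounded_linear_scaleR_right]
    show "Ck_on k (\<lambda>x. (inverse (sqrt x) / 2) * v) S" for v
      by (metis (no_types, lifting) ext real_scaleR_def mult.commute times_divide_eq_left)
  qed
qed

section \<open>Closure properties of smooth maps\<close>

lemma smooth_onD_open: "smooth_on S f \<Longrightarrow> open S"
  and smooth_on_Ck: "smooth_on S f \<Longrightarrow> Ck_on k f S"
  by (auto simp: smooth_on_def)

lemma smooth_on_cong: "smooth_on S f \<Longrightarrow> (\<And>x. x \<in> S \<Longrightarrow> f x = g x) \<Longrightarrow> smooth_on S g"
  using Ck_on_cong[of S f g] by (auto simp: smooth_on_def)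

lemma smooth_on_subset: "smooth_on S f \<Longrightarrow> T \<subseteq> S \<Longrightarrow> open T \<Longrightarrow> smooth_on T f"
  unfolding smooth_on_def using Ck_on_subset by blast

lemma smooth_on_const: "open S \<Longrightarrow> smooth_on S (\<lambda>x. c)"
  by (auto simp: smooth_on_def intro: Ck_on_const)

lemma smooth_on_bounded_linear: "smooth_on S f \<Longrightarrow> bounded_linear L \<Longrightarrow> smooth_on S (\<lambda>x. L (f x))"
  by (auto simp: smooth_on_def intro: Ck_on_bounded_linear)

lemma smooth_on_linear: "open S \<Longrightarrow> bounded_linear L \<Longrightarrow> smooth_on S L"
  by (auto simp: smooth_on_def intro: Ck_on_linear)

lemma smooth_on_add: "smooth_on S f \<Longrightarrow> smooth_on S g \<Longrightarrow> smooth_on S (\<lambda>x. f x + g x)"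
  by (auto simp: smooth_on_def intro: Ck_on_add)

lemma smooth_on_sum: "open S \<Longrightarrow> (\<And>i. i \<in> I \<Longrightarrow> smooth_on S (f i)) \<Longrightarrow> smooth_on S (\<lambda>x. \<Sum>i\<in>I. f i x)"
  by (auto simp: smooth_on_def intro: Ck_on_sum)

lemma smooth_on_bilinear:
  "bounded_bilinear B \<Longrightarrow> smooth_on S f \<Longrightarrow> smooth_on S g \<Longrightarrow> smooth_on S (\<lambda>x. B (f x) (g x))"
  by (auto simp: smooth_on_def intro: Ck_on_bilinear)

lemmas smooth_on_mult = smooth_on_bilinear[OF bounded_bilinear_mult]
lemmas smooth_on_scaleR = smooth_on_bilinear[OF bounded_bilinear_scaleR]

lemma smooth_on_minus: "smooth_on S f \<Longrightarrow> smooth_on S (\<lambda>x. - f x)"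
  using smooth_on_bounded_linear[OF _ bounded_linear_minus[OF bounded_linear_ident]] .

lemma smooth_on_diff: "smooth_on S f \<Longrightarrow> smooth_on S g \<Longrightarrow> smooth_on S (\<lambda>x. f x - g x)"
  using smooth_on_add[OF _ smooth_on_minus] by fastforce

lemma smooth_on_compose:
  "smooth_on S f \<Longrightarrow> smooth_on T g \<Longrightarrow> f ` S \<subseteq> T \<Longrightarrow> smooth_on S (\<lambda>x. g (f x))"
  unfolding smooth_on_def by (blast intro: Ck_on_compose)

lemma smooth_on_prod:
  fixes f :: "'i \<Rightarrow> 'a::euclidean_space \<Rightarrow> real"
  assumes "open S" "\<And>i. i \<in> I \<Longrightarrow> smooth_on S (f i)"
  shows "smooth_on S (\<lambda>x. \<Prod>i\<in>I. f i x)"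
  using assms(2)
  by (induction I rule: infinite_finite_induct)
    (auto intro: smooth_on_mult smooth_on_const[OF assms(1)])

lemma smooth_on_inverse:
  fixes f :: "'a::euclidean_space \<Rightarrow> real"
  assumes "smooth_on S f" "\<And>x. x \<in> S \<Longrightarrow> f x \<noteq> 0"
  shows "smooth_on S (\<lambda>x. inverse (f x))"
  by (rule smooth_on_compose[OF assms(1), where T="-{0}"])
    (use assms(2) in \<open>auto simp: smooth_on_def intro!: Ck_on_inverse_pos\<close>)

lemma smooth_on_divide:
  fixes f :: "'a::euclidean_space \<Rightarrow> real"
  assumes "smooth_on S f" "smooth_on S g" "\<And>x. x \<in> S \<Longrightarrow> g x \<noteq> 0"
  shows "smooth_on S (\<lambda>x. f x / g x)"
  using smooth_on_mult[OF assms(1) smooth_on_inverse[OF assms(2,3)]] by (simp add: field_simps)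

lemma smooth_on_sqrt:
  fixes f :: "'a::euclidean_space \<Rightarrow> real"
  assumes "smooth_on S f" "\<And>x. x \<in> S \<Longrightarrow> 0 < f x"
  shows "smooth_on S (\<lambda>x. sqrt (f x))"
  by (rule smooth_on_compose[OF assms(1), where T="{0<..}"])
    (use assms(2) in \<open>auto simp: smooth_on_def intro!: Ck_on_sqrt_pos\<close>)

lemma smooth_on_componentwise:
  assumes "open S" "\<And>b. b \<in> Basis \<Longrightarrow> smooth_on S (\<lambda>x. f x \<bullet> b)"
  shows "smooth_on S f"
proof -
  have "smooth_on S (\<lambda>x. \<Sum>b\<in>Basis. (f x \<bullet> b) *\<^sub>R b)"
    using assms by (intro smooth_on_sum smooth_on_scaleR smooth_on_const) auto
  then show ?thesis by (simp add: euclidean_representation)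
qed

lemma smooth_on_vec:
  fixes f :: "'a::euclidean_space \<Rightarrow> 'b::euclidean_space ^ 'n"
  assumes "open S" "\<And>i. smooth_on S (\<lambda>x. f x $ i)"
  shows "smooth_on S f"
proof (rule smooth_on_componentwise[OF assms(1)])
  fix b :: "'b ^ 'n" assume "b \<in> Basis"
  then obtain i c where b: "b = axis i c" "c \<in> Basis" by (auto simp: Basis_vec_def)
  show "smooth_on S (\<lambda>x. f x \<bullet> b)"
    unfolding b inner_axis by (rule smooth_on_bounded_linear[OF assms(2) bounded_linear_inner_left])
qed

lemma smooth_on_vec_nth:
  fixes f :: "'a::euclidean_space \<Rightarrow> 'b::euclidean_space ^ 'n"
  shows "smooth_on S f \<Longrightarrow> smooth_on S (\<lambda>x. f x $ i)"
  by (erule smooth_on_bounded_linear) (rule bounded_linear_vec_nth)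

lemma smooth_on_Pair:
  assumes "smooth_on S f" "smooth_on S g"
  shows "smooth_on S (\<lambda>x. (f x, g x))"
proof -
  have "smooth_on S (\<lambda>x. (f x, 0) + (0, g x))"
    by (rule smooth_on_add[OF smooth_on_bounded_linear[OF assms(1), of "\<lambda>y. (y, 0)"]
        smooth_on_bounded_linear[OF assms(2), of "\<lambda>y. (0, y)"]])
      (intro bounded_linear_Pair bounded_linear_ident bounded_linear_zero)+
  then show ?thesis by simp
qed

lemma smooth_on_det:
  fixes f :: "'a::euclidean_space \<Rightarrow> real ^ 'n ^ 'n"
  assumes "smooth_on S f"
  shows "smooth_on S (\<lambda>x. det (f x))"
proof -
  note S = smooth_onD_open[OF assms]
  have "smooth_on S (\<lambda>x. \<Prod>i\<in>UNIV. f x $ i $ p i)" for p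
    by (rule smooth_on_prod[OF S]) (rule smooth_on_vec_nth[OF smooth_on_vec_nth[OF assms]])
  then have "smooth_on S (\<lambda>x. of_int (sign p) * (\<Prod>i\<in>UNIV. f x $ i $ p i))" for p :: "'n \<Rightarrow> 'n"
    by (rule smooth_on_mult[OF smooth_on_const[OF S]])
  then show ?thesis unfolding det_def by (rule smooth_on_sum[OF S])
qed

lemma smooth_on_differentiable: "smooth_on S f \<Longrightarrow> x \<in> S \<Longrightarrow> f differentiable (at x)"
  using smooth_on_Ck[of S f "Suc 0"] by simp

lemma smooth_on_has_derivative:
  "smooth_on S f \<Longrightarrow> x \<in> S \<Longrightarrow> (f has_derivative frechet_derivative f (at x)) (at x)"
  using smooth_on_differentiable frechet_derivative_works by blast

lemma smooth_on_continuous_on: "smooth_on S f \<Longrightarrow> continuous_on S f"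
  using smooth_on_Ck Ck_on_imp_continuous_on by blast

lemma smooth_on_frechet_derivative:
  assumes "smooth_on S f"
  shows "smooth_on S (\<lambda>x. frechet_derivative f (at x) v)"
proof -
  have "Ck_on k (\<lambda>x. frechet_derivative f (at x) v) S" for k
    using smooth_on_Ck[OF assms, of "Suc k"] by simp
  then show ?thesis using smooth_onD_open[OF assms] by (simp add: smooth_on_def)
qed

lemma linear_frechet_derivative_smooth:
  "smooth_on S f \<Longrightarrow> x \<in> S \<Longrightarrow> linear (frechet_derivative f (at x))"
  by (rule has_derivative_linear[OF smooth_on_has_derivative])

section \<open>Symmetry of second derivatives\<close>

text \<open>The mean value theorem along v, applied to the increment in direction w, and then along
  w, applied to the derivative along v, turns the second difference over a parallelogram into a
  mixed derivative at an interior point. The second difference is symmetric in v and w.\<close>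

lemma mixed_difference_mvt:
  fixes f :: "'a::euclidean_space \<Rightarrow> real"
  assumes f: "smooth_on S f" and h: "0 < h"
    and sub: "\<And>s t. 0 \<le> s \<Longrightarrow> s \<le> h \<Longrightarrow> 0 \<le> t \<Longrightarrow> t \<le> h \<Longrightarrow> x + s *\<^sub>R v + t *\<^sub>R w \<in> S"
  shows "\<exists>s t. 0 < s \<and> s < h \<and> 0 < t \<and> t < h \<and>
    f (x + h *\<^sub>R v + h *\<^sub>R w) - f (x + h *\<^sub>R v) - f (x + h *\<^sub>R w) + f x =
    h * (h * frechet_derivative (\<lambda>y. frechet_derivative f (at y) v) (at (x + s *\<^sub>R v + t *\<^sub>R w)) w)"
proof -
  define Dv where "Dv = (\<lambda>y. frechet_derivative f (at y) v)"
  have Dv: "smooth_on S Dv" unfolding Dv_def by (rule smooth_on_frechet_derivative[OF f])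
  have line: "((\<lambda>r. g (a + r *\<^sub>R e)) has_real_derivative frechet_derivative g (at (a + r *\<^sub>R e)) e) (at r)"
    if g: "smooth_on S g" and m: "a + r *\<^sub>R e \<in> S" for g :: "'a \<Rightarrow> real" and a e r
  proof -
    have 1: "((\<lambda>r. a + r *\<^sub>R e) has_derivative (\<lambda>r. r *\<^sub>R e)) (at r)"
      by (auto intro!: derivative_eq_intros)
    have 2: "(g has_derivative frechet_derivative g (at (a + r *\<^sub>R e))) (at (a + r *\<^sub>R e))"
      using smooth_on_has_derivative[OF g m] .
    have l: "linear (frechet_derivative g (at (a + r *\<^sub>R e)))"
      using linear_frechet_derivative_smooth[OF g m] .
    show ?thesis
      using diff_chain_at[OF 1 2]
      by (simp add: has_field_derivative_def o_def linear_scale[OF l] mult.commute[of _ "frechet_derivative g _ _"])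
  qed
  define u where "u = (\<lambda>s. f ((x + h *\<^sub>R w) + s *\<^sub>R v) - f (x + s *\<^sub>R v))"
  have "\<exists>s. 0 < s \<and> s < h \<and> u h - u 0 = (h - 0) * (Dv ((x + h *\<^sub>R w) + s *\<^sub>R v) - Dv (x + s *\<^sub>R v))"
  proof (rule MVT2[OF h])
    fix s assume s: "0 \<le> s" "s \<le> h"
    have "x + s *\<^sub>R v + h *\<^sub>R w \<in> S" "x + s *\<^sub>R v + 0 *\<^sub>R w \<in> S"
      using sub[of s h] sub[of s 0] s h by auto
    then have "(x + h *\<^sub>R w) + s *\<^sub>R v \<in> S" "x + s *\<^sub>R v \<in> S" by (simp_all add: algebra_simps)
    then show "(u has_real_derivative Dv ((x + h *\<^sub>R w) + s *\<^sub>R v) - Dv (x + s *\<^sub>R v)) (at s)"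
      unfolding u_def Dv_def by (intro DERIV_diff line[OF f])
  qed
  then obtain s where s: "0 < s" "s < h"
    and us: "u h - u 0 = h * (Dv ((x + h *\<^sub>R w) + s *\<^sub>R v) - Dv (x + s *\<^sub>R v))" by auto
  define q where "q = (\<lambda>t. Dv ((x + s *\<^sub>R v) + t *\<^sub>R w))"
  have "\<exists>t. 0 < t \<and> t < h \<and> q h - q 0 = (h - 0) * frechet_derivative Dv (at ((x + s *\<^sub>R v) + t *\<^sub>R w)) w"
  proof (rule MVT2[OF h])
    fix t assume t: "0 \<le> t" "t \<le> h"
    then show "(q has_real_derivative frechet_derivative Dv (at ((x + s *\<^sub>R v) + t *\<^sub>R w)) w) (at t)"
      unfolding q_def using sub[of s t] s by (intro line[OF Dv]) auto
  qed
  then obtain t where t: "0 < t" "t < h"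
    and qt: "q h - q 0 = h * frechet_derivative Dv (at ((x + s *\<^sub>R v) + t *\<^sub>R w)) w" by auto
  have "u h - u 0 = h * (q h - q 0)"
    unfolding us q_def by (simp add: algebra_simps)
  moreover have "u h - u 0 = f (x + h *\<^sub>R v + h *\<^sub>R w) - f (x + h *\<^sub>R v) - f (x + h *\<^sub>R w) + f x"
    unfolding u_def by (simp add: algebra_simps)
  ultimately show ?thesis
    using s t qt unfolding Dv_def by auto
qed

text \<open>Both mixed derivatives are values of the same second difference over shrinking
  parallelograms, each at its own interior point; continuity identifies the limits.\<close>

lemma frechet_derivative_commute_real:
  fixes f :: "'a::euclidean_space \<Rightarrow> real"
  assumes f: "smooth_on S f" and x: "x \<in> S"
  shows "frechet_derivative (\<lambda>y. frechet_derivative f (at y) v) (at x) w =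
         frechet_derivative (\<lambda>y. frechet_derivative f (at y) w) (at x) v"
proof -
  define P where "P = (\<lambda>y. frechet_derivative (\<lambda>y. frechet_derivative f (at y) v) (at y) w)"
  define Q where "Q = (\<lambda>y. frechet_derivative (\<lambda>y. frechet_derivative f (at y) w) (at y) v)"
  have "smooth_on S P" "smooth_on S Q" unfolding P_def Q_def
    by (intro smooth_on_frechet_derivative f)+
  then have cont: "isCont P x" "isCont Q x"
    using x smooth_onD_open[OF f] by (auto dest!: smooth_on_continuous_on simp: continuous_on_eq_continuous_at)
  obtain r where r: "r > 0" "ball x r \<subseteq> S"
    using smooth_onD_open[OF f] x openE by blast
  \<comment> \<open>Chosen so that all points with parameters in [0, c) stay in the ball of radius
    r; the summand 1 keeps the denominator positive when v and w vanish.\<close>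
  define c where "c = r / (norm v + norm w + 1)"
  have c: "c > 0" using r by (auto simp: c_def divide_pos_pos add_nonneg_pos)
  have inS: "x + s *\<^sub>R v + t *\<^sub>R w \<in> S" if "0 \<le> s" "s < c" "0 \<le> t" "t < c" for s t
  proof -
    have "norm (s *\<^sub>R v + t *\<^sub>R w) \<le> s * norm v + t * norm w"
      using norm_triangle_ineq[of "s *\<^sub>R v" "t *\<^sub>R w"] that by simp
    also have "\<dots> \<le> c * norm v + c * norm w"
      using that by (intro add_mono mult_right_mono) auto
    also have "\<dots> < c * (norm v + norm w + 1)" using c by (simp add: algebra_simps)
    also have "\<dots> = r" unfolding c_def using add_nonneg_pos[of "norm v + norm w" 1] by simp
    finally have "norm (s *\<^sub>R v + t *\<^sub>R w) < r" .
    moreover have "dist x (x + s *\<^sub>R v + t *\<^sub>R w) = norm (s *\<^sub>R v + t *\<^sub>R w)"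
      using norm_minus_cancel[of "s *\<^sub>R v + t *\<^sub>R w"] by (simp add: dist_norm)
    ultimately have "x + s *\<^sub>R v + t *\<^sub>R w \<in> ball x r" by simp
    with r show ?thesis by blast
  qed
  \<comment> \<open>The denominator starts at 2, so that \<open>h n < c\<close> holds strictly from
    n = 0 on.\<close>
  define h where "h = (\<lambda>n::nat. c / (real n + 2))"
  have h: "0 < h n" "h n < c" for n
    using c by (auto simp: h_def field_simps intro: add_pos_nonneg)
  have h0: "h \<longlonglongrightarrow> 0"
    unfolding h_def by (rule tendsto_divide_0[OF tendsto_const])
      (auto intro!: filterlim_at_top_imp_at_infinity filterlim_tendsto_add_at_top[OF tendsto_const filterlim_real_sequentially, of 2, simplified add.commute])
  have "\<exists>s t. 0 < s \<and> s < h n \<and> 0 < t \<and> t < h n \<and>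
    f (x + h n *\<^sub>R v + h n *\<^sub>R w) - f (x + h n *\<^sub>R v) - f (x + h n *\<^sub>R w) + f x =
    h n * (h n * P (x + s *\<^sub>R v + t *\<^sub>R w))" for n
    unfolding P_def
    by (rule mixed_difference_mvt[OF f h(1)]) (use h(2)[of n] in \<open>auto intro: inS\<close>)
  then obtain s t where st: "\<And>n. 0 < s n" "\<And>n. s n < h n" "\<And>n. 0 < t n" "\<And>n. t n < h n"
    and eP: "\<And>n. f (x + h n *\<^sub>R v + h n *\<^sub>R w) - f (x + h n *\<^sub>R v) - f (x + h n *\<^sub>R w) + f x =
      h n * (h n * P (x + s n *\<^sub>R v + t n *\<^sub>R w))" by metis
  have "\<exists>s t. 0 < s \<and> s < h n \<and> 0 < t \<and> t < h n \<and>
    f (x + h n *\<^sub>R w + h n *\<^sub>R v) - f (x + h n *\<^sub>R w) - f (x + h n *\<^sub>R v) + f x =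
    h n * (h n * Q (x + s *\<^sub>R w + t *\<^sub>R v))" for n
    unfolding Q_def
  proof (rule mixed_difference_mvt[OF f h(1)])
    fix s t assume "0 \<le> s" "s \<le> h n" "0 \<le> t" "t \<le> h n"
    then show "x + s *\<^sub>R w + t *\<^sub>R v \<in> S"
      using inS[of t s] h(2)[of n] by (simp add: add_ac)
  qed
  then obtain s' t' where st': "\<And>n. 0 < s' n" "\<And>n. s' n < h n" "\<And>n. 0 < t' n" "\<And>n. t' n < h n"
    and eQ: "\<And>n. f (x + h n *\<^sub>R w + h n *\<^sub>R v) - f (x + h n *\<^sub>R w) - f (x + h n *\<^sub>R v) + f x =
      h n * (h n * Q (x + s' n *\<^sub>R w + t' n *\<^sub>R v))" by metis
  have eq: "P (x + s n *\<^sub>R v + t n *\<^sub>R w) = Q (x + s' n *\<^sub>R w + t' n *\<^sub>R v)" for n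
  proof -
    have sw: "x + h n *\<^sub>R w + h n *\<^sub>R v = x + h n *\<^sub>R v + h n *\<^sub>R w" by (simp add: add_ac)
    have "h n * (h n * P (x + s n *\<^sub>R v + t n *\<^sub>R w)) = h n * (h n * Q (x + s' n *\<^sub>R w + t' n *\<^sub>R v))"
      using eP[of n] eQ[of n, unfolded sw] by linarith
    then show ?thesis using h(1)[of n] by simp
  qed
  have sq: "a \<longlonglongrightarrow> 0" if "\<And>n. 0 < a n" "\<And>n. a n < h n" for a :: "nat \<Rightarrow> real"
    by (rule tendsto_sandwich[OF _ _ tendsto_const h0]) (use that in \<open>auto intro!: always_eventually less_imp_le\<close>)
  have "(\<lambda>n. x + s n *\<^sub>R v + t n *\<^sub>R w) \<longlonglongrightarrow> x + 0 *\<^sub>R v + 0 *\<^sub>R w"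
    by (intro tendsto_intros sq st)
  then have "(\<lambda>n. P (x + s n *\<^sub>R v + t n *\<^sub>R w)) \<longlonglongrightarrow> P x"
    using cont by (intro isCont_tendsto_compose[of x P]) auto
  moreover have "(\<lambda>n. x + s' n *\<^sub>R w + t' n *\<^sub>R v) \<longlonglongrightarrow> x + 0 *\<^sub>R w + 0 *\<^sub>R v"
    by (intro tendsto_intros sq st')
  then have "(\<lambda>n. Q (x + s' n *\<^sub>R w + t' n *\<^sub>R v)) \<longlonglongrightarrow> Q x"
    using cont by (intro isCont_tendsto_compose[of x Q]) auto
  ultimately have "P x = Q x" unfolding eq by (rule LIMSEQ_unique)
  then show ?thesis by (simp add: P_def Q_def)
qed

lemma frechet_derivative_bounded_linear:
  assumes "bounded_linear L" "f differentiable (at x)"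
  shows "frechet_derivative (\<lambda>y. L (f y)) (at x) v = L (frechet_derivative f (at x) v)"
proof -
  have "((\<lambda>y. L (f y)) has_derivative (\<lambda>v. L (frechet_derivative f (at x) v))) (at x)"
    by (rule bounded_linear.has_derivative[OF assms(1)]) (use assms(2) frechet_derivative_works in blast)
  then show ?thesis by (simp add: frechet_derivative_apply)
qed

lemma frechet_derivative_commute:
  assumes f: "smooth_on S f" and x: "x \<in> S"
  shows "frechet_derivative (\<lambda>y. frechet_derivative f (at y) v) (at x) w =
         frechet_derivative (\<lambda>y. frechet_derivative f (at y) w) (at x) v"
proof (rule euclidean_eqI)
  fix b :: 'b assume "b \<in> Basis"
  have fb: "smooth_on S (\<lambda>y. f y \<bullet> b)"
    by (rule smooth_on_bounded_linear[OF f bounded_linear_inner_left])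
  have 1: "frechet_derivative (\<lambda>y. f y \<bullet> b) (at y) v = frechet_derivative f (at y) v \<bullet> b" if "y \<in> S" for y v
    by (rule frechet_derivative_bounded_linear[OF bounded_linear_inner_left smooth_on_differentiable[OF f that]])
  have 2: "frechet_derivative (\<lambda>y. frechet_derivative (\<lambda>y. f y \<bullet> b) (at y) v) (at x) w =
      frechet_derivative (\<lambda>y. frechet_derivative f (at y) v) (at x) w \<bullet> b" for v w
  proof -
    note sv = smooth_on_frechet_derivative[OF f, of v]
    have "((\<lambda>y. frechet_derivative f (at y) v \<bullet> b) has_derivative
        (\<lambda>w. frechet_derivative (\<lambda>y. frechet_derivative f (at y) v) (at x) w \<bullet> b)) (at x)"
      by (rule bounded_linear.has_derivative[OF bounded_linear_inner_left smooth_on_has_derivative[OF sv x]])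
    then have "((\<lambda>y. frechet_derivative (\<lambda>y. f y \<bullet> b) (at y) v) has_derivative
        (\<lambda>w. frechet_derivative (\<lambda>y. frechet_derivative f (at y) v) (at x) w \<bullet> b)) (at x)"
      by (rule has_derivative_transform_within_open[OF _ smooth_onD_open[OF f] x]) (simp add: 1)
    then show ?thesis by (simp add: frechet_derivative_apply)
  qed
  show "frechet_derivative (\<lambda>y. frechet_derivative f (at y) v) (at x) w \<bullet> b =
         frechet_derivative (\<lambda>y. frechet_derivative f (at y) w) (at x) v \<bullet> b"
    unfolding 2[symmetric] by (rule frechet_derivative_commute_real[OF fb x])
qed

section \<open>Maps of a time and a position: slices and partial derivatives\<close>

lemma smooth_on_slice:
  assumes "smooth_on (I \<times> U) F" "t \<in> I" "open U"
  shows "smooth_on U (\<lambda>y. F (t, y))"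
  by (rule smooth_on_compose[OF smooth_on_Pair[OF smooth_on_const[OF assms(3), of t]
        smooth_on_linear[OF assms(3) bounded_linear_ident]] assms(1)])
    (use assms in auto)

lemma frechet_derivative_slice:
  assumes "F differentiable (at (t, y))"
  shows "frechet_derivative (\<lambda>y. F (t, y)) (at y) v = frechet_derivative F (at (t, y)) (0, v)"
proof -
  have 1: "((\<lambda>y. (t, y)) has_derivative (\<lambda>v. (0, v))) (at y)"
    by (auto intro!: derivative_eq_intros)
  have 2: "(F has_derivative frechet_derivative F (at (t, y))) (at (t, y))"
    using assms frechet_derivative_works by blast
  show ?thesis
    using diff_chain_at[OF 1 2] by (simp add: o_def frechet_derivative_apply)
qed

lemma has_vector_derivative_slice:
  assumes "F differentiable (at (t, y))"
  shows "((\<lambda>t. F (t, y)) has_vector_derivative frechet_derivative F (at (t, y)) (1, 0)) (at t)"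
proof -
  have 1: "((\<lambda>t. (t, y)) has_derivative (\<lambda>s. (s, 0))) (at t)"
    by (auto intro!: derivative_eq_intros)
  have 2: "(F has_derivative frechet_derivative F (at (t, y))) (at (t, y))"
    using assms frechet_derivative_works by blast
  have l: "linear (frechet_derivative F (at (t, y)))" using 2 has_derivative_linear by blast
  have "(\<lambda>s. frechet_derivative F (at (t, y)) (s, 0)) = (\<lambda>s. s *\<^sub>R frechet_derivative F (at (t, y)) (1, 0))"
  proof (rule ext)
    show "frechet_derivative F (at (t, y)) (s, 0) = s *\<^sub>R frechet_derivative F (at (t, y)) (1, 0)" for s
      using linear_scale[OF l, of s "(1,0)"] by simp
  qed
  with diff_chain_at[OF 1 2] show ?thesis
    unfolding has_vector_derivative_def o_def by (simp only:)
qed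

subsection \<open>Differentiation of the determinant\<close>

text \<open>This is the trace of adj(M) H, written by the Leibniz formula so that singular M are
  included.\<close>

definition det_deriv :: "real ^ 'n ^ 'n \<Rightarrow> real ^ 'n ^ 'n \<Rightarrow> real" where
  "det_deriv M H = (\<Sum>p\<in>{p. p permutes UNIV}. of_int (sign p) *
     (\<Sum>i\<in>UNIV. H $ i $ p i * (\<Prod>j\<in>UNIV - {i}. M $ j $ p j)))"

lemma det_deriv_add: "det_deriv M (H + H') = det_deriv M H + det_deriv M H'"
  by (simp add: det_deriv_def distrib_right distrib_left sum.distrib)

lemma det_deriv_scaleR: "det_deriv M (c *\<^sub>R H) = c * det_deriv M H"
  by (simp add: det_deriv_def sum_distrib_left mult_ac)

lemma linear_det_deriv: "linear (det_deriv M)"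
  by (rule linearI) (simp_all add: det_deriv_add det_deriv_scaleR)

lemma has_derivative_det:
  fixes M :: "real ^ 'n ^ 'n"
  shows "(det has_derivative det_deriv M) (at M)"
proof -
  have e: "((\<lambda>A::real^'n^'n. A $ i $ j) has_derivative (\<lambda>H. H $ i $ j)) (at M)" for i j
    by (intro bounded_linear_imp_has_derivative bounded_linear_compose[OF bounded_linear_vec_nth bounded_linear_vec_nth])
  have "((\<lambda>A::real^'n^'n. \<Prod>i\<in>UNIV. A $ i $ p i) has_derivative
      (\<lambda>H. \<Sum>i\<in>UNIV. H $ i $ p i * (\<Prod>j\<in>UNIV - {i}. M $ j $ p j))) (at M)" for p
    by (rule has_derivative_prod) (rule e)
  then have "((\<lambda>A::real^'n^'n. \<Sum>p\<in>{p. p permutes UNIV}. of_int (sign p) * (\<Prod>i\<in>UNIV. A $ i $ p i)) has_derivative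
      (\<lambda>H. \<Sum>p\<in>{p. p permutes UNIV}. of_int (sign p) *
        (\<Sum>i\<in>UNIV. H $ i $ p i * (\<Prod>j\<in>UNIV - {i}. M $ j $ p j)))) (at M)"
    by (intro has_derivative_sum has_derivative_mult_right)
  then show ?thesis unfolding det_def[abs_def] det_deriv_def[abs_def] .
qed

text \<open>A permutation other than \<open>id\<close> moves at least two indices, so after deletion
  of one row an off-diagonal zero of the identity matrix remains in the product.\<close>

lemma det_deriv_mat_1: "det_deriv (mat 1 :: real ^ 'n ^ 'n) H = trace H"
proof -
  have "(\<Sum>i\<in>UNIV. H $ i $ p i * (\<Prod>j\<in>UNIV - {i}. (mat 1 :: real ^ 'n ^ 'n) $ j $ p j)) = 0"
    if p: "p permutes UNIV" "p \<noteq> id" for p :: "'n \<Rightarrow> 'n"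
  proof (rule sum.neutral, rule ballI)
    fix i
    obtain k where k: "p k \<noteq> k" using p(2) by (auto simp: fun_eq_iff)
    have "p (p k) \<noteq> p k" using permutes_inj[OF p(1)] k by (auto dest: injD)
    then obtain j where "j \<noteq> i" "p j \<noteq> j" using k by metis
    then have "(\<Prod>j\<in>UNIV - {i}. (mat 1 :: real ^ 'n ^ 'n) $ j $ p j) = 0"
      by (intro prod_zero) (auto simp: mat_def intro!: bexI[of _ j])
    then show "H $ i $ p i * (\<Prod>j\<in>UNIV - {i}. (mat 1 :: real ^ 'n ^ 'n) $ j $ p j) = 0" by simp
  qed
  then have "det_deriv (mat 1 :: real ^ 'n ^ 'n) H =
      (\<Sum>p\<in>{id}. of_int (sign p) * (\<Sum>i\<in>UNIV. H $ i $ p i * (\<Prod>j\<in>UNIV - {i}. (mat 1 :: real ^ 'n ^ 'n) $ j $ p j)))"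
    unfolding det_deriv_def
    by (intro sum.mono_neutral_right) (auto simp: finite_permutations permutes_id)
  also have "\<dots> = trace H" by (simp add: trace_def mat_def sign_id)
  finally show ?thesis .
qed

lemma matrix_mult_bounded_linear_left:
  "bounded_linear (\<lambda>A :: real ^ 'n ^ 'n. A ** (B :: real ^ 'n ^ 'n))"
  by (simp add: linear_conv_bounded_linear[symmetric])
    (rule linearI; simp add: matrix_matrix_mult_def vec_eq_iff sum.distrib distrib_right
      sum_distrib_left mult.assoc)

text \<open>Obtained by differentiating det(A G) = det A det G in A at the identity, which avoids
  inverting G.\<close>

lemma det_deriv_matrix_mult:
  fixes B G :: "real ^ 'n ^ 'n"
  shows "det_deriv G (B ** G) = trace B * det G"
proof -
  have 1: "((\<lambda>A. A ** G) has_derivative (\<lambda>A. A ** G)) (at (mat 1 :: real ^ 'n ^ 'n))"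
    by (rule bounded_linear_imp_has_derivative[OF matrix_mult_bounded_linear_left])
  have "((\<lambda>A. det (A ** G)) has_derivative (\<lambda>H. det_deriv G (H ** G))) (at (mat 1 :: real ^ 'n ^ 'n))"
    using diff_chain_at[OF 1 has_derivative_det] by (simp add: o_def)
  moreover have "((\<lambda>A. det A * det G) has_derivative (\<lambda>H. trace H * det G)) (at (mat 1 :: real ^ 'n ^ 'n))"
    using has_derivative_mult_left[OF has_derivative_det[of "mat 1 :: real ^ 'n ^ 'n"], of "det G"]
    by (simp add: det_deriv_mat_1)
  ultimately show ?thesis
    using has_derivative_unique[of "\<lambda>A. det A * det G"] by (auto simp: det_mul fun_eq_iff)
qed

lemma bounded_linear_transpose: "bounded_linear (transpose :: real ^ 'n ^ 'n \<Rightarrow> real ^ 'n ^ 'n)"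
  by (simp add: linear_conv_bounded_linear[symmetric])
    (rule linearI; simp add: transpose_def vec_eq_iff)

lemma det_deriv_transpose:
  fixes G H :: "real ^ 'n ^ 'n"
  assumes "transpose G = G"
  shows "det_deriv G (transpose H) = det_deriv G H"
proof -
  have 1: "(transpose has_derivative transpose) (at G)"
    by (rule bounded_linear_imp_has_derivative[OF bounded_linear_transpose])
  have "((\<lambda>A. det (transpose A)) has_derivative (\<lambda>H. det_deriv G (transpose H))) (at G)"
    using diff_chain_at[OF 1 has_derivative_det] assms by (simp add: o_def)
  then have "(det has_derivative (\<lambda>H. det_deriv G (transpose H))) (at G)" by simp
  then show ?thesis
    using has_derivative_unique[OF _ has_derivative_det] by (auto simp: fun_eq_iff)
qed

subsection \<open>Integrals depending on a parameter\<close>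

text \<open>The weight carries measurability, bound and support, while f is controlled on the
  compact set only. Chart densities are of this kind: nothing is known about them outside the chart
  image.\<close>

lemma integrable_compact_support:
  fixes w f :: "'a::euclidean_space \<Rightarrow> real"
  assumes "compact Q" "w \<in> borel_measurable borel" "\<And>y. \<bar>w y\<bar> \<le> C" "\<And>y. y \<notin> Q \<Longrightarrow> w y = 0"
    and "continuous_on Q f"
  shows "integrable lborel (\<lambda>y. w y * f y)"
proof -
  have Q: "Q \<in> sets borel" using assms(1) by (simp add: compact_imp_closed borel_closed)
  have "(\<lambda>y. indicator Q y *\<^sub>R f y) \<in> borel_measurable borel"
    by (rule borel_measurable_continuous_on_indicator[OF Q assms(5)])
  then have m: "(\<lambda>y. w y * (indicator Q y *\<^sub>R f y)) \<in> borel_measurable borel"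
    using assms(2) by measurable
  have e: "w y * (indicator Q y *\<^sub>R f y) = w y * f y" for y
    using assms(4)[of y] by (auto simp: indicator_def)
  obtain B where B: "\<And>y. y \<in> Q \<Longrightarrow> \<bar>f y\<bar> \<le> B"
    using compact_imp_bounded[OF compact_continuous_image[OF assms(5,1)]]
    by (auto simp: bounded_iff)
  show ?thesis
  proof (rule integrableI_bounded_set[of Q])
    show "AE y in lborel. y \<in> Q \<longrightarrow> norm (w y * f y) \<le> C * B"
    proof (intro AE_I2 impI)
      fix y assume "y \<in> Q"
      then show "norm (w y * f y) \<le> C * B"
        using B assms(3)[of y] by (auto simp: abs_mult intro!: mult_mono order_trans[OF abs_ge_zero])
    qed
    show "emeasure lborel Q < \<infinity>" by (rule emeasure_compact_finite[OF assms(1)])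
    show "(\<lambda>y. w y * f y) \<in> borel_measurable lborel" using m unfolding e by simp
  qed (use Q assms(4) in auto)
qed

text \<open>Dominated convergence along sequences: by the mean value theorem the difference
  quotients are bounded by C times the supremum of the time derivative over a compact
  cylinder.\<close>

lemma has_real_derivative_integral:
  fixes g g' :: "real \<Rightarrow> 'a::euclidean_space \<Rightarrow> real"
  assumes "0 < \<eta>" and Q: "compact Q" and w: "w \<in> borel_measurable borel" "\<And>y. \<bar>w y\<bar> \<le> C" "\<And>y. y \<notin> Q \<Longrightarrow> w y = 0"
    and der: "\<And>t y. \<bar>t\<bar> < \<eta> \<Longrightarrow> y \<in> Q \<Longrightarrow> ((\<lambda>t. g t y) has_real_derivative g' t y) (at t)"
    and cont': "continuous_on ({-\<eta><..<\<eta>} \<times> Q) (\<lambda>(t, y). g' t y)"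
    and cont: "\<And>t. \<bar>t\<bar> < \<eta> \<Longrightarrow> continuous_on Q (g t)"
  shows "((\<lambda>t. \<integral>y. w y * g t y \<partial>lborel) has_real_derivative (\<integral>y. w y * g' 0 y \<partial>lborel)) (at 0)"
proof -
  have Qb: "Q \<in> sets borel" using Q by (simp add: compact_imp_closed borel_closed)
  have int: "integrable lborel (\<lambda>y. w y * g t y)" if "\<bar>t\<bar> < \<eta>" for t
    by (rule integrable_compact_support[OF Q w cont[OF that]])
  have cg0: "continuous_on Q (g' 0)"
  proof -
    have "continuous_on Q (\<lambda>y. (\<lambda>(t, y). g' t y) (0, y))"
      by (rule continuous_on_compose2[OF cont']) (use assms(1) in \<open>auto intro!: continuous_intros\<close>)
    then show ?thesis by simp
  qed
  \<comment> \<open>Half of the time interval, closed, makes the cylinder compact; the derivative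
    need not be bounded on the open one.\<close>
  have "compact ({-\<eta>/2..\<eta>/2} \<times> Q)" by (intro compact_Times Q compact_Icc)
  moreover have "continuous_on ({-\<eta>/2..\<eta>/2} \<times> Q) (\<lambda>(t, y). g' t y)"
    by (rule continuous_on_subset[OF cont']) (use assms(1) in auto)
  ultimately have "bounded ((\<lambda>(t, y). g' t y) ` ({-\<eta>/2..\<eta>/2} \<times> Q))"
    by (intro compact_imp_bounded compact_continuous_image)
  then obtain B where B': "\<And>z. z \<in> (\<lambda>(t, y). g' t y) ` ({-\<eta>/2..\<eta>/2} \<times> Q) \<Longrightarrow> norm z \<le> B"
    unfolding bounded_iff by blast
  have B: "\<bar>g' t y\<bar> \<le> B" if "\<bar>t\<bar> \<le> \<eta>/2" "y \<in> Q" for t y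
  proof -
    have "-\<eta>/2 \<le> t" "t \<le> \<eta>/2" using that(1) by linarith+
    then have "(t, y) \<in> {-\<eta>/2..\<eta>/2} \<times> Q" using that(2) by simp
    then have "(\<lambda>(t, y). g' t y) (t, y) \<in> (\<lambda>(t, y). g' t y) ` ({-\<eta>/2..\<eta>/2} \<times> Q)" by (rule imageI)
    from B'[OF this] show ?thesis by simp
  qed
  have lip: "\<bar>g t y - g 0 y\<bar> \<le> \<bar>t\<bar> * B" if t: "\<bar>t\<bar> \<le> \<eta>/2" and y: "y \<in> Q" for t y
  proof -
    have "norm (g t y - g 0 y) \<le> B * norm (t - 0)"
    proof (rule field_differentiable_bound[where S="{-\<eta>/2..\<eta>/2}" and f="\<lambda>t. g t y" and f'="\<lambda>t. g' t y"])
      show "((\<lambda>t. g t y) has_field_derivative g' s y) (at s within {-\<eta>/2..\<eta>/2})"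
        if "s \<in> {-\<eta>/2..\<eta>/2}" for s
        by (rule has_field_derivative_at_within[OF der[OF _ y]]) (use that assms(1) in auto)
      show "norm (g' s y) \<le> B" if "s \<in> {-\<eta>/2..\<eta>/2}" for s
        using that B[OF _ y, of s] by auto
    qed (use t assms(1) in auto)
    then show ?thesis by (simp add: mult.commute)
  qed
  have "C \<ge> 0" using w(2)[of undefined] by linarith
  have "((\<lambda>h. ((\<integral>y. w y * g (0 + h) y \<partial>lborel) - (\<integral>y. w y * g 0 y \<partial>lborel)) / h) \<longlongrightarrow>
      (\<integral>y. w y * g' 0 y \<partial>lborel)) (at 0)"
    unfolding tendsto_at_iff_sequentially
  proof (intro allI impI)
    fix X :: "nat \<Rightarrow> real"
    assume X0: "\<forall>i. X i \<in> UNIV - {0}" and X: "X \<longlonglongrightarrow> 0"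
    have ev: "\<forall>\<^sub>F i in sequentially. \<bar>X i\<bar> < \<eta>/2"
      using tendstoD[OF X, of "\<eta>/2"] assms(1) by (simp add: dist_real_def)
    \<comment> \<open>The quotient is set to 0 as long as \<open>X i\<close> lies outside the half
      interval, so that the domination holds for every i and not just eventually.\<close>
    define s where "s = (\<lambda>i y. if \<bar>X i\<bar> < \<eta>/2 then (w y * g (X i) y - w y * g 0 y) / X i else 0)"
    have "(\<lambda>i. \<integral>y. s i y \<partial>lborel) \<longlonglongrightarrow> (\<integral>y. w y * g' 0 y \<partial>lborel)"
    proof (rule integral_dominated_convergence[where w="\<lambda>y. indicator Q y * (C * B)"])
      show "(\<lambda>y. w y * g' 0 y) \<in> borel_measurable lborel"
        using integrable_compact_support[OF Q w cg0] by (rule borel_measurable_integrable)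
      show "s i \<in> borel_measurable lborel" for i
        using borel_measurable_integrable[OF int[of "X i"]] borel_measurable_integrable[OF int[of 0]] assms(1)
        by (cases "\<bar>X i\<bar> < \<eta>/2") (auto simp: s_def)
      show "integrable lborel (\<lambda>y. indicator Q y * (C * B))"
        using emeasure_compact_finite[OF Q] Qb by (intro integrable_mult_left) (auto simp: integrable_indicator_iff)
      show "AE y in lborel. (\<lambda>i. s i y) \<longlonglongrightarrow> w y * g' 0 y"
      proof (rule AE_I2)
        fix y
        show "(\<lambda>i. s i y) \<longlonglongrightarrow> w y * g' 0 y"
        proof (cases "y \<in> Q")
          case True
          have "((\<lambda>h. (g (0 + h) y - g 0 y) / h) \<longlongrightarrow> g' 0 y) (at 0)"
            using der[OF _ True, of 0] assms(1) by (simp add: DERIV_def)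
          then have "(\<lambda>i. (g (X i) y - g 0 y) / X i) \<longlonglongrightarrow> g' 0 y"
            using X0 X unfolding tendsto_at_iff_sequentially by (auto simp: o_def)
          then have "(\<lambda>i. w y * ((g (X i) y - g 0 y) / X i)) \<longlonglongrightarrow> w y * g' 0 y"
            by (rule tendsto_mult_left)
          moreover have "\<forall>\<^sub>F i in sequentially. w y * ((g (X i) y - g 0 y) / X i) = s i y"
            using ev by eventually_elim (simp add: s_def right_diff_distrib)
          ultimately show ?thesis by (rule Lim_transform_eventually)
        next
          case False
          then have "s i y = 0" for i by (simp add: w(3) s_def)
          then show ?thesis using False by (simp add: w(3))
        qed
      qed
      show "AE y in lborel. norm (s i y) \<le> indicator Q y * (C * B)" for i
      proof (rule AE_I2)
        fix y
        show "norm (s i y) \<le> indicator Q y * (C * B)"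
        proof (cases "y \<in> Q \<and> \<bar>X i\<bar> < \<eta>/2")
          case True
          have "norm (s i y) = \<bar>w y\<bar> * (\<bar>g (X i) y - g 0 y\<bar> / \<bar>X i\<bar>)"
            using True by (simp add: s_def right_diff_distrib[symmetric] abs_mult)
          also have "\<dots> \<le> C * B"
          proof (rule mult_mono)
            show "\<bar>g (X i) y - g 0 y\<bar> / \<bar>X i\<bar> \<le> B"
              using lip[of "X i" y] True X0 by (simp add: divide_le_eq mult.commute)
          qed (use w(2) \<open>C \<ge> 0\<close> in auto)
          finally show ?thesis using True by simp
        next
          case False
          then have "s i y = 0" using w(3)[of y] by (auto simp: s_def)
          moreover have "0 \<le> indicator Q y * (C * B)"
          proof (cases "y \<in> Q")
            case True
            then have "0 \<le> B" using B[of 0 y] assms(1) abs_ge_zero[of "g' 0 y"] by simp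
            then show ?thesis using \<open>C \<ge> 0\<close> by simp
          qed simp
          ultimately show ?thesis by simp
        qed
      qed
    qed
    moreover have "\<forall>\<^sub>F i in sequentially. (\<integral>y. s i y \<partial>lborel) =
        ((\<lambda>h. ((\<integral>y. w y * g (0 + h) y \<partial>lborel) - (\<integral>y. w y * g 0 y \<partial>lborel)) / h) \<circ> X) i"
      using ev
    proof eventually_elim
      case (elim i)
      have "(\<integral>y. s i y \<partial>lborel) = (\<integral>y. (w y * g (X i) y - w y * g 0 y) / X i \<partial>lborel)"
        using elim by (simp add: s_def)
      also have "\<dots> = ((\<integral>y. w y * g (X i) y \<partial>lborel) - (\<integral>y. w y * g 0 y \<partial>lborel)) / X i"
        using int[of "X i"] int[of 0] elim assms(1) by (simp add: Bochner_Integration.integral_diff)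
      finally show ?case by simp
    qed
    ultimately show "((\<lambda>h. ((\<integral>y. w y * g (0 + h) y \<partial>lborel) - (\<integral>y. w y * g 0 y \<partial>lborel)) / h) \<circ> X)
        \<longlonglongrightarrow> (\<integral>y. w y * g' 0 y \<partial>lborel)"
      by (rule Lim_transform_eventually)
  qed
  then show ?thesis by (simp add: DERIV_def)
qed

lemma integral_translate:
  fixes h :: "'a::euclidean_space \<Rightarrow> real"
  assumes "h \<in> borel_measurable borel"
  shows "(\<integral>y. h (y + c) \<partial>lborel) = (\<integral>y. h y \<partial>lborel)"
proof -
  have "(\<integral>y. h y \<partial>lborel) = (\<integral>y. h y \<partial>(distr lborel borel ((+) c)))"
    by (simp add: lborel_distr_plus)
  also have "\<dots> = (\<integral>y. h (c + y) \<partial>lborel)"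
    using assms by (intro integral_distr) auto
  finally show ?thesis by (simp add: add.commute)
qed

text \<open>The integral of \<open>h (y + t *\<^sub>R v)\<close> does not depend on t by translation
  invariance, and its derivative at 0 is the integral of the directional derivative.\<close>

lemma integral_frechet_derivative_compact_support:
  fixes h :: "'a::euclidean_space \<Rightarrow> real"
  assumes Q: "compact Q" "Q \<subseteq> U" and U: "open U" and h: "Ck_on (Suc 0) h U"
    and h0: "\<And>y. y \<notin> Q \<Longrightarrow> h y = 0"
  shows "integrable lborel (\<lambda>y. frechet_derivative h (at y) v)"
    and "(\<integral>y. frechet_derivative h (at y) v \<partial>lborel) = 0"
proof -
  define h' where "h' = (\<lambda>y. frechet_derivative h (at y) v)"
  have cQ: "open (- Q)" using Q(1) by (simp add: compact_imp_closed open_Compl)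
  have out: "(h has_derivative (\<lambda>_. 0)) (at y)" if "y \<in> - Q" for y
    by (rule has_derivative_transform_within_open[OF has_derivative_const[of 0] cQ that]) (simp add: h0)
  have der: "(h has_derivative frechet_derivative h (at y)) (at y)" for y
  proof (cases "y \<in> Q")
    case True
    then show ?thesis using h Q(2) by (auto simp: frechet_derivative_works)
  next
    case False
    then have "y \<in> - Q" by simp
    note o = out[OF this]
    show ?thesis using o by (simp only: frechet_derivative_apply[OF o])
  qed
  have h'0: "h' y = 0" if "y \<notin> Q" for y
    using frechet_derivative_apply[OF out[of y]] that by (simp add: h'_def)
  \<comment> \<open>h is of class C^1 on U and zero off the closed set Q; these two open sets cover
    the space.\<close>
  have "continuous_on (U \<union> (-Q)) h'"
  proof (rule continuous_on_open_Un[OF U cQ])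
    show "continuous_on U h'" using h by (simp add: h'_def)
    show "continuous_on (-Q) h'" by (rule continuous_on_eq[OF continuous_on_const[of _ 0]]) (simp add: h'0)
  qed
  moreover have "U \<union> (-Q) = UNIV" using Q(2) by auto
  ultimately have c': "continuous_on UNIV h'" by simp
  have "integrable lborel (\<lambda>y. indicator Q y * h' y)"
  proof (rule integrable_compact_support[OF Q(1), of _ 1])
    show "(indicator Q :: 'a \<Rightarrow> real) \<in> borel_measurable borel"
      using Q(1) by (intro borel_measurable_indicator) (simp add: compact_imp_closed borel_closed)
    show "\<bar>indicator Q y :: real\<bar> \<le> 1" for y by (simp add: indicator_def)
    show "continuous_on Q h'" by (rule continuous_on_subset[OF c']) simp
  qed simp
  moreover have "(\<lambda>y. indicator Q y * h' y) = h'"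
  proof (rule ext)
    show "indicator Q y * h' y = h' y" for y using h'0[of y] by (cases "y \<in> Q") auto
  qed
  ultimately show "integrable lborel (\<lambda>y. frechet_derivative h (at y) v)" by (simp add: h'_def)
  have ch: "continuous_on UNIV h"
    by (intro continuous_at_imp_continuous_on ballI has_derivative_continuous[OF der])
  \<comment> \<open>R contains the supports of all translates with time in [-1, 1], so its indicator
    is one compactly supported weight that does not depend on t.\<close>
  define R where "R = (\<lambda>(y, t). y - t *\<^sub>R v) ` (Q \<times> {-1..1::real})"
  have R: "compact R" unfolding R_def case_prod_beta
    by (intro compact_continuous_image compact_Times Q(1) compact_Icc continuous_intros)
  have inR: "y \<in> R" if "y + t *\<^sub>R v \<in> Q" "\<bar>t\<bar> \<le> 1" for y t
    unfolding R_def using that by (intro image_eqI[of _ _ "(y + t *\<^sub>R v, t)"]) auto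
  have line: "((\<lambda>t. h (y + t *\<^sub>R v)) has_real_derivative h' (y + t *\<^sub>R v)) (at t)" for y t
  proof -
    have 1: "((\<lambda>r. y + r *\<^sub>R v) has_derivative (\<lambda>r. r *\<^sub>R v)) (at t)"
      by (auto intro!: derivative_eq_intros)
    have l: "linear (frechet_derivative h (at (y + t *\<^sub>R v)))"
      by (rule has_derivative_linear[OF der])
    show ?thesis
      using diff_chain_at[OF 1 der] unfolding h'_def
      by (simp add: has_field_derivative_def o_def linear_scale[OF l] mult.commute[of _ "frechet_derivative h _ _"])
  qed
  have "((\<lambda>t. \<integral>y. indicator R y * h (y + t *\<^sub>R v) \<partial>lborel) has_real_derivative
      (\<integral>y. indicator R y * h' (y + 0 *\<^sub>R v) \<partial>lborel)) (at 0)"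
  proof (rule has_real_derivative_integral[where \<eta>=1 and C=1 and Q=R])
    show "(indicator R :: 'a \<Rightarrow> real) \<in> borel_measurable borel"
      using R by (intro borel_measurable_indicator) (simp add: compact_imp_closed borel_closed)
    show "continuous_on ({- 1<..<1} \<times> R) (\<lambda>(t, y). h' (y + t *\<^sub>R v))"
      unfolding case_prod_beta by (intro continuous_on_compose2[OF c'] continuous_intros) auto
    show "continuous_on R (\<lambda>y. h (y + t *\<^sub>R v))" for t
      by (intro continuous_on_compose2[OF ch] continuous_intros) auto
    show "\<bar>indicator R y :: real\<bar> \<le> 1" for y by (simp add: indicator_def)
    show "(indicator R y :: real) = 0" if "y \<notin> R" for y using that by simp
    show "((\<lambda>t. h (y + t *\<^sub>R v)) has_real_derivative h' (y + t *\<^sub>R v)) (at t)" for y t by (rule line)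
    show "compact R" by (rule R)
  qed simp
  moreover have "(\<integral>y. indicator R y * h (y + t *\<^sub>R v) \<partial>lborel) = (\<integral>y. h y \<partial>lborel)" if "\<bar>t\<bar> < 1" for t
  proof -
    have "indicator R y * h (y + t *\<^sub>R v) = h (y + t *\<^sub>R v)" for y
      using inR[of y t] h0[of "y + t *\<^sub>R v"] that by (cases "y \<in> R") auto
    then have "(\<integral>y. indicator R y * h (y + t *\<^sub>R v) \<partial>lborel) = (\<integral>y. h (y + t *\<^sub>R v) \<partial>lborel)"
      by (rule Bochner_Integration.integral_cong[OF refl])
    then show ?thesis
      using integral_translate[OF borel_measurable_continuous_onI[OF ch], of "t *\<^sub>R v"] by simp
  qed
  then have "((\<lambda>t. \<integral>y. indicator R y * h (y + t *\<^sub>R v) \<partial>lborel) has_real_derivative 0) (at 0)"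
    by (rule_tac has_field_derivative_transform_within_open[OF DERIV_const[of "\<integral>y. h y \<partial>lborel"], of "{-1<..<1}"]) auto
  ultimately have "(\<integral>y. indicator R y * h' (y + 0 *\<^sub>R v) \<partial>lborel) = 0"
    using DERIV_unique by blast
  moreover have "indicator R y * h' (y + 0 *\<^sub>R v) = h' y" for y
    using inR[of y 0] h'0[of y] by (cases "y \<in> R") auto
  then have "(\<integral>y. indicator R y * h' (y + 0 *\<^sub>R v) \<partial>lborel) = (\<integral>y. h' y \<partial>lborel)"
    by (rule Bochner_Integration.integral_cong[OF refl])
  ultimately show "(\<integral>y. frechet_derivative h (at y) v \<partial>lborel) = 0" by (simp add: h'_def)
qed

section \<open>Self-adjoint operators and determinants of bilinear forms\<close>

definition inner_form :: "('a::euclidean_space \<Rightarrow> 'a \<Rightarrow> real) \<Rightarrow> bool" where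
  "inner_form g \<longleftrightarrow> bilinear g \<and> (\<forall>x y. g x y = g y x) \<and> (\<forall>x. x \<noteq> 0 \<longrightarrow> 0 < g x x)"

text \<open>First-order condition at the minimum t = 0. The test value t = -b/C with C = |c| + 1
  would give at most -b^2/C.\<close>

lemma quadratic_nonneg_imp_linear_coeff_zero:
  fixes b c :: real
  assumes "\<And>t. 0 \<le> 2 * t * b + t\<^sup>2 * c"
  shows "b = 0"
proof (rule ccontr)
  assume "b \<noteq> 0"
  define C where "C = \<bar>c\<bar> + 1"
  have C: "C > 0" "c \<le> C" by (auto simp: C_def)
  have "0 \<le> 2 * (- b / C) * b + (- b / C)\<^sup>2 * c" by (rule assms)
  also have "\<dots> \<le> 2 * (- b / C) * b + (- b / C)\<^sup>2 * C"
    using C by (intro add_left_mono mult_left_mono) auto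
  also have "\<dots> = - (b\<^sup>2 / C)" using C by (simp add: field_simps power2_eq_square)
  finally show False using C \<open>b \<noteq> 0\<close> by (simp add: divide_le_0_iff)
qed

text \<open>A maximiser of the Rayleigh quotient of L with respect to g on V is an eigenvector. The
  quotient is homogeneous of degree 0, so compactness of the standard unit sphere serves for every
  g.\<close>

lemma selfadjoint_eigenvector_exists:
  fixes g :: "'a::euclidean_space \<Rightarrow> 'a \<Rightarrow> real"
  assumes g: "inner_form g" and L: "linear L" and sa: "\<And>v w. g (L v) w = g v (L w)"
    and V: "subspace V" "V \<noteq> {0}" "L ` V \<subseteq> V"
  shows "\<exists>v\<in>V. v \<noteq> 0 \<and> (\<exists>k. L v = k *\<^sub>R v)"
proof -
  have bil: "bilinear g" and sym: "\<And>x y. g x y = g y x" and pos: "\<And>x. x \<noteq> 0 \<Longrightarrow> 0 < g x x"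
    using g by (auto simp: inner_form_def)
  note bs = bilinear_ladd[OF bil] bilinear_radd[OF bil] bilinear_lmul[OF bil] bilinear_rmul[OF bil]
    bilinear_lsub[OF bil] bilinear_rsub[OF bil]
  have bb: "bounded_bilinear g" using bil bilinear_conv_bounded_bilinear by blast
  define S where "S = V \<inter> sphere 0 1"
  have cS: "compact S" unfolding S_def by (intro closed_Int_compact closed_subspace V compact_sphere)
  have nS: "S \<noteq> {}"
  proof -
    obtain v where "v \<in> V" "v \<noteq> 0" using V(1,2) subspace_0 by blast
    then have "(1 / norm v) *\<^sub>R v \<in> S" unfolding S_def using V(1) by (auto intro: subspace_scale)
    then show ?thesis by auto
  qed
  have fS: "continuous_on S (\<lambda>v. g (L v) v / g v v)"
  proof -
    have "continuous_on S L" using L by (simp add: linear_continuous_on linear_conv_bounded_linear[symmetric])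
    moreover have "g v v \<noteq> 0" if "v \<in> S" for v
      using pos[of v] that by (force simp: S_def)
    ultimately show ?thesis
      by (intro continuous_on_divide bounded_bilinear.continuous_on[OF bb] continuous_on_id) auto
  qed
  from continuous_attains_sup[OF cS nS fS]
  obtain v0 where v0: "v0 \<in> S" and mx: "\<And>v. v \<in> S \<Longrightarrow> g (L v) v / g v v \<le> g (L v0) v0 / g v0 v0"
    by blast
  define k where "k = g (L v0) v0 / g v0 v0"
  have v0': "v0 \<in> V" "v0 \<noteq> 0" using v0 by (auto simp: S_def)
  \<comment> \<open>With k the maximal quotient this symmetric form is nonnegative on V and zero at
    \<open>v0\<close>, hence \<open>v0\<close> is \<beta>-orthogonal to V; testing with
    \<open>k *\<^sub>R v0 - L v0\<close> yields the eigenvalue equation.\<close>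
  define \<beta> where "\<beta> = (\<lambda>v w. k * g v w - g (L v) w)"
  have \<beta>0: "\<beta> v0 v0 = 0" using pos[OF v0'(2)] by (simp add: \<beta>_def k_def)
  have \<beta>pos: "0 \<le> \<beta> w w" if "w \<in> V" for w
  proof (cases "w = 0")
    case True
    then show ?thesis by (simp add: \<beta>_def bilinear_lzero[OF bil] bilinear_rzero[OF bil])
  next
    case False
    have "(1 / norm w) *\<^sub>R w \<in> S" unfolding S_def using V(1) that False by (auto intro: subspace_scale)
    from mx[OF this] have "g (L w) w / g w w \<le> k"
      using False by (simp add: k_def bs linear_scale[OF L])
    then show ?thesis using pos[OF False] by (simp add: \<beta>_def divide_le_eq)
  qed
  have "\<beta> v0 w = 0" if w: "w \<in> V" for w
  proof (rule quadratic_nonneg_imp_linear_coeff_zero)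
    fix t
    have "v0 + t *\<^sub>R w \<in> V" using V(1) v0' w by (auto intro: subspace_add subspace_scale)
    then have "0 \<le> \<beta> (v0 + t *\<^sub>R w) (v0 + t *\<^sub>R w)" by (rule \<beta>pos)
    also have "\<dots> = \<beta> v0 v0 + 2 * t * \<beta> v0 w + t\<^sup>2 * \<beta> w w"
      unfolding \<beta>_def using sym[of w v0] sa[of w v0] sym[of w "L v0"]
      by (simp add: bs linear_add[OF L] linear_scale[OF L] algebra_simps power2_eq_square)
    finally show "0 \<le> 2 * t * \<beta> v0 w + t\<^sup>2 * \<beta> w w" by (simp add: \<beta>0)
  qed
  moreover have kV: "k *\<^sub>R v0 - L v0 \<in> V" using V v0' by (auto intro!: subspace_diff subspace_scale)
  ultimately have "\<beta> v0 (k *\<^sub>R v0 - L v0) = 0" by blast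
  then have "g (k *\<^sub>R v0 - L v0) (k *\<^sub>R v0 - L v0) = 0" by (simp add: \<beta>_def bs algebra_simps)
  then have "L v0 = k *\<^sub>R v0" using pos[of "k *\<^sub>R v0 - L v0"] by force
  then show ?thesis using v0' by blast
qed

text \<open>Otherwise the g-orthogonal complement of the eigenvectors is a nonzero L-invariant
  subspace; it contains an eigenvector, which is then g-orthogonal to itself.\<close>

lemma selfadjoint_span_eigenvectors:
  fixes g :: "'a::euclidean_space \<Rightarrow> 'a \<Rightarrow> real"
  assumes g: "inner_form g" and L: "linear L" and sa: "\<And>v w. g (L v) w = g v (L w)"
  shows "span {v. v \<noteq> 0 \<and> (\<exists>k. L v = k *\<^sub>R v)} = UNIV"
proof (rule ccontr)
  let ?E = "{v. v \<noteq> 0 \<and> (\<exists>k. L v = k *\<^sub>R v)}"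
  assume ne: "span ?E \<noteq> UNIV"
  have bil: "bilinear g" and sym: "\<And>x y. g x y = g y x" and pos: "\<And>x. x \<noteq> 0 \<Longrightarrow> 0 < g x x"
    using g by (auto simp: inner_form_def)
  note bs = bilinear_ladd[OF bil] bilinear_radd[OF bil] bilinear_lmul[OF bil] bilinear_rmul[OF bil]
    bilinear_lsub[OF bil] bilinear_rsub[OF bil]
  have "dim ?E < DIM('a)"
    using ne dim_eq_full[of ?E] dim_subset_UNIV[of ?E] by linarith
  then obtain a where a: "a \<noteq> 0" "\<And>y. y \<in> span ?E \<Longrightarrow> orthogonal a y"
    using orthogonal_to_subspace_exists by blast
  \<comment> \<open>G represents g by the standard inner product. Its inverse turns the standard
    orthogonal vector a into a g-orthogonal one.\<close>
  define G where "G = (\<lambda>v. \<Sum>b\<in>Basis. g v b *\<^sub>R b)"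
  have Gl: "linear G" unfolding G_def
    by (rule linearI) (simp_all add: bs scaleR_add_left sum.distrib scaleR_sum_right)
  have G: "G v \<bullet> w = g v w" for v w
  proof -
    have rl: "linear (g v)" using bil by (simp add: bilinear_def)
    have "g v w = g v (\<Sum>b\<in>Basis. (w \<bullet> b) *\<^sub>R b)" by (simp add: euclidean_representation)
    also have "\<dots> = (\<Sum>b\<in>Basis. (w \<bullet> b) * g v b)" by (simp add: linear_sum[OF rl] linear_scale[OF rl])
    finally show ?thesis by (simp add: G_def inner_sum_left inner_commute[of w] mult.commute)
  qed
  have "inj G"
  proof (rule injI)
    fix x y assume "G x = G y"
    then have "G (x - y) = 0" by (simp add: linear_diff[OF Gl])
    then have "g (x - y) (x - y) = 0" using G[of "x - y" "x - y"] by simp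
    then show "x = y" using pos[of "x - y"] by force
  qed
  then have "surj G" using Gl linear_injective_imp_surjective by blast
  then obtain v where v: "G v = a" by (metis surjD)
  define V where "V = {v. \<forall>e\<in>?E. g v e = 0}"
  have "subspace V" unfolding V_def subspace_def by (auto simp: bs bilinear_lzero[OF bil])
  moreover have "v \<in> V" unfolding V_def using a(2)[OF span_base] G[of v] v by (auto simp: orthogonal_def)
  moreover have "v \<noteq> 0" using v a(1) linear_0[OF Gl] by auto
  moreover have "L ` V \<subseteq> V" unfolding V_def by (auto simp: sa bs)
  ultimately obtain e where "e \<in> V" "e \<in> ?E"
    using selfadjoint_eigenvector_exists[OF g L sa, of V] by blast
  then have "g e e = 0" unfolding V_def by blast
  with \<open>e \<in> ?E\<close> pos[of e] show False by simp
qed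

text \<open>With the basis vectors as columns of P, the matrix of M satisfies M P = P D for a
  diagonal D, and det P cancels.\<close>

lemma det_eigenbasis:
  fixes M :: "real ^ 'n \<Rightarrow> real ^ 'n"
  assumes M: "linear M" and B: "span B = UNIV" "card B = CARD('n)" "finite B"
    and h: "\<And>b. b \<in> B \<Longrightarrow> M b = h b *\<^sub>R b"
  shows "det (matrix M) = (\<Prod>b\<in>B. h b)"
proof -
  obtain e where e: "bij_betw e (UNIV :: 'n set) B"
    using B finite_same_card_bij[of "UNIV :: 'n set" B] by auto
  define P :: "real ^ 'n ^ 'n" where "P = (\<chi> i j. e j $ i)"
  define D :: "real ^ 'n ^ 'n" where "D = (\<chi> i j. if i = j then h (e j) else 0)"
  have "columns P = B"
    using bij_betw_imp_surj_on[OF e] by (auto simp: columns_def column_def P_def)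
  then have "\<exists>R. P ** R = mat 1"
    using B(1) matrix_right_invertible_span_columns[of P] by (simp add: span_vec_eq)
  then have P: "det P \<noteq> 0"
    by (simp only: invertible_det_nz[symmetric] invertible_right_inverse)
  have "matrix M ** P = P ** D"
  proof -
    have eB: "e j \<in> B" for j using bij_betw_apply[OF e] by simp
    have "(matrix M ** P) $ i $ j = (matrix M *v e j) $ i" for i j
      by (simp add: matrix_matrix_mult_def matrix_vector_mult_def P_def)
    also have "\<dots> i j = (P ** D) $ i $ j" for i j
      by (simp add: fun_cong[OF matrix_vector_mul(2)[OF M]] h[OF eB] matrix_matrix_mult_def P_def D_def
          if_distrib[of "\<lambda>x. _ * x"] cong: if_cong)
    finally show ?thesis by (simp add: vec_eq_iff)
  qed
  then have "det (matrix M) * det P = det P * det D" by (simp only: det_mul[symmetric])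
  moreover have "det D = (\<Prod>i\<in>UNIV. h (e i))"
    by (subst det_diagonal) (auto simp: D_def)
  moreover have "\<dots> = (\<Prod>b\<in>B. h b)" by (rule prod.reindex_bij_betw[OF e])
  ultimately show ?thesis using P by simp
qed

text \<open>M plays the role of h(L): it is diagonal in any eigenbasis of L. Grouping the basis
  vectors by eigenvalue turns the product over the basis into a product over eigenvalues, with the
  dimensions of the eigenspaces as exponents.\<close>

lemma selfadjoint_prod_eigenvalues:
  fixes g :: "real ^ 'n \<Rightarrow> real ^ 'n \<Rightarrow> real" and h :: "real \<Rightarrow> real"
  assumes g: "inner_form g" and L: "linear L" and sa: "\<And>v w. g (L v) w = g v (L w)"
    and M: "linear M" and hM: "\<And>v k. L v = k *\<^sub>R v \<Longrightarrow> M v = h k *\<^sub>R v"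
  shows "(\<Prod>k\<in>{k. \<exists>v. v \<noteq> 0 \<and> L v = k *\<^sub>R v}. h k ^ dim {v. L v = k *\<^sub>R v}) = det (matrix M)"
proof -
  let ?E = "{v. v \<noteq> 0 \<and> (\<exists>k. L v = k *\<^sub>R v)}"
  note sp = selfadjoint_span_eigenvectors[OF g L sa]
  obtain B where B: "B \<subseteq> ?E" "independent B" "?E \<subseteq> span B" "card B = dim ?E"
    using basis_exists by blast
  have spB: "span B = UNIV" using span_minimal[OF B(3) subspace_span] sp by auto
  have fin: "finite B" using B(2) independent_imp_finite by blast
  have card: "card B = CARD('n)" using dim_span_eq_card_independent[OF B(2)] spB by simp
  define \<kappa> where "\<kappa> = (\<lambda>b. SOME k. L b = k *\<^sub>R b)"
  have \<kappa>: "L b = \<kappa> b *\<^sub>R b" if "b \<in> B" for b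
    unfolding \<kappa>_def by (rule someI_ex) (use B(1) that in auto)
  have nz: "b \<noteq> 0" if "b \<in> B" for b using B(1) that by auto
  \<comment> \<open>By independence an eigenvector for k has zero coefficient at every basis vector
    with another eigenvalue.\<close>
  have sub: "{v. L v = k *\<^sub>R v} \<subseteq> span {b\<in>B. \<kappa> b = k}" for k
  proof
    fix v assume "v \<in> {v. L v = k *\<^sub>R v}"
    then have v: "L v = k *\<^sub>R v" by simp
    have "v \<in> span B" using spB by simp
    then obtain c where c: "v = (\<Sum>b\<in>B. c b *\<^sub>R b)" using span_finite[OF fin] by auto
    have "(\<Sum>b\<in>B. (c b * (\<kappa> b - k)) *\<^sub>R b) = L v - k *\<^sub>R v"
      unfolding c linear_sum[OF L] scaleR_sum_right sum_subtractf[symmetric]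
      by (rule sum.cong[OF refl]) (simp add: linear_scale[OF L] \<kappa> algebra_simps)
    then have "(\<Sum>b\<in>B. (c b * (\<kappa> b - k)) *\<^sub>R b) = 0" using v by simp
    then have z: "c b * (\<kappa> b - k) = 0" if "b \<in> B" for b
      using independentD[OF B(2) fin subset_refl _ that, of "\<lambda>b. c b * (\<kappa> b - k)"] by simp
    have "v = (\<Sum>b\<in>{b\<in>B. \<kappa> b = k}. c b *\<^sub>R b)"
      unfolding c by (rule sum.mono_neutral_right) (use fin z in auto)
    also have "\<dots> \<in> span {b\<in>B. \<kappa> b = k}" by (intro span_sum span_scale span_base)
    finally show "v \<in> span {b\<in>B. \<kappa> b = k}" .
  qed
  have dim: "dim {v. L v = k *\<^sub>R v} = card {b\<in>B. \<kappa> b = k}" for k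
    by (rule dim_unique[OF _ sub]) (use \<kappa> in \<open>auto intro!: independent_mono[OF B(2)]\<close>)
  have ev: "{k. \<exists>v. v \<noteq> 0 \<and> L v = k *\<^sub>R v} = \<kappa> ` B"
  proof (intro equalityI subsetI)
    fix k assume "k \<in> {k. \<exists>v. v \<noteq> 0 \<and> L v = k *\<^sub>R v}"
    then obtain v where "v \<noteq> 0" "v \<in> span {b\<in>B. \<kappa> b = k}" using sub by blast
    have "{b\<in>B. \<kappa> b = k} \<noteq> {}"
    proof
      assume e: "{b\<in>B. \<kappa> b = k} = {}"
      from \<open>v \<in> span {b\<in>B. \<kappa> b = k}\<close> \<open>v \<noteq> 0\<close> show False unfolding e by simp
    qed
    then show "k \<in> \<kappa> ` B" by auto
  qed (use \<kappa> nz in auto)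
  have "(\<Prod>k\<in>\<kappa> ` B. h k ^ dim {v. L v = k *\<^sub>R v}) = (\<Prod>k\<in>\<kappa> ` B. \<Prod>b\<in>{b\<in>B. \<kappa> b = k}. h (\<kappa> b))"
    by (rule prod.cong[OF refl]) (simp add: dim)
  also have "\<dots> = (\<Prod>b\<in>B. h (\<kappa> b))" by (rule prod.image_gen[OF fin, symmetric])
  also have "\<dots> = det (matrix M)"
    by (rule det_eigenbasis[OF M spB card fin, symmetric]) (rule hM[OF \<kappa>])
  finally show ?thesis unfolding ev .
qed

definition form_matrix :: "(real ^ 'n \<Rightarrow> real ^ 'n \<Rightarrow> real) \<Rightarrow> real ^ 'n ^ 'n" where
  "form_matrix q = (\<chi> i j. q (axis i 1) (axis j 1))"

lemma form_matrix_apply: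
  assumes "bilinear q"
  shows "q x y = x \<bullet> (form_matrix q *v y)"
proof -
  have l: "linear (\<lambda>x. q x y)" "linear (q x)" for x y using assms by (auto simp: bilinear_def)
  have ex: "(\<Sum>i\<in>UNIV. x $ i *\<^sub>R axis i 1) = x" for x :: "real ^ 'n"
    using basis_expansion[of x] by (simp add: scalar_mult_eq_scaleR)
  have "q x y = q (\<Sum>i\<in>UNIV. x $ i *\<^sub>R axis i 1) (\<Sum>j\<in>UNIV. y $ j *\<^sub>R axis j 1)"
    unfolding ex ..
  also have "\<dots> = (\<Sum>i\<in>UNIV. \<Sum>j\<in>UNIV. x $ i * (y $ j * q (axis i 1) (axis j 1)))"
    by (simp add: linear_sum[OF l(1)] linear_sum[OF l(2)] linear_scale[OF l(1)] linear_scale[OF l(2)]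
        sum_distrib_left mult.left_commute) (rule sum.swap)
  also have "\<dots> = x \<bullet> (form_matrix q *v y)"
    by (simp add: inner_vec_def matrix_vector_mult_def form_matrix_def sum_distrib_left mult_ac)
  finally show ?thesis .
qed

lemma form_matrix_mult:
  assumes "bilinear q"
  shows "form_matrix (\<lambda>v w. q v (M w)) = form_matrix q ** matrix M"
proof -
  have "q (axis i 1) (M (axis j 1)) = (form_matrix q ** matrix M) $ i $ j" for i j
    by (simp add: form_matrix_apply[OF assms] inner_axis' matrix_vector_mult_def
        matrix_matrix_mult_def matrix_def)
  then show ?thesis by (subst form_matrix_def) (simp add: vec_eq_iff)
qed

lemma form_matrix_compose:
  assumes "bilinear q"
  shows "form_matrix (\<lambda>v w. q (P v) (P w)) = transpose (matrix P) ** form_matrix q ** matrix P"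
proof -
  have "q (P (axis i 1)) (P (axis j 1)) = (transpose (matrix P) ** (form_matrix q ** matrix P)) $ i $ j" for i j
    by (simp add: form_matrix_apply[OF assms] inner_vec_def matrix_vector_mult_def transpose_def
        matrix_matrix_mult_def matrix_def)
  then show ?thesis by (subst form_matrix_def) (simp add: vec_eq_iff matrix_mul_assoc)
qed

lemma det_form_matrix_compose:
  assumes "bilinear q"
  shows "det (form_matrix (\<lambda>v w. q (P v) (P w))) = (det (matrix P))\<^sup>2 * det (form_matrix q)"
  by (simp add: form_matrix_compose[OF assms, of P] det_mul power2_eq_square)

lemma det_form_matrix_nonzero:
  assumes "bilinear q"
  shows "det (form_matrix q) \<noteq> 0 \<longleftrightarrow> (\<forall>v. (\<forall>w. q v w = 0) \<longrightarrow> v = 0)"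
proof -
  define F where "F = transpose (form_matrix q)"
  have q: "q v w = (F *v v) \<bullet> w" for v w
    by (simp only: F_def form_matrix_apply[OF assms] transpose_matrix_vector dot_lmul_matrix)
  have "(\<forall>w. a \<bullet> w = 0) \<longleftrightarrow> a = 0" for a :: "real ^ 'n"
    by (auto dest: spec[of _ a])
  then have "(\<forall>w. q v w = 0) \<longleftrightarrow> F *v v = 0" for v
    by (simp only: q)
  then have "(\<forall>v. (\<forall>w. q v w = 0) \<longrightarrow> v = 0) \<longleftrightarrow> (\<forall>v. F *v v = 0 \<longrightarrow> v = 0)" by simp
  also have "\<dots> \<longleftrightarrow> inj ((*v) F)" by (simp only: linear_injective_0[OF matrix_vector_mul_linear[of F]])
  also have "\<dots> \<longleftrightarrow> det F \<noteq> 0" using det_nz_iff_inj[OF matrix_vector_mul_linear[of F]] by simp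
  finally show ?thesis by (simp add: F_def)
qed

text \<open>Riesz representation for a form that may be indefinite; invertibility of its matrix
  takes the place of positivity.\<close>

lemma nondegenerate_represent:
  fixes q :: "real ^ 'n \<Rightarrow> real ^ 'n \<Rightarrow> real"
  assumes q: "bilinear q" and nd: "\<And>v. (\<And>w. q v w = 0) \<Longrightarrow> v = 0" and l: "linear l"
  shows "\<exists>!v. \<forall>w. q v w = l w"
proof -
  define F where "F = transpose (form_matrix q)"
  have qF: "q v w = (F *v v) \<bullet> w" for v w
    by (simp only: F_def form_matrix_apply[OF q] transpose_matrix_vector dot_lmul_matrix)
  have "det F \<noteq> 0" using det_form_matrix_nonzero[OF q] nd unfolding F_def det_transpose by blast
  then have "inj ((*v) F)" using det_nz_iff_inj[OF matrix_vector_mul_linear[of F]] by simp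
  moreover have "linear ((*v) F)" by (rule matrix_vector_mul_linear)
  ultimately have "surj ((*v) F)" using linear_injective_imp_surjective by blast
  define a where "a = (\<Sum>b\<in>Basis. l b *\<^sub>R b)"
  have la: "l w = a \<bullet> w" for w
  proof -
    have "l w = l (\<Sum>b\<in>Basis. (w \<bullet> b) *\<^sub>R b)" by (simp add: euclidean_representation)
    also have "\<dots> = (\<Sum>b\<in>Basis. (w \<bullet> b) * l b)" by (simp add: linear_sum[OF l] linear_scale[OF l])
    finally show ?thesis by (simp add: a_def inner_sum_left inner_commute[of w] mult.commute)
  qed
  obtain v where "a = F *v v" using \<open>surj ((*v) F)\<close> by (rule surjE)
  then have "\<forall>w. q v w = l w" by (simp add: qF la)
  moreover have "v' = v" if "\<forall>w. q v' w = l w" for v'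
  proof -
    have "v' - v = 0"
      by (rule nd) (use that \<open>\<forall>w. q v w = l w\<close> in \<open>simp add: bilinear_lsub[OF q]\<close>)
    then show ?thesis by simp
  qed
  ultimately show ?thesis by (rule ex1I)
qed

section \<open>Change of variables without an order on the index type\<close>

text \<open>The library proves the change of variables formula only for well-ordered index types. A copy
  of the index type, ordered by an arbitrary enumeration, transports it to all finite index types.\<close>

typedef 'a wo = "UNIV :: 'a set" by auto

lemma bij_Rep_wo: "bij Rep_wo" and bij_Abs_wo: "bij Abs_wo"
  by (auto intro!: bijI' simp: Rep_wo_inject Abs_wo_inject)
    (metis Abs_wo_inverse UNIV_I, metis Rep_wo_inverse)

lemma Rep_Abs_wo [simp]: "Rep_wo (Abs_wo x) = x"
  by (simp add: Abs_wo_inverse)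

declare Rep_wo_inverse [simp]

instance wo :: (finite) finite
proof
  have "(UNIV :: 'a wo set) = Abs_wo ` UNIV" using bij_Abs_wo by (auto simp: bij_def)
  then show "finite (UNIV :: 'a wo set)" by (metis finite_imageI finite)
qed

instantiation wo :: (finite) wellorder
begin

definition less_eq_wo :: "'a wo \<Rightarrow> 'a wo \<Rightarrow> bool" where
  "x \<le> y \<longleftrightarrow> to_nat (Rep_wo x) \<le> to_nat (Rep_wo y)"

definition less_wo :: "'a wo \<Rightarrow> 'a wo \<Rightarrow> bool" where
  "x < y \<longleftrightarrow> to_nat (Rep_wo x) < to_nat (Rep_wo y)"

instance
proof
  fix P :: "'a wo \<Rightarrow> bool" and a
  assume step: "\<And>x. (\<And>y. y < x \<Longrightarrow> P y) \<Longrightarrow> P x"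
  show "P a"
  proof (induction a rule: measure_induct_rule[of "\<lambda>x. to_nat (Rep_wo x)"])
    case (less x)
    show ?case by (rule step, rule less.IH) (simp add: less_wo_def)
  qed
next
  fix x y :: "'a wo" assume "x \<le> y" "y \<le> x"
  then have "to_nat (Rep_wo x) = to_nat (Rep_wo y)" unfolding less_eq_wo_def by (rule order_antisym)
  then show "x = y" by (simp add: Rep_wo_inject)
qed (auto simp: less_eq_wo_def less_wo_def)

end

definition to_wo :: "real ^ 'n \<Rightarrow> real ^ 'n wo" where
  "to_wo x = (\<chi> i. x $ Rep_wo i)"

definition of_wo :: "real ^ 'n wo \<Rightarrow> real ^ 'n" where
  "of_wo x = (\<chi> i. x $ Abs_wo i)"

lemma of_to_wo [simp]: "of_wo (to_wo x) = x" and to_of_wo [simp]: "to_wo (of_wo y) = y"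
  by (simp_all add: of_wo_def to_wo_def vec_eq_iff)

lemma linear_to_wo: "linear to_wo" and linear_of_wo: "linear of_wo"
  by (rule linearI; simp add: to_wo_def of_wo_def vec_eq_iff)+

lemma bounded_linear_to_wo: "bounded_linear to_wo" and bounded_linear_of_wo: "bounded_linear of_wo"
  using linear_to_wo linear_of_wo by (simp_all add: linear_conv_bounded_linear[symmetric])

lemma prod_Basis_vec: "(\<Prod>b\<in>(Basis :: (real ^ 'n) set). x \<bullet> b) = (\<Prod>i\<in>UNIV. x $ i)"
proof -
  have B: "(Basis :: (real ^ 'n) set) = (\<lambda>i. axis i 1) ` UNIV" by (auto simp: Basis_vec_def)
  have inj: "inj (\<lambda>i::'n. axis i (1::real))" by (auto simp: inj_def axis_eq_axis)
  show ?thesis unfolding B prod.reindex[OF inj] by (simp add: inner_axis)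
qed

text \<open>Permuting coordinates maps boxes to boxes with the same side lengths, and the measure of
  boxes determines Lebesgue measure.\<close>

lemma lborel_distr_of_wo: "distr lborel borel (of_wo :: real ^ 'n wo \<Rightarrow> real ^ 'n) = lborel"
proof (rule lborel_eqI[symmetric])
  fix l u :: "real ^ 'n" assume le: "\<And>b. b \<in> Basis \<Longrightarrow> l \<bullet> b \<le> u \<bullet> b"
  have le': "l $ i \<le> u $ i" for i using le[of "axis i 1"] by (simp add: inner_axis axis_in_Basis_iff)
  have "(of_wo :: real ^ 'n wo \<Rightarrow> real ^ 'n) \<in> borel_measurable borel"
    by (intro borel_measurable_continuous_onI linear_continuous_on bounded_linear_of_wo)
  then have m: "(of_wo :: real ^ 'n wo \<Rightarrow> real ^ 'n) \<in> lborel \<rightarrow>\<^sub>M borel" by simp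
  have "of_wo -` box l u = box (to_wo l) (to_wo u)"
    by (auto simp: mem_box_cart to_wo_def of_wo_def) (metis Rep_wo_inverse Rep_Abs_wo)+
  then have "emeasure (distr lborel borel of_wo) (box l u) = emeasure lborel (box (to_wo l) (to_wo u))"
    by (simp add: emeasure_distr[OF m])
  also have "\<dots> = (\<Prod>b\<in>Basis. (to_wo u - to_wo l) \<bullet> b)"
    by (rule emeasure_lborel_box) (auto simp: Basis_vec_def inner_axis to_wo_def le')
  also have "\<dots> = ennreal (\<Prod>i\<in>UNIV. (u - l) $ Rep_wo i)"
    unfolding prod_Basis_vec by (simp add: to_wo_def)
  also have "(\<Prod>i\<in>UNIV. (u - l) $ Rep_wo i) = (\<Prod>i\<in>UNIV. (u - l) $ i)"
    by (rule prod.reindex_bij_betw[OF bij_Rep_wo])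
  finally show "emeasure (distr lborel borel of_wo) (box l u) = (\<Prod>b\<in>Basis. (u - l) \<bullet> b)"
    unfolding prod_Basis_vec .
qed simp

text \<open>Relabelling rows and columns together conjugates each permutation of the Leibniz sum,
  which preserves its sign.\<close>

lemma det_reindex_wo:
  fixes A :: "real ^ 'n ^ 'n"
  shows "det (\<chi> i j. A $ Rep_wo i $ Rep_wo j) = det A"
proof -
  let ?c = "\<lambda>p :: 'n \<Rightarrow> 'n. Abs_wo \<circ> p \<circ> Rep_wo"
  have perm: "?c p permutes UNIV" if "p permutes UNIV" for p
    using bij_comp[OF bij_Rep_wo bij_comp[OF permutes_bij[OF that] bij_Abs_wo]]
    by (auto intro!: bij_imp_permutes simp: o_assoc)
  have perm': "Rep_wo \<circ> q \<circ> Abs_wo permutes UNIV" if "q permutes UNIV" for q :: "'n wo \<Rightarrow> 'n wo"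
    using bij_comp[OF bij_Abs_wo bij_comp[OF permutes_bij[OF that] bij_Rep_wo]]
    by (auto intro!: bij_imp_permutes simp: o_assoc)
  have bij: "bij_betw ?c {p. p permutes UNIV} {p. p permutes UNIV}"
    by (rule bij_betwI[where g="\<lambda>q. Rep_wo \<circ> q \<circ> Abs_wo"]) (use perm perm' in \<open>auto simp: fun_eq_iff\<close>)
  have sign: "sign (?c p) = sign p" if "p permutes UNIV" for p
  proof -
    interpret permutes_bij_finite p UNIV UNIV Abs_wo Rep_wo "\<lambda>x. if x \<in> UNIV then Abs_wo (p (Rep_wo x)) else x"
      by unfold_locales (use that bij_Abs_wo in auto)
    show ?thesis using sign_p' by (simp add: o_def)
  qed
  have prd: "(\<Prod>i\<in>UNIV. A $ Rep_wo i $ Rep_wo (?c p i)) = (\<Prod>i\<in>UNIV. A $ i $ p i)" for p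
    using prod.reindex_bij_betw[OF bij_Rep_wo, of "\<lambda>i. A $ i $ p i"] by simp
  have "det (\<chi> i j. A $ Rep_wo i $ Rep_wo j) =
      (\<Sum>q\<in>{q. q permutes UNIV}. of_int (sign q) * (\<Prod>i\<in>UNIV. A $ Rep_wo i $ Rep_wo (q i)))"
    by (simp add: det_def)
  also have "\<dots> = (\<Sum>p\<in>{p. p permutes UNIV}. of_int (sign (?c p)) * (\<Prod>i\<in>UNIV. A $ Rep_wo i $ Rep_wo (?c p i)))"
    by (rule sum.reindex_bij_betw[OF bij, symmetric])
  also have "\<dots> = det A"
    unfolding det_def by (rule sum.cong[OF refl]) (simp only: mem_Collect_eq sign prd)
  finally show ?thesis .
qed

text \<open>An extended-valued form of the change of variables: the image has finite measure exactly
  if the Jacobian is integrable, and otherwise both sides are infinite.\<close>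

lemma emeasure_differentiable_image_wo:
  fixes g :: "real ^ 'n::{finite,wellorder} \<Rightarrow> real ^ 'n::_"
  assumes S: "S \<in> sets borel" and gS: "g ` S \<in> sets borel"
    and der: "\<And>x. x \<in> S \<Longrightarrow> (g has_derivative g' x) (at x)" and inj: "inj_on g S"
    and m: "(\<lambda>x. indicator S x * \<bar>det (matrix (g' x))\<bar>) \<in> borel_measurable borel"
  shows "emeasure lborel (g ` S) = (\<integral>\<^sup>+x. ennreal (indicator S x * \<bar>det (matrix (g' x))\<bar>) \<partial>lborel)"
proof -
  let ?D = "\<lambda>x. \<bar>det (matrix (g' x))\<bar>"
  have Sl: "S \<in> sets lebesgue" using S by auto
  have der': "(g has_derivative g' x) (at x within S)" if "x \<in> S" for x
    using der[OF that] by (rule has_derivative_at_withinI)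
  note eq = measurable_differentiable_image_eq[OF Sl der' inj]
  have le: "emeasure lebesgue (g ` S) = emeasure lborel (g ` S)" using gS by simp
  show ?thesis
  proof (cases "?D integrable_on S")
    case True
    then have lm: "g ` S \<in> lmeasurable" using eq by simp
    have "emeasure lebesgue (g ` S) = ennreal (measure lebesgue (g ` S))"
      by (rule emeasure_eq_ennreal_measure[OF fmeasurableD2[OF lm]])
    also have "\<dots> = ennreal (integral S ?D)"
      using measure_differentiable_image_eq[OF Sl der' inj True] by simp
    also have "\<dots> = integral\<^sup>N lborel (\<lambda>x. indicator S x * ?D x)"
      using nn_integral_has_integral_lebesgue[of S ?D "integral S ?D"] True by (simp add: integrable_integral)
    finally show ?thesis unfolding le .
  next
    case False
    have "(\<integral>\<^sup>+x. ennreal (indicator S x * ?D x) \<partial>lborel) = \<infinity>"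
    proof (rule ccontr)
      assume "\<not> ?thesis"
      then have "(\<integral>\<^sup>+x. ennreal (indicator S x * ?D x) \<partial>lborel) < \<infinity>" by (simp add: less_top)
      then have "(\<lambda>x. indicator S x * ?D x) integrable_on UNIV"
        by (intro nn_integral_integrable_on m) auto
      moreover have "(\<lambda>x. indicator S x * ?D x) = (\<lambda>x. if x \<in> S then ?D x else 0)"
        by (auto simp: indicator_def)
      ultimately show False using False by (simp add: integrable_restrict_UNIV)
    qed
    moreover have "emeasure lborel (g ` S) = \<infinity>"
    proof (rule ccontr)
      assume "\<not> ?thesis"
      then have "g ` S \<in> lmeasurable" unfolding le[symmetric] using gS by (intro fmeasurableI) (auto simp: less_top)
      with eq False show False by blast
    qed
    ultimately show ?thesis by simp
  qed
qed

lemma emeasure_differentiable_image: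
  fixes g :: "real ^ 'n \<Rightarrow> real ^ 'n"
  assumes S: "S \<in> sets borel" and gS: "g ` S \<in> sets borel"
    and der: "\<And>x. x \<in> S \<Longrightarrow> (g has_derivative g' x) (at x)" and inj: "inj_on g S"
    and m: "(\<lambda>x. indicator S x * \<bar>det (matrix (g' x))\<bar>) \<in> borel_measurable borel"
  shows "emeasure lborel (g ` S) = (\<integral>\<^sup>+x. ennreal (indicator S x * \<bar>det (matrix (g' x))\<bar>) \<partial>lborel)"
proof -
  define G where "G = (\<lambda>z. to_wo (g (of_wo z)))"
  define G' where "G' = (\<lambda>z v. to_wo (g' (of_wo z) (of_wo v)))"
  have mo: "(of_wo :: real ^ 'n wo \<Rightarrow> real ^ 'n) \<in> borel_measurable borel"
    by (intro borel_measurable_continuous_onI linear_continuous_on bounded_linear_of_wo)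
  have vi: "of_wo -` T = to_wo ` T" for T :: "(real ^ 'n) set"
    by (auto intro: rev_image_eqI[of "of_wo _"])
  have img: "G ` (to_wo ` S) = to_wo ` (g ` S)" by (simp add: G_def image_image)
  have bor: "to_wo ` T \<in> sets borel" if "T \<in> sets borel" for T :: "(real ^ 'n) set"
    unfolding vi[symmetric] using measurable_sets[OF mo that] by simp
  have dt: "det (matrix (G' z)) = det (matrix (g' (of_wo z)))" for z
  proof -
    have ax: "of_wo (axis j 1) = axis (Rep_wo j) (1 :: real)" for j :: "'n wo"
      by (auto simp: of_wo_def axis_def vec_eq_iff)
    have "matrix (G' z) = (\<chi> i j. matrix (g' (of_wo z)) $ Rep_wo i $ Rep_wo j)"
      by (simp add: matrix_def G'_def ax to_wo_def)
    then show ?thesis by (simp add: det_reindex_wo)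
  qed
  have ind: "indicator (to_wo ` S) z = (indicator S (of_wo z) :: real)" for z
    unfolding vi[symmetric] by (simp add: indicator_def)
  have "emeasure lborel (G ` (to_wo ` S)) =
      (\<integral>\<^sup>+z. ennreal (indicator (to_wo ` S) z * \<bar>det (matrix (G' z))\<bar>) \<partial>lborel)"
  proof (rule emeasure_differentiable_image_wo)
    show "G ` to_wo ` S \<in> sets borel" unfolding img by (rule bor[OF gS])
    show "inj_on G (to_wo ` S)"
    proof (rule inj_onI)
      fix x y assume "x \<in> to_wo ` S" "y \<in> to_wo ` S" "G x = G y"
      then obtain a b where ab: "x = to_wo a" "y = to_wo b" "a \<in> S" "b \<in> S" by auto
      with \<open>G x = G y\<close> have "of_wo (to_wo (g a)) = of_wo (to_wo (g b))" by (simp add: G_def del: of_to_wo) simp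
      then show "x = y" using inj ab by (auto dest: inj_onD)
    qed
    show "(G has_derivative G' z) (at z)" if "z \<in> to_wo ` S" for z
    proof -
      have zS: "of_wo z \<in> S" using that by auto
      have 1: "(of_wo has_derivative of_wo) (at z)"
        by (rule bounded_linear_imp_has_derivative[OF bounded_linear_of_wo])
      have 2: "(to_wo has_derivative to_wo) (at (g (of_wo z)))"
        by (rule bounded_linear_imp_has_derivative[OF bounded_linear_to_wo])
      have "((g \<circ> of_wo) has_derivative (g' (of_wo z) \<circ> of_wo)) (at z)"
        by (rule diff_chain_at[OF 1 der[OF zS]])
      from diff_chain_at[OF this, of to_wo to_wo] 2 show ?thesis
        by (simp add: G_def G'_def o_def)
    qed
    have "(\<lambda>z. (\<lambda>x. indicator S x * \<bar>det (matrix (g' x))\<bar>) (of_wo z)) \<in> borel_measurable borel"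
      by (rule measurable_compose[OF mo m])
    then show "(\<lambda>z. indicator (to_wo ` S) z * \<bar>det (matrix (G' z))\<bar>) \<in> borel_measurable borel"
      by (simp add: ind dt)
  qed (rule bor[OF S])
  moreover have "emeasure lborel (G ` (to_wo ` S)) = emeasure lborel (g ` S)"
  proof -
    have "emeasure (distr lborel borel of_wo) (g ` S) = emeasure lborel (of_wo -` (g ` S))"
      using gS mo by (simp add: emeasure_distr)
    then show ?thesis unfolding lborel_distr_of_wo vi img by simp
  qed
  moreover have "(\<integral>\<^sup>+x. ennreal (indicator S x * \<bar>det (matrix (g' x))\<bar>) \<partial>lborel) =
      (\<integral>\<^sup>+z. ennreal (indicator (to_wo ` S) z * \<bar>det (matrix (G' z))\<bar>) \<partial>lborel)"
  proof -
    have "(\<integral>\<^sup>+x. ennreal (indicator S x * \<bar>det (matrix (g' x))\<bar>) \<partial>(distr lborel borel of_wo)) =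
      (\<integral>\<^sup>+z. ennreal (indicator S (of_wo z) * \<bar>det (matrix (g' (of_wo z)))\<bar>) \<partial>lborel)"
      by (rule nn_integral_distr) (use mo m in auto)
    then show ?thesis unfolding lborel_distr_of_wo by (simp add: ind dt)
  qed
  ultimately show ?thesis by simp
qed

lemma nn_integral_change_of_variables:
  fixes g h :: "real ^ 'n \<Rightarrow> real ^ 'n"
  assumes U: "open U" and V: "open V" and gh: "homeomorphism U V g h"
    and der: "\<And>x. x \<in> U \<Longrightarrow> (g has_derivative g' x) (at x)"
    and c: "continuous_on U (\<lambda>x. det (matrix (g' x)))"
    and F: "F \<in> borel_measurable borel"
  shows "(\<integral>\<^sup>+y. F y * indicator V y \<partial>lborel) =
    (\<integral>\<^sup>+x. ennreal \<bar>det (matrix (g' x))\<bar> * F (g x) * indicator U x \<partial>lborel)"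
proof -
  have gU: "g ` U = V" and hg: "\<And>x. x \<in> U \<Longrightarrow> h (g x) = x" and ghh: "\<And>y. y \<in> V \<Longrightarrow> g (h y) = y"
    and hV: "h ` V = U" and cg: "continuous_on U g" and ch: "continuous_on V h"
    using gh by (auto simp: homeomorphism_def)
  have Ub: "U \<in> sets borel" and Vb: "V \<in> sets borel" using U V by auto
  have inj: "inj_on g U" by (rule inj_on_inverseI[of U h g]) (rule hg)
  \<comment> \<open>Extension by a constant makes the diffeomorphism a Borel map on the whole space,
    as \<open>distr\<close> requires.\<close>
  define G where "G = (\<lambda>x. if x \<in> U then g x else 0)"
  define H where "H = (\<lambda>y. if y \<in> V then h y else 0)"
  have Gm: "G \<in> borel_measurable borel"
    unfolding G_def by (rule borel_measurable_continuous_on_if[OF Ub cg continuous_on_const])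
  have Hm: "H \<in> borel_measurable borel"
    unfolding H_def by (rule borel_measurable_continuous_on_if[OF Vb ch continuous_on_const])
  define D where "D = (\<lambda>x. indicator U x * \<bar>det (matrix (g' x))\<bar>)"
  have "(\<lambda>x. indicator U x *\<^sub>R \<bar>det (matrix (g' x))\<bar>) \<in> borel_measurable borel"
    by (rule borel_measurable_continuous_on_indicator[OF Ub]) (intro continuous_intros c)
  then have Dm: "D \<in> borel_measurable borel" by (simp add: D_def)
  \<comment> \<open>The formula for sets says that Lebesgue measure on V is the image of the
    Jacobian density on U; the formula for functions is integration against both sides.\<close>
  have me: "density lborel (indicator V) = distr (density lborel D) borel G"
  proof (rule measure_eqI)
    fix B assume "B \<in> sets (density lborel (indicator V :: real ^ 'n \<Rightarrow> ennreal))"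
    then have B: "B \<in> sets borel" by simp
    define S where "S = U \<inter> G -` B"
    have S: "S \<in> sets borel" unfolding S_def using measurable_sets[OF Gm B] Ub by auto
    have SU: "S \<subseteq> U" by (auto simp: S_def)
    have gS: "g ` S = V \<inter> B"
    proof
      show "g ` S \<subseteq> V \<inter> B" using gU by (auto simp: S_def G_def)
      show "V \<inter> B \<subseteq> g ` S"
      proof
        fix y assume y: "y \<in> V \<inter> B"
        then have "h y \<in> S" using hV ghh by (auto simp: S_def G_def)
        then show "y \<in> g ` S" using ghh[of y] y by (intro image_eqI[of _ g "h y"]) auto
      qed
    qed
    have Di: "indicator S x * \<bar>det (matrix (g' x))\<bar> = indicator S x * D x" for x
      using SU by (auto simp: D_def indicator_def)
    have "emeasure lborel (g ` S) = (\<integral>\<^sup>+x. ennreal (indicator S x * \<bar>det (matrix (g' x))\<bar>) \<partial>lborel)"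
    proof (rule emeasure_differentiable_image[OF S])
      show "g ` S \<in> sets borel" unfolding gS using B Vb by auto
      show "inj_on g S" using inj SU by (rule inj_on_subset)
      show "(\<lambda>x. indicator S x * \<bar>det (matrix (g' x))\<bar>) \<in> borel_measurable borel"
        unfolding Di using Dm S by measurable
    qed (use der SU in auto)
    also have "\<dots> = (\<integral>\<^sup>+x. ennreal (D x) * indicator (G -` B) x \<partial>lborel)"
      by (rule nn_integral_cong) (auto simp: D_def S_def indicator_def)
    also have "\<dots> = emeasure (density lborel D) (G -` B)"
      using Dm measurable_sets[OF Gm B] by (subst emeasure_density) auto
    also have "\<dots> = emeasure (distr (density lborel D) borel G) B"
      using Gm B by (subst emeasure_distr) auto
    finally have "emeasure lborel (V \<inter> B) = emeasure (distr (density lborel D) borel G) B" unfolding gS .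
    moreover have "emeasure (density lborel (indicator V)) B = emeasure lborel (V \<inter> B)"
      using B Vb by (subst emeasure_density) (auto simp: indicator_inter_arith[symmetric])
    ultimately show "emeasure (density lborel (indicator V)) B = emeasure (distr (density lborel D) borel G) B" by simp
  qed simp
  have "(\<integral>\<^sup>+y. F y * indicator V y \<partial>lborel) = (\<integral>\<^sup>+y. F y \<partial>density lborel (indicator V))"
    using F Vb by (subst nn_integral_density) (auto simp: mult.commute)
  also have "\<dots> = (\<integral>\<^sup>+x. F (G x) \<partial>density lborel D)"
    unfolding me using F Gm by (subst nn_integral_distr) auto
  also have "\<dots> = (\<integral>\<^sup>+x. ennreal (D x) * F (G x) \<partial>lborel)"
    using F Gm Dm by (subst nn_integral_density) auto
  also have "\<dots> = (\<integral>\<^sup>+x. ennreal \<bar>det (matrix (g' x))\<bar> * F (g x) * indicator U x \<partial>lborel)"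
    by (rule nn_integral_cong) (auto simp: D_def G_def indicator_def)
  finally show ?thesis .
qed

section \<open>Atlases, tangent maps and volume measures\<close>

abbreviation chart_img :: "('m, 'n) chart \<Rightarrow> (real ^ 'n) set" where
  "chart_img c \<equiv> coords c ` chart_dom c"

abbreviation overlap :: "('m, 'n) chart \<Rightarrow> ('m, 'n) chart \<Rightarrow> (real ^ 'n) set" where
  "overlap c d \<equiv> coords c ` (chart_dom c \<inter> chart_dom d)"

definition chart_deriv :: "('m \<Rightarrow> 'e::euclidean_space) \<Rightarrow> ('m, 'n::finite) chart \<Rightarrow> real ^ 'n \<Rightarrow> real ^ 'n \<Rightarrow> 'e" where
  "chart_deriv f c y = frechet_derivative (f \<circ> chart_inv c) (at y)"

definition transition_deriv :: "('m, 'n::finite) chart \<Rightarrow> ('m, 'n) chart \<Rightarrow> real ^ 'n \<Rightarrow> real ^ 'n \<Rightarrow> real ^ 'n" where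
  "transition_deriv c d y = frechet_derivative (coords d \<circ> chart_inv c) (at y)"

locale manifold =
  fixes A :: "('m::{t2_space,second_countable_topology}, 'n::finite) chart set"
  assumes smooth_atlas: "smooth_atlas A"
begin

lemma chart: "c \<in> A \<Longrightarrow> is_chart c"
  using smooth_atlas by (auto simp: smooth_atlas_def)

lemma open_chart_dom: "c \<in> A \<Longrightarrow> open (chart_dom c)"
  and open_chart_img: "c \<in> A \<Longrightarrow> open (chart_img c)"
  and chart_homeomorphism: "c \<in> A \<Longrightarrow> homeomorphism (chart_dom c) (chart_img c) (coords c) (chart_inv c)"
  using chart by (auto simp: is_chart_def)

lemma chart_inv_coords: "c \<in> A \<Longrightarrow> x \<in> chart_dom c \<Longrightarrow> chart_inv c (coords c x) = x"
  using chart_homeomorphism by (auto simp: homeomorphism_def)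

lemma coords_chart_inv: "c \<in> A \<Longrightarrow> y \<in> chart_img c \<Longrightarrow> coords c (chart_inv c y) = y"
  using chart_homeomorphism[of c] unfolding homeomorphism_def by blast

lemma chart_inv_mem: "c \<in> A \<Longrightarrow> y \<in> chart_img c \<Longrightarrow> chart_inv c y \<in> chart_dom c"
  using chart_homeomorphism[of c] unfolding homeomorphism_def by blast

lemma continuous_on_coords: "c \<in> A \<Longrightarrow> continuous_on (chart_dom c) (coords c)"
  and continuous_on_chart_inv: "c \<in> A \<Longrightarrow> continuous_on (chart_img c) (chart_inv c)"
  using chart_homeomorphism by (auto simp: homeomorphism_def)

text \<open>A chart image becomes a preimage under the inverse chart, so that openness and
  measurability follow from continuity.\<close>

lemma image_coords_eq:
  assumes "c \<in> A" "B \<subseteq> chart_dom c"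
  shows "coords c ` B = {y \<in> chart_img c. chart_inv c y \<in> B}"
  using assms chart_inv_coords[OF assms(1)] by force

lemma open_image_coords:
  assumes "c \<in> A" "B \<subseteq> chart_dom c" "open B"
  shows "open (coords c ` B)"
proof -
  have "open (chart_img c \<inter> chart_inv c -` B)"
    by (rule continuous_open_preimage[OF continuous_on_chart_inv[OF assms(1)] open_chart_img[OF assms(1)] assms(3)])
  moreover have "chart_img c \<inter> chart_inv c -` B = coords c ` B"
    unfolding image_coords_eq[OF assms(1,2)] by auto
  ultimately show ?thesis by simp
qed

lemma chart_exists: "\<exists>c\<in>A. x \<in> chart_dom c"
  using smooth_atlas by (auto simp: smooth_atlas_def)

lemma chart_at: "chart_at A x \<in> A" "x \<in> chart_dom (chart_at A x)"
proof -
  have "\<exists>c. c \<in> A \<and> x \<in> chart_dom c" using chart_exists[of x] by blast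
  then have "chart_at A x \<in> A \<and> x \<in> chart_dom (chart_at A x)"
    unfolding chart_at_def by (rule someI_ex)
  then show "chart_at A x \<in> A" "x \<in> chart_dom (chart_at A x)" by auto
qed

lemma coords_chart_at: "coords (chart_at A x) x \<in> chart_img (chart_at A x)"
  using chart_at by blast

lemma chart_inv_measurable:
  assumes "c \<in> A"
  shows "(\<lambda>y. if y \<in> chart_img c then chart_inv c y else undefined) \<in> borel_measurable borel"
  by (rule borel_measurable_continuous_on_if[OF _ continuous_on_chart_inv[OF assms] continuous_on_const])
    (use open_chart_img[OF assms] in auto)

lemma borel_image_coords:
  assumes "c \<in> A" "B \<subseteq> chart_dom c" "B \<in> sets borel"
  shows "coords c ` B \<in> sets borel"
proof -
  let ?G = "\<lambda>y. if y \<in> chart_img c then chart_inv c y else undefined"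
  have "?G -` B \<inter> chart_img c \<in> sets borel"
    using measurable_sets[OF chart_inv_measurable[OF assms(1)] assms(3)] open_chart_img[OF assms(1)] by auto
  moreover have "?G -` B \<inter> chart_img c = coords c ` B"
    unfolding image_coords_eq[OF assms(1,2)] by auto
  ultimately show ?thesis by simp
qed

lemma compact_image_coords:
  assumes "c \<in> A" "K \<subseteq> chart_dom c" "compact K"
  shows "compact (coords c ` K)"
  using continuous_on_subset[OF continuous_on_coords[OF assms(1)] assms(2)] assms(3)
  by (rule compact_continuous_image)

lemma smooth_transition:
  "c \<in> A \<Longrightarrow> d \<in> A \<Longrightarrow> smooth_on (overlap c d) (coords d \<circ> chart_inv c)"
  using smooth_atlas by (auto simp: smooth_atlas_def)

lemma open_overlap: "c \<in> A \<Longrightarrow> d \<in> A \<Longrightarrow> open (overlap c d)"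
  by (rule smooth_onD_open[OF smooth_transition])

lemma overlapD:
  assumes "c \<in> A" "d \<in> A" "y \<in> overlap c d"
  shows "y \<in> chart_img c" "chart_inv c y \<in> chart_dom c" "chart_inv c y \<in> chart_dom d"
    "coords d (chart_inv c y) \<in> overlap d c" "chart_inv d (coords d (chart_inv c y)) = chart_inv c y"
proof -
  from assms(3) obtain x where x: "y = coords c x" "x \<in> chart_dom c" "x \<in> chart_dom d" by blast
  have e: "chart_inv c y = x" using chart_inv_coords[OF assms(1)] x by simp
  show "y \<in> chart_img c" "chart_inv c y \<in> chart_dom c" "chart_inv c y \<in> chart_dom d"
    "coords d (chart_inv c y) \<in> overlap d c" "chart_inv d (coords d (chart_inv c y)) = chart_inv c y"
    unfolding e using x chart_inv_coords[OF assms(2)] by auto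
qed

lemma transition_has_derivative:
  "c \<in> A \<Longrightarrow> d \<in> A \<Longrightarrow> y \<in> overlap c d \<Longrightarrow>
    ((coords d \<circ> chart_inv c) has_derivative transition_deriv c d y) (at y)"
  unfolding transition_deriv_def by (rule smooth_on_has_derivative[OF smooth_transition])

lemma linear_transition_deriv: "c \<in> A \<Longrightarrow> d \<in> A \<Longrightarrow> y \<in> overlap c d \<Longrightarrow> linear (transition_deriv c d y)"
  by (rule has_derivative_linear[OF transition_has_derivative])

text \<open>Differentiability is assumed in one chart at one point, so that the rule also covers
  partition functions, which are merely C^1 on an open set.\<close>

lemma chart_change:
  fixes f :: "'m \<Rightarrow> 'e::euclidean_space"
  assumes c: "c \<in> A" and d: "d \<in> A" and y: "y \<in> overlap c d"
    and f: "(f \<circ> chart_inv d) differentiable (at (coords d (chart_inv c y)))"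
  shows "((f \<circ> chart_inv c) has_derivative
    (\<lambda>v. chart_deriv f d (coords d (chart_inv c y)) (transition_deriv c d y v))) (at y)"
proof -
  have 2: "((f \<circ> chart_inv d) has_derivative chart_deriv f d (coords d (chart_inv c y))) (at ((coords d \<circ> chart_inv c) y))"
    using f unfolding chart_deriv_def by (simp add: frechet_derivative_works)
  have "(((f \<circ> chart_inv d) \<circ> (coords d \<circ> chart_inv c)) has_derivative
      (chart_deriv f d (coords d (chart_inv c y)) \<circ> transition_deriv c d y)) (at y)"
    by (rule diff_chain_at[OF transition_has_derivative[OF c d y] 2])
  then have "(((f \<circ> chart_inv d) \<circ> (coords d \<circ> chart_inv c)) has_derivative
      (\<lambda>v. chart_deriv f d (coords d (chart_inv c y)) (transition_deriv c d y v))) (at y)"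
    by (simp only: o_def)
  then show ?thesis
    by (rule has_derivative_transform_within_open[OF _ open_overlap[OF c d] y])
      (simp add: overlapD(5)[OF c d])
qed

lemma chart_deriv_change:
  fixes f :: "'m \<Rightarrow> 'e::euclidean_space"
  assumes "c \<in> A" "d \<in> A" "y \<in> overlap c d"
    "(f \<circ> chart_inv d) differentiable (at (coords d (chart_inv c y)))"
  shows "chart_deriv f c y v = chart_deriv f d (coords d (chart_inv c y)) (transition_deriv c d y v)"
  using frechet_derivative_apply[OF chart_change[OF assms]] by (simp add: chart_deriv_def)

lemma transition_deriv_inverse:
  assumes c: "c \<in> A" and d: "d \<in> A" and y: "y \<in> overlap c d"
  shows "transition_deriv d c (coords d (chart_inv c y)) (transition_deriv c d y v) = v"
proof -
  have y': "coords d (chart_inv c y) \<in> overlap d c" by (rule overlapD(4)[OF c d y])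
  have "(coords c \<circ> chart_inv d) differentiable (at (coords d (chart_inv c y)))"
    using transition_has_derivative[OF d c y'] by (auto simp: differentiable_def)
  from chart_change[OF c d y this]
  have "((coords c \<circ> chart_inv c) has_derivative
      (\<lambda>v. transition_deriv d c (coords d (chart_inv c y)) (transition_deriv c d y v))) (at y)"
    by (simp only: chart_deriv_def transition_deriv_def)
  moreover have "((coords c \<circ> chart_inv c) has_derivative (\<lambda>v. v)) (at y)"
    by (rule has_derivative_transform_within_open[OF has_derivative_ident open_overlap[OF c d] y])
      (use overlapD(1)[OF c d] coords_chart_inv[OF c] in auto)
  ultimately have "(\<lambda>v. transition_deriv d c (coords d (chart_inv c y)) (transition_deriv c d y v)) = (\<lambda>v. v)"
    by (rule has_derivative_unique)
  then show ?thesis by (rule fun_cong)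
qed

lemma inj_transition_deriv:
  assumes "c \<in> A" "d \<in> A" "y \<in> overlap c d"
  shows "inj (transition_deriv c d y)"
  by (rule inj_on_inverseI[where g="transition_deriv d c (coords d (chart_inv c y))"])
    (rule transition_deriv_inverse[OF assms])

lemma surj_transition_deriv:
  assumes "c \<in> A" "d \<in> A" "y \<in> overlap c d"
  shows "surj (transition_deriv c d y)"
  using linear_injective_imp_surjective[OF linear_transition_deriv[OF assms] inj_transition_deriv[OF assms]] by simp

lemma smooth_map_chart: "smooth_map A f \<Longrightarrow> c \<in> A \<Longrightarrow> smooth_on (chart_img c) (f \<circ> chart_inv c)"
  by (auto simp: smooth_map_def)

lemma smooth_map_differentiable:
  "smooth_map A f \<Longrightarrow> c \<in> A \<Longrightarrow> y \<in> chart_img c \<Longrightarrow> (f \<circ> chart_inv c) differentiable (at y)"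
  by (rule smooth_on_differentiable[OF smooth_map_chart])

lemma chart_deriv_has_derivative:
  "smooth_map A f \<Longrightarrow> c \<in> A \<Longrightarrow> y \<in> chart_img c \<Longrightarrow>
    ((f \<circ> chart_inv c) has_derivative chart_deriv f c y) (at y)"
  unfolding chart_deriv_def by (rule smooth_on_has_derivative[OF smooth_map_chart])

lemma linear_chart_deriv: "smooth_map A f \<Longrightarrow> c \<in> A \<Longrightarrow> y \<in> chart_img c \<Longrightarrow> linear (chart_deriv f c y)"
  by (rule has_derivative_linear[OF chart_deriv_has_derivative])

lemma tangent_map_chart_deriv: "tangent_map A f x = chart_deriv f (chart_at A x) (coords (chart_at A x) x)"
  by (simp add: tangent_map_def chart_deriv_def)

text \<open>\<open>tangent_map\<close> takes vectors in the coordinates of the chart chosen at x;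
  this isomorphism converts the components of a tangent vector in the chart c into those
  coordinates.\<close>

definition to_chart_at :: "('m, 'n) chart \<Rightarrow> 'm \<Rightarrow> real ^ 'n \<Rightarrow> real ^ 'n" where
  "to_chart_at c x = transition_deriv c (chart_at A x) (coords c x)"

lemma mem_overlap_chart_at: "c \<in> A \<Longrightarrow> x \<in> chart_dom c \<Longrightarrow> coords c x \<in> overlap c (chart_at A x)"
  using chart_at(2) by blast

lemma chart_deriv_tangent_map:
  fixes f :: "'m \<Rightarrow> 'e::euclidean_space"
  assumes c: "c \<in> A" and x: "x \<in> chart_dom c"
    and f: "(f \<circ> chart_inv (chart_at A x)) differentiable (at (coords (chart_at A x) x))"
  shows "chart_deriv f c (coords c x) v = tangent_map A f x (to_chart_at c x v)"
  using chart_deriv_change[OF c chart_at(1) mem_overlap_chart_at[OF c x], of f] f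
  by (simp add: chart_inv_coords[OF c x] tangent_map_chart_deriv to_chart_at_def)

lemma linear_to_chart_at: "c \<in> A \<Longrightarrow> x \<in> chart_dom c \<Longrightarrow> linear (to_chart_at c x)"
  unfolding to_chart_at_def by (rule linear_transition_deriv[OF _ chart_at(1) mem_overlap_chart_at])

lemma inj_to_chart_at: "c \<in> A \<Longrightarrow> x \<in> chart_dom c \<Longrightarrow> inj (to_chart_at c x)"
  unfolding to_chart_at_def by (rule inj_transition_deriv[OF _ chart_at(1) mem_overlap_chart_at])

lemma surj_to_chart_at: "c \<in> A \<Longrightarrow> x \<in> chart_dom c \<Longrightarrow> surj (to_chart_at c x)"
  unfolding to_chart_at_def by (rule surj_transition_deriv[OF _ chart_at(1) mem_overlap_chart_at])

lemma chart_deriv_tangent_map_smooth: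
  assumes "smooth_map A f" "c \<in> A" "x \<in> chart_dom c"
  shows "chart_deriv f c (coords c x) v = tangent_map A f x (to_chart_at c x v)"
  by (rule chart_deriv_tangent_map[OF assms(2,3) smooth_map_differentiable[OF assms(1) chart_at(1) coords_chart_at]])

lemma linear_tangent_map: "smooth_map A f \<Longrightarrow> linear (tangent_map A f x)"
  unfolding tangent_map_chart_deriv by (rule linear_chart_deriv[OF _ chart_at(1) coords_chart_at])

lemma continuous_on_chartwise:
  fixes f :: "'m \<Rightarrow> 'b::topological_space"
  assumes "\<And>c. c \<in> A \<Longrightarrow> continuous_on (chart_img c) (f \<circ> chart_inv c)"
  shows "continuous_on UNIV f"
proof -
  have "continuous_on (chart_dom c) f" if c: "c \<in> A" for c
  proof -
    have "continuous_on (chart_dom c) (\<lambda>x. (f \<circ> chart_inv c) (coords c x))"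
      by (rule continuous_on_compose2[OF assms[OF c] continuous_on_coords[OF c]]) auto
    then show ?thesis by (rule continuous_on_eq) (simp add: chart_inv_coords[OF c])
  qed
  then have "continuous_on (\<Union>c\<in>A. chart_dom c) f"
    by (intro continuous_on_open_UN) (auto simp: open_chart_dom)
  moreover have "(\<Union>c\<in>A. chart_dom c) = UNIV" using smooth_atlas by (auto simp: smooth_atlas_def)
  ultimately show ?thesis by simp
qed

lemma smooth_map_continuous: "smooth_map A f \<Longrightarrow> continuous_on UNIV f"
  by (intro continuous_on_chartwise smooth_on_continuous_on smooth_map_chart)

subsection \<open>Measures with prescribed chart densities\<close>

text \<open>The transformation law of a density is what makes the chart integrals agree on overlaps,
  so that such a family glues to a measure.\<close>

definition compatible_densities :: "(('m, 'n) chart \<Rightarrow> real ^ 'n \<Rightarrow> real) \<Rightarrow> bool" where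
  "compatible_densities h \<longleftrightarrow> (\<forall>c\<in>A. continuous_on (chart_img c) (h c) \<and> (\<forall>y\<in>chart_img c. 0 \<le> h c y)) \<and>
    (\<forall>c\<in>A. \<forall>d\<in>A. \<forall>y\<in>overlap c d.
      h c y = \<bar>det (matrix (transition_deriv c d y))\<bar> * h d (coords d (chart_inv c y)))"

text \<open>The condition under the definite description in \<open>volume_measure\<close>, for an
  arbitrary family of densities.\<close>

definition has_densities :: "'m measure \<Rightarrow> (('m, 'n) chart \<Rightarrow> real ^ 'n \<Rightarrow> real) \<Rightarrow> bool" where
  "has_densities M h \<longleftrightarrow> sets M = sets borel \<and>
     (\<forall>c\<in>A. \<forall>B\<in>sets borel. B \<subseteq> chart_dom c \<longrightarrow>
        emeasure M B = (\<integral>\<^sup>+ y\<in>coords c ` B. ennreal (h c y) \<partial>lborel))"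

lemma density_measurable:
  assumes h: "compatible_densities h" and c: "c \<in> A" and B: "B \<in> sets borel" "B \<subseteq> chart_img c"
  shows "(\<lambda>y. ennreal (h c y) * indicator B y) \<in> borel_measurable borel"
proof -
  have "(\<lambda>y. indicator (chart_img c) y *\<^sub>R h c y) \<in> borel_measurable borel"
    by (rule borel_measurable_continuous_on_indicator)
      (use h c open_chart_img in \<open>auto simp: compatible_densities_def\<close>)
  then have "(\<lambda>y. ennreal (indicator (chart_img c) y *\<^sub>R h c y) * indicator B y) \<in> borel_measurable borel"
    using B by measurable
  moreover have "ennreal (indicator (chart_img c) y *\<^sub>R h c y) * indicator B y = ennreal (h c y) * indicator B y" for y
    using B(2) by (auto simp: indicator_def)
  ultimately show ?thesis by simp
qed

lemma countable_chart_cover: "\<exists>C :: nat \<Rightarrow> ('m, 'n) chart. (\<forall>i. C i \<in> A) \<and> (\<Union>i. chart_dom (C i)) = UNIV"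
proof -
  have "open S" if "S \<in> chart_dom ` A" for S using that open_chart_dom by blast
  then have "\<exists>F. F \<subseteq> chart_dom ` A \<and> countable F \<and> \<Union>F = \<Union>(chart_dom ` A)"
    using Lindelof_openin[of "chart_dom ` A" UNIV] by (metis open_openin subtopology_UNIV)
  then obtain F where F: "F \<subseteq> chart_dom ` A" "countable F" "\<Union>F = \<Union>(chart_dom ` A)" by blast
  have U: "\<Union>(chart_dom ` A) = UNIV" using smooth_atlas by (auto simp: smooth_atlas_def)
  obtain B where B: "B \<subseteq> A" "countable B" "F = chart_dom ` B"
    using countable_subset_image[of F chart_dom A] F by auto
  have ne: "B \<noteq> {}" using B(3) F(3) U by auto
  have "from_nat_into B i \<in> A" for i using from_nat_into[OF ne, of i] B(1) by auto
  moreover have "range (from_nat_into B) = B" by (rule range_from_nat_into[OF ne B(2)])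
  then have "(\<Union>i. chart_dom (from_nat_into B i)) = UNIV" using B(3) F(3) U by (metis image_image)
  ultimately show ?thesis by blast
qed

text \<open>Second countability gives countably many charts that cover; cutting them to disjoint
  Borel pieces reduces both existence and uniqueness of a measure to sets inside a single
  chart.\<close>

lemma disjoint_chart_cover:
  "\<exists>(C :: nat \<Rightarrow> ('m, 'n) chart) D. (\<forall>i. C i \<in> A) \<and> (\<forall>i. D i \<subseteq> chart_dom (C i)) \<and>
    (\<forall>i. D i \<in> sets borel) \<and> disjoint_family D \<and> (\<Union>i. D i) = UNIV"
proof -
  obtain C :: "nat \<Rightarrow> ('m, 'n) chart" where C: "\<And>i. C i \<in> A" "(\<Union>i. chart_dom (C i)) = UNIV"
    using countable_chart_cover by blast
  let ?D = "disjointed (\<lambda>i. chart_dom (C i))"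
  have "?D i \<subseteq> chart_dom (C i)" for i by (rule disjointed_subset)
  moreover have "range ?D \<subseteq> sets borel"
  proof (rule sets.range_disjointed_sets)
    show "range (\<lambda>i. chart_dom (C i)) \<subseteq> sets borel" using borel_open[OF open_chart_dom[OF C(1)]] by blast
  qed
  then have "?D i \<in> sets borel" for i by blast
  moreover have "disjoint_family ?D" by (rule disjoint_family_disjointed)
  moreover have "(\<Union>i. ?D i) = UNIV" using C(2) by (simp add: UN_disjointed_eq)
  ultimately show ?thesis using C(1) by blast
qed

lemma has_densities_unique:
  assumes M: "has_densities M h" and N: "has_densities N h"
  shows "M = N"
proof -
  obtain C :: "nat \<Rightarrow> ('m, 'n) chart" and D where C: "\<And>i. C i \<in> A" "\<And>i. D i \<subseteq> chart_dom (C i)" "\<And>i. D i \<in> sets borel"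
    "disjoint_family D" "(\<Union>i. D i) = UNIV" using disjoint_chart_cover by blast
  have sM: "sets M = sets borel" and sN: "sets N = sets borel" using M N by (auto simp: has_densities_def)
  have dec: "emeasure X B = (\<Sum>i. emeasure X (B \<inter> D i))" if "sets X = sets borel" "B \<in> sets borel" for X B
  proof -
    have "(\<Sum>i. emeasure X (B \<inter> D i)) = emeasure X (\<Union>i. B \<inter> D i)"
    proof (rule suminf_emeasure)
      show "range (\<lambda>i. B \<inter> D i) \<subseteq> sets X" using that C(3) by auto
      show "disjoint_family (\<lambda>i. B \<inter> D i)" by (rule disjoint_family_subset[OF C(4)]) auto
    qed
    also have "(\<Union>i. B \<inter> D i) = B" using C(5) by blast
    finally show ?thesis by simp
  qed
  have eq: "emeasure M (B \<inter> D i) = emeasure N (B \<inter> D i)" if "B \<in> sets borel" for B i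
  proof -
    have "B \<inter> D i \<in> sets borel" "B \<inter> D i \<subseteq> chart_dom (C i)" using that C by auto
    then show ?thesis using M N C(1)[of i] by (simp add: has_densities_def)
  qed
  show ?thesis
  proof (rule measure_eqI)
    fix B assume "B \<in> sets M"
    then have "B \<in> sets borel" by (simp add: sM)
    then show "emeasure M B = emeasure N B" by (simp add: dec[OF sM] dec[OF sN] eq)
  qed (simp add: sM sN)
qed

lemma density_integral_change:
  assumes h: "compatible_densities h" and c: "c \<in> A" and d: "d \<in> A"
    and B: "B \<in> sets borel" "B \<subseteq> chart_dom c" "B \<subseteq> chart_dom d"
  shows "(\<integral>\<^sup>+ y\<in>coords d ` B. ennreal (h d y) \<partial>lborel) = (\<integral>\<^sup>+ y\<in>coords c ` B. ennreal (h c y) \<partial>lborel)"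
proof -
  let ?t = "coords d \<circ> chart_inv c" and ?s = "coords c \<circ> chart_inv d"
  define F where "F = (\<lambda>y. ennreal (h d y) * indicator (coords d ` B) y)"
  \<comment> \<open>The change of variables is carried out with the transition map between the two
    images of the overlap.\<close>
  have hom: "homeomorphism (overlap c d) (overlap d c) ?t ?s"
  proof (rule homeomorphismI)
    show "continuous_on (overlap c d) ?t" by (rule smooth_on_continuous_on[OF smooth_transition[OF c d]])
    show "continuous_on (overlap d c) ?s" by (rule smooth_on_continuous_on[OF smooth_transition[OF d c]])
    show "?t ` overlap c d \<subseteq> overlap d c" using overlapD(4)[OF c d] by auto
    show "?s ` overlap d c \<subseteq> overlap c d" using overlapD(4)[OF d c] by auto
    show "?s (?t y) = y" if "y \<in> overlap c d" for y
      using overlapD(1,5)[OF c d that] coords_chart_inv[OF c] by simp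
    show "?t (?s y) = y" if "y \<in> overlap d c" for y
      using overlapD(1,5)[OF d c that] coords_chart_inv[OF d] by simp
  qed
  have dc: "continuous_on (overlap c d) (\<lambda>y. det (matrix (transition_deriv c d y)))"
  proof -
    have "smooth_on (overlap c d) (\<lambda>y. matrix (transition_deriv c d y))"
    proof (intro smooth_on_vec open_overlap c d)
      fix i j
      have "smooth_on (overlap c d) (\<lambda>y. transition_deriv c d y (axis j 1) $ i)"
        unfolding transition_deriv_def
        by (rule smooth_on_vec_nth[OF smooth_on_frechet_derivative[OF smooth_transition[OF c d]]])
      then show "smooth_on (overlap c d) (\<lambda>y. matrix (transition_deriv c d y) $ i $ j)"
        by (simp add: matrix_def)
    qed
    then show ?thesis by (rule smooth_on_continuous_on[OF smooth_on_det])
  qed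
  have Fm: "F \<in> borel_measurable borel"
    unfolding F_def by (rule density_measurable[OF h d borel_image_coords[OF d B(3) B(1)]]) (use B in auto)
  have "(\<integral>\<^sup>+y. F y * indicator (overlap d c) y \<partial>lborel) =
    (\<integral>\<^sup>+y. ennreal \<bar>det (matrix (transition_deriv c d y))\<bar> * F (?t y) * indicator (overlap c d) y \<partial>lborel)"
    by (rule nn_integral_change_of_variables[OF open_overlap[OF c d] open_overlap[OF d c] hom
          transition_has_derivative[OF c d] dc Fm])
  also have "\<dots> = (\<integral>\<^sup>+ y\<in>coords c ` B. ennreal (h c y) \<partial>lborel)"
  proof (rule nn_integral_cong)
    fix y
    show "ennreal \<bar>det (matrix (transition_deriv c d y))\<bar> * F (?t y) * indicator (overlap c d) y =
        ennreal (h c y) * indicator (coords c ` B) y"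
    proof (cases "y \<in> overlap c d")
      case True
      have "?t y \<in> coords d ` B \<longleftrightarrow> y \<in> coords c ` B"
        using overlapD[OF c d True] unfolding image_coords_eq[OF c B(2)] image_coords_eq[OF d B(3)] by auto
      moreover have "h c y = \<bar>det (matrix (transition_deriv c d y))\<bar> * h d (?t y)"
        using h c d True unfolding compatible_densities_def o_def by blast
      moreover have "0 \<le> h d (?t y)"
        using h d overlapD(4)[OF c d True] unfolding compatible_densities_def o_def by blast
      ultimately show ?thesis using True by (auto simp: F_def indicator_def ennreal_mult)
    next
      case False
      then have "y \<notin> coords c ` B" using B by auto
      with False show ?thesis by simp
    qed
  qed
  also have "(\<integral>\<^sup>+y. F y * indicator (overlap d c) y \<partial>lborel) = (\<integral>\<^sup>+ y\<in>coords d ` B. ennreal (h d y) \<partial>lborel)"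
    by (rule nn_integral_cong) (use B in \<open>auto simp: F_def indicator_def\<close>)
  finally show ?thesis .
qed

text \<open>The disjoint pieces are laid out in copies of the coordinate space indexed by
  \<open>nat\<close>, each with its chart density, and the total measure is pushed forward by the
  inverse charts.\<close>

lemma has_densities_exists:
  assumes h: "compatible_densities h"
  shows "\<exists>M. has_densities M h"
proof -
  obtain C :: "nat \<Rightarrow> ('m, 'n) chart" and D where C: "\<And>i. C i \<in> A" "\<And>i. D i \<subseteq> chart_dom (C i)" "\<And>i. D i \<in> sets borel"
    "disjoint_family D" "(\<Union>i. D i) = UNIV" using disjoint_chart_cover by blast
  define H where "H = (\<lambda>(i, y). ennreal (h (C i) y) * indicator (coords (C i) ` D i) y)"
  define G where "G = (\<lambda>(i, y). if y \<in> chart_img (C i) then chart_inv (C i) y else undefined)"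
  let ?P = "count_space (UNIV :: nat set) \<Otimes>\<^sub>M (lborel :: (real ^ 'n) measure)"
  have Hm: "H \<in> borel_measurable ?P"
  proof (rule measurable_pair_measure_countable1)
    fix i
    have "coords (C i) ` D i \<in> sets borel" "coords (C i) ` D i \<subseteq> chart_img (C i)"
      using borel_image_coords[OF C(1) C(2) C(3)] C(2) by blast+
    then show "(\<lambda>y. H (i, y)) \<in> borel_measurable lborel"
      unfolding H_def using density_measurable[OF h C(1)] by simp
  qed simp
  have Gm: "G \<in> measurable ?P borel"
    by (rule measurable_pair_measure_countable1)
      (use chart_inv_measurable[OF C(1)] in \<open>simp_all add: G_def\<close>)
  define M where "M = distr (density ?P H) borel G"
  have sM: "sets M = sets borel" by (simp add: M_def)
  have em: "emeasure M B = (\<Sum>i. \<integral>\<^sup>+ y\<in>coords (C i) ` (B \<inter> D i). ennreal (h (C i) y) \<partial>lborel)"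
    if B: "B \<in> sets borel" for B
  proof -
    have GB: "G -` B \<inter> space ?P \<in> sets ?P" by (rule measurable_sets[OF Gm B])
    have "emeasure M B = emeasure (density ?P H) (G -` B \<inter> space ?P)"
      unfolding M_def using Gm B by (subst emeasure_distr) auto
    also have "\<dots> = (\<integral>\<^sup>+z. H z * indicator (G -` B \<inter> space ?P) z \<partial>?P)"
      by (rule emeasure_density[OF Hm GB])
    also have "\<dots> = (\<integral>\<^sup>+i. \<integral>\<^sup>+y. H (i, y) * indicator (G -` B \<inter> space ?P) (i, y) \<partial>lborel \<partial>count_space UNIV)"
      by (rule lborel.nn_integral_fst[symmetric])
        (intro borel_measurable_times_ennreal Hm borel_measurable_indicator GB)
    also have "\<dots> = (\<Sum>i. \<integral>\<^sup>+y. H (i, y) * indicator (G -` B \<inter> space ?P) (i, y) \<partial>lborel)"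
      by (rule nn_integral_count_space_nat)
    also have "\<dots> = (\<Sum>i. \<integral>\<^sup>+ y\<in>coords (C i) ` (B \<inter> D i). ennreal (h (C i) y) \<partial>lborel)"
    proof (rule suminf_cong, rule nn_integral_cong)
      fix i and y :: "real ^ 'n"
      have BD: "B \<inter> D i \<subseteq> chart_dom (C i)" using C(2) by blast
      have "y \<in> coords (C i) ` (B \<inter> D i) \<longleftrightarrow> y \<in> coords (C i) ` D i \<and> (i, y) \<in> G -` B \<inter> space ?P"
        unfolding image_coords_eq[OF C(1) BD] image_coords_eq[OF C(1) C(2)]
        by (auto simp: G_def space_pair_measure)
      then show "H (i, y) * indicator (G -` B \<inter> space ?P) (i, y) =
          ennreal (h (C i) y) * indicator (coords (C i) ` (B \<inter> D i)) y"
        by (auto simp: H_def indicator_def)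
    qed
    finally show ?thesis .
  qed
  have "emeasure M B = (\<integral>\<^sup>+ y\<in>coords c ` B. ennreal (h c y) \<partial>lborel)"
    if c: "c \<in> A" and B: "B \<in> sets borel" "B \<subseteq> chart_dom c" for c B
  proof -
    \<comment> \<open>The chart c need not be among the charts of the cover. Each piece of B is
      moved from its own chart to c, and countable additivity of this auxiliary measure reassembles
      B there.\<close>
    let ?N = "density lborel (\<lambda>y. ennreal (h c y) * indicator (chart_img c) y)"
    have img: "chart_img c \<in> sets borel" using open_chart_img[OF c] by simp
    have N: "emeasure ?N (coords c ` B') = (\<integral>\<^sup>+ y\<in>coords c ` B'. ennreal (h c y) \<partial>lborel)"
      if "B' \<in> sets borel" "B' \<subseteq> chart_dom c" for B'
    proof -
      have "emeasure ?N (coords c ` B') =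
          (\<integral>\<^sup>+y. ennreal (h c y) * indicator (chart_img c) y * indicator (coords c ` B') y \<partial>lborel)"
        using density_measurable[OF h c img] borel_image_coords[OF c that(2,1)]
        by (intro emeasure_density) auto
      also have "\<dots> = (\<integral>\<^sup>+ y\<in>coords c ` B'. ennreal (h c y) \<partial>lborel)"
        by (rule nn_integral_cong) (use that(2) in \<open>auto simp: indicator_def\<close>)
      finally show ?thesis .
    qed
    have BD: "B \<inter> D i \<in> sets borel" "B \<inter> D i \<subseteq> chart_dom c" "B \<inter> D i \<subseteq> chart_dom (C i)" for i
      using B C(2,3) by auto
    have "emeasure M B = (\<Sum>i. \<integral>\<^sup>+ y\<in>coords c ` (B \<inter> D i). ennreal (h c y) \<partial>lborel)"
      unfolding em[OF B(1)]
      by (rule suminf_cong) (rule density_integral_change[OF h c C(1) BD])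
    also have "\<dots> = (\<Sum>i. emeasure ?N (coords c ` (B \<inter> D i)))"
      by (rule suminf_cong) (rule N[OF BD(1,2), symmetric])
    also have "\<dots> = emeasure ?N (\<Union>i. coords c ` (B \<inter> D i))"
    proof (rule suminf_emeasure)
      show "range (\<lambda>i. coords c ` (B \<inter> D i)) \<subseteq> sets ?N"
        using borel_image_coords[OF c BD(2,1)] by auto
      have inj: "inj_on (coords c) (chart_dom c)"
        by (rule inj_on_inverseI) (rule chart_inv_coords[OF c])
      show "disjoint_family (\<lambda>i. coords c ` (B \<inter> D i))"
        unfolding disjoint_family_on_def
      proof (intro ballI impI)
        fix i j :: nat assume "i \<noteq> j"
        then have "D i \<inter> D j = {}" using C(4) by (auto simp: disjoint_family_on_def)
        then have "(B \<inter> D i) \<inter> (B \<inter> D j) = {}" by blast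
        then show "coords c ` (B \<inter> D i) \<inter> coords c ` (B \<inter> D j) = {}"
          using inj_on_image_Int[OF inj BD(2) BD(2), of i j] by simp
      qed
    qed
    also have "(\<Union>i. coords c ` (B \<inter> D i)) = coords c ` B" using C(5) by blast
    also have "emeasure ?N (coords c ` B) = (\<integral>\<^sup>+ y\<in>coords c ` B. ennreal (h c y) \<partial>lborel)"
      by (rule N[OF B])
    finally show ?thesis .
  qed
  then have "has_densities M h" using sM by (simp add: has_densities_def)
  then show ?thesis by blast
qed

lemma chart_density_measurable:
  assumes h: "compatible_densities h" and c: "c \<in> A"
  shows "(\<lambda>y. indicator (chart_img c) y * h c y) \<in> borel_measurable borel"
    and "0 \<le> indicator (chart_img c) y * h c y"
proof -
  have "(\<lambda>y. indicator (chart_img c) y *\<^sub>R h c y) \<in> borel_measurable borel"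
    by (rule borel_measurable_continuous_on_indicator)
      (use h c open_chart_img[OF c] in \<open>auto simp: compatible_densities_def\<close>)
  then show "(\<lambda>y. indicator (chart_img c) y * h c y) \<in> borel_measurable borel" by simp
  show "0 \<le> indicator (chart_img c) y * h c y"
    using h c by (auto simp: compatible_densities_def indicator_def)
qed

lemma measure_in_chart:
  assumes h: "compatible_densities h" and M: "has_densities M h" and c: "c \<in> A"
  shows "density M (\<lambda>x. ennreal (indicator (chart_dom c) x)) =
    distr (density lborel (\<lambda>y. indicator (chart_img c) y * h c y)) borel
      (\<lambda>y. if y \<in> chart_img c then chart_inv c y else undefined)"
proof -
  let ?G = "\<lambda>y. if y \<in> chart_img c then chart_inv c y else undefined"
  let ?D = "\<lambda>y. indicator (chart_img c) y * h c y"
  have sM [simp, measurable_cong]: "sets M = sets borel" using M by (simp add: has_densities_def)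
  have dom: "chart_dom c \<in> sets borel" using open_chart_dom[OF c] by simp
  have Gm: "?G \<in> measurable (density lborel ?D) borel" using chart_inv_measurable[OF c] by simp
  have Dm: "?D \<in> borel_measurable lborel" using chart_density_measurable(1)[OF h c] by simp
  show ?thesis
  proof (rule measure_eqI)
    fix B assume "B \<in> sets (density M (\<lambda>x. ennreal (indicator (chart_dom c) x)))"
    then have B: "B \<in> sets borel" by simp
    have "emeasure (density M (\<lambda>x. ennreal (indicator (chart_dom c) x))) B = emeasure M (chart_dom c \<inter> B)"
    proof -
      have "emeasure (density M (\<lambda>x. ennreal (indicator (chart_dom c) x))) B =
          (\<integral>\<^sup>+x. ennreal (indicator (chart_dom c) x) * indicator B x \<partial>M)"
        using B dom by (intro emeasure_density) auto
      also have "\<dots> = (\<integral>\<^sup>+x. indicator (chart_dom c \<inter> B) x \<partial>M)"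
        by (rule nn_integral_cong) (auto simp: indicator_def)
      finally show ?thesis using B dom by simp
    qed
    also have "\<dots> = (\<integral>\<^sup>+ y\<in>coords c ` (chart_dom c \<inter> B). ennreal (h c y) \<partial>lborel)"
      using M c B dom by (auto simp: has_densities_def)
    also have "\<dots> = (\<integral>\<^sup>+y. ennreal (?D y) * indicator (?G -` B) y \<partial>lborel)"
    proof (rule nn_integral_cong)
      fix y
      have "y \<in> coords c ` (chart_dom c \<inter> B) \<longleftrightarrow> y \<in> chart_img c \<and> ?G y \<in> B"
        using image_coords_eq[OF c, of "chart_dom c \<inter> B"] chart_inv_mem[OF c, of y] by auto
      then show "ennreal (h c y) * indicator (coords c ` (chart_dom c \<inter> B)) y = ennreal (?D y) * indicator (?G -` B) y"
        by (auto simp: indicator_def)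
    qed
    also have "\<dots> = emeasure (density lborel ?D) (?G -` B)"
      using Dm measurable_sets[OF chart_inv_measurable[OF c] B] by (subst emeasure_density) auto
    also have "\<dots> = emeasure (distr (density lborel ?D) borel ?G) B"
      using Gm B by (subst emeasure_distr) auto
    finally show "emeasure (density M (\<lambda>x. ennreal (indicator (chart_dom c) x))) B =
        emeasure (distr (density lborel ?D) borel ?G) B" .
  qed simp
qed

lemma nn_integral_in_chart:
  assumes h: "compatible_densities h" and M: "has_densities M h" and c: "c \<in> A"
    and q: "q \<in> borel_measurable borel" and q0: "\<And>x. x \<notin> chart_dom c \<Longrightarrow> q x = 0"
  shows "(\<integral>\<^sup>+x. q x \<partial>M) = (\<integral>\<^sup>+y. ennreal (h c y) * q (chart_inv c y) * indicator (chart_img c) y \<partial>lborel)"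
proof -
  let ?G = "\<lambda>y. if y \<in> chart_img c then chart_inv c y else undefined"
  let ?D = "\<lambda>y. indicator (chart_img c) y * h c y"
  have sM [simp, measurable_cong]: "sets M = sets borel" using M by (simp add: has_densities_def)
  have dom: "chart_dom c \<in> sets borel" using open_chart_dom[OF c] by simp
  have Gm: "?G \<in> measurable (density lborel ?D) borel" using chart_inv_measurable[OF c] by simp
  have Dm: "?D \<in> borel_measurable lborel" using chart_density_measurable(1)[OF h c] by simp
  have "(\<integral>\<^sup>+x. q x \<partial>M) = (\<integral>\<^sup>+x. ennreal (indicator (chart_dom c) x) * q x \<partial>M)"
    by (rule nn_integral_cong) (use q0 in \<open>auto simp: indicator_def\<close>)
  also have "\<dots> = (\<integral>\<^sup>+x. q x \<partial>density M (\<lambda>x. ennreal (indicator (chart_dom c) x)))"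
    using q dom by (intro nn_integral_density[symmetric]) auto
  also have "\<dots> = (\<integral>\<^sup>+y. q (?G y) \<partial>density lborel ?D)"
    unfolding measure_in_chart[OF h M c] using Gm q by (intro nn_integral_distr) auto
  also have "\<dots> = (\<integral>\<^sup>+y. ennreal (?D y) * q (?G y) \<partial>lborel)"
    using measurable_compose[OF chart_inv_measurable[OF c] q] Dm by (intro nn_integral_density) auto
  also have "\<dots> = (\<integral>\<^sup>+y. ennreal (h c y) * q (chart_inv c y) * indicator (chart_img c) y \<partial>lborel)"
    by (rule nn_integral_cong) (auto simp: indicator_def)
  finally show ?thesis .
qed

text \<open>The integrand is arranged as a weight times the density. In a variation only the second
  factor moves, which is the shape that differentiation under the integral expects.\<close>

lemma integral_in_chart:
  fixes q :: "'m \<Rightarrow> real"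
  assumes h: "compatible_densities h" and M: "has_densities M h" and c: "c \<in> A"
    and q: "q \<in> borel_measurable borel" and q0: "\<And>x. x \<notin> chart_dom c \<Longrightarrow> q x = 0"
  shows "(\<integral>x. q x \<partial>M) = (\<integral>y. (indicator (chart_img c) y * q (chart_inv c y)) * h c y \<partial>lborel)"
    and "integrable M q \<longleftrightarrow> integrable lborel (\<lambda>y. (indicator (chart_img c) y * q (chart_inv c y)) * h c y)"
proof -
  let ?G = "\<lambda>y. if y \<in> chart_img c then chart_inv c y else undefined"
  let ?D = "\<lambda>y. indicator (chart_img c) y * h c y"
  have sM [simp, measurable_cong]: "sets M = sets borel" using M by (simp add: has_densities_def)
  then have spM [simp]: "space M = UNIV" using sets_eq_imp_space_eq[OF sM] by simp
  have img: "chart_img c \<in> sets borel" and dom: "chart_dom c \<in> sets borel"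
    using open_chart_img[OF c] open_chart_dom[OF c] by simp_all
  have Gm: "?G \<in> measurable (density lborel ?D) borel" using chart_inv_measurable[OF c] by simp
  have eD: "ennreal (?D y) = ennreal (h c y) * indicator (chart_img c) y" for y
    by (auto simp: indicator_def)
  have "(\<lambda>y. indicator (chart_img c) y *\<^sub>R h c y) \<in> borel_measurable borel"
    by (rule borel_measurable_continuous_on_indicator[OF img])
      (use h c in \<open>auto simp: compatible_densities_def\<close>)
  then have Dm: "?D \<in> borel_measurable lborel" by simp
  have Dn: "0 \<le> ?D y" for y using h c by (auto simp: compatible_densities_def indicator_def)
  have qM: "q \<in> borel_measurable M" using q by simp
  note me = measure_in_chart[OF h M c]
  have qi: "indicator (chart_dom c) x *\<^sub>R q x = q x" for x
    using q0[of x] by (auto simp: indicator_def)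
  have qG: "?D y *\<^sub>R q (?G y) = (indicator (chart_img c) y * q (chart_inv c y)) * h c y" for y
    by (auto simp: indicator_def)
  have "(\<integral>x. q x \<partial>M) = (\<integral>x. indicator (chart_dom c) x *\<^sub>R q x \<partial>M)" by (simp only: qi)
  also have "\<dots> = (\<integral>x. q x \<partial>density M (\<lambda>x. ennreal (indicator (chart_dom c) x)))"
    using qM dom by (intro integral_density[symmetric]) auto
  also have "\<dots> = (\<integral>y. q (?G y) \<partial>density lborel ?D)"
    unfolding me using Gm q by (intro integral_distr) auto
  also have "\<dots> = (\<integral>y. ?D y *\<^sub>R q (?G y) \<partial>lborel)"
    using measurable_compose[OF chart_inv_measurable[OF c] q] Dm Dn by (intro integral_density) auto
  finally show "(\<integral>x. q x \<partial>M) = (\<integral>y. (indicator (chart_img c) y * q (chart_inv c y)) * h c y \<partial>lborel)"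
    unfolding qG .
  have "integrable M q \<longleftrightarrow> integrable M (\<lambda>x. indicator (chart_dom c) x *\<^sub>R q x)" by (simp only: qi)
  also have "\<dots> \<longleftrightarrow> integrable (density M (\<lambda>x. ennreal (indicator (chart_dom c) x))) q"
    using qM dom by (intro integrable_density[symmetric]) auto
  also have "\<dots> \<longleftrightarrow> integrable (density lborel ?D) (\<lambda>y. q (?G y))"
    unfolding me using Gm q by (intro integrable_distr_eq) auto
  also have "\<dots> \<longleftrightarrow> integrable lborel (\<lambda>y. ?D y *\<^sub>R q (?G y))"
    using measurable_compose[OF chart_inv_measurable[OF c] q] Dm Dn by (intro integrable_density) auto
  finally show "integrable M q \<longleftrightarrow> integrable lborel (\<lambda>y. (indicator (chart_img c) y * q (chart_inv c y)) * h c y)"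
    unfolding qG .
qed

subsection \<open>Volume of an induced metric\<close>

definition vol_density :: "('e::euclidean_space \<Rightarrow> 'e \<Rightarrow> real) \<Rightarrow> ('m \<Rightarrow> 'e) \<Rightarrow> ('m, 'n) chart \<Rightarrow> real ^ 'n \<Rightarrow> real" where
  "vol_density b f c y = sqrt \<bar>det (gram b c f y)\<bar>"

lemma gram_form_matrix: "gram b c f y = form_matrix (\<lambda>v w. b (chart_deriv f c y v) (chart_deriv f c y w))"
  by (simp add: gram_def form_matrix_def chart_deriv_def Let_def)

lemma bilinear_pullback:
  assumes "bilinear b" "linear T"
  shows "bilinear (\<lambda>v w. b (T v) (T w))"
  unfolding bilinear_def
  using assms(1) by (auto simp: bilinear_def intro: linear_compose[OF assms(2), unfolded o_def])

lemma smooth_on_gram: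
  fixes f :: "'m \<Rightarrow> 'e::euclidean_space"
  assumes b: "bilinear b" and f: "smooth_map A f" and c: "c \<in> A"
  shows "smooth_on (chart_img c) (gram b c f)"
proof (intro smooth_on_vec open_chart_img c)
  fix i j
  have bb: "bounded_bilinear b" using b bilinear_conv_bounded_bilinear by blast
  have "smooth_on (chart_img c) (\<lambda>y. b (frechet_derivative (f \<circ> chart_inv c) (at y) (axis i 1))
      (frechet_derivative (f \<circ> chart_inv c) (at y) (axis j 1)))"
    by (rule smooth_on_bilinear[OF bb]) (rule smooth_on_frechet_derivative[OF smooth_map_chart[OF f c]])+
  then show "smooth_on (chart_img c) (\<lambda>y. gram b c f y $ i $ j)"
    by (simp add: gram_def Let_def)
qed

lemma det_gram_change:
  fixes f :: "'m \<Rightarrow> 'e::euclidean_space"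
  assumes b: "bilinear b" and f: "smooth_map A f" and c: "c \<in> A" and d: "d \<in> A" and y: "y \<in> overlap c d"
  shows "det (gram b c f y) = (det (matrix (transition_deriv c d y)))\<^sup>2 * det (gram b d f (coords d (chart_inv c y)))"
proof -
  have y': "coords d (chart_inv c y) \<in> chart_img d" using overlapD(4)[OF c d y] by blast
  note df = smooth_map_differentiable[OF f d y']
  have q: "bilinear (\<lambda>v w. b (chart_deriv f d (coords d (chart_inv c y)) v) (chart_deriv f d (coords d (chart_inv c y)) w))"
    by (rule bilinear_pullback[OF b linear_chart_deriv[OF f d y']])
  show ?thesis
    unfolding gram_form_matrix chart_deriv_change[OF c d y df] by (rule det_form_matrix_compose[OF q])
qed

text \<open>A transition multiplies the Gram determinant by the square of the Jacobian, whose root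
  is the absolute value in the transformation law.\<close>

lemma compatible_vol_density:
  fixes f :: "'m \<Rightarrow> 'e::euclidean_space"
  assumes b: "bilinear b" and f: "smooth_map A f"
  shows "compatible_densities (vol_density b f)"
  unfolding compatible_densities_def
proof (intro conjI ballI)
  fix c assume c: "c \<in> A"
  show "continuous_on (chart_img c) (vol_density b f c)"
    unfolding vol_density_def[abs_def]
    by (intro continuous_intros smooth_on_continuous_on[OF smooth_on_det] smooth_on_gram b f c)
  fix d y assume d: "d \<in> A" and y: "y \<in> overlap c d"
  show "vol_density b f c y = \<bar>det (matrix (transition_deriv c d y))\<bar> * vol_density b f d (coords d (chart_inv c y))"
    by (simp add: vol_density_def det_gram_change[OF b f c d y] abs_mult real_sqrt_mult)
qed (simp add: vol_density_def)

text \<open>Existence and uniqueness together give meaning to the definite description in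
  \<open>volume_measure\<close>.\<close>

lemma volume_measure_has_densities:
  fixes f :: "'m \<Rightarrow> 'e::euclidean_space"
  assumes b: "bilinear b" and f: "smooth_map A f"
  shows "has_densities (volume_measure A b f) (vol_density b f)"
proof -
  have "\<exists>!M. has_densities M (vol_density b f)"
    using has_densities_exists[OF compatible_vol_density[OF b f]] has_densities_unique by blast
  then have "has_densities (THE M. has_densities M (vol_density b f)) (vol_density b f)" by (rule theI')
  then show ?thesis unfolding volume_measure_def has_densities_def vol_density_def .
qed

lemma volume_measure_eqI:
  fixes f :: "'m \<Rightarrow> 'e::euclidean_space"
  assumes "bilinear b" "smooth_map A f" "has_densities M (vol_density b f)"
  shows "volume_measure A b f = M"
  using volume_measure_has_densities[OF assms(1,2)] assms(3) by (rule has_densities_unique)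

end

section \<open>The pseudo-Euclidean form and orthonormal frames\<close>

lemma signature_square [simp]: "signature sf i * signature sf i = 1"
  by (cases sf) auto

lemma eps_square [simp]: "eps sf * eps sf = 1"
  by (cases sf) auto

text \<open>Lowers the index: it translates between orthogonality for the pseudo-Euclidean form and
  standard orthogonality.\<close>

definition flip_sig :: "space_form \<Rightarrow> real ^ ('n::finite + 2) \<Rightarrow> real ^ ('n + 2)" where
  "flip_sig sf x = (\<chi> i. signature sf i * x $ i)"

lemma linear_flip_sig: "linear (flip_sig sf)"
  by (rule linearI) (simp_all add: flip_sig_def vec_eq_iff algebra_simps)

lemma flip_flip [simp]: "flip_sig sf (flip_sig sf x) = x"
  by (simp add: flip_sig_def vec_eq_iff mult.assoc[symmetric])

lemma pinner_flip: "pinner sf x y = flip_sig sf x \<bullet> y"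
  by (simp add: pinner_def flip_sig_def inner_vec_def)

lemma pinner_commute: "pinner sf x y = pinner sf y x"
  by (simp add: pinner_def mult_ac)

lemma bilinear_pinner: "bilinear (pinner sf)"
  unfolding bilinear_def
  by (auto intro!: linearI simp: pinner_def sum.distrib sum_distrib_left algebra_simps)

lemmas pinner_simps = bilinear_ladd[OF bilinear_pinner] bilinear_radd[OF bilinear_pinner]
  bilinear_lmul[OF bilinear_pinner] bilinear_rmul[OF bilinear_pinner]
  bilinear_lsub[OF bilinear_pinner] bilinear_rsub[OF bilinear_pinner]
  bilinear_lzero[OF bilinear_pinner] bilinear_rzero[OF bilinear_pinner]
  bilinear_lneg[OF bilinear_pinner] bilinear_rneg[OF bilinear_pinner]

lemma bounded_bilinear_pinner: "bounded_bilinear (pinner sf)"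
  using bilinear_pinner bilinear_conv_bounded_bilinear by blast

lemma model_space_pinner: "x \<in> model_space sf \<Longrightarrow> pinner sf x x = 1"
  by (cases sf) auto

lemma pinner_Hyperbolic:
  "pinner Hyperbolic x y = x $ Inr 1 * y $ Inr 1 - (\<Sum>i\<in>UNIV - {Inr 1}. x $ i * y $ i)"
proof -
  have "pinner Hyperbolic x y = signature Hyperbolic (Inr 1 :: 'a + 2) * x $ Inr 1 * y $ Inr 1
      + (\<Sum>i\<in>UNIV - {Inr 1}. signature Hyperbolic i * x $ i * y $ i)"
    unfolding pinner_def by (rule sum.remove) auto
  also have "(\<Sum>i\<in>UNIV - {Inr 1}. signature Hyperbolic i * x $ i * y $ i) = - (\<Sum>i\<in>UNIV - {Inr 1}. x $ i * y $ i)"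
    unfolding sum_negf[symmetric] by (rule sum.cong) auto
  finally show ?thesis by simp
qed

text \<open>The Cauchy-Schwarz inequality for the negative coordinates, with their sums of squares
  and products rewritten by the two hypotheses.\<close>

lemma hyperbolic_cauchy_schwarz:
  assumes "pinner Hyperbolic p p = 1" "pinner Hyperbolic p v = 0"
  shows "(p $ Inr 1)\<^sup>2 * (v $ Inr 1)\<^sup>2 \<le> ((p $ Inr 1)\<^sup>2 - 1) * ((v $ Inr 1)\<^sup>2 - pinner Hyperbolic v v)"
proof -
  have 1: "(\<Sum>i\<in>UNIV - {Inr 1}. (p $ i)\<^sup>2) = (p $ Inr 1)\<^sup>2 - 1"
    using assms(1) by (simp add: pinner_Hyperbolic power2_eq_square)
  have 2: "(\<Sum>i\<in>UNIV - {Inr 1}. (v $ i)\<^sup>2) = (v $ Inr 1)\<^sup>2 - pinner Hyperbolic v v"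
    by (simp add: pinner_Hyperbolic power2_eq_square)
  have 3: "(\<Sum>i\<in>UNIV - {Inr 1}. p $ i * v $ i) = p $ Inr 1 * v $ Inr 1"
    using assms(2) by (simp add: pinner_Hyperbolic)
  show ?thesis
    using Cauchy_Schwarz_ineq_sum[of "($) p" "($) v" "UNIV - {Inr 1}"]
    unfolding 1 2 3 by (simp add: power_mult_distrib)
qed

text \<open>In the hyperbolic case the form has a single plus sign, which p uses up; so the
  complement of p is negative definite and the factor \<open>eps sf\<close> makes it
  positive.\<close>

lemma model_space_complement_definite:
  assumes p: "p \<in> model_space sf" and v: "pinner sf p v = 0" "v \<noteq> 0"
  shows "0 < eps sf * pinner sf v v"
proof (cases sf)
  case Spherical
  have "pinner sf v v = v \<bullet> v" by (simp add: Spherical pinner_def inner_vec_def)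
  then show ?thesis using v(2) by (simp add: Spherical)
next
  case Hyperbolic
  let ?a = "(p $ Inr 1)\<^sup>2" and ?b = "(v $ Inr 1)\<^sup>2" and ?q = "pinner Hyperbolic v v"
  have pp: "pinner Hyperbolic p p = 1" using p Hyperbolic by simp
  have 1: "?a * ?b \<le> (?a - 1) * (?b - ?q)"
    using hyperbolic_cauchy_schwarz[OF pp, of v] v Hyperbolic by simp
  have V: "?b - ?q = (\<Sum>i\<in>UNIV - {Inr 1}. (v $ i)\<^sup>2)"
    by (simp add: pinner_Hyperbolic power2_eq_square)
  have a0: "0 < ?a" using p Hyperbolic by simp
  \<comment> \<open>This difference is the sum of squares of the negative coordinates of v. If it
    were zero, the inequality above would force the last coordinate to vanish as well.\<close>
  have "?b - ?q > 0"
  proof (rule ccontr)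
    assume "\<not> ?thesis"
    moreover have "0 \<le> ?b - ?q" unfolding V by (rule sum_nonneg) simp
    ultimately have z: "?b - ?q = 0" by simp
    then have "v $ i = 0" if "i \<noteq> Inr 1" for i
      using V that by (simp add: sum_nonneg_eq_0_iff)
    moreover have "?b = 0" using 1 z a0 by (simp add: mult_le_0_iff)
    then have "v $ Inr 1 = 0" by simp
    ultimately have "v $ i = 0" for i by (cases "i = Inr 1") simp_all
    then have "v = 0" by (simp add: vec_eq_iff)
    then show False using v by simp
  qed
  moreover have "?a * ?b \<le> ?a * (?b - ?q) - (?b - ?q)" using 1 by (simp add: algebra_simps)
  ultimately have "?a * ?b < ?a * (?b - ?q)" by linarith
  then have "?q < 0" using a0 by (simp add: mult_less_cancel_left_pos)
  then show ?thesis by (simp add: Hyperbolic)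
qed

text \<open>The point \<open>p + s *\<^sub>R \<nu>\<close> has square
  \<open>1 + eps sf * s\<^sup>2\<close>, positive for |s| < 1. In the hyperbolic case the last
  coordinate of \<nu> is smaller in absolute value than that of p, so the point also stays on the
  sheet.\<close>

lemma model_space_normalize:
  assumes p: "p \<in> model_space sf" and n: "pinner sf p \<nu> = 0" "pinner sf \<nu> \<nu> = eps sf" and s: "\<bar>s\<bar> < 1"
  shows "(1 / sqrt (1 + eps sf * s\<^sup>2)) *\<^sub>R (p + s *\<^sub>R \<nu>) \<in> model_space sf"
proof -
  have s2: "s\<^sup>2 < 1" using s by (simp add: abs_square_less_1)
  then have pos: "0 < 1 + eps sf * s\<^sup>2" by (cases sf) (auto simp: add_pos_nonneg)
  have "pinner sf (p + s *\<^sub>R \<nu>) (p + s *\<^sub>R \<nu>) = 1 + eps sf * s\<^sup>2"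
    using n pinner_commute[of sf \<nu> p] model_space_pinner[OF p] by (simp add: pinner_simps power2_eq_square)
  then have 1: "pinner sf ((1 / sqrt (1 + eps sf * s\<^sup>2)) *\<^sub>R (p + s *\<^sub>R \<nu>)) ((1 / sqrt (1 + eps sf * s\<^sup>2)) *\<^sub>R (p + s *\<^sub>R \<nu>)) = 1"
    using pos by (simp add: bilinear_lmul[OF bilinear_pinner] bilinear_rmul[OF bilinear_pinner])
  show ?thesis
  proof (cases sf)
    case Spherical
    with 1 show ?thesis by simp
  next
    case Hyperbolic
    let ?a = "p $ Inr 1" and ?b = "\<nu> $ Inr 1"
    have a: "?a > 0" and pp: "pinner Hyperbolic p p = 1" using p Hyperbolic by auto
    have "?a\<^sup>2 * ?b\<^sup>2 \<le> (?a\<^sup>2 - 1) * (?b\<^sup>2 + 1)"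
      using hyperbolic_cauchy_schwarz[OF pp, of \<nu>] n Hyperbolic by simp
    then have "?b\<^sup>2 < ?a\<^sup>2" by (simp add: algebra_simps)
    then have "\<bar>?b\<bar>\<^sup>2 < ?a\<^sup>2" by simp
    then have "\<bar>?b\<bar> < ?a" by (rule power2_less_imp_less) (use a in simp)
    then have "\<bar>s * ?b\<bar> < ?a"
      using s mult_left_le_one_le[of "\<bar>?b\<bar>" "\<bar>s\<bar>"] by (simp add: abs_mult)
    then have "0 < ?a + s * ?b" by linarith
    then have "0 < ((1 / sqrt (1 + eps sf * s\<^sup>2)) *\<^sub>R (p + s *\<^sub>R \<nu>)) $ Inr 1" using pos by simp
    with 1 Hyperbolic show ?thesis by simp
  qed
qed

text \<open>The data of an immersed hypersurface at one point: position p, unit normal \<nu> and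
  differential T.\<close>

locale hyper_frame =
  fixes sf :: space_form and p \<nu> :: "real ^ ('n::finite + 2)" and T :: "real ^ 'n \<Rightarrow> real ^ ('n + 2)"
  assumes p: "p \<in> model_space sf" and T: "linear T" "inj T"
    and pT: "\<And>v. pinner sf p (T v) = 0" and p\<nu>: "pinner sf p \<nu> = 0" and \<nu>T: "\<And>v. pinner sf \<nu> (T v) = 0"
    and \<nu>\<nu>: "pinner sf \<nu> \<nu> = eps sf"
begin

lemma pp: "pinner sf p p = 1"
  by (rule model_space_pinner[OF p])

lemmas frame_simps = pp pT p\<nu> \<nu>T \<nu>\<nu> pT[unfolded pinner_commute[of sf p]] \<nu>T[unfolded pinner_commute[of sf \<nu>]]
  p\<nu>[unfolded pinner_commute[of sf p]]

lemma T_definite: "v \<noteq> 0 \<Longrightarrow> 0 < eps sf * pinner sf (T v) (T v)"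
  using model_space_complement_definite[OF p pT] T linear_injective_0[OF T(1)] by blast

lemma T_eq_0I: "pinner sf (T v) (T v) = 0 \<Longrightarrow> v = 0"
  using T_definite[of v] by force

lemma combination_eq_0:
  assumes "T a + \<alpha> *\<^sub>R p + \<beta> *\<^sub>R \<nu> = 0"
  shows "a = 0 \<and> \<alpha> = 0 \<and> \<beta> = 0"
proof -
  have "pinner sf p (T a + \<alpha> *\<^sub>R p + \<beta> *\<^sub>R \<nu>) = \<alpha>" by (simp add: pinner_simps frame_simps)
  then have \<alpha>: "\<alpha> = 0" using assms by (simp add: pinner_simps)
  have "pinner sf \<nu> (T a + \<alpha> *\<^sub>R p + \<beta> *\<^sub>R \<nu>) = \<beta> * eps sf" by (simp add: pinner_simps frame_simps)
  then have "\<beta> * eps sf = 0" using assms by (simp add: pinner_simps)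
  then have \<beta>: "\<beta> = 0" by (cases sf) auto
  have "T a = 0" using assms \<alpha> \<beta> by simp
  then show ?thesis using linear_injective_0[OF T(1)] T(2) \<alpha> \<beta> by blast
qed

text \<open>By \<open>combination_eq_0\<close> the map from triples is injective, and its source and
  target both have dimension n + 2.\<close>

lemma decomposition: "\<exists>a \<alpha> \<beta>. w = T a + \<alpha> *\<^sub>R p + \<beta> *\<^sub>R \<nu>"
proof -
  define f where "f = (\<lambda>(a, \<alpha>::real, \<beta>::real). T a + \<alpha> *\<^sub>R p + \<beta> *\<^sub>R \<nu>)"
  have lf: "linear f" unfolding f_def
    by (rule linearI) (auto simp: linear_add[OF T(1)] linear_scale[OF T(1)] algebra_simps)
  have "x = 0" if "f x = 0" for x
    using combination_eq_0 that by (cases x) (auto simp: f_def zero_prod_def)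
  then have "inj f" using linear_injective_0[OF lf] by blast
  then have "surj f"
    using linear_injective_imp_surjective[OF lf] by (simp add: dim_UNIV)
  then obtain x where "w = f x" by (rule surjE)
  then show ?thesis unfolding f_def by (cases x) auto
qed

lemma orthogonal_in_range:
  assumes "pinner sf p w = 0" "pinner sf \<nu> w = 0"
  shows "\<exists>a. w = T a"
proof -
  obtain a \<alpha> \<beta> where w: "w = T a + \<alpha> *\<^sub>R p + \<beta> *\<^sub>R \<nu>" using decomposition by blast
  have "\<alpha> = 0" using assms(1) unfolding w by (simp add: pinner_simps frame_simps)
  moreover have "\<beta> * eps sf = 0" using assms(2) unfolding w by (simp add: pinner_simps frame_simps)
  then have "\<beta> = 0" by (cases sf) auto
  ultimately show ?thesis using w by auto
qed

lemma normal_multiple: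
  assumes "pinner sf p w = 0" "\<And>v. pinner sf (T v) w = 0"
  shows "\<exists>\<beta>. w = \<beta> *\<^sub>R \<nu>"
proof -
  obtain a \<alpha> \<beta> where w: "w = T a + \<alpha> *\<^sub>R p + \<beta> *\<^sub>R \<nu>" using decomposition by blast
  have "\<alpha> = 0" using assms(1) unfolding w by (simp add: pinner_simps frame_simps)
  moreover have "pinner sf (T a) (T a) = 0" using assms(2)[of a] unfolding w by (simp add: pinner_simps frame_simps)
  then have "T a = 0" using T_eq_0I linear_0[OF T(1)] by blast
  ultimately show ?thesis using w by auto
qed

end

subsection \<open>The unit normal as a generalised cross product\<close>

definition frame_matrix :: "real ^ ('n::finite + 2) \<Rightarrow> (real ^ 'n \<Rightarrow> real ^ ('n + 2)) \<Rightarrow> real ^ ('n + 2) \<Rightarrow> real ^ ('n + 2) ^ ('n + 2)" where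
  "frame_matrix p T \<nu> = (\<chi> r s. case s of Inl i \<Rightarrow> T (axis i 1) $ r | Inr j \<Rightarrow> (if j = 0 then p $ r else \<nu> $ r))"

text \<open>The generalised cross product: the vector that represents the linear functional
  \<open>w \<mapsto> det (frame_matrix p T w)\<close> in the standard inner product.\<close>

definition cross_vector :: "real ^ ('n::finite + 2) \<Rightarrow> (real ^ 'n \<Rightarrow> real ^ ('n + 2)) \<Rightarrow> real ^ ('n + 2)" where
  "cross_vector p T = (\<chi> r. det (frame_matrix p T (axis r 1)))"

text \<open>A formula in place of the definite description of \<open>unit_normal\<close>; smoothness
  in p and T can be read off from it. Since c pairs with itself to a number of sign
  \<open>eps sf\<close>, the factor \<open>eps sf\<close> makes the frame positive.\<close>

definition frame_normal :: "space_form \<Rightarrow> real ^ ('n::finite + 2) \<Rightarrow> (real ^ 'n \<Rightarrow> real ^ ('n + 2)) \<Rightarrow> real ^ ('n + 2)" where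
  "frame_normal sf p T = (let c = flip_sig sf (cross_vector p T)
     in (eps sf / sqrt (eps sf * pinner sf c c)) *\<^sub>R c)"

lemma two_cases: "j = 0 \<or> j = 1" for j :: 2
  using exhaust_2[of j] by auto

text \<open>Brings the variable vector into a row, where the row rules for determinants
  apply.\<close>

lemma transpose_frame_matrix:
  "transpose (frame_matrix p T w) =
    (\<chi> i. if i = Inr 1 then w else (case i of Inl i \<Rightarrow> T (axis i 1) | Inr j \<Rightarrow> p))"
proof -
  have "transpose (frame_matrix p T w) $ i $ r =
      (if i = Inr 1 then w else (case i of Inl i \<Rightarrow> T (axis i 1) | Inr j \<Rightarrow> p)) $ r" for i r
  proof (cases i)
    case (Inr b)
    then show ?thesis using two_cases[of b] by (auto simp: transpose_def frame_matrix_def)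
  qed (simp add: transpose_def frame_matrix_def)
  then show ?thesis by (simp add: vec_eq_iff)
qed

lemma linear_det_frame_matrix: "linear (\<lambda>w. det (frame_matrix p T w))"
proof (rule linearI)
  show "det (frame_matrix p T (x + y)) = det (frame_matrix p T x) + det (frame_matrix p T y)" for x y
    unfolding det_transpose[of "frame_matrix p T _", symmetric] transpose_frame_matrix
    by (rule det_row_add)
  show "det (frame_matrix p T (c *\<^sub>R x)) = c *\<^sub>R det (frame_matrix p T x)" for c x
    unfolding det_transpose[of "frame_matrix p T _", symmetric] transpose_frame_matrix
    unfolding scalar_mult_eq_scaleR[symmetric]
    by (simp add: det_row_mul)
qed

lemma vec_expansion: "(\<Sum>i\<in>UNIV. x $ i *\<^sub>R axis i 1) = (x :: real ^ 'k)"
  using basis_expansion[of x] by (simp add: scalar_mult_eq_scaleR)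

lemma det_frame_matrix: "det (frame_matrix p T w) = cross_vector p T \<bullet> w"
proof -
  note l = linear_det_frame_matrix[of p T]
  have "det (frame_matrix p T w) = det (frame_matrix p T (\<Sum>i\<in>UNIV. w $ i *\<^sub>R axis i 1))"
    by (simp only: vec_expansion)
  also have "\<dots> = (\<Sum>i\<in>UNIV. w $ i * det (frame_matrix p T (axis i 1)))"
    by (simp add: linear_sum[OF l] linear_scale[OF l])
  finally show ?thesis by (simp add: cross_vector_def inner_vec_def mult.commute)
qed

lemma cross_vector_orthogonal:
  assumes "linear T"
  shows "cross_vector p T \<bullet> p = 0" "cross_vector p T \<bullet> T v = 0"
proof -
  have "det (transpose (frame_matrix p T p)) = 0"
    by (rule det_identical_rows[of "Inr 0" "Inr 1"]) (auto simp: transpose_frame_matrix row_def)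
  then show "cross_vector p T \<bullet> p = 0" by (simp add: det_frame_matrix)
  have e: "cross_vector p T \<bullet> T (axis i 1) = 0" for i
  proof -
    have "det (transpose (frame_matrix p T (T (axis i 1)))) = 0"
      by (rule det_identical_rows[of "Inl i" "Inr 1"]) (auto simp: transpose_frame_matrix row_def)
    then show ?thesis by (simp add: det_frame_matrix)
  qed
  have "T v = (\<Sum>i\<in>UNIV. v $ i *\<^sub>R T (axis i 1))"
    using linear_sum[OF assms, of "\<lambda>i. v $ i *\<^sub>R axis i 1" UNIV]
    by (simp add: vec_expansion linear_scale[OF assms])
  then show "cross_vector p T \<bullet> T v = 0" by (simp add: inner_sum_right e)
qed

lemma UNIV_sum_2: "(UNIV :: ('n::finite + 2) set) = range Inl \<union> {Inr 0, Inr 1}"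
proof -
  have "x \<in> range Inl \<union> {Inr 0, Inr 1}" for x :: "'n + 2"
  proof (cases x)
    case (Inr b)
    then show ?thesis using two_cases[of b] by auto
  qed simp
  then show ?thesis by blast
qed

lemma sum_sum_2: "(\<Sum>i\<in>(UNIV :: ('n::finite + 2) set). f i) = (\<Sum>i\<in>UNIV. f (Inl i)) + f (Inr 0) + (f (Inr 1) :: real)"
proof -
  have "sum f UNIV = sum f (range Inl \<union> {Inr 0, Inr 1})" by (rule arg_cong[OF UNIV_sum_2])
  also have "\<dots> = sum f (range Inl) + sum f {Inr 0, Inr 1}" by (rule sum.union_disjoint) auto
  finally show ?thesis by (simp add: sum.reindex)
qed

lemma (in hyper_frame) det_frame_matrix_nonzero: "det (frame_matrix p T \<nu>) \<noteq> 0"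
proof -
  have mv: "frame_matrix p T \<nu> *v z = T (\<chi> i. z $ Inl i) + z $ Inr 0 *\<^sub>R p + z $ Inr 1 *\<^sub>R \<nu>" for z
  proof -
    have "T (\<chi> i. z $ Inl i) = T (\<Sum>i\<in>UNIV. (\<chi> i. z $ Inl i) $ i *\<^sub>R axis i 1)" by (simp only: vec_expansion)
    also have "\<dots> = (\<Sum>i\<in>UNIV. z $ Inl i *\<^sub>R T (axis i 1))"
      by (simp add: linear_sum[OF T(1)] linear_scale[OF T(1)])
    finally show ?thesis
      by (simp add: vec_eq_iff matrix_vector_mult_def sum_sum_2 frame_matrix_def mult.commute)
  qed
  have "z = 0" if "frame_matrix p T \<nu> *v z = 0" for z
  proof -
    have z: "(\<chi> i. z $ Inl i) = 0" "z $ Inr 0 = 0" "z $ Inr 1 = 0"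
      using combination_eq_0 that unfolding mv by blast+
    have "z $ i = 0" for i
    proof (cases i)
      case (Inl a)
      then show ?thesis using z(1) by (simp add: vec_eq_iff)
    next
      case (Inr b)
      then show ?thesis using z(2,3) two_cases[of b] by auto
    qed
    then show ?thesis by (simp add: vec_eq_iff)
  qed
  then have "inj ((*v) (frame_matrix p T \<nu>))"
    using linear_injective_0[OF matrix_vector_mul_linear[of "frame_matrix p T \<nu>"]] by blast
  then show ?thesis using det_nz_iff_inj[OF matrix_vector_mul_linear[of "frame_matrix p T \<nu>"]] by simp
qed

text \<open>At most n + 1 flipped vectors leave room for a standard orthogonal vector. It is
  orthogonal to p and to the range of T for the form, and definiteness on the complement of p allows
  it to be normalised.\<close>

lemma hyper_frame_exists:
  fixes T :: "real ^ 'n::finite \<Rightarrow> real ^ ('n + 2)"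
  assumes p: "p \<in> model_space sf" and T: "linear T" "inj T" and pT: "\<And>v. pinner sf p (T v) = 0"
  shows "\<exists>\<nu>. hyper_frame sf p \<nu> T"
proof -
  define S where "S = insert (flip_sig sf p) (flip_sig sf ` T ` Basis)"
  have "finite S" by (simp add: S_def)
  have "card (flip_sig sf ` T ` Basis) \<le> card (T ` Basis)" by (rule card_image_le) simp
  also have "\<dots> \<le> card (Basis :: (real ^ 'n) set)" by (rule card_image_le) simp
  finally have "card S \<le> Suc (card (Basis :: (real ^ 'n) set))"
    unfolding S_def by (simp add: card_insert_if)
  then have "dim S < DIM(real ^ ('n + 2))"
    using dim_le_card'[OF \<open>finite S\<close>] by simp
  then obtain n where n: "n \<noteq> 0" "\<And>y. y \<in> span S \<Longrightarrow> orthogonal n y"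
    using orthogonal_to_subspace_exists by blast
  have pn: "pinner sf p n = 0"
    using n(2)[OF span_base, of "flip_sig sf p"] by (simp add: S_def pinner_flip orthogonal_def inner_commute)
  have Tb: "pinner sf n (T b) = 0" if "b \<in> Basis" for b
    using n(2)[OF span_base, of "flip_sig sf (T b)"] that
    unfolding pinner_commute[of sf n "T b"] by (simp add: S_def pinner_flip orthogonal_def inner_commute)
  have Tn: "pinner sf n (T v) = 0" for v
  proof -
    have "T v = (\<Sum>b\<in>Basis. (v \<bullet> b) *\<^sub>R T b)"
      using linear_sum[OF T(1), of "\<lambda>b. (v \<bullet> b) *\<^sub>R b" Basis] by (simp add: euclidean_representation linear_scale[OF T(1)])
    then show ?thesis
      using bilinear_pinner[of sf] by (simp add: pinner_flip inner_sum_right Tb[unfolded pinner_flip])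
  qed
  have pos: "0 < eps sf * pinner sf n n" by (rule model_space_complement_definite[OF p pn n(1)])
  let ?r = "1 / sqrt (eps sf * pinner sf n n)"
  have "pinner sf (?r *\<^sub>R n) (?r *\<^sub>R n) = pinner sf n n / (eps sf * pinner sf n n)"
    using pos by (simp add: bilinear_lmul[OF bilinear_pinner] bilinear_rmul[OF bilinear_pinner])
  also have "\<dots> = eps sf" using pos by (cases sf) (auto simp: field_simps)
  finally have nn: "pinner sf (?r *\<^sub>R n) (?r *\<^sub>R n) = eps sf" .
  have "hyper_frame sf p (?r *\<^sub>R n) T"
  proof (rule hyper_frame.intro[OF p T pT _ _ nn])
    show "pinner sf p (?r *\<^sub>R n) = 0" by (simp add: pinner_simps pn)
    show "pinner sf (?r *\<^sub>R n) (T v) = 0" for v by (simp add: pinner_simps Tn)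
  qed
  then show ?thesis by blast
qed

text \<open>The cross vector is orthogonal to p and to the range of T because the determinant then
  has equal columns. It is nonzero because its product with any normal of the frame is a nonzero
  frame determinant.\<close>

lemma frame_normal:
  fixes T :: "real ^ 'n::finite \<Rightarrow> real ^ ('n + 2)"
  assumes p: "p \<in> model_space sf" and T: "linear T" "inj T" and pT: "\<And>v. pinner sf p (T v) = 0"
  shows "hyper_frame sf p (frame_normal sf p T) T" "0 < det (frame_matrix p T (frame_normal sf p T))"
    "0 < eps sf * pinner sf (flip_sig sf (cross_vector p T)) (flip_sig sf (cross_vector p T))"
proof -
  obtain \<nu> where "hyper_frame sf p \<nu> T" using hyper_frame_exists[OF assms] by blast
  then interpret F: hyper_frame sf p \<nu> T .
  define c where "c = cross_vector p T"
  define n where "n = flip_sig sf c"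
  have "c \<noteq> 0" using F.det_frame_matrix_nonzero by (auto simp: det_frame_matrix c_def)
  have n0: "n \<noteq> 0"
  proof
    assume "n = 0"
    then have "flip_sig sf n = 0" using linear_0[OF linear_flip_sig] by simp
    then show False using \<open>c \<noteq> 0\<close> by (simp add: n_def)
  qed
  have nc: "pinner sf w n = c \<bullet> w" for w
    unfolding pinner_commute[of sf w n] by (simp add: pinner_flip n_def)
  have pn: "pinner sf p n = 0" unfolding nc c_def by (rule cross_vector_orthogonal(1)[OF T(1)])
  have Tn: "pinner sf (T v) n = 0" for v unfolding nc c_def by (rule cross_vector_orthogonal(2)[OF T(1)])
  have pos: "0 < eps sf * pinner sf n n" by (rule model_space_complement_definite[OF p pn n0])
  then show "0 < eps sf * pinner sf (flip_sig sf (cross_vector p T)) (flip_sig sf (cross_vector p T))"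
    by (simp add: n_def c_def)
  let ?r = "eps sf / sqrt (eps sf * pinner sf n n)"
  have fn: "frame_normal sf p T = ?r *\<^sub>R n" by (simp add: frame_normal_def n_def c_def Let_def)
  have "?r * ?r = 1 / (eps sf * pinner sf n n)"
    using pos by (simp add: times_divide_times_eq)
  moreover have "pinner sf (?r *\<^sub>R n) (?r *\<^sub>R n) = (?r * ?r) * pinner sf n n"
    by (simp only: bilinear_lmul[OF bilinear_pinner] bilinear_rmul[OF bilinear_pinner] real_scaleR_def mult.assoc)
  ultimately have nn: "pinner sf (?r *\<^sub>R n) (?r *\<^sub>R n) = eps sf"
    using pos by (cases sf) (simp_all add: field_simps)
  show "hyper_frame sf p (frame_normal sf p T) T"
    unfolding fn
  proof (rule hyper_frame.intro[OF p T pT _ _ nn])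
    show "pinner sf p (?r *\<^sub>R n) = 0" by (simp add: pinner_simps pn)
    show "pinner sf (?r *\<^sub>R n) (T v) = 0" for v
      unfolding pinner_commute[of sf "?r *\<^sub>R n"] by (simp add: pinner_simps Tn)
  qed
  have "det (frame_matrix p T (?r *\<^sub>R n)) = ?r * pinner sf n n"
    by (simp add: det_frame_matrix nc[symmetric] c_def[symmetric])
  also have "\<dots> = sqrt (eps sf * pinner sf n n)"
    using pos by (simp add: real_div_sqrt)
  finally show "0 < det (frame_matrix p T (frame_normal sf p T))" using pos unfolding fn by simp
qed

text \<open>Normals form a line, the unit condition leaves two of them, and the sign of the
  determinant selects one.\<close>

lemma frame_normal_unique:
  fixes T :: "real ^ 'n::finite \<Rightarrow> real ^ ('n + 2)"
  assumes p: "p \<in> model_space sf" and T: "linear T" "inj T" and pT: "\<And>v. pinner sf p (T v) = 0"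
    and n: "pinner sf p n = 0" "\<And>v. pinner sf (T v) n = 0" "pinner sf n n = eps sf" "0 < det (frame_matrix p T n)"
  shows "n = frame_normal sf p T"
proof -
  note fn = frame_normal[OF p T pT]
  interpret F: hyper_frame sf p "frame_normal sf p T" T by (rule fn(1))
  obtain \<beta> where \<beta>: "n = \<beta> *\<^sub>R frame_normal sf p T" using F.normal_multiple[OF n(1,2)] by blast
  have "\<beta> * \<beta> * eps sf = eps sf" using n(3) unfolding \<beta> by (simp add: pinner_simps F.frame_simps)
  then have "\<beta> * \<beta> = 1" by (cases sf) auto
  moreover have "0 < \<beta>"
    using n(4) fn(2) unfolding \<beta> det_frame_matrix by (simp add: zero_less_mult_iff)
  ultimately have "\<beta> = 1" using square_eq_1_iff[of \<beta>] by auto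
  then show ?thesis using \<beta> by simp
qed

lemma frame_normal_eq_THE:
  fixes T :: "real ^ 'n::finite \<Rightarrow> real ^ ('n + 2)"
  assumes p: "p \<in> model_space sf" and T: "linear T" "inj T" and pT: "\<And>v. pinner sf p (T v) = 0"
  shows "(THE \<nu>. pinner sf p \<nu> = 0 \<and> (\<forall>v. pinner sf (T v) \<nu> = 0) \<and> pinner sf \<nu> \<nu> = eps sf \<and>
     0 < det (\<chi> r s. case s of Inl i \<Rightarrow> T (axis i 1) $ r | Inr j \<Rightarrow> (if j = 0 then p $ r else \<nu> $ r)))
     = frame_normal sf p T"
  unfolding frame_matrix_def[symmetric]
proof (rule the_equality)
  note fn = frame_normal[OF p T pT]
  interpret F: hyper_frame sf p "frame_normal sf p T" T by (rule fn(1))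
  show "pinner sf p (frame_normal sf p T) = 0 \<and> (\<forall>v. pinner sf (T v) (frame_normal sf p T) = 0) \<and>
    pinner sf (frame_normal sf p T) (frame_normal sf p T) = eps sf \<and> 0 < det (frame_matrix p T (frame_normal sf p T))"
    using fn(2) by (simp add: F.frame_simps)
qed (use frame_normal_unique[OF assms] in blast)

definition block_matrix :: "real ^ 'n ^ 'n \<Rightarrow> real ^ ('n::finite + 2) ^ ('n + 2)" where
  "block_matrix P = (\<chi> i j. case i of
     Inl a \<Rightarrow> (case j of Inl b \<Rightarrow> P $ a $ b | Inr _ \<Rightarrow> 0)
   | Inr a \<Rightarrow> (case j of Inl _ \<Rightarrow> 0 | Inr b \<Rightarrow> if a = b then 1 else 0))"

text \<open>A permutation that moves one of the two \<open>Inr\<close> indices meets a zero entry.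
  The others are the permutations of \<open>range Inl\<close>, in sign-preserving bijection with
  those of the original index type.\<close>

lemma det_block_matrix: "det (block_matrix P) = det (P :: real ^ 'n ^ 'n)"
proof -
  let ?I = "range Inl :: ('n + 2) set"
  let ?c = "\<lambda>\<pi> x. if x \<in> ?I then Inl (\<pi> (inv_into UNIV Inl x)) else (x :: 'n + 2)"
  have bi: "bij_betw (Inl :: 'n \<Rightarrow> 'n + 2) UNIV ?I" by (simp add: bij_betw_def)
  have inv: "inv_into UNIV Inl (Inl a :: 'n + 2) = a" for a by (rule inv_into_f_f) auto
  have bij: "bij_betw ?c {\<pi>. \<pi> permutes UNIV} {\<pi>. \<pi> permutes ?I}"
    by (rule bij_betw_permutations[OF bi])
  have sign: "sign (?c \<pi>) = sign \<pi>" if "\<pi> permutes UNIV" for \<pi>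
  proof -
    interpret permutes_bij_finite \<pi> UNIV ?I Inl "inv_into UNIV Inl" "\<lambda>x. if x \<in> ?I then Inl (\<pi> (inv_into UNIV Inl x)) else x"
      by unfold_locales (use that bi inv in auto)
    show ?thesis using sign_p' by simp
  qed
  have prd: "(\<Prod>i\<in>(UNIV :: ('n + 2) set). f i) = (\<Prod>i\<in>UNIV. f (Inl i)) * (\<Prod>i\<in>UNIV. f (Inr i))" for f :: "'n + 2 \<Rightarrow> real"
  proof -
    have U: "(UNIV :: ('n + 2) set) = range Inl \<union> range Inr" by (rule UNIV_sum)
    have "prod f UNIV = prod f (range Inl \<union> range Inr)" by (rule arg_cong[OF U])
    also have "\<dots> = prod f (range Inl) * prod f (range Inr)" by (rule prod.union_disjoint) auto
    finally show ?thesis by (simp add: prod.reindex)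
  qed
  have zero: "(\<Prod>i\<in>UNIV. block_matrix P $ i $ q i) = 0" if q: "q permutes UNIV" "\<not> q permutes ?I" for q
  proof -
    have "\<exists>a. q (Inr a) \<noteq> Inr a"
    proof (rule ccontr)
      assume *: "\<not> ?thesis"
      have "q x = x" if "x \<notin> ?I" for x using * that by (cases x) auto
      then have "q permutes ?I" using q(1) unfolding permutes_def by auto
      with q(2) show False by simp
    qed
    then obtain a where "q (Inr a) \<noteq> Inr a" by blast
    then have "block_matrix P $ Inr a $ q (Inr a) = 0"
      by (auto simp: block_matrix_def split: sum.splits)
    then show ?thesis by (intro prod_zero) auto
  qed
  have "det (block_matrix P) = (\<Sum>q\<in>{q. q permutes UNIV}. of_int (sign q) * (\<Prod>i\<in>UNIV. block_matrix P $ i $ q i))"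
    by (simp add: det_def)
  also have "\<dots> = (\<Sum>q\<in>{q. q permutes ?I}. of_int (sign q) * (\<Prod>i\<in>UNIV. block_matrix P $ i $ q i))"
  proof (rule sum.mono_neutral_right)
    show "finite {q. q permutes (UNIV :: ('n + 2) set)}" by (rule finite_permutations) simp
    show "{q. q permutes ?I} \<subseteq> {q. q permutes UNIV}"
    proof
      fix q assume "q \<in> {q. q permutes ?I}"
      then show "q \<in> {q. q permutes UNIV}" using permutes_subset[of q ?I UNIV] by simp
    qed
    show "\<forall>q\<in>{q. q permutes UNIV} - {q. q permutes ?I}.
        of_int (sign q) * (\<Prod>i\<in>UNIV. block_matrix P $ i $ q i) = 0"
      by (intro ballI) (simp add: zero)
  qed
  also have "\<dots> = (\<Sum>\<pi>\<in>{\<pi>. \<pi> permutes UNIV}. of_int (sign (?c \<pi>)) * (\<Prod>i\<in>UNIV. block_matrix P $ i $ ?c \<pi> i))"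
    by (rule sum.reindex_bij_betw[OF bij, symmetric])
  also have "\<dots> = det P"
    unfolding det_def
  proof (rule sum.cong[OF refl])
    fix \<pi> assume "\<pi> \<in> {\<pi>. \<pi> permutes (UNIV :: 'n set)}"
    then have s: "sign (?c \<pi>) = sign \<pi>" by (intro sign) simp
    have "(\<Prod>i\<in>UNIV. block_matrix P $ i $ ?c \<pi> i) = (\<Prod>i\<in>UNIV. P $ i $ \<pi> i)"
      unfolding prd by (simp add: block_matrix_def inv image_iff)
    then show "of_int (sign (?c \<pi>)) * (\<Prod>i\<in>UNIV. block_matrix P $ i $ ?c \<pi> i) =
        of_int (sign \<pi>) * (\<Prod>i\<in>UNIV. P $ i $ \<pi> i)" unfolding s by simp
  qed
  finally show ?thesis .
qed

lemma det_frame_matrix_compose: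
  fixes T :: "real ^ 'n::finite \<Rightarrow> real ^ ('n + 2)"
  assumes "linear T"
  shows "det (frame_matrix p (\<lambda>v. T (P v)) n) = det (matrix P) * det (frame_matrix p T n)"
proof -
  have TP: "T (P v) = (\<Sum>k\<in>UNIV. P v $ k *\<^sub>R T (axis k 1))" for v
    using linear_sum[OF assms, of "\<lambda>k. P v $ k *\<^sub>R axis k 1" UNIV]
    by (simp add: vec_expansion linear_scale[OF assms])
  \<comment> \<open>A change of basis in the tangent space acts on the columns as right
    multiplication by diag(P, 1, 1).\<close>
  have "frame_matrix p (\<lambda>v. T (P v)) n = frame_matrix p T n ** block_matrix (matrix P)"
  proof -
    have "frame_matrix p (\<lambda>v. T (P v)) n $ r $ s = (frame_matrix p T n ** block_matrix (matrix P)) $ r $ s" for r s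
    proof (cases s)
      case (Inl a)
      then show ?thesis
        by (simp add: matrix_matrix_mult_def sum_sum_2 frame_matrix_def block_matrix_def TP[of "axis a 1"] matrix_def mult.commute)
    next
      case (Inr b)
      then show ?thesis
        using two_cases[of b] by (auto simp: matrix_matrix_mult_def sum_sum_2 frame_matrix_def block_matrix_def)
    qed
    then show ?thesis by (simp add: vec_eq_iff)
  qed
  then show ?thesis by (simp add: det_mul det_block_matrix)
qed

text \<open>An orientation-preserving P multiplies the frame determinant by a positive number, so
  uniqueness yields the same normal. This is why the normal does not depend on the chart of an
  oriented atlas.\<close>

lemma frame_normal_compose:
  fixes T :: "real ^ 'n::finite \<Rightarrow> real ^ ('n + 2)"
  assumes p: "p \<in> model_space sf" and T: "linear T" "inj T" and pT: "\<And>v. pinner sf p (T v) = 0"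
    and P: "linear P" "inj P" "0 < det (matrix P)"
  shows "frame_normal sf p (\<lambda>v. T (P v)) = frame_normal sf p T"
proof (rule frame_normal_unique[symmetric, OF p])
  note fn = frame_normal[OF p T pT]
  interpret F: hyper_frame sf p "frame_normal sf p T" T by (rule fn(1))
  show "linear (\<lambda>v. T (P v))" using linear_compose[OF P(1) T(1)] by (simp add: o_def)
  show "inj (\<lambda>v. T (P v))" using inj_compose[OF T(2) P(2)] by (simp add: o_def)
  show "0 < det (frame_matrix p (\<lambda>v. T (P v)) (frame_normal sf p T))"
    using fn(2) P(3) by (simp only: det_frame_matrix_compose[OF T(1), of p P] mult_pos_pos)
  show "pinner sf p (T (P v)) = 0" for v by (rule pT)
  show "pinner sf p (frame_normal sf p T) = 0" by (rule F.p\<nu>)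
  show "pinner sf (T (P v)) (frame_normal sf p T) = 0" for v by (simp add: F.frame_simps)
  show "pinner sf (frame_normal sf p T) (frame_normal sf p T) = eps sf" by (rule F.\<nu>\<nu>)
qed

section \<open>Pointwise geometry of the Gauss map\<close>

lemma bilinear_wedge: "bilinear (\<^bold>\<and>)"
  unfolding bilinear_def
  by (auto intro!: linearI simp: wedge_def vec_eq_iff algebra_simps)

lemma bounded_bilinear_wedge: "bounded_bilinear (\<^bold>\<and>)"
  using bilinear_wedge bilinear_conv_bounded_bilinear by blast

lemmas wedge_simps = bilinear_ladd[OF bilinear_wedge] bilinear_radd[OF bilinear_wedge]
  bilinear_lmul[OF bilinear_wedge] bilinear_rmul[OF bilinear_wedge]
  bilinear_lsub[OF bilinear_wedge] bilinear_rsub[OF bilinear_wedge]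
  bilinear_lzero[OF bilinear_wedge] bilinear_rzero[OF bilinear_wedge]
  bilinear_lneg[OF bilinear_wedge] bilinear_rneg[OF bilinear_wedge]

lemma wedge_self [simp]: "x \<^bold>\<and> x = 0"
  by (simp add: wedge_def vec_eq_iff)

lemma wedge_flip: "x \<^bold>\<and> y = - (y \<^bold>\<and> x)"
  by (simp add: wedge_def vec_eq_iff)

lemma bilinear_wedge_inner: "bilinear (wedge_inner sf)"
  unfolding bilinear_def
  by (auto intro!: linearI simp: wedge_inner_def sum.distrib sum_distrib_left algebra_simps add_divide_distrib sum_divide_distrib)

lemmas wedge_inner_simps = bilinear_ladd[OF bilinear_wedge_inner] bilinear_radd[OF bilinear_wedge_inner]
  bilinear_lmul[OF bilinear_wedge_inner] bilinear_rmul[OF bilinear_wedge_inner]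
  bilinear_lsub[OF bilinear_wedge_inner] bilinear_rsub[OF bilinear_wedge_inner]
  bilinear_lneg[OF bilinear_wedge_inner] bilinear_rneg[OF bilinear_wedge_inner]

lemma wedge_inner_commute: "wedge_inner sf X Y = wedge_inner sf Y X"
  by (simp add: wedge_inner_def mult_ac)

text \<open>\<open>\<J>\<close> is a Lie bracket with the base point; so its value does not depend on the frame that
  represents a tangent vector.\<close>

definition sig_bracket :: "space_form \<Rightarrow> real ^ ('n::finite + 2) ^ ('n + 2) \<Rightarrow> real ^ ('n + 2) ^ ('n + 2)
    \<Rightarrow> real ^ ('n + 2) ^ ('n + 2)" where
  "sig_bracket sf Z \<xi> = (\<chi> i j. \<Sum>k\<in>UNIV. signature sf k * (Z $ i $ k * \<xi> $ k $ j - \<xi> $ i $ k * Z $ k $ j))"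

lemma sig_bracket_add: "sig_bracket sf (Z + Z') \<xi> = sig_bracket sf Z \<xi> + sig_bracket sf Z' \<xi>"
  by (simp add: sig_bracket_def vec_eq_iff sum.distrib[symmetric] algebra_simps)

lemma sig_bracket_wedge:
  "sig_bracket sf (a \<^bold>\<and> b) (x \<^bold>\<and> y) =
    pinner sf b x *\<^sub>R (a \<^bold>\<and> y) - pinner sf b y *\<^sub>R (a \<^bold>\<and> x) - pinner sf a x *\<^sub>R (b \<^bold>\<and> y) + pinner sf a y *\<^sub>R (b \<^bold>\<and> x)"
proof -
  have "sig_bracket sf (a \<^bold>\<and> b) (x \<^bold>\<and> y) $ i $ j =
    (pinner sf b x *\<^sub>R (a \<^bold>\<and> y) - pinner sf b y *\<^sub>R (a \<^bold>\<and> x) - pinner sf a x *\<^sub>R (b \<^bold>\<and> y) + pinner sf a y *\<^sub>R (b \<^bold>\<and> x)) $ i $ j" for i j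
    by (simp add: sig_bracket_def wedge_def pinner_def sum_distrib_right sum_distrib_left
        sum.distrib[symmetric] sum_subtractf[symmetric] algebra_simps)
  then show ?thesis by (simp add: vec_eq_iff)
qed

lemma J_structure_eq:
  assumes "x \<in> model_space sf" "pinner sf x y = 0" "pinner sf y y = eps sf"
    "pinner sf x X = 0" "pinner sf y X = 0" "pinner sf x Y = 0" "pinner sf y Y = 0"
  shows "J_structure sf (x \<^bold>\<and> y) (x \<^bold>\<and> X + y \<^bold>\<and> Y) = y \<^bold>\<and> X - eps sf *\<^sub>R (x \<^bold>\<and> Y)"
proof -
  have br: "y \<^bold>\<and> X - eps sf *\<^sub>R (x \<^bold>\<and> Y) = sig_bracket sf (x \<^bold>\<and> X + y \<^bold>\<and> Y) (x \<^bold>\<and> y)"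
    if "x \<in> model_space sf" "pinner sf x y = 0" "pinner sf y y = eps sf"
    "pinner sf x X = 0" "pinner sf y X = 0" "pinner sf x Y = 0" "pinner sf y Y = 0" for x y X Y
    unfolding sig_bracket_add sig_bracket_wedge
    using that model_space_pinner[OF that(1)] pinner_commute[of sf X] pinner_commute[of sf Y] pinner_commute[of sf y x]
      wedge_flip[of X y] wedge_flip[of Y x]
    by simp
  show ?thesis
    unfolding J_structure_def
  proof (rule the_equality)
    show "\<exists>x' y' X' Y'. x' \<in> model_space sf \<and> pinner sf x' y' = 0 \<and> pinner sf y' y' = eps sf \<and> x \<^bold>\<and> y = x' \<^bold>\<and> y' \<and>
       pinner sf x' X' = 0 \<and> pinner sf y' X' = 0 \<and> pinner sf x' Y' = 0 \<and> pinner sf y' Y' = 0 \<and>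
       x \<^bold>\<and> X + y \<^bold>\<and> Y = x' \<^bold>\<and> X' + y' \<^bold>\<and> Y' \<and> y \<^bold>\<and> X - eps sf *\<^sub>R (x \<^bold>\<and> Y) = y' \<^bold>\<and> X' - eps sf *\<^sub>R (x' \<^bold>\<and> Y')"
      using assms by blast
  next
    fix W
    assume "\<exists>x' y' X' Y'. x' \<in> model_space sf \<and> pinner sf x' y' = 0 \<and> pinner sf y' y' = eps sf \<and> x \<^bold>\<and> y = x' \<^bold>\<and> y' \<and>
       pinner sf x' X' = 0 \<and> pinner sf y' X' = 0 \<and> pinner sf x' Y' = 0 \<and> pinner sf y' Y' = 0 \<and>
       x \<^bold>\<and> X + y \<^bold>\<and> Y = x' \<^bold>\<and> X' + y' \<^bold>\<and> Y' \<and> W = y' \<^bold>\<and> X' - eps sf *\<^sub>R (x' \<^bold>\<and> Y')"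
    then obtain x' y' X' Y' where *: "x' \<in> model_space sf" "pinner sf x' y' = 0" "pinner sf y' y' = eps sf"
       "pinner sf x' X' = 0" "pinner sf y' X' = 0" "pinner sf x' Y' = 0" "pinner sf y' Y' = 0"
       and e: "x \<^bold>\<and> y = x' \<^bold>\<and> y'" "x \<^bold>\<and> X + y \<^bold>\<and> Y = x' \<^bold>\<and> X' + y' \<^bold>\<and> Y'" "W = y' \<^bold>\<and> X' - eps sf *\<^sub>R (x' \<^bold>\<and> Y')"
      by blast
    have "W = sig_bracket sf (x' \<^bold>\<and> X' + y' \<^bold>\<and> Y') (x' \<^bold>\<and> y')"
      unfolding e(3) by (rule br[OF *])
    also have "\<dots> = y \<^bold>\<and> X - eps sf *\<^sub>R (x \<^bold>\<and> Y)"
      unfolding e(1,2)[symmetric] by (rule br[OF assms, symmetric])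
    finally show "W = y \<^bold>\<and> X - eps sf *\<^sub>R (x \<^bold>\<and> Y)" .
  qed
qed

text \<open>S is the differential of the unit normal; \<open>TS\<close> is the symmetry of the
  second fundamental form.\<close>

locale gauss_frame = hyper_frame +
  fixes S :: "real ^ 'n \<Rightarrow> real ^ ('n::finite + 2)"
  assumes S: "linear S" and pS: "\<And>v. pinner sf p (S v) = 0" and \<nu>S: "\<And>v. pinner sf \<nu> (S v) = 0"
    and TS: "\<And>v w. pinner sf (T v) (S w) = pinner sf (S v) (T w)"
begin

lemmas gframe_simps = frame_simps pS \<nu>S pS[unfolded pinner_commute[of sf p]] \<nu>S[unfolded pinner_commute[of sf \<nu>]]

text \<open>The product rule for the wedge of position and normal: the value of the differential of
  the Gauss map at v.\<close>

definition dG :: "real ^ 'n \<Rightarrow> real ^ ('n + 2) ^ ('n + 2)" where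
  "dG v = T v \<^bold>\<and> \<nu> + p \<^bold>\<and> S v"

definition JdG :: "real ^ 'n \<Rightarrow> real ^ ('n + 2) ^ ('n + 2)" where
  "JdG v = \<nu> \<^bold>\<and> S v + eps sf *\<^sub>R (p \<^bold>\<and> T v)"

lemma dG_frame: "dG v = p \<^bold>\<and> S v + \<nu> \<^bold>\<and> (- T v)"
  using wedge_flip[of "T v" \<nu>] by (simp add: dG_def wedge_simps)

lemma J_structure_dG: "J_structure sf (p \<^bold>\<and> \<nu>) (dG v) = JdG v"
proof -
  have "J_structure sf (p \<^bold>\<and> \<nu>) (p \<^bold>\<and> S v + \<nu> \<^bold>\<and> (- T v)) = \<nu> \<^bold>\<and> S v - eps sf *\<^sub>R (p \<^bold>\<and> (- T v))"
    by (rule J_structure_eq[OF p]) (simp_all add: gframe_simps pinner_simps)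
  then show ?thesis by (simp add: dG_frame JdG_def wedge_simps)
qed

lemma wedge_inner_dG: "wedge_inner sf (dG v) (dG w) = eps sf * pinner sf (T v) (T w) + pinner sf (S v) (S w)"
  by (simp add: dG_def wedge_inner_simps wedge_inner_wedge gframe_simps)

text \<open>What survives is \<open>eps sf\<close> times \<open><T v, S w> - <T w, S v>\<close>,
  zero by symmetry of the second fundamental form; hence the Gauss map is Lagrangian.\<close>

lemma wedge_inner_JdG_dG: "wedge_inner sf (JdG v) (dG w) = 0"
  using TS[of v w]
  by (simp add: JdG_def dG_def wedge_inner_simps wedge_inner_wedge gframe_simps pinner_commute[of sf "T w"])

lemma Omega_dG: "Omega sf (p \<^bold>\<and> \<nu>) (dG v) (dG w) = 0"
  by (simp add: Omega_def J_structure_dG wedge_inner_JdG_dG)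

definition shape :: "real ^ 'n \<Rightarrow> real ^ 'n" where
  "shape v = (THE w. T w = - S v)"

lemma T_inject: "T v = T w \<longleftrightarrow> v = w"
  using T(2) by (auto dest: injD)

lemma T_shape: "T (shape v) = - S v"
proof -
  obtain a where a: "- S v = T a"
    using orthogonal_in_range[of "- S v"] by (auto simp: pinner_simps gframe_simps)
  show ?thesis unfolding shape_def
    by (rule theI[of _ a]) (auto simp: a T_inject)
qed

lemma linear_shape: "linear shape"
proof (rule linearI)
  have "T (shape (a + b)) = T (shape a + shape b)" for a b
    by (simp add: T_shape linear_add[OF T(1)] linear_add[OF S])
  then show "shape (a + b) = shape a + shape b" for a b by (simp add: T_inject)
  have "T (shape (c *\<^sub>R a)) = T (c *\<^sub>R shape a)" for a c
    by (simp add: T_shape linear_scale[OF T(1)] linear_scale[OF S])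
  then show "shape (c *\<^sub>R a) = c *\<^sub>R shape a" for a c by (simp add: T_inject)
qed

definition g :: "real ^ 'n \<Rightarrow> real ^ 'n \<Rightarrow> real" where
  "g v w = eps sf * pinner sf (T v) (T w)"

lemma bilinear_g: "bilinear g"
  unfolding bilinear_def g_def
  by (auto intro!: linearI simp: pinner_simps linear_add[OF T(1)] linear_scale[OF T(1)] algebra_simps)

lemma inner_form_g: "inner_form g"
  unfolding inner_form_def
  using bilinear_g T_definite pinner_commute[of sf] by (auto simp: g_def)

lemma g_shape: "g (shape v) w = g v (shape w)"
  using TS[of v w] by (simp add: g_def T_shape pinner_simps)

text \<open>The operator that represents the metric of the Gauss map with respect to g. As a
  polynomial in the shape operator it is diagonal in the same basis, with entries
  \<open>1 + eps sf * k\<^sup>2\<close>.\<close>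

definition shape_form :: "real ^ 'n \<Rightarrow> real ^ 'n" where
  "shape_form v = v + eps sf *\<^sub>R shape (shape v)"

lemma linear_shape_form: "linear shape_form"
  by (rule linearI) (simp_all add: shape_form_def linear_add[OF linear_shape] linear_scale[OF linear_shape] algebra_simps)

lemma wedge_inner_dG_shape: "wedge_inner sf (dG v) (dG w) = g v (shape_form w)"
proof -
  have "g v (shape_form w) = g v w + eps sf * g v (shape (shape w))"
    by (simp add: shape_form_def bilinear_radd[OF bilinear_g] bilinear_rmul[OF bilinear_g])
  also have "g v (shape (shape w)) = g (shape v) (shape w)" by (rule g_shape[symmetric])
  also have "eps sf * g (shape v) (shape w) = (eps sf * eps sf) * pinner sf (S v) (S w)"
    unfolding g_def T_shape by (simp add: pinner_simps mult.assoc)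
  finally show ?thesis by (simp add: wedge_inner_dG g_def)
qed

lemma det_form_dG:
  "det (form_matrix (\<lambda>v w. wedge_inner sf (dG v) (dG w))) = det (form_matrix g) * det (matrix shape_form)"
  unfolding wedge_inner_dG_shape form_matrix_mult[OF bilinear_g, of shape_form] by (rule det_mul)

text \<open>Here the principal curvatures leave the proof: the integrand of the functional becomes
  the determinant of an operator.\<close>

lemma prod_W_factor:
  "(\<Prod>k\<in>{k. \<exists>v. v \<noteq> 0 \<and> shape v = k *\<^sub>R v}. W_factor sf k ^ dim {v. shape v = k *\<^sub>R v}) = \<bar>det (matrix shape_form)\<bar>"
proof -
  have W: "W_factor sf k = \<bar>1 + eps sf * k\<^sup>2\<bar>" for k
    by (cases sf) (simp_all add: abs_of_nonneg add_nonneg_nonneg)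
  have "(\<Prod>k\<in>{k. \<exists>v. v \<noteq> 0 \<and> shape v = k *\<^sub>R v}. (1 + eps sf * k\<^sup>2) ^ dim {v. shape v = k *\<^sub>R v}) = det (matrix shape_form)"
  proof (rule selfadjoint_prod_eigenvalues[OF inner_form_g linear_shape g_shape linear_shape_form])
    fix v k assume "shape v = k *\<^sub>R v"
    then show "shape_form v = (1 + eps sf * k\<^sup>2) *\<^sub>R v"
      by (simp add: shape_form_def linear_scale[OF linear_shape] power2_eq_square algebra_simps)
  qed
  then show ?thesis unfolding W by (simp only: power_abs[symmetric] abs_prod[symmetric])
qed

text \<open>The velocity of the Gauss maps of a variation with velocity \<open>a\<close>, whose unit normals move with
  velocity \<open>m\<close>; \<open>w\<close> is the gradient of \<open>- \<langle>a, \<nu>\<rangle>\<close>.\<close>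

lemma velocity_normal_part:
  assumes a: "pinner sf p a = 0" and m: "pinner sf \<nu> m = 0"
    and w: "\<And>v. wedge_inner sf (dG w) (dG v) = pinner sf m (T v) - pinner sf a (S v)"
  shows "\<exists>z. a \<^bold>\<and> \<nu> + p \<^bold>\<and> m - JdG w = dG z"
proof -
  define \<beta> where "\<beta> = eps sf * pinner sf a \<nu>"
  define \<kappa> where "\<kappa> = pinner sf p m"
  obtain \<alpha> where \<alpha>: "a - \<beta> *\<^sub>R \<nu> = T \<alpha>"
    using orthogonal_in_range[of "a - \<beta> *\<^sub>R \<nu>"] a pinner_commute[of sf \<nu> a]
    by (auto simp: pinner_simps gframe_simps \<beta>_def algebra_simps mult.assoc[symmetric])
  obtain \<mu> where \<mu>: "m - \<kappa> *\<^sub>R p = T \<mu>"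
    using orthogonal_in_range[of "m - \<kappa> *\<^sub>R p"] m by (auto simp: pinner_simps gframe_simps \<kappa>_def)
  have a': "a = T \<alpha> + \<beta> *\<^sub>R \<nu>" using \<alpha> by (simp add: algebra_simps)
  have m': "m = T \<mu> + \<kappa> *\<^sub>R p" using \<mu> by (simp add: algebra_simps)
  define z where "z = \<alpha> - shape w"
  \<comment> \<open>Both sides are tangent to the hypersurface, where the form is definite; so it is
    enough to pair them with all \<open>T v\<close>, and there the equation is the hypothesis on
    w.\<close>
  have key: "T \<mu> - eps sf *\<^sub>R T w = S z"
  proof -
    obtain b where b: "T \<mu> - eps sf *\<^sub>R T w - S z = T b"
      using orthogonal_in_range[of "T \<mu> - eps sf *\<^sub>R T w - S z"] by (auto simp: pinner_simps gframe_simps)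
    have "pinner sf (T b) (T v) = 0" for v
    proof -
      have 1: "pinner sf (S z) (T v) = pinner sf (T \<alpha>) (S v) + pinner sf (S w) (S v)"
        using TS[of z v] by (simp add: z_def linear_diff[OF T(1)] T_shape pinner_simps)
      have 2: "pinner sf (T \<mu>) (T v) - pinner sf (T \<alpha>) (S v) = eps sf * pinner sf (T w) (T v) + pinner sf (S w) (S v)"
        using w[of v] by (simp add: wedge_inner_dG a' m' pinner_simps gframe_simps)
      show ?thesis unfolding b[symmetric] using 1 2 by (simp add: pinner_simps)
    qed
    then have "b = 0" by (rule T_eq_0I)
    then show ?thesis using b linear_0[OF T(1)] by simp
  qed
  have "a \<^bold>\<and> \<nu> + p \<^bold>\<and> m - JdG w = T \<alpha> \<^bold>\<and> \<nu> + p \<^bold>\<and> (T \<mu> - eps sf *\<^sub>R T w) - \<nu> \<^bold>\<and> S w"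
    by (simp add: a' m' JdG_def wedge_simps)
  also have "\<dots> = T \<alpha> \<^bold>\<and> \<nu> + p \<^bold>\<and> S z - T (shape w) \<^bold>\<and> \<nu>"
    unfolding key using wedge_flip[of \<nu> "S w"] by (simp add: T_shape wedge_simps)
  also have "\<dots> = dG z"
    by (simp add: dG_def z_def linear_diff[OF T(1)] wedge_simps)
  finally show ?thesis by blast
qed

end

section \<open>The Gauss map of an immersed hypersurface\<close>

text \<open>For differentiating the relations of an orthonormal frame, such as
  \<open><p, p> = 1\<close> or \<open><N, d\<phi>> = 0\<close>.\<close>

lemma bilinear_const_frechet_derivative:
  assumes B: "bounded_bilinear B" and U: "open U" "y \<in> U"
    and f: "f differentiable (at y)" and h: "h differentiable (at y)"
    and c: "\<And>z. z \<in> U \<Longrightarrow> B (f z) (h z) = c"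
  shows "B (f y) (frechet_derivative h (at y) v) + B (frechet_derivative f (at y) v) (h y) = 0"
proof -
  have "((\<lambda>z. B (f z) (h z)) has_derivative
      (\<lambda>v. B (f y) (frechet_derivative h (at y) v) + B (frechet_derivative f (at y) v) (h y))) (at y)"
    by (rule bounded_bilinear.FDERIV[OF B]) (use f h in \<open>simp_all add: frechet_derivative_works\<close>)
  moreover have "((\<lambda>z. B (f z) (h z)) has_derivative (\<lambda>v. 0)) (at y)"
    by (rule has_derivative_transform_within_open[OF has_derivative_const[of c] U]) (simp add: c)
  ultimately have "(\<lambda>v. B (f y) (frechet_derivative h (at y) v) + B (frechet_derivative f (at y) v) (h y)) = (\<lambda>v. 0)"
    by (rule has_derivative_unique)
  then show ?thesis by (rule fun_cong)
qed

lemma linear_eq_axis: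
  assumes "linear T"
  shows "T v = (\<Sum>i\<in>UNIV. v $ i *\<^sub>R T (axis i (1 :: real)))"
  using linear_sum[OF assms, of "\<lambda>i. v $ i *\<^sub>R axis i 1" UNIV]
  by (simp add: vec_expansion linear_scale[OF assms])

text \<open>The parameter space is arbitrary, so that the lemma serves a chart as well as the
  product of a time interval and a chart.\<close>

lemma smooth_on_frame_normal:
  fixes P :: "'a::euclidean_space \<Rightarrow> real ^ ('n::finite + 2)" and T :: "'a \<Rightarrow> real ^ 'n \<Rightarrow> real ^ ('n + 2)"
  assumes P: "smooth_on W P" and T: "\<And>i. smooth_on W (\<lambda>z. T z (axis i 1))"
    and fr: "\<And>z. z \<in> W \<Longrightarrow> P z \<in> model_space sf \<and> linear (T z) \<and> inj (T z) \<and> (\<forall>v. pinner sf (P z) (T z v) = 0)"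
  shows "smooth_on W (\<lambda>z. frame_normal sf (P z) (T z))"
proof -
  note W = smooth_onD_open[OF P]
  have "smooth_on W (\<lambda>z. frame_matrix (P z) (T z) (axis r 1))" for r :: "'n + 2"
  proof (intro smooth_on_vec W)
    fix i j :: "'n + 2"
    show "smooth_on W (\<lambda>z. frame_matrix (P z) (T z) (axis r 1) $ i $ j)"
    proof (cases j)
      case (Inl a)
      then show ?thesis using smooth_on_vec_nth[OF T[of a], of i] by (simp add: frame_matrix_def)
    next
      case (Inr b)
      then show ?thesis
        using smooth_on_vec_nth[OF P, of i] smooth_on_const[OF W, of "axis r 1 $ i :: real"]
        by (cases "b = 0") (simp_all add: frame_matrix_def)
    qed
  qed
  then have "smooth_on W (\<lambda>z. det (frame_matrix (P z) (T z) (axis r 1)))" for r :: "'n + 2"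
    by (rule smooth_on_det)
  then have "smooth_on W (\<lambda>z. cross_vector (P z) (T z))"
    by (intro smooth_on_vec W) (simp add: cross_vector_def)
  moreover have "bounded_linear (flip_sig sf :: real ^ ('n + 2) \<Rightarrow> real ^ ('n + 2))"
    using linear_flip_sig by (simp add: linear_conv_bounded_linear[symmetric])
  ultimately have c: "smooth_on W (\<lambda>z. flip_sig sf (cross_vector (P z) (T z)))"
    by (rule smooth_on_bounded_linear)
  have q: "smooth_on W (\<lambda>z. eps sf * pinner sf (flip_sig sf (cross_vector (P z) (T z))) (flip_sig sf (cross_vector (P z) (T z))))"
    by (rule smooth_on_mult[OF smooth_on_const[OF W] smooth_on_bilinear[OF bounded_bilinear_pinner c c]])
  have pos: "0 < eps sf * pinner sf (flip_sig sf (cross_vector (P z) (T z))) (flip_sig sf (cross_vector (P z) (T z)))"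
    if "z \<in> W" for z
    using frame_normal(3)[of "P z" sf "T z"] fr[OF that] by blast
  have s: "smooth_on W (\<lambda>z. sqrt (eps sf * pinner sf (flip_sig sf (cross_vector (P z) (T z))) (flip_sig sf (cross_vector (P z) (T z)))))"
    by (rule smooth_on_sqrt[OF q pos])
  have "smooth_on W (\<lambda>z. eps sf / sqrt (eps sf * pinner sf (flip_sig sf (cross_vector (P z) (T z))) (flip_sig sf (cross_vector (P z) (T z)))))"
  proof (rule smooth_on_divide[OF smooth_on_const[OF W] s])
    show "sqrt (eps sf * pinner sf (flip_sig sf (cross_vector (P z) (T z))) (flip_sig sf (cross_vector (P z) (T z)))) \<noteq> 0"
      if "z \<in> W" for z using real_sqrt_gt_zero[OF pos[OF that]] by linarith
  qed
  from smooth_on_scaleR[OF this c] show ?thesis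
    by (simp add: frame_normal_def Let_def)
qed

locale oriented_manifold =
  fixes A :: "('m::{t2_space,second_countable_topology}, 'n::finite) chart set"
  assumes oriented: "oriented_atlas A"

sublocale oriented_manifold \<subseteq> manifold
  using oriented by unfold_locales (simp add: oriented_atlas_def)

context manifold
begin

lemma tangent_map_cong:
  fixes f h :: "'m \<Rightarrow> 'e::euclidean_space"
  assumes W: "open W" "x \<in> W" and fh: "\<And>z. z \<in> W \<Longrightarrow> f z = h z"
  shows "tangent_map A f x = tangent_map A h x"
proof -
  let ?c = "chart_at A x"
  have o: "open (coords ?c ` (chart_dom ?c \<inter> W))"
    using W open_chart_dom[OF chart_at(1)] by (intro open_image_coords chart_at(1)) auto
  have m: "coords ?c x \<in> coords ?c ` (chart_dom ?c \<inter> W)" using chart_at(2) W by blast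
  have e: "(f \<circ> chart_inv ?c) z = (h \<circ> chart_inv ?c) z" if "z \<in> coords ?c ` (chart_dom ?c \<inter> W)" for z
    using that fh chart_inv_coords[OF chart_at(1)] by auto
  have "((f \<circ> chart_inv ?c) has_derivative D) (at (coords ?c x)) \<longleftrightarrow>
      ((h \<circ> chart_inv ?c) has_derivative D) (at (coords ?c x))" for D
    using has_derivative_transform_within_open[OF _ o m, of "f \<circ> chart_inv ?c" D UNIV "h \<circ> chart_inv ?c"]
      has_derivative_transform_within_open[OF _ o m, of "h \<circ> chart_inv ?c" D UNIV "f \<circ> chart_inv ?c"] e
    by auto
  then show ?thesis unfolding tangent_map_def frechet_derivative_def by simp
qed

text \<open>Two candidates differ by a tangent vector orthogonal to all tangent vectors, which
  nondegeneracy makes zero.\<close>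

lemma normal_componentI:
  fixes f :: "'m \<Rightarrow> 'e::euclidean_space"
  assumes b: "bilinear b" and nd: "nondegenerate_metric A b f" and f: "smooth_map A f"
    and 1: "V - \<nu> \<in> range (tangent_map A f x)" and 2: "\<And>v. b \<nu> (tangent_map A f x v) = 0"
  shows "normal_component A b f x V = \<nu>"
  unfolding normal_component_def
proof (rule the_equality)
  fix \<nu>' assume n: "V - \<nu>' \<in> range (tangent_map A f x) \<and> (\<forall>v. b \<nu>' (tangent_map A f x v) = 0)"
  note l = linear_tangent_map[OF f, of x]
  obtain y y' where y: "V - \<nu> = tangent_map A f x y" "V - \<nu>' = tangent_map A f x y'" using 1 n by blast
  have e: "\<nu>' - \<nu> = tangent_map A f x (y - y')" unfolding linear_diff[OF l] y[symmetric] by simp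
  have "\<forall>w. b (tangent_map A f x (y - y')) (tangent_map A f x w) = 0"
    unfolding e[symmetric] using n 2 by (simp add: bilinear_lsub[OF b])
  then have "y - y' = 0" using nd unfolding nondegenerate_metric_def by blast
  then show "\<nu>' = \<nu>" using e linear_0[OF l] by simp
qed (use 1 2 in blast)

lemma nondegenerate_represent_tangent:
  fixes f :: "'m \<Rightarrow> 'e::euclidean_space"
  assumes b: "bilinear b" and nd: "nondegenerate_metric A b f" and f: "smooth_map A f" and l: "linear l"
  shows "\<exists>!w. \<forall>v. b (tangent_map A f x w) (tangent_map A f x v) = l v"
  by (rule nondegenerate_represent[OF bilinear_pullback[OF b linear_tangent_map[OF f]] _ l])
    (use nd in \<open>auto simp: nondegenerate_metric_def\<close>)

text \<open>The tangential part is the vector that represents the functional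
  \<open>v \<mapsto> b V (tangent_map A f x v)\<close>; subtracting it from V leaves a normal
  vector.\<close>

lemma normal_component_in_range:
  fixes f :: "'m \<Rightarrow> 'e::euclidean_space"
  assumes b: "bilinear b" and nd: "nondegenerate_metric A b f" and f: "smooth_map A f"
  shows "V - normal_component A b f x V \<in> range (tangent_map A f x)"
proof -
  have bl: "linear (b V)" using b by (simp add: bilinear_def)
  have l: "linear (\<lambda>v. b V (tangent_map A f x v))"
    using linear_compose[OF linear_tangent_map[OF f] bl] by (simp add: o_def)
  obtain w where w: "\<And>v. b (tangent_map A f x w) (tangent_map A f x v) = b V (tangent_map A f x v)"
    using nondegenerate_represent_tangent[OF b nd f l] by blast
  have "normal_component A b f x V = V - tangent_map A f x w"
    by (rule normal_componentI[OF b nd f]) (simp_all add: bilinear_lsub[OF b] w)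
  then show ?thesis by simp
qed

end

context oriented_manifold
begin

lemma det_transition_deriv_pos:
  "c \<in> A \<Longrightarrow> d \<in> A \<Longrightarrow> y \<in> overlap c d \<Longrightarrow> 0 < det (matrix (transition_deriv c d y))"
  using oriented unfolding oriented_atlas_def transition_deriv_def by blast

lemma det_to_chart_at_pos: "c \<in> A \<Longrightarrow> x \<in> chart_dom c \<Longrightarrow> 0 < det (matrix (to_chart_at c x))"
  unfolding to_chart_at_def by (rule det_transition_deriv_pos[OF _ chart_at(1) mem_overlap_chart_at])

end

locale hypersurface = oriented_manifold A
  for A :: "('m::{t2_space,second_countable_topology}, 'n::finite) chart set" +
  fixes sf :: space_form and \<phi> :: "'m \<Rightarrow> real ^ ('n + 2)"
  assumes hyp: "immersed_hypersurface A sf \<phi>"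
begin

abbreviation N :: "'m \<Rightarrow> real ^ ('n + 2)" where
  "N \<equiv> unit_normal A sf \<phi>"

abbreviation G :: "'m \<Rightarrow> real ^ ('n + 2) ^ ('n + 2)" where
  "G \<equiv> gauss_map A sf \<phi>"

lemma smooth_phi: "smooth_map A \<phi>" and inj_tangent_phi: "inj (tangent_map A \<phi> x)"
  and phi_model: "\<phi> x \<in> model_space sf"
  using hyp by (auto simp: immersed_hypersurface_def immersion_def)

lemma pinner_phi_deriv:
  assumes c: "c \<in> A" and y: "y \<in> chart_img c"
  shows "pinner sf (\<phi> (chart_inv c y)) (chart_deriv \<phi> c y v) = 0"
  using bilinear_const_frechet_derivative[OF bounded_bilinear_pinner open_chart_img[OF c] y
      smooth_map_differentiable[OF smooth_phi c y] smooth_map_differentiable[OF smooth_phi c y], of sf 1 v]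
    model_space_pinner[OF phi_model]
    pinner_commute[of sf "\<phi> (chart_inv c y)" "chart_deriv \<phi> c y v"]
  by (simp add: chart_deriv_def)

lemma chart_deriv_phi:
  assumes c: "c \<in> A" and x: "x \<in> chart_dom c"
  shows "chart_deriv \<phi> c (coords c x) = (\<lambda>v. tangent_map A \<phi> x (to_chart_at c x v))"
  by (rule ext) (rule chart_deriv_tangent_map_smooth[OF smooth_phi c x])

lemma inj_chart_deriv_phi:
  assumes c: "c \<in> A" and y: "y \<in> chart_img c"
  shows "inj (chart_deriv \<phi> c y)"
proof -
  from y obtain x where x: "x \<in> chart_dom c" "y = coords c x" by blast
  show ?thesis unfolding x(2) chart_deriv_phi[OF c x(1)]
    using inj_compose[OF inj_tangent_phi inj_to_chart_at[OF c x(1)]] by (simp add: o_def)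
qed

lemma pinner_phi_tangent: "pinner sf (\<phi> x) (tangent_map A \<phi> x v) = 0"
  using pinner_phi_deriv[OF chart_at(1) coords_chart_at, of x v]
  by (simp add: tangent_map_chart_deriv chart_inv_coords chart_at)

lemma unit_normal_frame: "N x = frame_normal sf (\<phi> x) (tangent_map A \<phi> x)"
  unfolding unit_normal_def
  by (rule frame_normal_eq_THE[OF phi_model linear_tangent_map[OF smooth_phi] inj_tangent_phi pinner_phi_tangent])

text \<open>\<open>unit_normal\<close> goes through the chart chosen at each point, and this choice
  need not vary continuously. A formula in one fixed chart is what gives smoothness.\<close>

lemma unit_normal_chart:
  assumes c: "c \<in> A" and y: "y \<in> chart_img c"
  shows "N (chart_inv c y) = frame_normal sf (\<phi> (chart_inv c y)) (chart_deriv \<phi> c y)"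
proof -
  from y obtain x where x: "x \<in> chart_dom c" "y = coords c x" by blast
  show ?thesis
    unfolding x(2) chart_deriv_phi[OF c x(1)] chart_inv_coords[OF c x(1)] unit_normal_frame
    by (rule frame_normal_compose[symmetric, OF phi_model linear_tangent_map[OF smooth_phi] inj_tangent_phi
          pinner_phi_tangent linear_to_chart_at[OF c x(1)] inj_to_chart_at[OF c x(1)] det_to_chart_at_pos[OF c x(1)]])
qed

lemma hyper_frame_chart:
  assumes c: "c \<in> A" and y: "y \<in> chart_img c"
  shows "hyper_frame sf (\<phi> (chart_inv c y)) (N (chart_inv c y)) (chart_deriv \<phi> c y)"
  unfolding unit_normal_chart[OF c y]
  by (rule frame_normal(1)[OF phi_model linear_chart_deriv[OF smooth_phi c y] inj_chart_deriv_phi[OF c y]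
        pinner_phi_deriv[OF c y]])

lemma smooth_N: "smooth_map A N"
  unfolding smooth_map_def
proof
  fix c assume c: "c \<in> A"
  have "smooth_on (chart_img c) (\<lambda>y. frame_normal sf ((\<phi> \<circ> chart_inv c) y) (chart_deriv \<phi> c y))"
  proof (rule smooth_on_frame_normal[OF smooth_map_chart[OF smooth_phi c]])
    show "smooth_on (chart_img c) (\<lambda>y. chart_deriv \<phi> c y (axis i 1))" for i
      unfolding chart_deriv_def by (rule smooth_on_frechet_derivative[OF smooth_map_chart[OF smooth_phi c]])
    show "(\<phi> \<circ> chart_inv c) y \<in> model_space sf \<and> linear (chart_deriv \<phi> c y) \<and> inj (chart_deriv \<phi> c y) \<and>
        (\<forall>v. pinner sf ((\<phi> \<circ> chart_inv c) y) (chart_deriv \<phi> c y v) = 0)" if "y \<in> chart_img c" for y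
      using phi_model linear_chart_deriv[OF smooth_phi c that] inj_chart_deriv_phi[OF c that]
        pinner_phi_deriv[OF c that] by simp
  qed
  then show "smooth_on (chart_img c) (N \<circ> chart_inv c)"
    by (rule smooth_on_cong) (simp add: unit_normal_chart[OF c])
qed

lemma smooth_G: "smooth_map A G"
  unfolding smooth_map_def
proof
  fix c assume c: "c \<in> A"
  have "smooth_on (chart_img c) (\<lambda>y. (\<phi> \<circ> chart_inv c) y \<^bold>\<and> (N \<circ> chart_inv c) y)"
    by (rule smooth_on_bilinear[OF bounded_bilinear_wedge smooth_map_chart[OF smooth_phi c] smooth_map_chart[OF smooth_N c]])
  then show "smooth_on (chart_img c) (G \<circ> chart_inv c)"
    by (simp add: gauss_map_def o_def)
qed

text \<open>Differentiating \<open><N, N>\<close> and \<open><\<phi>, N>\<close> makes dN tangent.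
  Differentiating \<open><N, d\<phi>(w)> = 0\<close> along v expresses
  \<open><dN(v), d\<phi>(w)>\<close> by a second derivative of \<phi>, which is symmetric in v and
  w.\<close>

lemma gauss_frame_chart:
  assumes c: "c \<in> A" and y: "y \<in> chart_img c"
  shows "gauss_frame sf (\<phi> (chart_inv c y)) (N (chart_inv c y)) (chart_deriv \<phi> c y) (chart_deriv N c y)"
proof -
  interpret F: hyper_frame sf "\<phi> (chart_inv c y)" "N (chart_inv c y)" "chart_deriv \<phi> c y"
    by (rule hyper_frame_chart[OF c y])
  note U = open_chart_img[OF c]
  note dphi = smooth_map_differentiable[OF smooth_phi c y]
  note dN = smooth_map_differentiable[OF smooth_N c y]
  have h: "pinner sf (\<phi> (chart_inv c z)) (N (chart_inv c z)) = 0" "pinner sf (N (chart_inv c z)) (N (chart_inv c z)) = eps sf"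
    "pinner sf (N (chart_inv c z)) (chart_deriv \<phi> c z v) = 0" if "z \<in> chart_img c" for z v
    using hyper_frame_chart[OF c that] by (auto simp: hyper_frame_def)
  have 1: "pinner sf (N (chart_inv c y)) (chart_deriv N c y v) = 0" for v
    using bilinear_const_frechet_derivative[OF bounded_bilinear_pinner U y dN dN, of sf "eps sf" v] h(2)
      pinner_commute[of sf "N (chart_inv c y)" "chart_deriv N c y v"]
    by (simp add: chart_deriv_def)
  have 2: "pinner sf (\<phi> (chart_inv c y)) (chart_deriv N c y v) = 0" for v
    using bilinear_const_frechet_derivative[OF bounded_bilinear_pinner U y dphi dN, of sf 0 v] h(1)
      F.\<nu>T[of v] pinner_commute[of sf "chart_deriv \<phi> c y v" "N (chart_inv c y)"]
    by (simp add: chart_deriv_def)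
  have 3: "pinner sf (N (chart_inv c y)) (frechet_derivative (\<lambda>z. chart_deriv \<phi> c z w) (at y) v)
      + pinner sf (chart_deriv N c y v) (chart_deriv \<phi> c y w) = 0" for v w
  proof -
    have "smooth_on (chart_img c) (\<lambda>z. chart_deriv \<phi> c z w)"
      unfolding chart_deriv_def by (rule smooth_on_frechet_derivative[OF smooth_map_chart[OF smooth_phi c]])
    from bilinear_const_frechet_derivative[OF bounded_bilinear_pinner U y dN smooth_on_differentiable[OF this y], of sf 0 v] h(3)
    show ?thesis by (simp add: chart_deriv_def)
  qed
  have 4: "frechet_derivative (\<lambda>z. chart_deriv \<phi> c z w) (at y) v = frechet_derivative (\<lambda>z. chart_deriv \<phi> c z v) (at y) w" for v w
    unfolding chart_deriv_def by (rule frechet_derivative_commute[OF smooth_map_chart[OF smooth_phi c] y])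
  have 5: "pinner sf (chart_deriv \<phi> c y v) (chart_deriv N c y w) = pinner sf (chart_deriv N c y v) (chart_deriv \<phi> c y w)" for v w
    using 3[of v w] 3[of w v] 4[of v w] pinner_commute[of sf "chart_deriv \<phi> c y v" "chart_deriv N c y w"] by simp
  show ?thesis
    by (rule gauss_frame.intro[OF hyper_frame_chart[OF c y]])
      (rule gauss_frame_axioms.intro[OF linear_chart_deriv[OF smooth_N c y] 2 1 5])
qed

lemma gauss_frame_tangent: "gauss_frame sf (\<phi> x) (N x) (tangent_map A \<phi> x) (tangent_map A N x)"
  using gauss_frame_chart[OF chart_at(1) coords_chart_at, of x]
  by (simp add: tangent_map_chart_deriv[abs_def] chart_inv_coords chart_at)

lemma chart_deriv_G:
  assumes c: "c \<in> A" and y: "y \<in> chart_img c"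
  shows "chart_deriv G c y v = gauss_frame.dG (\<phi> (chart_inv c y)) (N (chart_inv c y)) (chart_deriv \<phi> c y) (chart_deriv N c y) v"
proof -
  interpret F: gauss_frame sf "\<phi> (chart_inv c y)" "N (chart_inv c y)" "chart_deriv \<phi> c y" "chart_deriv N c y"
    by (rule gauss_frame_chart[OF c y])
  have "((\<lambda>z. (\<phi> \<circ> chart_inv c) z \<^bold>\<and> (N \<circ> chart_inv c) z) has_derivative
      (\<lambda>v. (\<phi> \<circ> chart_inv c) y \<^bold>\<and> chart_deriv N c y v + chart_deriv \<phi> c y v \<^bold>\<and> (N \<circ> chart_inv c) y)) (at y)"
    by (rule bounded_bilinear.FDERIV[OF bounded_bilinear_wedge chart_deriv_has_derivative[OF smooth_phi c y]
          chart_deriv_has_derivative[OF smooth_N c y]])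
  moreover have "G \<circ> chart_inv c = (\<lambda>z. (\<phi> \<circ> chart_inv c) z \<^bold>\<and> (N \<circ> chart_inv c) z)"
    by (simp add: gauss_map_def fun_eq_iff)
  ultimately show ?thesis
    by (simp add: chart_deriv_def[of G] frechet_derivative_apply F.dG_def add.commute)
qed

lemma tangent_map_G:
  "tangent_map A G x v = gauss_frame.dG (\<phi> x) (N x) (tangent_map A \<phi> x) (tangent_map A N x) v"
  using chart_deriv_G[OF chart_at(1) coords_chart_at, of x v]
  by (simp add: tangent_map_chart_deriv[abs_def] chart_inv_coords chart_at)

lemma G_geodesic: "G x \<in> geodesic_space sf"
proof -
  interpret F: gauss_frame sf "\<phi> x" "N x" "tangent_map A \<phi> x" "tangent_map A N x" by (rule gauss_frame_tangent)
  show ?thesis unfolding geodesic_space_def gauss_map_def using F.p F.frame_simps by blast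
qed

lemma lagrangian_G: "immersion A G \<Longrightarrow> lagrangian_immersion A sf G"
  unfolding lagrangian_immersion_def
proof (intro conjI allI)
  fix x v w
  interpret F: gauss_frame sf "\<phi> x" "N x" "tangent_map A \<phi> x" "tangent_map A N x" by (rule gauss_frame_tangent)
  show "Omega sf (G x) (tangent_map A G x v) (tangent_map A G x w) = 0"
    unfolding tangent_map_G by (subst gauss_map_def) (rule F.Omega_dG)
qed (use G_geodesic in auto)

subsection \<open>The functional as the volume of the Gauss map\<close>

definition curvature_weight :: "'m \<Rightarrow> real" where
  "curvature_weight x = sqrt (\<Prod>k\<in>principal_curvatures A sf \<phi> x.
     W_factor sf k ^ curvature_multiplicity A sf \<phi> x k)"

definition riem :: "real ^ ('n + 2) \<Rightarrow> real ^ ('n + 2) \<Rightarrow> real" where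
  "riem v w = eps sf * pinner sf v w"

lemma bilinear_riem: "bilinear riem"
  unfolding bilinear_def riem_def
  by (auto intro!: linearI simp: pinner_simps algebra_simps)

text \<open>The shape operator lives in the chart chosen at the point, where the two Gram
  determinants differ by the determinant of \<open>shape_form\<close>. Both pick up the same squared
  Jacobian on the way to c.\<close>

lemma vol_density_G:
  assumes c: "c \<in> A" and y: "y \<in> chart_img c"
  shows "vol_density (wedge_inner sf) G c y = vol_density riem \<phi> c y * curvature_weight (chart_inv c y)"
proof -
  define x where "x = chart_inv c y"
  have x: "x \<in> chart_dom c" "coords c x = y" unfolding x_def by (auto simp: chart_inv_mem[OF c y] coords_chart_inv[OF c y])
  interpret F: gauss_frame sf "\<phi> x" "N x" "tangent_map A \<phi> x" "tangent_map A N x" by (rule gauss_frame_tangent)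
  let ?d = "chart_at A x"
  have o: "y \<in> overlap c ?d" using mem_overlap_chart_at[OF c x(1)] x(2) by simp
  have sh: "shape_operator A sf \<phi> x v = F.shape v" for v
    by (simp add: shape_operator_def F.shape_def)
  have W: "curvature_weight x = sqrt \<bar>det (matrix F.shape_form)\<bar>"
    unfolding curvature_weight_def principal_curvatures_def curvature_multiplicity_def sh F.prod_W_factor ..
  have "gram (wedge_inner sf) ?d G (coords ?d x) = form_matrix (\<lambda>v w. wedge_inner sf (F.dG v) (F.dG w))"
    unfolding gram_form_matrix tangent_map_chart_deriv[symmetric] tangent_map_G ..
  moreover have "gram riem ?d \<phi> (coords ?d x) = form_matrix F.g"
    unfolding gram_form_matrix tangent_map_chart_deriv[symmetric] riem_def F.g_def[abs_def] ..
  ultimately have d: "det (gram (wedge_inner sf) ?d G (coords ?d x)) = det (gram riem ?d \<phi> (coords ?d x)) * det (matrix F.shape_form)"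
    using F.det_form_dG by simp
  have "det (gram (wedge_inner sf) c G y) = det (gram riem c \<phi> y) * det (matrix F.shape_form)"
    unfolding det_gram_change[OF bilinear_wedge_inner smooth_G c chart_at(1) o]
      det_gram_change[OF bilinear_riem smooth_phi c chart_at(1) o] x_def[symmetric] d by simp
  then show ?thesis unfolding vol_density_def W x_def[symmetric] by (simp add: abs_mult real_sqrt_mult)
qed

lemma det_gram_riem:
  assumes c: "c \<in> A" and y: "y \<in> chart_img c"
  shows "det (gram riem c \<phi> y) \<noteq> 0"
proof -
  interpret F: gauss_frame sf "\<phi> (chart_inv c y)" "N (chart_inv c y)" "chart_deriv \<phi> c y" "chart_deriv N c y"
    by (rule gauss_frame_chart[OF c y])
  have "gram riem c \<phi> y = form_matrix F.g" unfolding gram_form_matrix riem_def F.g_def[abs_def] ..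
  moreover have "v = 0" if "\<And>w. F.g v w = 0" for v
    using that[of v] F.inner_form_g unfolding inner_form_def by force
  ultimately show ?thesis using det_form_matrix_nonzero[OF F.bilinear_g] by auto
qed

lemma curvature_weight_nonneg: "0 \<le> curvature_weight x"
  unfolding curvature_weight_def by (intro real_sqrt_ge_zero prod_nonneg zero_le_power) (cases sf; simp add: add_nonneg_nonneg)

text \<open>Eigenvalues with multiplicities are awkward to control as functions of the point; a
  quotient of continuous densities with nonzero denominator is not.\<close>

lemma curvature_weight_measurable: "curvature_weight \<in> borel_measurable borel"
proof (rule borel_measurable_continuous_onI, rule continuous_on_chartwise)
  fix c assume c: "c \<in> A"
  have v: "continuous_on (chart_img c) (vol_density b f c)" if "bilinear b" "smooth_map A f" for b and f :: "'m \<Rightarrow> 'e::euclidean_space"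
    using compatible_vol_density[OF that] c by (simp add: compatible_densities_def)
  have nz: "vol_density riem \<phi> c y \<noteq> 0" if "y \<in> chart_img c" for y
    using det_gram_riem[OF c that] by (simp add: vol_density_def)
  have "continuous_on (chart_img c) (\<lambda>y. vol_density (wedge_inner sf) G c y / vol_density riem \<phi> c y)"
    by (intro continuous_on_divide v bilinear_wedge_inner bilinear_riem smooth_G smooth_phi) (use nz in auto)
  then show "continuous_on (chart_img c) (curvature_weight \<circ> chart_inv c)"
    by (rule continuous_on_eq) (use nz in \<open>simp add: vol_density_G[OF c]\<close>)
qed

lemma volume_measure_G:
  "volume_measure A (wedge_inner sf) G = density (volume_measure A riem \<phi>) (\<lambda>x. ennreal (curvature_weight x))"
proof (rule volume_measure_eqI[OF bilinear_wedge_inner smooth_G])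
  note h = compatible_vol_density[OF bilinear_riem smooth_phi]
  note M = volume_measure_has_densities[OF bilinear_riem smooth_phi]
  have sM: "sets (volume_measure A riem \<phi>) = sets borel" using M by (simp add: has_densities_def)
  show "has_densities (density (volume_measure A riem \<phi>) (\<lambda>x. ennreal (curvature_weight x))) (vol_density (wedge_inner sf) G)"
    unfolding has_densities_def
  proof (intro conjI ballI impI)
    show "sets (density (volume_measure A riem \<phi>) (\<lambda>x. ennreal (curvature_weight x))) = sets borel"
      using sM by simp
    fix c and B :: "'m set" assume c: "c \<in> A" and B: "B \<in> sets borel" "B \<subseteq> chart_dom c"
    have "emeasure (density (volume_measure A riem \<phi>) (\<lambda>x. ennreal (curvature_weight x))) B =
        (\<integral>\<^sup>+x. ennreal (curvature_weight x) * indicator B x \<partial>volume_measure A riem \<phi>)"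
      using curvature_weight_measurable B sM
      by (intro emeasure_density) (auto simp: measurable_cong_sets[OF sM refl])
    also have "\<dots> = (\<integral>\<^sup>+y. ennreal (vol_density riem \<phi> c y) * (ennreal (curvature_weight (chart_inv c y)) * indicator B (chart_inv c y))
        * indicator (chart_img c) y \<partial>lborel)"
    proof (rule nn_integral_in_chart[OF h M c])
      show "(\<lambda>x. ennreal (curvature_weight x) * indicator B x) \<in> borel_measurable borel"
        using curvature_weight_measurable B by measurable
      show "ennreal (curvature_weight x) * indicator B x = 0" if "x \<notin> chart_dom c" for x
        using that B(2) by (auto simp: indicator_def)
    qed
    also have "\<dots> = (\<integral>\<^sup>+ y\<in>coords c ` B. ennreal (vol_density (wedge_inner sf) G c y) \<partial>lborel)"
    proof (rule nn_integral_cong)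
      fix y
      have "0 \<le> vol_density riem \<phi> c y" by (simp add: vol_density_def)
      then show "ennreal (vol_density riem \<phi> c y) * (ennreal (curvature_weight (chart_inv c y)) * indicator B (chart_inv c y))
        * indicator (chart_img c) y = ennreal (vol_density (wedge_inner sf) G c y) * indicator (coords c ` B) y"
        using image_coords_eq[OF c B(2)] vol_density_G[OF c, of y] curvature_weight_nonneg
        by (auto simp: indicator_def ennreal_mult)
    qed
    finally show "emeasure (density (volume_measure A riem \<phi>) (\<lambda>x. ennreal (curvature_weight x))) B =
        (\<integral>\<^sup>+ y\<in>coords c ` B. ennreal (vol_density (wedge_inner sf) G c y) \<partial>lborel)" .
  qed
qed

lemma W_functional_eq_volume:
  assumes K: "K \<in> sets borel"
  shows "W_functional A sf K \<phi> = measure (volume_measure A (wedge_inner sf) G) K"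
proof -
  let ?M = "volume_measure A riem \<phi>"
  have sM: "sets ?M = sets borel"
    using volume_measure_has_densities[OF bilinear_riem smooth_phi] by (simp add: has_densities_def)
  have qm: "curvature_weight \<in> borel_measurable ?M"
    using curvature_weight_measurable by (simp add: measurable_cong_sets[OF sM refl])
  have KM: "K \<in> sets ?M" using K sM by simp
  have "W_functional A sf K \<phi> = (\<integral>x. indicator K x * curvature_weight x \<partial>?M)"
    unfolding W_functional_def set_lebesgue_integral_def curvature_weight_def riem_def[abs_def] by simp
  \<comment> \<open>The integral of a nonnegative function is \<open>enn2real\<close> of the
    extended integral, as \<open>measure\<close> is of \<open>emeasure\<close>; so the two sides
    also agree when the value is infinite.\<close>
  also have "\<dots> = enn2real (\<integral>\<^sup>+x. ennreal (indicator K x * curvature_weight x) \<partial>?M)"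
    using qm KM curvature_weight_nonneg by (intro integral_eq_nn_integral) auto
  also have "(\<integral>\<^sup>+x. ennreal (indicator K x * curvature_weight x) \<partial>?M) = (\<integral>\<^sup>+x. ennreal (curvature_weight x) * indicator K x \<partial>?M)"
    by (rule nn_integral_cong) (auto simp: indicator_def)
  also have "\<dots> = emeasure (density ?M (\<lambda>x. ennreal (curvature_weight x))) K"
    using qm KM by (intro emeasure_density[symmetric]) auto
  finally show ?thesis unfolding volume_measure_G measure_def .
qed

end

section \<open>Gauss maps of a variation\<close>

locale hyp_variation = hypersurface A sf \<phi>
  for A :: "('m::{t2_space,second_countable_topology}, 'n::finite) chart set" and sf
    and \<phi> :: "'m \<Rightarrow> real ^ ('n + 2)" +
  fixes \<delta> :: real and K :: "'m set" and F :: "real \<Rightarrow> 'm \<Rightarrow> real ^ ('n + 2)"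
  assumes var: "variation A (model_space sf) \<phi> \<delta> K F"
    and imm: "\<And>t. \<bar>t\<bar> < \<delta> \<Longrightarrow> immersion A (F t)"
begin

lemma delta_pos: "0 < \<delta>" and compact_K: "compact K" and F_0: "F 0 = \<phi>"
  and F_model: "\<bar>t\<bar> < \<delta> \<Longrightarrow> F t x \<in> model_space sf"
  and F_outside: "\<bar>t\<bar> < \<delta> \<Longrightarrow> x \<notin> K \<Longrightarrow> F t x = \<phi> x"
  using var by (auto simp: variation_def)

lemma hypersurface_F: "\<bar>t\<bar> < \<delta> \<Longrightarrow> hypersurface A sf (F t)"
  by unfold_locales (use imm F_model in \<open>auto simp: immersed_hypersurface_def\<close>)

abbreviation I :: "real set" where
  "I \<equiv> {-\<delta><..<\<delta>}"

text \<open>Time and position are the arguments of one smooth map, so that time and space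
  derivatives commute by the symmetry of second derivatives.\<close>

definition jF :: "('m, 'n) chart \<Rightarrow> real \<times> (real ^ 'n) \<Rightarrow> real ^ ('n + 2)" where
  "jF c = (\<lambda>(t, y). F t (chart_inv c y))"

definition jN :: "('m, 'n) chart \<Rightarrow> real \<times> (real ^ 'n) \<Rightarrow> real ^ ('n + 2)" where
  "jN c = (\<lambda>(t, y). unit_normal A sf (F t) (chart_inv c y))"

lemma I_iff: "t \<in> I \<longleftrightarrow> \<bar>t\<bar> < \<delta>"
  by auto

lemma smooth_jF: "c \<in> A \<Longrightarrow> smooth_on (I \<times> chart_img c) (jF c)"
  using var unfolding variation_def jF_def by blast

lemma chart_deriv_F:
  assumes c: "c \<in> A" and t: "t \<in> I" and y: "y \<in> chart_img c"
  shows "chart_deriv (F t) c y v = frechet_derivative (jF c) (at (t, y)) (0, v)"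
proof -
  have d: "jF c differentiable (at (t, y))"
    by (rule smooth_on_differentiable[OF smooth_jF[OF c]]) (use t y in blast)
  show ?thesis
    using frechet_derivative_slice[OF d, of v] by (simp add: chart_deriv_def jF_def o_def)
qed

text \<open>The normals of all times come from one formula in the position and its space
  derivatives, which are jointly smooth.\<close>

lemma smooth_jN:
  assumes c: "c \<in> A"
  shows "smooth_on (I \<times> chart_img c) (jN c)"
proof -
  have "smooth_on (I \<times> chart_img c) (\<lambda>z. frame_normal sf (jF c z) (\<lambda>v. frechet_derivative (jF c) (at z) (0, v)))"
  proof (rule smooth_on_frame_normal[OF smooth_jF[OF c]])
    show "smooth_on (I \<times> chart_img c) (\<lambda>z. frechet_derivative (jF c) (at z) (0, axis i 1))" for i
      by (rule smooth_on_frechet_derivative[OF smooth_jF[OF c]])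
    fix z assume z: "z \<in> I \<times> chart_img c"
    obtain t y where ty: "z = (t, y)" "t \<in> I" "y \<in> chart_img c" using z by (cases z) blast
    interpret H: hypersurface A sf "F t" using hypersurface_F ty(2) I_iff by blast
    have "(\<lambda>v. frechet_derivative (jF c) (at z) (0, v)) = chart_deriv (F t) c y"
      using chart_deriv_F[OF c ty(2,3)] ty(1) by (simp add: fun_eq_iff)
    moreover have "jF c z = F t (chart_inv c y)" by (simp add: jF_def ty(1))
    ultimately show "jF c z \<in> model_space sf \<and> linear (\<lambda>v. frechet_derivative (jF c) (at z) (0, v)) \<and>
        inj (\<lambda>v. frechet_derivative (jF c) (at z) (0, v)) \<and>
        (\<forall>v. pinner sf (jF c z) (frechet_derivative (jF c) (at z) (0, v)) = 0)"
      using H.phi_model linear_chart_deriv[OF H.smooth_phi c ty(3)] H.inj_chart_deriv_phi[OF c ty(3)]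
        H.pinner_phi_deriv[OF c ty(3)] chart_deriv_F[OF c ty(2,3)] ty(1) by simp
  qed
  then show ?thesis
  proof (rule smooth_on_cong)
    fix z assume z: "z \<in> I \<times> chart_img c"
    obtain t y where ty: "z = (t, y)" "t \<in> I" "y \<in> chart_img c" using z by (cases z) blast
    interpret H: hypersurface A sf "F t" using hypersurface_F ty(2) I_iff by blast
    have "chart_deriv (F t) c y = (\<lambda>v. frechet_derivative (jF c) (at z) (0, v))"
      using chart_deriv_F[OF c ty(2,3)] ty(1) by (simp add: fun_eq_iff)
    then show "frame_normal sf (jF c z) (\<lambda>v. frechet_derivative (jF c) (at z) (0, v)) = jN c z"
      using H.unit_normal_chart[OF c ty(3)] by (simp add: jF_def jN_def ty(1))
  qed
qed

text \<open>K is closed, so at a point outside it the variation is trivial on a whole neighbourhood;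
  hence the differential and the normal stay the same there too.\<close>

lemma variation_G: "variation A (geodesic_space sf) G \<delta> K (\<lambda>t. gauss_map A sf (F t))"
  unfolding variation_def
proof (intro conjI allI impI ballI)
  fix c assume c: "c \<in> A"
  have "smooth_on (I \<times> chart_img c) (\<lambda>z. jF c z \<^bold>\<and> jN c z)"
    by (rule smooth_on_bilinear[OF bounded_bilinear_wedge smooth_jF[OF c] smooth_jN[OF c]])
  moreover have "(\<lambda>z. jF c z \<^bold>\<and> jN c z) = (\<lambda>(t, y). gauss_map A sf (F t) (chart_inv c y))"
    by (simp add: fun_eq_iff jF_def jN_def gauss_map_def)
  ultimately show "smooth_on (I \<times> chart_img c) (\<lambda>(t, y). gauss_map A sf (F t) (chart_inv c y))" by simp
next
  fix t x assume t: "\<bar>t\<bar> < \<delta>"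
  interpret H: hypersurface A sf "F t" by (rule hypersurface_F[OF t])
  show "gauss_map A sf (F t) x \<in> geodesic_space sf" by (rule H.G_geodesic)
next
  fix t x assume t: "\<bar>t\<bar> < \<delta>" and x: "x \<notin> K"
  interpret H: hypersurface A sf "F t" by (rule hypersurface_F[OF t])
  have "open (- K)" using compact_K by (simp add: compact_imp_closed open_Compl)
  then have "tangent_map A (F t) x = tangent_map A \<phi> x"
    by (rule tangent_map_cong) (use x F_outside[OF t] in auto)
  then show "gauss_map A sf (F t) x = gauss_map A sf \<phi> x"
    by (simp add: gauss_map_def H.unit_normal_frame unit_normal_frame F_outside[OF t x])
qed (use delta_pos compact_K F_0 in auto)

definition velocity :: "'m \<Rightarrow> real ^ ('n + 2)" where
  "velocity x = vector_derivative (\<lambda>t. F t x) (at 0)"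

text \<open>A velocity h N has \<open><h N, N> = eps sf * h\<close>, so it corresponds to the
  Hamiltonian \<open>- eps sf * h\<close>.\<close>

definition hamiltonian :: "'m \<Rightarrow> real" where
  "hamiltonian x = - pinner sf (velocity x) (N x)"

lemma zero_in_I: "0 \<in> I"
  using delta_pos by simp

lemma F_has_velocity:
  assumes c: "c \<in> A" and y: "y \<in> chart_img c"
  shows "((\<lambda>t. F t (chart_inv c y)) has_vector_derivative frechet_derivative (jF c) (at (0, y)) (1, 0)) (at 0)"
proof -
  have "jF c differentiable (at (0, y))"
    by (rule smooth_on_differentiable[OF smooth_jF[OF c]]) (use zero_in_I y in blast)
  from has_vector_derivative_slice[OF this] show ?thesis by (simp add: jF_def)
qed

lemma velocity_chart:
  assumes c: "c \<in> A" and y: "y \<in> chart_img c"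
  shows "velocity (chart_inv c y) = frechet_derivative (jF c) (at (0, y)) (1, 0)"
  unfolding velocity_def by (rule vector_derivative_at[OF F_has_velocity[OF assms]])

lemma smooth_velocity: "smooth_map A velocity"
  unfolding smooth_map_def
proof
  fix c assume c: "c \<in> A"
  have "smooth_on (chart_img c) (\<lambda>y. frechet_derivative (jF c) (at (0, y)) (1, 0))"
    by (rule smooth_on_slice[OF smooth_on_frechet_derivative[OF smooth_jF[OF c]] zero_in_I open_chart_img[OF c]])
  then show "smooth_on (chart_img c) (velocity \<circ> chart_inv c)"
    by (rule smooth_on_cong) (simp add: velocity_chart[OF c])
qed

lemma smooth_hamiltonian: "smooth_map A hamiltonian"
  unfolding smooth_map_def
proof
  fix c assume c: "c \<in> A"
  have "smooth_on (chart_img c) (\<lambda>y. - pinner sf ((velocity \<circ> chart_inv c) y) ((N \<circ> chart_inv c) y))"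
    by (rule smooth_on_minus[OF smooth_on_bilinear[OF bounded_bilinear_pinner
            smooth_map_chart[OF smooth_velocity c] smooth_map_chart[OF smooth_N c]]])
  then show "smooth_on (chart_img c) (hamiltonian \<circ> chart_inv c)"
    by (simp add: hamiltonian_def o_def)
qed

lemma velocity_outside:
  assumes "x \<notin> K"
  shows "velocity x = 0"
proof -
  have "((\<lambda>t. F t x) has_vector_derivative 0) (at 0)"
    by (rule has_vector_derivative_transform_within_open[OF has_vector_derivative_const[of "\<phi> x"], of I])
      (use zero_in_I F_outside[OF _ assms] in auto)
  then show ?thesis unfolding velocity_def by (rule vector_derivative_at)
qed

lemma hamiltonian_outside: "x \<notin> K \<Longrightarrow> hamiltonian x = 0"
  by (simp add: hamiltonian_def velocity_outside pinner_simps)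

text \<open>Once the differential of the Hamiltonian is expressed by the velocities a of the
  position and m of the normal, its gradient meets the hypothesis of
  \<open>velocity_normal_part\<close>, which splits off the normal part of the velocity.\<close>

lemma normal_component_velocity:
  assumes nd: "nondegenerate_metric A (wedge_inner sf) G"
  shows "normal_component A (wedge_inner sf) G x (vector_derivative (\<lambda>t. gauss_map A sf (F t) x) (at 0)) =
    J_structure sf (G x) (tangent_map A G x (metric_gradient A (wedge_inner sf) G hamiltonian x))"
proof -
  interpret Fr: gauss_frame sf "\<phi> x" "N x" "tangent_map A \<phi> x" "tangent_map A N x" by (rule gauss_frame_tangent)
  define c where "c = chart_at A x"
  define y where "y = coords c x"
  have c: "c \<in> A" and y: "y \<in> chart_img c" and xy: "chart_inv c y = x"
    using chart_at[of x] chart_inv_coords[OF chart_at(1) chart_at(2)] by (auto simp: c_def y_def)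
  have tm: "tangent_map A f x = chart_deriv f c y" for f :: "'m \<Rightarrow> 'e::euclidean_space"
    by (simp add: tangent_map_chart_deriv c_def y_def)
  let ?W = "I \<times> chart_img c" and ?z = "(0 :: real, y)"
  have W: "open ?W" by (intro open_Times open_chart_img c) simp
  have z: "?z \<in> ?W" using zero_in_I y by blast
  note dF = smooth_on_differentiable[OF smooth_jF[OF c] z] and dN = smooth_on_differentiable[OF smooth_jN[OF c] z]
  define a where "a = frechet_derivative (jF c) (at ?z) (1, 0)"
  define m where "m = frechet_derivative (jN c) (at ?z) (1, 0)"
  have jF0: "jF c (t, y) = F t x" and jN0: "jN c (t, y) = unit_normal A sf (F t) x" for t
    by (simp_all add: jF_def jN_def xy)
  have fr: "jF c z \<in> model_space sf" "pinner sf (jN c z) (jN c z) = eps sf"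
    "pinner sf (jN c z) (frechet_derivative (jF c) (at z) (0, v)) = 0" if zW: "z \<in> ?W" for z v
  proof -
    obtain t y where ty: "z = (t, y)" "t \<in> I" "y \<in> chart_img c" using zW by (cases z) blast
    have "hypersurface A sf (F t)" using hypersurface_F ty(2) I_iff by simp
    then have h: "hyper_frame sf (F t (chart_inv c y)) (unit_normal A sf (F t) (chart_inv c y)) (chart_deriv (F t) c y)"
      by (rule hypersurface.hyper_frame_chart[OF _ c ty(3)])
    have e: "jF c z = F t (chart_inv c y)" "jN c z = unit_normal A sf (F t) (chart_inv c y)"
      by (simp_all add: ty(1) jF_def jN_def)
    show "jF c z \<in> model_space sf" unfolding e by (rule hyper_frame.p[OF h])
    show "pinner sf (jN c z) (jN c z) = eps sf" unfolding e by (rule hyper_frame.\<nu>\<nu>[OF h])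
    show "pinner sf (jN c z) (frechet_derivative (jF c) (at z) (0, v)) = 0"
      unfolding e unfolding ty(1) chart_deriv_F[OF c ty(2,3), symmetric] by (rule hyper_frame.\<nu>T[OF h])
  qed
  have pa: "pinner sf (\<phi> x) a = 0"
    using bilinear_const_frechet_derivative[OF bounded_bilinear_pinner W z dF dF, of sf 1 "(1, 0)"]
      model_space_pinner[OF fr(1)] pinner_commute[of sf a "\<phi> x"] by (simp add: jF0 F_0 a_def)
  have nm: "pinner sf (N x) m = 0"
    using bilinear_const_frechet_derivative[OF bounded_bilinear_pinner W z dN dN, of sf "eps sf" "(1, 0)"]
      fr(2) pinner_commute[of sf m "N x"] by (simp add: jN0 F_0 m_def)
  have du: "tangent_map A hamiltonian x v = pinner sf m (tangent_map A \<phi> x v) - pinner sf a (tangent_map A N x v)" for v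
  proof -
    let ?X = "\<lambda>z. frechet_derivative (jF c) (at z) (0, v)"
    have X: "?X differentiable (at ?z)"
      by (rule smooth_on_differentiable[OF smooth_on_frechet_derivative[OF smooth_jF[OF c]] z])
    \<comment> \<open>The time derivative of the orthogonality of N and the tangent vectors trades
      the derivative of a tangent vector for the velocity of the normal.\<close>
    have 1: "pinner sf (N x) (frechet_derivative ?X (at ?z) (1, 0)) + pinner sf m (?X ?z) = 0"
      using bilinear_const_frechet_derivative[OF bounded_bilinear_pinner W z dN X, of sf 0 "(1, 0)"] fr(3)
      by (simp add: jN0 F_0 m_def)
    have 2: "?X ?z = tangent_map A \<phi> x v"
      using chart_deriv_F[OF c zero_in_I y, of v] by (simp add: tm F_0)
    let ?V = "\<lambda>z. frechet_derivative (jF c) (at z) (1, 0)"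
    have V: "?V differentiable (at ?z)"
      by (rule smooth_on_differentiable[OF smooth_on_frechet_derivative[OF smooth_jF[OF c]] z])
    \<comment> \<open>The time derivative of the space derivative is the space derivative of the
      velocity field.\<close>
    have 3: "frechet_derivative ?X (at ?z) (1, 0) = frechet_derivative (\<lambda>y. ?V (0, y)) (at y) v"
      using frechet_derivative_slice[OF V, of v] frechet_derivative_commute[OF smooth_jF[OF c] z, of "(0, v)" "(1, 0)"]
      by simp
    have dV: "((\<lambda>y. ?V (0, y)) has_derivative frechet_derivative (\<lambda>y. ?V (0, y)) (at y)) (at y)"
      by (rule smooth_on_has_derivative[OF smooth_on_slice[OF smooth_on_frechet_derivative[OF smooth_jF[OF c]] zero_in_I open_chart_img[OF c]] y])
    have "((\<lambda>y. - pinner sf (?V (0, y)) ((N \<circ> chart_inv c) y)) has_derivative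
        (\<lambda>v. - (pinner sf (?V (0, y)) (chart_deriv N c y v) + pinner sf (frechet_derivative (\<lambda>y. ?V (0, y)) (at y) v) ((N \<circ> chart_inv c) y)))) (at y)"
      by (rule has_derivative_minus[OF bounded_bilinear.FDERIV[OF bounded_bilinear_pinner dV chart_deriv_has_derivative[OF smooth_N c y]]])
    then have "((hamiltonian \<circ> chart_inv c) has_derivative
        (\<lambda>v. - (pinner sf (?V (0, y)) (chart_deriv N c y v) + pinner sf (frechet_derivative (\<lambda>y. ?V (0, y)) (at y) v) ((N \<circ> chart_inv c) y)))) (at y)"
      by (rule has_derivative_transform_within_open[OF _ open_chart_img[OF c] y])
        (simp add: hamiltonian_def velocity_chart[OF c])
    then have "tangent_map A hamiltonian x v =
        - (pinner sf a (tangent_map A N x v) + pinner sf (frechet_derivative ?X (at ?z) (1, 0)) (N x))"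
      unfolding tm chart_deriv_def[of hamiltonian] by (simp add: frechet_derivative_apply a_def 3 xy)
    then show ?thesis
      using 1 pinner_commute[of sf "N x" "frechet_derivative ?X (at ?z) (1, 0)"] unfolding 2 by simp
  qed
  define w where "w = metric_gradient A (wedge_inner sf) G hamiltonian x"
  have w: "wedge_inner sf (Fr.dG w) (Fr.dG v) = pinner sf m (tangent_map A \<phi> x v) - pinner sf a (tangent_map A N x v)" for v
  proof -
    have "\<forall>v. wedge_inner sf (tangent_map A G x w) (tangent_map A G x v) = tangent_map A hamiltonian x v"
      unfolding w_def metric_gradient_def
      by (rule theI'[OF nondegenerate_represent_tangent[OF bilinear_wedge_inner nd smooth_G linear_tangent_map[OF smooth_hamiltonian]]])
    then show ?thesis by (simp add: du tangent_map_G)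
  qed
  have vel: "vector_derivative (\<lambda>t. gauss_map A sf (F t) x) (at 0) = a \<^bold>\<and> N x + \<phi> x \<^bold>\<and> m"
  proof (rule vector_derivative_at)
    have "((\<lambda>t. F t x) has_vector_derivative a) (at 0)"
      using has_vector_derivative_slice[OF dF] by (simp add: jF0 a_def)
    moreover have "((\<lambda>t. unit_normal A sf (F t) x) has_vector_derivative m) (at 0)"
      using has_vector_derivative_slice[OF dN] by (simp add: jN0 m_def)
    ultimately have "((\<lambda>t. F t x \<^bold>\<and> unit_normal A sf (F t) x) has_vector_derivative
        (F 0 x \<^bold>\<and> m + a \<^bold>\<and> unit_normal A sf (F 0) x)) (at 0)"
      by (rule bounded_bilinear.has_vector_derivative[OF bounded_bilinear_wedge])
    then show "((\<lambda>t. gauss_map A sf (F t) x) has_vector_derivative a \<^bold>\<and> N x + \<phi> x \<^bold>\<and> m) (at 0)"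
      by (simp add: gauss_map_def F_0 add.commute)
  qed
  have "normal_component A (wedge_inner sf) G x (a \<^bold>\<and> N x + \<phi> x \<^bold>\<and> m) = Fr.JdG w"
  proof (rule normal_componentI[OF bilinear_wedge_inner nd smooth_G])
    show "a \<^bold>\<and> N x + \<phi> x \<^bold>\<and> m - Fr.JdG w \<in> range (tangent_map A G x)"
      using Fr.velocity_normal_part[OF pa nm w] unfolding tangent_map_G by blast
    show "wedge_inner sf (Fr.JdG w) (tangent_map A G x v) = 0" for v
      unfolding tangent_map_G by (rule Fr.wedge_inner_JdG_dG)
  qed
  moreover have "J_structure sf (G x) (tangent_map A G x w) = Fr.JdG w"
    unfolding tangent_map_G gauss_map_def by (rule Fr.J_structure_dG)
  ultimately show ?thesis unfolding vel w_def by simp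
qed

lemma hamiltonian_variation_G:
  assumes "nondegenerate_metric A (wedge_inner sf) G"
  shows "hamiltonian_variation A sf G \<delta> K (\<lambda>t. gauss_map A sf (F t))"
  unfolding hamiltonian_variation_def
  using variation_G smooth_hamiltonian compact_K hamiltonian_outside normal_component_velocity[OF assms] by blast

lemma W_functional_F:
  assumes t: "\<bar>t\<bar> < \<delta>" and "B \<in> sets borel"
  shows "W_functional A sf B (F t) = measure (volume_measure A (wedge_inner sf) (gauss_map A sf (F t))) B"
proof -
  interpret H: hypersurface A sf "F t" by (rule hypersurface_F[OF t])
  show ?thesis by (rule H.W_functional_eq_volume[OF assms(2)])
qed

lemma W_functional_derivative_iff:
  assumes "B \<in> sets borel"
  shows "((\<lambda>t. W_functional A sf B (F t)) has_real_derivative D) (at 0) \<longleftrightarrow>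
    ((\<lambda>t. measure (volume_measure A (wedge_inner sf) (gauss_map A sf (F t))) B) has_real_derivative D) (at 0)"
proof -
  have ev: "\<forall>\<^sub>F t in nhds 0. W_functional A sf B (F t) = measure (volume_measure A (wedge_inner sf) (gauss_map A sf (F t))) B"
    unfolding eventually_nhds
    by (rule exI[of _ I]) (use zero_in_I W_functional_F[OF _ assms] I_iff in auto)
  show ?thesis by (rule DERIV_cong_ev[OF refl ev refl])
qed

end

section \<open>Partitions of unity of class \<open>C\<^sup>1\<close>\<close>

lemma Ck_on_open_Un:
  assumes "open S" "open T" "Ck_on k f S" "Ck_on k f T"
  shows "Ck_on k f (S \<union> T)"
  using assms(3,4) by (induction k arbitrary: f) (auto intro: continuous_on_open_Un[OF assms(1,2)])

lemma Ck_on_mult: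
  fixes f g :: "'a::euclidean_space \<Rightarrow> real"
  assumes "open S" "Ck_on k f S" "Ck_on k g S"
  shows "Ck_on k (\<lambda>x. f x * g x) S"
  by (rule Ck_on_bilinear[OF assms(1) bounded_bilinear_mult assms(2,3)])

lemma Ck_on_zero:
  assumes "open S" "\<And>x. x \<in> S \<Longrightarrow> f x = 0"
  shows "Ck_on k f S"
  using Ck_on_cong[OF assms(1), of f "\<lambda>x. 0" k] assms(2) Ck_on_const by auto

text \<open>The squared positive part is a simple cutoff with a continuous first derivative, which
  is all that the integration by parts asks of a partition function.\<close>

lemma has_derivative_square_pos_part:
  "((\<lambda>u::real. (max 0 u)\<^sup>2) has_derivative (\<lambda>v. 2 * max 0 u * v)) (at u)"
proof -
  consider "u < 0" | "u = 0" | "u > 0" by linarith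
  then have "((\<lambda>u::real. (max 0 u)\<^sup>2) has_real_derivative 2 * max 0 u) (at u)"
  proof cases
    case 1
    have "((\<lambda>u::real. (max 0 u)\<^sup>2) has_real_derivative 0) (at u)"
      by (rule has_field_derivative_transform_within_open[OF DERIV_const[of 0], of "{..<0}"]) (use 1 in auto)
    then show ?thesis using 1 by simp
  next
    case 2
    have "((\<lambda>h::real. (max 0 h)\<^sup>2 / h) \<longlongrightarrow> 0) (at 0)"
    proof (rule Lim_null_comparison)
      show "\<forall>\<^sub>F h in at 0. norm ((max 0 h)\<^sup>2 / h) \<le> \<bar>h\<bar>"
        by (rule always_eventually) (auto simp: max_def power2_eq_square)
      show "((\<lambda>h::real. \<bar>h\<bar>) \<longlongrightarrow> 0) (at 0)" by (auto intro!: tendsto_eq_intros)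
    qed
    then show ?thesis using 2 by (simp add: DERIV_def)
  next
    case 3
    have "((\<lambda>u::real. u\<^sup>2) has_real_derivative 2 * u) (at u)" by (auto intro!: derivative_eq_intros)
    then have "((\<lambda>u::real. (max 0 u)\<^sup>2) has_real_derivative 2 * u) (at u)"
      by (rule has_field_derivative_transform_within_open[of _ _ _ "{0<..}"]) (use 3 in auto)
    then show ?thesis using 3 by simp
  qed
  then show ?thesis by (simp add: has_field_derivative_def)
qed

lemma C1_square_pos_part: "Ck_on (Suc 0) (\<lambda>u::real. (max 0 u)\<^sup>2) UNIV"
  by (rule Ck_on_SucI[OF open_UNIV has_derivative_square_pos_part]) (auto intro!: continuous_intros)

lemma C1_bump:
  fixes y0 :: "'a::euclidean_space"
  shows "Ck_on (Suc 0) (\<lambda>y. (max 0 (r\<^sup>2 - (y - y0) \<bullet> (y - y0)))\<^sup>2) UNIV"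
proof -
  have "smooth_on UNIV (\<lambda>y. r\<^sup>2 - (y - y0) \<bullet> (y - y0))"
    by (intro smooth_on_diff smooth_on_bilinear[OF bounded_bilinear_inner] smooth_on_const
        smooth_on_linear[OF _ bounded_linear_ident] open_UNIV)
  then show ?thesis
    by (rule Ck_on_compose[OF open_UNIV open_UNIV smooth_on_Ck C1_square_pos_part subset_UNIV])
qed

text \<open>Each function lives in the chart chosen at its index. The sum is 1 on an open
  neighbourhood W of K and not just on K, so that the differentials of the functions add up to zero
  at the points of K.\<close>

locale C1_partition = manifold A
  for A :: "('m::{t2_space,second_countable_topology}, 'n::finite) chart set" +
  fixes K :: "'m set" and X :: "'m set" and W :: "'m set" and \<rho> :: "'m \<Rightarrow> 'm \<Rightarrow> real" and Q :: "'m \<Rightarrow> 'm set"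
  assumes compact_K: "compact K" and finite_X: "finite X" and open_W: "open W" and K_W: "K \<subseteq> W"
    and compact_Q: "\<And>x. compact (Q x)" and Q_dom: "\<And>x. Q x \<subseteq> chart_dom (chart_at A x)"
    and rho_outside: "\<And>x z. z \<notin> Q x \<Longrightarrow> \<rho> x z = 0"
    and rho_C1: "\<And>x d. d \<in> A \<Longrightarrow> Ck_on (Suc 0) (\<rho> x \<circ> chart_inv d) (coords d ` (chart_dom d \<inter> W))"
    and rho_sum: "\<And>z. z \<in> W \<Longrightarrow> (\<Sum>x\<in>X. \<rho> x z) = 1"
    and rho_bound: "\<And>x z. x \<in> X \<Longrightarrow> z \<in> W \<Longrightarrow> \<bar>\<rho> x z\<bar> \<le> 1"

context manifold
begin

text \<open>In another chart the function is a C^1 bump composed with a transition on the overlap,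
  and zero off the closed set Q; since Q lies in the first chart, these two open sets cover.\<close>

lemma bump_exists:
  "\<exists>(\<beta> :: 'm \<Rightarrow> real) Q. compact Q \<and> Q \<subseteq> chart_dom (chart_at A x) \<and> (\<forall>z. z \<notin> Q \<longrightarrow> \<beta> z = 0) \<and> (\<forall>z. 0 \<le> \<beta> z) \<and> 0 < \<beta> x \<and>
    (\<forall>d\<in>A. Ck_on (Suc 0) (\<beta> \<circ> chart_inv d) (chart_img d))"
proof -
  define c where "c = chart_at A x"
  define y0 where "y0 = coords c x"
  have c: "c \<in> A" and x: "x \<in> chart_dom c" and y0: "y0 \<in> chart_img c"
    using chart_at[of x] by (auto simp: c_def y0_def)
  obtain r where r: "r > 0" "cball y0 r \<subseteq> chart_img c"
    using open_chart_img[OF c] y0 open_contains_cball by blast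
  define \<psi> where "\<psi> = (\<lambda>y. (max 0 (r\<^sup>2 - (y - y0) \<bullet> (y - y0)))\<^sup>2)"
  define \<beta> where "\<beta> = (\<lambda>z. if z \<in> chart_dom c then \<psi> (coords c z) else 0)"
  define Q where "Q = chart_inv c ` cball y0 r"
  have Q: "compact Q" unfolding Q_def
    by (rule compact_continuous_image[OF continuous_on_subset[OF continuous_on_chart_inv[OF c] r(2)] compact_cball])
  have Qd: "Q \<subseteq> chart_dom c" unfolding Q_def using r(2) chart_inv_mem[OF c] by blast
  have out: "\<beta> z = 0" if z: "z \<notin> Q" for z
  proof (cases "z \<in> chart_dom c")
    case True
    have "coords c z \<notin> cball y0 r"
      using z chart_inv_coords[OF c True] unfolding Q_def by force
    then have "r < norm (coords c z - y0)" by (simp add: dist_norm norm_minus_commute)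
    then have "r\<^sup>2 < (norm (coords c z - y0))\<^sup>2" using r(1) by (intro power_strict_mono) auto
    then show ?thesis using True by (simp add: \<beta>_def \<psi>_def power2_norm_eq_inner)
  qed (simp add: \<beta>_def)
  have C1: "Ck_on (Suc 0) (\<beta> \<circ> chart_inv d) (chart_img d)" if d: "d \<in> A" for d
  proof -
    let ?V = "chart_img d \<inter> chart_inv d -` (- Q)"
    have oV: "open ?V"
      by (rule continuous_open_preimage[OF continuous_on_chart_inv[OF d] open_chart_img[OF d]])
        (use Q in \<open>simp add: compact_imp_closed open_Compl\<close>)
    have 1: "Ck_on (Suc 0) (\<beta> \<circ> chart_inv d) ?V" by (rule Ck_on_zero[OF oV]) (simp add: out)
    have "Ck_on (Suc 0) (\<lambda>y. \<psi> ((coords c \<circ> chart_inv d) y)) (overlap d c)"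
      unfolding \<psi>_def
      by (rule Ck_on_compose[OF open_overlap[OF d c] open_UNIV smooth_on_Ck[OF smooth_transition[OF d c]] C1_bump subset_UNIV])
    then have 2: "Ck_on (Suc 0) (\<beta> \<circ> chart_inv d) (overlap d c)"
      by (subst Ck_on_cong[OF open_overlap[OF d c], of _ "\<lambda>y. \<psi> ((coords c \<circ> chart_inv d) y)"])
        (use overlapD(3)[OF d c] in \<open>auto simp: \<beta>_def\<close>)
    have "Ck_on (Suc 0) (\<beta> \<circ> chart_inv d) (?V \<union> overlap d c)"
      by (rule Ck_on_open_Un[OF oV open_overlap[OF d c] 1 2])
    moreover have "chart_img d \<subseteq> ?V \<union> overlap d c"
    proof
      fix y assume y: "y \<in> chart_img d"
      show "y \<in> ?V \<union> overlap d c"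
      proof (cases "chart_inv d y \<in> Q")
        case True
        then have "chart_inv d y \<in> chart_dom d \<inter> chart_dom c" using Qd chart_inv_mem[OF d y] by blast
        then have "coords d (chart_inv d y) \<in> overlap d c" by blast
        then show ?thesis using coords_chart_inv[OF d y] by simp
      qed (use y in simp)
    qed
    ultimately show ?thesis by (rule Ck_on_subset)
  qed
  show ?thesis
  proof (intro exI[of _ \<beta>] exI[of _ Q] conjI allI impI ballI)
    show "Q \<subseteq> chart_dom (chart_at A x)" using Qd by (simp only: c_def)
    show "0 \<le> \<beta> z" for z by (simp add: \<beta>_def \<psi>_def)
    show "0 < \<beta> x" using x r(1) by (simp add: \<beta>_def \<psi>_def y0_def)
  qed (fact Q out C1)+
qed

text \<open>Finitely many bumps are positive somewhere over each point of K. W is the set where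
  their sum is positive, and dividing by the sum there keeps class C^1.\<close>

lemma C1_partition_exists:
  assumes K: "compact K"
  shows "\<exists>X W \<rho> Q. C1_partition A K X W \<rho> Q"
proof -
  have "\<forall>x. \<exists>(\<beta> :: 'm \<Rightarrow> real) Q. compact Q \<and> Q \<subseteq> chart_dom (chart_at A x) \<and> (\<forall>z. z \<notin> Q \<longrightarrow> \<beta> z = 0) \<and> (\<forall>z. 0 \<le> \<beta> z) \<and> 0 < \<beta> x \<and>
    (\<forall>d\<in>A. Ck_on (Suc 0) (\<beta> \<circ> chart_inv d) (chart_img d))" using bump_exists by blast
  then have "\<exists>(\<beta> :: 'm \<Rightarrow> 'm \<Rightarrow> real) Q. \<forall>x. compact (Q x) \<and> Q x \<subseteq> chart_dom (chart_at A x) \<and> (\<forall>z. z \<notin> Q x \<longrightarrow> \<beta> x z = 0) \<and>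
     (\<forall>z. 0 \<le> \<beta> x z) \<and> 0 < \<beta> x x \<and> (\<forall>d\<in>A. Ck_on (Suc 0) (\<beta> x \<circ> chart_inv d) (chart_img d))"
    unfolding choice_iff .
  then obtain \<beta> :: "'m \<Rightarrow> 'm \<Rightarrow> real" and Q where bQ: "\<forall>x. compact (Q x) \<and> Q x \<subseteq> chart_dom (chart_at A x) \<and> (\<forall>z. z \<notin> Q x \<longrightarrow> \<beta> x z = 0) \<and>
     (\<forall>z. 0 \<le> \<beta> x z) \<and> 0 < \<beta> x x \<and> (\<forall>d\<in>A. Ck_on (Suc 0) (\<beta> x \<circ> chart_inv d) (chart_img d))"
    by (elim exE)
  have Q: "\<And>x. compact (Q x)" "\<And>x. Q x \<subseteq> chart_dom (chart_at A x)" "\<And>x z. z \<notin> Q x \<Longrightarrow> \<beta> x z = 0"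
    and \<beta>: "\<And>x z. 0 \<le> \<beta> x z" "\<And>x. 0 < \<beta> x x" "\<And>x d. d \<in> A \<Longrightarrow> Ck_on (Suc 0) (\<beta> x \<circ> chart_inv d) (chart_img d)"
    using bQ by (simp_all del: Ck_on.simps)
  have cont: "continuous_on UNIV (\<beta> x)" for x
    by (rule continuous_on_chartwise) (rule Ck_on_imp_continuous_on[OF \<beta>(3)])
  have op: "open {z. 0 < \<beta> x z}" for x
    by (rule open_Collect_less[OF continuous_on_const cont])
  have "K \<subseteq> (\<Union>x\<in>UNIV. {z. 0 < \<beta> x z})" using \<beta>(2) by blast
  then obtain X where X: "X \<subseteq> UNIV" "finite X" "K \<subseteq> (\<Union>x\<in>X. {z. 0 < \<beta> x z})"
    by (rule compactE_image[OF K op])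
  define s where "s = (\<lambda>z. \<Sum>x\<in>X. \<beta> x z)"
  define W where "W = {z. 0 < s z}"
  define \<rho> where "\<rho> = (\<lambda>x z. \<beta> x z / s z)"
  have conts: "continuous_on UNIV s" unfolding s_def by (intro continuous_on_sum cont)
  have oW: "open W" unfolding W_def by (rule open_Collect_less[OF continuous_on_const conts])
  have "C1_partition A K X W \<rho> Q"
  proof (unfold_locales)
    show "K \<subseteq> W"
    proof
      fix z assume "z \<in> K"
      then obtain x where "x \<in> X" "0 < \<beta> x z" using X(3) by blast
      then have "0 < s z" unfolding s_def using sum_pos2[OF X(2), of x "\<lambda>x. \<beta> x z"] \<beta>(1) by simp
      then show "z \<in> W" by (simp add: W_def)
    qed
    show "\<rho> x z = 0" if "z \<notin> Q x" for x z using Q(3)[OF that] by (simp add: \<rho>_def)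
    show "(\<Sum>x\<in>X. \<rho> x z) = 1" if "z \<in> W" for z
      using that unfolding \<rho>_def sum_divide_distrib[symmetric] by (simp add: W_def s_def)
    show "\<bar>\<rho> x z\<bar> \<le> 1" if "x \<in> X" "z \<in> W" for x z
    proof -
      have "\<beta> x z \<le> s z" unfolding s_def using member_le_sum[OF that(1), of "\<lambda>x. \<beta> x z"] \<beta>(1) X(2) by simp
      then show ?thesis using that(2) \<beta>(1)[of x z] by (simp add: \<rho>_def W_def)
    qed
    fix x d assume d: "d \<in> A"
    let ?U = "coords d ` (chart_dom d \<inter> W)"
    have oU: "open ?U" by (rule open_image_coords[OF d]) (use oW open_chart_dom[OF d] in auto)
    have sub: "?U \<subseteq> chart_img d" by blast
    have 1: "Ck_on (Suc 0) (\<lambda>y. (\<beta> x \<circ> chart_inv d) y) ?U" for x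
      using Ck_on_subset[OF \<beta>(3)[OF d] sub] unfolding o_def .
    have s1: "Ck_on (Suc 0) (\<lambda>y. \<Sum>x\<in>X. (\<beta> x \<circ> chart_inv d) y) ?U" by (rule Ck_on_sum[OF oU 1])
    have pos: "0 < (\<Sum>x\<in>X. (\<beta> x \<circ> chart_inv d) y)" if "y \<in> ?U" for y
      using that chart_inv_coords[OF d] by (auto simp: W_def s_def)
    have "Ck_on (Suc 0) (\<lambda>y. inverse (\<Sum>x\<in>X. (\<beta> x \<circ> chart_inv d) y)) ?U"
      by (rule Ck_on_compose[OF oU _ s1 Ck_on_inverse_pos[of "{0<..}"]]) (use pos in auto)
    from Ck_on_mult[OF oU 1[of x] this] show "Ck_on (Suc 0) (\<rho> x \<circ> chart_inv d) ?U"
      by (simp add: \<rho>_def s_def o_def divide_inverse del: Ck_on.simps)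
  qed (fact K X(2) oW Q(1,2))+
  then show ?thesis by blast
qed

end

section \<open>The first variation of the volume\<close>

locale nondegenerate_map = manifold A
  for A :: "('m::{t2_space,second_countable_topology}, 'n::finite) chart set" +
  fixes b :: "'e::euclidean_space \<Rightarrow> 'e \<Rightarrow> real" and f :: "'m \<Rightarrow> 'e"
  assumes b: "bilinear b" and b_sym: "\<And>v w. b v w = b w v"
    and smooth_f: "smooth_map A f" and nd: "nondegenerate_metric A b f"
begin

lemma bb: "bounded_bilinear b"
  using b bilinear_conv_bounded_bilinear by blast

lemma chart_nondegenerate:
  assumes c: "c \<in> A" and y: "y \<in> chart_img c" and v: "\<And>w. b (chart_deriv f c y v) (chart_deriv f c y w) = 0"
  shows "v = 0"
proof -
  from y obtain x where x: "x \<in> chart_dom c" "y = coords c x" by blast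
  have e: "chart_deriv f c y v = tangent_map A f x (to_chart_at c x v)" for v
    unfolding x(2) by (rule chart_deriv_tangent_map_smooth[OF smooth_f c x(1)])
  have "b (tangent_map A f x (to_chart_at c x v)) (tangent_map A f x w) = 0" for w
  proof -
    obtain w' where "w = to_chart_at c x w'" using surj_to_chart_at[OF c x(1)] by (rule surjE)
    then show ?thesis using v[of w'] by (simp add: e)
  qed
  then have "to_chart_at c x v = 0" using nd unfolding nondegenerate_metric_def by blast
  then show ?thesis
    using linear_injective_0[OF linear_to_chart_at[OF c x(1)]] inj_to_chart_at[OF c x(1)] by blast
qed

lemma det_gram_nonzero:
  assumes c: "c \<in> A" and y: "y \<in> chart_img c"
  shows "det (gram b c f y) \<noteq> 0"
  unfolding gram_form_matrix det_form_matrix_nonzero[OF bilinear_pullback[OF b linear_chart_deriv[OF smooth_f c y]]]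
  using chart_nondegenerate[OF c y] by blast

lemma inj_chart_deriv:
  assumes c: "c \<in> A" and y: "y \<in> chart_img c"
  shows "inj (chart_deriv f c y)"
proof -
  note l = linear_chart_deriv[OF smooth_f c y]
  have "v = 0" if "chart_deriv f c y v = 0" for v
    by (rule chart_nondegenerate[OF c y]) (simp add: that bilinear_lzero[OF b])
  then show ?thesis using linear_injective_0[OF l] by blast
qed

text \<open>The time derivative of the Gram matrix when f moves with velocity V.\<close>

definition gram_dot :: "('m \<Rightarrow> 'e) \<Rightarrow> ('m, 'n) chart \<Rightarrow> real ^ 'n \<Rightarrow> real ^ 'n ^ 'n" where
  "gram_dot V c y = (\<chi> i j. b (chart_deriv V c y (axis i 1)) (chart_deriv f c y (axis j 1))
     + b (chart_deriv f c y (axis i 1)) (chart_deriv V c y (axis j 1)))"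

text \<open>The corresponding derivative of the volume density, by the chain rule through the root
  and the determinant. It is linear in V, which allows two variations to be compared by their
  difference.\<close>

definition rate :: "('m \<Rightarrow> 'e) \<Rightarrow> ('m, 'n) chart \<Rightarrow> real ^ 'n \<Rightarrow> real" where
  "rate V c y = sgn (det (gram b c f y)) / (2 * sqrt \<bar>det (gram b c f y)\<bar>) * det_deriv (gram b c f y) (gram_dot V c y)"

lemma rate_diff:
  assumes V: "smooth_map A V1" "smooth_map A V2" and c: "c \<in> A" and y: "y \<in> chart_img c"
  shows "rate (\<lambda>x. V1 x - V2 x) c y = rate V1 c y - rate V2 c y"
proof -
  have "(((\<lambda>x. V1 x - V2 x) \<circ> chart_inv c) has_derivative (\<lambda>v. chart_deriv V1 c y v - chart_deriv V2 c y v)) (at y)"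
    using has_derivative_diff[OF chart_deriv_has_derivative[OF V(1) c y] chart_deriv_has_derivative[OF V(2) c y]]
    by (simp add: o_def)
  then have "chart_deriv (\<lambda>x. V1 x - V2 x) c y = (\<lambda>v. chart_deriv V1 c y v - chart_deriv V2 c y v)"
    unfolding chart_deriv_def[of "\<lambda>x. V1 x - V2 x"] by (rule frechet_derivative_apply)
  then have "gram_dot (\<lambda>x. V1 x - V2 x) c y = gram_dot V1 c y - gram_dot V2 c y"
    by (simp add: gram_dot_def vec_eq_iff bilinear_lsub[OF b] bilinear_rsub[OF b])
  then show ?thesis
    unfolding rate_def by (simp only: linear_diff[OF linear_det_deriv] right_diff_distrib)
qed

lemma rate_zero:
  assumes c: "c \<in> A" and y: "y \<in> chart_img c" and U: "open U" "chart_inv c y \<in> U" and V: "\<And>x. x \<in> U \<Longrightarrow> V x = 0"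
  shows "rate V c y = 0"
proof -
  have "open (chart_img c \<inter> chart_inv c -` U)"
    by (rule continuous_open_preimage[OF continuous_on_chart_inv[OF c] open_chart_img[OF c] U(1)])
  then have "((V \<circ> chart_inv c) has_derivative (\<lambda>v. 0)) (at y)"
    by (rule has_derivative_transform_within_open[OF has_derivative_const[of 0]]) (use y U V in auto)
  then have "chart_deriv V c y = (\<lambda>v. 0)" unfolding chart_deriv_def by (rule frechet_derivative_apply)
  then have "gram_dot V c y = 0" by (simp add: gram_dot_def vec_eq_iff bilinear_lzero[OF b] bilinear_rzero[OF b])
  then show ?thesis by (simp add: rate_def linear_0[OF linear_det_deriv])
qed

lemma smooth_on_vol_density:
  assumes c: "c \<in> A"
  shows "smooth_on (chart_img c) (vol_density b f c)"
proof -
  note D = smooth_on_det[OF smooth_on_gram[OF b smooth_f c]]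
  \<comment> \<open>The inner root of the square is the absolute value, so both signs of the Gram
    determinant are covered by roots of positive functions.\<close>
  have "smooth_on (chart_img c) (\<lambda>y. sqrt (sqrt (det (gram b c f y) * det (gram b c f y))))"
  proof (rule smooth_on_sqrt, rule smooth_on_sqrt[OF smooth_on_mult[OF D D]])
    show "0 < det (gram b c f y) * det (gram b c f y)" if "y \<in> chart_img c" for y
      using det_gram_nonzero[OF c that] not_real_square_gt_zero by blast
    show "0 < sqrt (det (gram b c f y) * det (gram b c f y))" if "y \<in> chart_img c" for y
      using det_gram_nonzero[OF c that] by simp
  qed
  then show ?thesis by (simp add: vol_density_def[abs_def])
qed

end

section \<open>The derivative of the volume under a variation\<close>

lemma sqrt_abs_has_derivative:
  assumes "D \<noteq> 0"
  shows "((\<lambda>x. sqrt \<bar>x\<bar>) has_real_derivative sgn D / (2 * sqrt \<bar>D\<bar>)) (at D)"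
proof (cases "D > 0")
  case True
  have "(sqrt has_real_derivative inverse (sqrt D) / 2) (at D)" by (rule DERIV_real_sqrt[OF True])
  then have "((\<lambda>x. sqrt \<bar>x\<bar>) has_real_derivative inverse (sqrt D) / 2) (at D)"
    by (rule has_field_derivative_transform_within_open[of _ _ _ "{0<..}"]) (use True in auto)
  then show ?thesis using True by (simp add: field_simps)
next
  case False
  then have D: "D < 0" using assms by simp
  have "((\<lambda>x. sqrt (- x)) has_real_derivative (inverse (sqrt (- D)) / 2) * (- 1)) (at D)"
    by (rule DERIV_chain2[OF DERIV_real_sqrt]) (use D in \<open>auto intro!: derivative_eq_intros\<close>)
  then have "((\<lambda>x. sqrt \<bar>x\<bar>) has_real_derivative (inverse (sqrt (- D)) / 2) * (- 1)) (at D)"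
    by (rule has_field_derivative_transform_within_open[of _ _ _ "{..<0}"]) (use D in auto)
  then show ?thesis using D by (simp add: field_simps)
qed

lemma has_field_derivative_of_vector_derivative:
  "(g has_vector_derivative g') (at t) \<Longrightarrow> (g has_real_derivative g') (at t)"
  by (simp add: has_real_derivative_iff_has_vector_derivative)

locale volume_variation = nondegenerate_map A b f
  for A :: "('m::{t2_space,second_countable_topology}, 'n::finite) chart set"
    and b :: "'e::euclidean_space \<Rightarrow> 'e \<Rightarrow> real" and f :: "'m \<Rightarrow> 'e" +
  fixes S :: "'e set" and \<delta> :: real and K :: "'m set" and F :: "real \<Rightarrow> 'm \<Rightarrow> 'e"
  assumes var: "variation A S f \<delta> K F"
begin

lemma delta_pos: "0 < \<delta>" and compact_K: "compact K" and F_0: "F 0 = f"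
  and F_outside: "\<bar>t\<bar> < \<delta> \<Longrightarrow> x \<notin> K \<Longrightarrow> F t x = f x"
  using var by (auto simp: variation_def)

abbreviation I :: "real set" where
  "I \<equiv> {-\<delta><..<\<delta>}"

definition jF :: "('m, 'n) chart \<Rightarrow> real \<times> (real ^ 'n) \<Rightarrow> 'e" where
  "jF c = (\<lambda>(t, y). F t (chart_inv c y))"

lemma smooth_jF: "c \<in> A \<Longrightarrow> smooth_on (I \<times> chart_img c) (jF c)"
  using var unfolding variation_def jF_def by blast

lemma zero_in_I: "0 \<in> I"
  using delta_pos by simp

lemma smooth_F:
  assumes "t \<in> I"
  shows "smooth_map A (F t)"
  unfolding smooth_map_def
proof
  fix c assume c: "c \<in> A"
  show "smooth_on (chart_img c) (F t \<circ> chart_inv c)"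
    using smooth_on_slice[OF smooth_jF[OF c] assms open_chart_img[OF c]] by (simp add: jF_def o_def)
qed

lemma chart_deriv_F:
  assumes c: "c \<in> A" and t: "t \<in> I" and y: "y \<in> chart_img c"
  shows "chart_deriv (F t) c y v = frechet_derivative (jF c) (at (t, y)) (0, v)"
proof -
  have d: "jF c differentiable (at (t, y))"
    by (rule smooth_on_differentiable[OF smooth_jF[OF c]]) (use t y in blast)
  show ?thesis
    using frechet_derivative_slice[OF d, of v] by (simp add: chart_deriv_def jF_def o_def)
qed

definition velocity :: "'m \<Rightarrow> 'e" where
  "velocity x = vector_derivative (\<lambda>t. F t x) (at 0)"

lemma velocity_chart:
  assumes c: "c \<in> A" and y: "y \<in> chart_img c"
  shows "velocity (chart_inv c y) = frechet_derivative (jF c) (at (0, y)) (1, 0)"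
proof -
  have "jF c differentiable (at (0, y))"
    by (rule smooth_on_differentiable[OF smooth_jF[OF c]]) (use zero_in_I y in blast)
  from has_vector_derivative_slice[OF this]
  have "((\<lambda>t. F t (chart_inv c y)) has_vector_derivative frechet_derivative (jF c) (at (0, y)) (1, 0)) (at 0)"
    by (simp add: jF_def)
  then show ?thesis unfolding velocity_def by (rule vector_derivative_at)
qed

lemma smooth_velocity: "smooth_map A velocity"
  unfolding smooth_map_def
proof
  fix c assume c: "c \<in> A"
  have "smooth_on (chart_img c) (\<lambda>y. frechet_derivative (jF c) (at (0, y)) (1, 0))"
    by (rule smooth_on_slice[OF smooth_on_frechet_derivative[OF smooth_jF[OF c]] zero_in_I open_chart_img[OF c]])
  then show "smooth_on (chart_img c) (velocity \<circ> chart_inv c)"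
    by (rule smooth_on_cong) (simp add: velocity_chart[OF c])
qed

lemma velocity_outside:
  assumes "x \<notin> K"
  shows "velocity x = 0"
proof -
  have "((\<lambda>t. F t x) has_vector_derivative 0) (at 0)"
    by (rule has_vector_derivative_transform_within_open[OF has_vector_derivative_const[of "f x"], of I])
      (use zero_in_I F_outside[OF _ assms] in auto)
  then show ?thesis unfolding velocity_def by (rule vector_derivative_at)
qed

definition jG :: "('m, 'n) chart \<Rightarrow> real \<times> (real ^ 'n) \<Rightarrow> real ^ 'n ^ 'n" where
  "jG c = (\<lambda>z. \<chi> i j. b (frechet_derivative (jF c) (at z) (0, axis i 1)) (frechet_derivative (jF c) (at z) (0, axis j 1)))"

lemma jG_gram:
  assumes c: "c \<in> A" and t: "t \<in> I" and y: "y \<in> chart_img c"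
  shows "jG c (t, y) = gram b c (F t) y"
  unfolding jG_def gram_form_matrix form_matrix_def chart_deriv_F[OF assms] ..

lemma smooth_jG:
  assumes c: "c \<in> A"
  shows "smooth_on (I \<times> chart_img c) (jG c)"
proof (intro smooth_on_vec smooth_onD_open[OF smooth_jF[OF c]])
  show "smooth_on (I \<times> chart_img c) (\<lambda>z. jG c z $ i $ j)" for i j
    unfolding jG_def
    using smooth_on_bilinear[OF bb smooth_on_frechet_derivative[OF smooth_jF[OF c]] smooth_on_frechet_derivative[OF smooth_jF[OF c]]]
    by simp
qed

text \<open>After time and space derivatives are exchanged, the derivative of the Gram matrix
  contains the space derivatives of the velocity field.\<close>

lemma det_jG_derivative_0:
  assumes c: "c \<in> A" and y: "y \<in> chart_img c"
  shows "frechet_derivative (\<lambda>z. det (jG c z)) (at (0, y)) (1, 0) = det_deriv (gram b c f y) (gram_dot velocity c y)"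
proof -
  let ?z = "(0 :: real, y)"
  have z: "?z \<in> I \<times> chart_img c" using zero_in_I y by blast
  let ?X = "\<lambda>v z. frechet_derivative (jF c) (at z) (0, v)" and ?V = "\<lambda>z. frechet_derivative (jF c) (at z) (1, 0)"
  have X: "(?X v has_derivative frechet_derivative (?X v) (at ?z)) (at ?z)" for v
    by (rule smooth_on_has_derivative[OF smooth_on_frechet_derivative[OF smooth_jF[OF c]] z])
  have V: "?V differentiable (at ?z)"
    by (rule smooth_on_differentiable[OF smooth_on_frechet_derivative[OF smooth_jF[OF c]] z])
  have XV: "frechet_derivative (?X v) (at ?z) (1, 0) = chart_deriv velocity c y v" for v
  proof -
    have "frechet_derivative (?X v) (at ?z) (1, 0) = frechet_derivative (\<lambda>y. ?V (0, y)) (at y) v"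
      using frechet_derivative_slice[OF V, of v] frechet_derivative_commute[OF smooth_jF[OF c] z, of "(0, v)" "(1, 0)"] by simp
    also have "\<dots> = chart_deriv velocity c y v"
    proof -
      have "((\<lambda>y. ?V (0, y)) has_derivative chart_deriv velocity c y) (at y)"
        by (rule has_derivative_transform_within_open[OF chart_deriv_has_derivative[OF smooth_velocity c y] open_chart_img[OF c] y])
          (simp add: velocity_chart[OF c])
      then show ?thesis by (simp add: frechet_derivative_apply)
    qed
    finally show ?thesis .
  qed
  have X0: "?X v ?z = chart_deriv f c y v" for v
    using chart_deriv_F[OF c zero_in_I y, of v] by (simp add: F_0)
  have e: "((\<lambda>z. jG c z $ i $ j) has_derivative
      (\<lambda>h. b (?X (axis i 1) ?z) (frechet_derivative (?X (axis j 1)) (at ?z) h) + b (frechet_derivative (?X (axis i 1)) (at ?z) h) (?X (axis j 1) ?z))) (at ?z)" for i j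
    unfolding jG_def using bounded_bilinear.FDERIV[OF bb X[of "axis i 1"] X[of "axis j 1"]] by simp
  have dj: "(jG c has_derivative frechet_derivative (jG c) (at ?z)) (at ?z)"
    by (rule smooth_on_has_derivative[OF smooth_jG[OF c] z])
  have "frechet_derivative (jG c) (at ?z) (1, 0) $ i $ j = gram_dot velocity c y $ i $ j" for i j
  proof -
    have "((\<lambda>z. jG c z $ i $ j) has_derivative (\<lambda>h. frechet_derivative (jG c) (at ?z) h $ i $ j)) (at ?z)"
      by (intro bounded_linear.has_derivative[OF bounded_linear_vec_nth] dj)
    from has_derivative_unique[OF this e[of i j]]
    have "frechet_derivative (jG c) (at ?z) (1, 0) $ i $ j =
        b (?X (axis i 1) ?z) (frechet_derivative (?X (axis j 1)) (at ?z) (1, 0)) + b (frechet_derivative (?X (axis i 1)) (at ?z) (1, 0)) (?X (axis j 1) ?z)"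
      by (rule fun_cong)
    then show ?thesis unfolding XV X0 by (simp add: gram_dot_def)
  qed
  then have "frechet_derivative (jG c) (at ?z) (1, 0) = gram_dot velocity c y" by (simp add: vec_eq_iff)
  moreover have "((\<lambda>z. det (jG c z)) has_derivative (\<lambda>h. det_deriv (jG c ?z) (frechet_derivative (jG c) (at ?z) h))) (at ?z)"
    using diff_chain_at[OF dj has_derivative_det] by (simp add: o_def)
  moreover have "jG c ?z = gram b c f y" using jG_gram[OF c zero_in_I y] by (simp add: F_0)
  ultimately show ?thesis by (simp add: frechet_derivative_apply)
qed

lemma chart_volume_derivative:
  assumes c: "c \<in> A" and Q: "compact Q" "Q \<subseteq> chart_img c"
    and w: "w \<in> borel_measurable borel" "\<And>y. \<bar>w y\<bar> \<le> C" "\<And>y. y \<notin> Q \<Longrightarrow> w y = 0"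
  shows "((\<lambda>t. \<integral>y. w y * vol_density b (F t) c y \<partial>lborel) has_real_derivative
    (\<integral>y. w y * rate velocity c y \<partial>lborel)) (at 0)"
proof -
  let ?W = "I \<times> chart_img c"
  let ?D = "\<lambda>z. det (jG c z)"
  note sD = smooth_on_det[OF smooth_jG[OF c]]
  define g' where "g' = (\<lambda>t y. sgn (?D (t, y)) / (2 * sqrt \<bar>?D (t, y)\<bar>) * frechet_derivative ?D (at (t, y)) (1, 0))"
  define Wn where "Wn = ?W \<inter> ?D -` (- {0})"
  have oW: "open Wn" unfolding Wn_def
    by (rule continuous_open_preimage[OF smooth_on_continuous_on[OF sD] smooth_onD_open[OF sD]]) auto
  have D0: "?D (0, y) = det (gram b c f y)" if "y \<in> chart_img c" for y
    using jG_gram[OF c zero_in_I that] by (simp add: F_0)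
  have "{0} \<times> Q \<subseteq> Wn"
    using zero_in_I Q(2) D0 det_gram_nonzero[OF c] by (auto simp: Wn_def)
  \<comment> \<open>At time 0 the Gram determinant is nonzero on the compact set Q. The tube lemma
    gives one time interval on which it stays nonzero over all of Q, so that the root of its
    absolute value is differentiable there.\<close>
  from Elementary_Topology.tube_lemma[OF Q(1) oW this] obtain X0 where X0: "0 \<in> X0" "open X0" "X0 \<times> Q \<subseteq> Wn" by blast
  obtain \<eta> where \<eta>: "\<eta> > 0" "ball 0 \<eta> \<subseteq> X0" using X0 openE by blast
  have inW: "(t, y) \<in> Wn" if "\<bar>t\<bar> < \<eta>" "y \<in> Q" for t y
    using that \<eta>(2) X0(3) by (auto simp: dist_real_def)
  have tI: "t \<in> I" if "\<bar>t\<bar> < \<eta>" "Q \<noteq> {}" for t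
    using that inW by (auto simp: Wn_def)
  have vd: "vol_density b (F t) c y = sqrt \<bar>?D (t, y)\<bar>" if "\<bar>t\<bar> < \<eta>" "y \<in> Q" for t y
    using inW[OF that] jG_gram[OF c, of t y] by (simp add: vol_density_def Wn_def)
  have "((\<lambda>t. \<integral>y. w y * sqrt \<bar>?D (t, y)\<bar> \<partial>lborel) has_real_derivative (\<integral>y. w y * g' 0 y \<partial>lborel)) (at 0)"
  proof (rule has_real_derivative_integral[OF \<eta>(1) Q(1) w])
    fix t y assume t: "\<bar>t\<bar> < \<eta>" and y: "y \<in> Q"
    have z: "(t, y) \<in> ?W" "?D (t, y) \<noteq> 0" using inW[OF t y] by (auto simp: Wn_def)
    have "((\<lambda>t. ?D (t, y)) has_real_derivative frechet_derivative ?D (at (t, y)) (1, 0)) (at t)"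
      by (rule has_field_derivative_of_vector_derivative[OF has_vector_derivative_slice[OF smooth_on_differentiable[OF sD z(1)]]])
    from DERIV_chain2[OF sqrt_abs_has_derivative[OF z(2)] this]
    show "((\<lambda>t. sqrt \<bar>?D (t, y)\<bar>) has_real_derivative g' t y) (at t)" by (simp add: g'_def)
  next
    have sub: "{-\<eta><..<\<eta>} \<times> Q \<subseteq> Wn" using inW by auto
    have nz: "?D z \<noteq> 0" if "z \<in> Wn" for z using that by (simp add: Wn_def)
    have cD: "continuous_on Wn ?D" by (rule continuous_on_subset[OF smooth_on_continuous_on[OF sD]]) (auto simp: Wn_def)
    have cD': "continuous_on Wn (\<lambda>z. frechet_derivative ?D (at z) (1, 0))"
      by (rule continuous_on_subset[OF smooth_on_continuous_on[OF smooth_on_frechet_derivative[OF sD]]]) (auto simp: Wn_def)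
    have "continuous_on Wn (\<lambda>z. sgn (?D z) / (2 * sqrt \<bar>?D z\<bar>) * frechet_derivative ?D (at z) (1, 0))"
      by (intro continuous_on_mult continuous_on_divide continuous_on_sgn cD cD' continuous_on_const
          continuous_on_real_sqrt continuous_on_rabs) (use nz in auto)
    from continuous_on_subset[OF this sub] show "continuous_on ({-\<eta><..<\<eta>} \<times> Q) (\<lambda>(t, y). g' t y)"
      by (simp add: g'_def case_prod_beta)
  next
    fix t assume t: "\<bar>t\<bar> < \<eta>"
    have "continuous_on Q (\<lambda>y. ?D (t, y))"
      by (rule continuous_on_compose2[OF smooth_on_continuous_on[OF sD]])
        (use inW[OF t] in \<open>auto intro!: continuous_intros simp: Wn_def\<close>)
    then show "continuous_on Q (\<lambda>y. sqrt \<bar>?D (t, y)\<bar>)" by (intro continuous_intros)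
  qed
  moreover have "(\<integral>y. w y * sqrt \<bar>?D (t, y)\<bar> \<partial>lborel) = (\<integral>y. w y * vol_density b (F t) c y \<partial>lborel)" if "\<bar>t\<bar> < \<eta>" for t
  proof (rule Bochner_Integration.integral_cong[OF refl])
    show "w y * sqrt \<bar>?D (t, y)\<bar> = w y * vol_density b (F t) c y" for y
      using vd[OF that, of y] w(3)[of y] by (cases "y \<in> Q") auto
  qed
  moreover have "(\<integral>y. w y * g' 0 y \<partial>lborel) = (\<integral>y. w y * rate velocity c y \<partial>lborel)"
  proof (rule Bochner_Integration.integral_cong[OF refl])
    show "w y * g' 0 y = w y * rate velocity c y" for y
    proof (cases "y \<in> Q")
      case True
      then have y: "y \<in> chart_img c" using Q(2) by blast
      show ?thesis unfolding g'_def rate_def det_jG_derivative_0[OF c y] D0[OF y] ..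
    qed (simp add: w(3))
  qed
  ultimately have "((\<lambda>t. \<integral>y. w y * sqrt \<bar>?D (t, y)\<bar> \<partial>lborel) has_real_derivative (\<integral>y. w y * rate velocity c y \<partial>lborel)) (at 0)"
    by simp
  then show ?thesis
    by (rule has_field_derivative_transform_within_open[of _ _ _ "{-\<eta><..<\<eta>}"])
      (use \<eta>(1) \<open>\<And>t. \<bar>t\<bar> < \<eta> \<Longrightarrow> (\<integral>y. w y * sqrt \<bar>?D (t, y)\<bar> \<partial>lborel) = (\<integral>y. w y * vol_density b (F t) c y \<partial>lborel)\<close> in auto)
qed

end

context C1_partition
begin

lemma open_W_img: "c \<in> A \<Longrightarrow> open (coords c ` (chart_dom c \<inter> W))"
  by (rule open_image_coords[OF _ Int_lower1 open_Int[OF open_chart_dom open_W]])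

lemma rho_continuous: "continuous_on W (\<rho> x)"
proof -
  have "continuous_on (chart_dom d \<inter> W) (\<rho> x)" if d: "d \<in> A" for d
  proof -
    have "continuous_on (chart_dom d \<inter> W) (\<lambda>z. (\<rho> x \<circ> chart_inv d) (coords d z))"
      by (rule continuous_on_compose2[OF Ck_on_imp_continuous_on[OF rho_C1[OF d]]
            continuous_on_subset[OF continuous_on_coords[OF d]]]) auto
    then show ?thesis by (rule continuous_on_eq) (simp add: chart_inv_coords[OF d])
  qed
  then have "continuous_on (\<Union>d\<in>A. chart_dom d \<inter> W) (\<rho> x)"
    by (intro continuous_on_open_UN open_Int open_chart_dom open_W)
  moreover have "(\<Union>d\<in>A. chart_dom d \<inter> W) = W" using chart_exists by blast
  ultimately show ?thesis by simp
qed

text \<open>A partition function cut down to B, transported to its chart and extended by zero. B is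
  a parameter of its own, so that one partition serves two variations with different compact
  sets.\<close>

definition weight :: "'m set \<Rightarrow> 'm \<Rightarrow> real ^ 'n \<Rightarrow> real" where
  "weight B x y = indicator (chart_img (chart_at A x)) y *
     (\<rho> x (chart_inv (chart_at A x) y) * indicator B (chart_inv (chart_at A x) y))"

lemma rho_indicator_measurable:
  assumes "B \<in> sets borel" "B \<subseteq> W"
  shows "(\<lambda>z. \<rho> x z * indicator B z) \<in> borel_measurable borel"
proof -
  have "(\<lambda>z. indicator W z *\<^sub>R \<rho> x z) \<in> borel_measurable borel"
    by (rule borel_measurable_continuous_on_indicator[OF _ rho_continuous]) (use open_W in simp)
  then have "(\<lambda>z. (indicator W z *\<^sub>R \<rho> x z) * indicator B z) \<in> borel_measurable borel"
    using assms(1) by measurable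
  moreover have "(\<lambda>z. (indicator W z *\<^sub>R \<rho> x z) * indicator B z) = (\<lambda>z. \<rho> x z * indicator B z)"
    using assms(2) by (auto simp: indicator_def fun_eq_iff)
  ultimately show ?thesis by simp
qed

lemma weight_measurable:
  assumes "B \<in> sets borel" "B \<subseteq> W"
  shows "weight B x \<in> borel_measurable borel"
proof -
  let ?c = "chart_at A x"
  let ?G = "\<lambda>y. if y \<in> chart_img ?c then chart_inv ?c y else undefined"
  have img: "chart_img ?c \<in> sets borel" by (rule borel_open[OF open_chart_img[OF chart_at(1)]])
  have "(\<lambda>y. (\<lambda>z. \<rho> x z * indicator B z) (?G y)) \<in> borel_measurable borel"
    by (rule measurable_compose[OF chart_inv_measurable[OF chart_at(1)] rho_indicator_measurable[OF assms]])
  then have "(\<lambda>y. indicator (chart_img ?c) y * (\<lambda>z. \<rho> x z * indicator B z) (?G y)) \<in> borel_measurable borel"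
    by (rule borel_measurable_times[OF borel_measurable_indicator[OF img]])
  moreover have "(\<lambda>y. indicator (chart_img ?c) y * (\<lambda>z. \<rho> x z * indicator B z) (?G y)) = weight B x"
    by (auto simp: weight_def indicator_def fun_eq_iff)
  ultimately show ?thesis by simp
qed

lemma weight_bound:
  assumes "x \<in> X" "B \<subseteq> W"
  shows "\<bar>weight B x y\<bar> \<le> 1"
  using rho_bound[OF assms(1), of "chart_inv (chart_at A x) y"] assms(2)
  by (auto simp: weight_def indicator_def)

lemma weight_outside: "y \<notin> coords (chart_at A x) ` Q x \<Longrightarrow> weight B x y = 0"
  using image_coords_eq[OF chart_at(1) Q_dom, of x] rho_outside[of "chart_inv (chart_at A x) y" x]
  by (auto simp: weight_def indicator_def)

lemma compact_Q_img: "compact (coords (chart_at A x) ` Q x)"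
  by (rule compact_image_coords[OF chart_at(1) Q_dom compact_Q])

lemma Q_img_sub: "coords (chart_at A x) ` Q x \<subseteq> chart_img (chart_at A x)"
  using Q_dom by blast

end

text \<open>On B the partition functions add up to 1, so the volume of B is a finite sum of chart
  integrals with fixed weights, and each of them is differentiable.\<close>

lemma (in volume_variation) volume_derivative:
  assumes P: "C1_partition A K0 X W \<rho> Q" and B: "compact B" "B \<subseteq> K0"
  shows "((\<lambda>t. measure (volume_measure A b (F t)) B) has_real_derivative
    (\<Sum>x\<in>X. \<integral>y. C1_partition.weight A \<rho> B x y * rate velocity (chart_at A x) y \<partial>lborel)) (at 0)"
proof -
  interpret P: C1_partition A K0 X W \<rho> Q by (rule P)
  have Bb: "B \<in> sets borel" using B(1) by (simp add: compact_imp_closed borel_closed)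
  have BW: "B \<subseteq> W" using B(2) P.K_W by blast
  have D0: "((\<lambda>t. \<Sum>x\<in>X. \<integral>y. P.weight B x y * vol_density b (F t) (chart_at A x) y \<partial>lborel) has_real_derivative
    (\<Sum>x\<in>X. \<integral>y. P.weight B x y * rate velocity (chart_at A x) y \<partial>lborel)) (at 0)"
    by (rule DERIV_sum)
      (rule chart_volume_derivative[OF chart_at(1) P.compact_Q_img P.Q_img_sub P.weight_measurable[OF Bb BW]
          P.weight_bound[OF _ BW] P.weight_outside])
  have E0: "(\<Sum>x\<in>X. \<integral>y. P.weight B x y * vol_density b (F t) (chart_at A x) y \<partial>lborel) = measure (volume_measure A b (F t)) B"
    if t: "t \<in> I" for t
  proof -
    let ?M = "volume_measure A b (F t)"
    note h = compatible_vol_density[OF b smooth_F[OF t]]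
    note M = volume_measure_has_densities[OF b smooth_F[OF t]]
    have sM: "sets ?M = sets borel" using M by (simp add: has_densities_def)
    have spM: "space ?M = UNIV" using sets_eq_imp_space_eq[OF sM] by simp
    have q0: "\<rho> x z * indicator B z = 0" if "z \<notin> chart_dom (chart_at A x)" for x z
      using P.rho_outside[of z x] P.Q_dom[of x] that by auto
    note I1 = integral_in_chart[OF h M chart_at(1) P.rho_indicator_measurable[OF Bb BW]]
    have I2: "(\<integral>z. \<rho> x z * indicator B z \<partial>?M) = (\<integral>y. P.weight B x y * vol_density b (F t) (chart_at A x) y \<partial>lborel)" for x
      unfolding P.weight_def by (rule I1(1)) (rule q0)
    have I3: "integrable ?M (\<lambda>z. \<rho> x z * indicator B z) \<longleftrightarrow>
        integrable lborel (\<lambda>y. P.weight B x y * vol_density b (F t) (chart_at A x) y)" for x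
      unfolding P.weight_def by (rule I1(2)) (rule q0)
    have "integrable lborel (\<lambda>y. P.weight B x y * vol_density b (F t) (chart_at A x) y)" if "x \<in> X" for x
    proof (rule integrable_compact_support[OF P.compact_Q_img P.weight_measurable[OF Bb BW] P.weight_bound[OF that BW] P.weight_outside])
      have "continuous_on (chart_img (chart_at A x)) (vol_density b (F t) (chart_at A x))"
        using h chart_at(1)[of x] by (simp add: compatible_densities_def)
      then show "continuous_on (coords (chart_at A x) ` Q x) (vol_density b (F t) (chart_at A x))"
        by (rule continuous_on_subset[OF _ P.Q_img_sub])
    qed
    then have int: "integrable ?M (\<lambda>z. \<rho> x z * indicator B z)" if "x \<in> X" for x
      unfolding I3 by this (rule that)
    have "(\<Sum>x\<in>X. \<integral>y. P.weight B x y * vol_density b (F t) (chart_at A x) y \<partial>lborel) = (\<Sum>x\<in>X. \<integral>z. \<rho> x z * indicator B z \<partial>?M)"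
      by (rule sum.cong[OF refl]) (rule I2[symmetric])
    also have "\<dots> = (\<integral>z. (\<Sum>x\<in>X. \<rho> x z * indicator B z) \<partial>?M)"
      by (rule Bochner_Integration.integral_sum[symmetric]) (rule int)
    also have "\<dots> = (\<integral>z. indicator B z \<partial>?M)"
    proof (rule Bochner_Integration.integral_cong[OF refl])
      show "(\<Sum>x\<in>X. \<rho> x z * indicator B z) = indicator B z" for z
        unfolding sum_distrib_right[symmetric] using P.rho_sum[of z] BW by (auto simp: indicator_def)
    qed
    also have "\<dots> = measure ?M B" using spM by simp
    finally show ?thesis .
  qed
  show ?thesis
    by (rule has_field_derivative_transform_within_open[OF D0 _ zero_in_I E0]) simp
qed

section \<open>Tangential velocities and the divergence theorem\<close>

context nondegenerate_map
begin

text \<open>The chart components of a tangential field: the linear system given by the Gram matrix,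
  solved by Cramer's rule so that smoothness is visible.\<close>

definition comp :: "('m \<Rightarrow> 'e) \<Rightarrow> ('m, 'n) chart \<Rightarrow> real ^ 'n \<Rightarrow> real ^ 'n" where
  "comp V c y = (\<chi> k. det (\<chi> i j. if j = k then (\<chi> i. b (chart_deriv f c y (axis i 1)) (V (chart_inv c y))) $ i
     else gram b c f y $ i $ j) / det (gram b c f y))"

lemma gram_mult:
  assumes c: "c \<in> A" and y: "y \<in> chart_img c"
  shows "(gram b c f y *v z) $ i = b (chart_deriv f c y (axis i 1)) (chart_deriv f c y z)"
proof -
  note q = bilinear_pullback[OF b linear_chart_deriv[OF smooth_f c y]]
  show ?thesis
    using form_matrix_apply[OF q, of "axis i 1" z] by (simp add: gram_form_matrix inner_axis')
qed

lemma chart_deriv_comp: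
  assumes c: "c \<in> A" and y: "y \<in> chart_img c" and V: "V (chart_inv c y) \<in> range (tangent_map A f (chart_inv c y))"
  shows "chart_deriv f c y (comp V c y) = V (chart_inv c y)"
proof -
  define x where "x = chart_inv c y"
  have x: "x \<in> chart_dom c" "coords c x = y" unfolding x_def by (auto simp: chart_inv_mem[OF c y] coords_chart_inv[OF c y])
  obtain w where w: "V x = tangent_map A f x w" using V unfolding x_def by blast
  obtain z where z: "w = to_chart_at c x z" using surj_to_chart_at[OF c x(1)] by (rule surjE)
  have Vz: "V x = chart_deriv f c y z"
    using chart_deriv_tangent_map_smooth[OF smooth_f c x(1), of z] by (simp add: w z x(2))
  have "gram b c f y *v z = (\<chi> i. b (chart_deriv f c y (axis i 1)) (V (chart_inv c y)))"
    by (simp add: vec_eq_iff gram_mult[OF c y] Vz[symmetric] x_def)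
  then have "z = comp V c y" unfolding comp_def cramer[OF det_gram_nonzero[OF c y]] .
  then show ?thesis using Vz by (simp add: x_def)
qed

lemma smooth_on_chart_deriv: "smooth_map A h \<Longrightarrow> c \<in> A \<Longrightarrow> smooth_on (chart_img c) (\<lambda>y. chart_deriv h c y v)"
  for h :: "'m \<Rightarrow> 'a::euclidean_space"
  unfolding chart_deriv_def by (rule smooth_on_frechet_derivative[OF smooth_map_chart])

lemma smooth_comp:
  assumes c: "c \<in> A" and V: "smooth_map A V"
  shows "smooth_on (chart_img c) (comp V c)"
proof (rule smooth_on_vec[OF open_chart_img[OF c]])
  fix k
  have B: "smooth_on (chart_img c) (\<lambda>y. b (chart_deriv f c y (axis i 1)) ((V \<circ> chart_inv c) y))" for i
    by (rule smooth_on_bilinear[OF bb smooth_on_chart_deriv[OF smooth_f c] smooth_map_chart[OF V c]])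
  have "smooth_on (chart_img c) (\<lambda>y. \<chi> i j. if j = k then (\<chi> i. b (chart_deriv f c y (axis i 1)) (V (chart_inv c y))) $ i
     else gram b c f y $ i $ j)"
  proof (intro smooth_on_vec open_chart_img c)
    fix i j
    show "smooth_on (chart_img c) (\<lambda>y. (\<chi> i j. if j = k then (\<chi> i. b (chart_deriv f c y (axis i 1)) (V (chart_inv c y))) $ i
     else gram b c f y $ i $ j) $ i $ j)"
      using B[of i] smooth_on_vec_nth[OF smooth_on_vec_nth[OF smooth_on_gram[OF b smooth_f c], of i], of j]
      by (cases "j = k") simp_all
  qed
  from smooth_on_divide[OF smooth_on_det[OF this] smooth_on_det[OF smooth_on_gram[OF b smooth_f c]] det_gram_nonzero[OF c]]
  show "smooth_on (chart_img c) (\<lambda>y. comp V c y $ k)" by (simp add: comp_def)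
qed

lemma gram_symmetric: "transpose (gram b c f y) = gram b c f y"
  unfolding vec_eq_iff transpose_def gram_form_matrix form_matrix_def vec_lambda_beta by (intro allI) (rule b_sym)

text \<open>For a tangential velocity \<open>V = df(Z)\<close> the rate of change of the volume density is the
  divergence of \<open>Z\<close> times the density.\<close>

lemma rate_tangential:
  assumes c: "c \<in> A" and y: "y \<in> chart_img c" and V: "smooth_map A V"
    and tan: "\<And>x. V x \<in> range (tangent_map A f x)"
  shows "rate V c y = (\<Sum>k\<in>UNIV. frechet_derivative (\<lambda>y. vol_density b f c y * comp V c y $ k) (at y) (axis k 1))"
proof -
  let ?G = "gram b c f y" and ?D = "det (gram b c f y)"
  define E where "E = (\<lambda>k y. chart_deriv f c y (axis k 1))"
  define Z where "Z = comp V c"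
  define dE where "dE = (\<lambda>k v. frechet_derivative (E k) (at y) v)"
  define dZ where "dZ = (\<lambda>k v. frechet_derivative (\<lambda>y. Z y $ k) (at y) v)"
  define Bm :: "real ^ 'n ^ 'n" where "Bm = (\<chi> i k. dZ k (axis i 1))"
  define dGr where "dGr = (\<lambda>k. frechet_derivative (gram b c f) (at y) (axis k 1))"
  have sE: "smooth_on (chart_img c) (E k)" for k unfolding E_def by (rule smooth_on_chart_deriv[OF smooth_f c])
  have hE: "(E k has_derivative dE k) (at y)" for k
    unfolding dE_def by (rule smooth_on_has_derivative[OF sE y])
  have sZ: "smooth_on (chart_img c) (\<lambda>y. Z y $ k)" for k
    unfolding Z_def by (rule smooth_on_vec_nth[OF smooth_comp[OF c V]])
  have hZ: "((\<lambda>y. Z y $ k) has_derivative dZ k) (at y)" for k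
    unfolding dZ_def by (rule smooth_on_has_derivative[OF sZ y])
  have dE_sym: "dE k (axis i 1) = dE i (axis k 1)" for i k
    unfolding dE_def E_def chart_deriv_def by (rule frechet_derivative_commute[OF smooth_map_chart[OF smooth_f c] y])
  have Ef: "chart_deriv f c y (axis k 1) = E k y" for k by (simp add: E_def)
  have G: "?G $ i $ j = b (E i y) (E j y)" for i j
    by (simp add: gram_form_matrix form_matrix_def E_def)
  have VE: "(V \<circ> chart_inv c) y' = (\<Sum>k\<in>UNIV. Z y' $ k *\<^sub>R E k y')" if y': "y' \<in> chart_img c" for y'
  proof -
    have "(V \<circ> chart_inv c) y' = chart_deriv f c y' (Z y')"
      unfolding Z_def using chart_deriv_comp[OF c y', of V] tan by simp
    also have "\<dots> = (\<Sum>k\<in>UNIV. Z y' $ k *\<^sub>R E k y')"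
      unfolding E_def by (rule linear_eq_axis[OF linear_chart_deriv[OF smooth_f c y']])
    finally show ?thesis .
  qed
  have "((\<lambda>y. \<Sum>k\<in>UNIV. Z y $ k *\<^sub>R E k y) has_derivative (\<lambda>v. \<Sum>k\<in>UNIV. Z y $ k *\<^sub>R dE k v + dZ k v *\<^sub>R E k y)) (at y)"
    by (intro has_derivative_sum has_derivative_scaleR hZ hE)
  then have "((V \<circ> chart_inv c) has_derivative (\<lambda>v. \<Sum>k\<in>UNIV. Z y $ k *\<^sub>R dE k v + dZ k v *\<^sub>R E k y)) (at y)"
    by (rule has_derivative_transform_within_open[OF _ open_chart_img[OF c] y]) (simp only: VE)
  then have dV: "chart_deriv V c y = (\<lambda>v. \<Sum>k\<in>UNIV. Z y $ k *\<^sub>R dE k v + dZ k v *\<^sub>R E k y)"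
    unfolding chart_deriv_def[of V] by (rule frechet_derivative_apply)
  have hG: "(gram b c f has_derivative frechet_derivative (gram b c f) (at y)) (at y)"
    by (rule smooth_on_has_derivative[OF smooth_on_gram[OF b smooth_f c] y])
  have dGr: "dGr k $ i $ j = b (E i y) (dE j (axis k 1)) + b (dE i (axis k 1)) (E j y)" for i j k
  proof -
    have "((\<lambda>y. gram b c f y $ i $ j) has_derivative (\<lambda>v. frechet_derivative (gram b c f) (at y) v $ i $ j)) (at y)"
      by (intro bounded_linear.has_derivative[OF bounded_linear_vec_nth] hG)
    moreover have "(\<lambda>y. gram b c f y $ i $ j) = (\<lambda>y. b (E i y) (E j y))"
      by (simp add: gram_form_matrix form_matrix_def E_def)
    ultimately have "((\<lambda>y. b (E i y) (E j y)) has_derivative (\<lambda>v. frechet_derivative (gram b c f) (at y) v $ i $ j)) (at y)"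
      by simp
    from has_derivative_unique[OF this bounded_bilinear.FDERIV[OF bb hE[of i] hE[of j]]]
    show ?thesis unfolding dGr_def by (rule fun_cong)
  qed
  have lin: "linear (b v)" "linear (\<lambda>v. b v w)" for v w using b by (auto simp: bilinear_def)
  \<comment> \<open>The Lie derivative of the induced metric along Z in coordinates: the derivative
    of the metric along Z and two terms with the Jacobian matrix \<open>Bm\<close> of Z. The second
    derivatives of f combine into the first term by their symmetry.\<close>
  have "gram_dot V c y $ i $ j = ((\<Sum>k\<in>UNIV. Z y $ k *\<^sub>R dGr k) + Bm ** ?G + transpose (Bm ** ?G)) $ i $ j" for i j
  proof -
    have 1: "b (chart_deriv V c y (axis i 1)) (E j y) =
        (\<Sum>k\<in>UNIV. Z y $ k * b (dE i (axis k 1)) (E j y)) + (\<Sum>k\<in>UNIV. dZ k (axis i 1) * b (E k y) (E j y))" for i j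
      unfolding dV linear_sum[OF lin(2)]
      by (simp add: bilinear_ladd[OF b] bilinear_lmul[OF b] sum.distrib dE_sym[of _ i])
    have 2: "b (E i y) (chart_deriv V c y (axis j 1)) =
        (\<Sum>k\<in>UNIV. Z y $ k * b (dE j (axis k 1)) (E i y)) + (\<Sum>k\<in>UNIV. dZ k (axis j 1) * b (E k y) (E i y))" for i j
      unfolding b_sym[of "E i y" "chart_deriv V c y (axis j 1)"] by (rule 1)
    show ?thesis
      using 1[of i j] 2[of i j] b_sym[of "E i y" "dE j _"]
      by (simp add: gram_dot_def Ef dGr Bm_def matrix_matrix_mult_def transpose_def G
          sum.distrib distrib_left b_sym[of "E i y"])
  qed
  then have gd: "gram_dot V c y = (\<Sum>k\<in>UNIV. Z y $ k *\<^sub>R dGr k) + Bm ** ?G + transpose (Bm ** ?G)"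
    by (simp add: vec_eq_iff)
  \<comment> \<open>Since the Gram matrix is symmetric, the two Jacobian terms contribute equally,
    each the trace of \<open>Bm\<close>, the coordinate divergence of Z, times the
    determinant.\<close>
  have dd: "det_deriv ?G (gram_dot V c y) = (\<Sum>k\<in>UNIV. Z y $ k * det_deriv ?G (dGr k)) + 2 * trace Bm * ?D"
    unfolding gd linear_add[OF linear_det_deriv] linear_sum[OF linear_det_deriv] linear_scale[OF linear_det_deriv]
      det_deriv_transpose[OF gram_symmetric] det_deriv_matrix_mult by simp
  define s where "s = sgn ?D / (2 * sqrt \<bar>?D\<bar>)"
  note Dnz = det_gram_nonzero[OF c y]
  have hv: "(vol_density b f c has_derivative (\<lambda>v. s * det_deriv ?G (frechet_derivative (gram b c f) (at y) v))) (at y)"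
  proof -
    have "((\<lambda>x. sqrt \<bar>x\<bar>) has_derivative (\<lambda>x. s * x)) (at ?D)"
      using sqrt_abs_has_derivative[OF Dnz] unfolding has_field_derivative_def s_def .
    from diff_chain_at[OF diff_chain_at[OF hG has_derivative_det] this[folded o_apply[of det "gram b c f"]]]
    show ?thesis by (simp add: o_def vol_density_def[abs_def])
  qed
  have pr: "frechet_derivative (\<lambda>y. vol_density b f c y * Z y $ k) (at y) (axis k 1) =
      vol_density b f c y * dZ k (axis k 1) + s * det_deriv ?G (dGr k) * Z y $ k" for k
    using frechet_derivative_apply[OF has_derivative_mult[OF hv hZ[of k]]] by (simp add: dGr_def)
  have vs: "s * (2 * trace Bm * ?D) = vol_density b f c y * trace Bm"
  proof -
    have "s * (2 * ?D) = sqrt \<bar>?D\<bar>"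
    proof -
      have "s * (2 * ?D) = \<bar>?D\<bar> / sqrt \<bar>?D\<bar>" unfolding s_def by (simp add: abs_sgn mult.commute)
      then show ?thesis by (simp add: real_div_sqrt)
    qed
    then show ?thesis by (simp add: vol_density_def mult.commute mult.left_commute)
  qed
  have "rate V c y = s * (\<Sum>k\<in>UNIV. Z y $ k * det_deriv ?G (dGr k)) + vol_density b f c y * trace Bm"
    unfolding rate_def s_def[symmetric] dd distrib_left vs ..
  also have "\<dots> = (\<Sum>k\<in>UNIV. frechet_derivative (\<lambda>y. vol_density b f c y * Z y $ k) (at y) (axis k 1))"
    unfolding pr by (simp add: sum.distrib trace_def Bm_def sum_distrib_left mult_ac)
  finally show ?thesis by (simp add: Z_def)
qed

lemma inj_tangent_map_f: "inj (tangent_map A f x)"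
  unfolding tangent_map_chart_deriv by (rule inj_chart_deriv[OF chart_at(1) coords_chart_at])

text \<open>With V = df(Z), the chart integral of the divergence of \<rho> Z times the density is
  zero for each partition function. So the sum in question is minus the integral of the sum of the
  d\<rho>(Z), and that sum is the differential of the constant 1.\<close>

lemma tangential_integral:
  assumes P: "C1_partition A K X W \<rho> Q" and V: "smooth_map A V"
    and tan: "\<And>x. V x \<in> range (tangent_map A f x)" and V0: "\<And>x. x \<notin> K \<Longrightarrow> V x = 0"
  shows "(\<Sum>x\<in>X. \<integral>y. C1_partition.weight A \<rho> K x y * rate V (chart_at A x) y \<partial>lborel) = 0"
proof -
  interpret P: C1_partition A K X W \<rho> Q by (rule P)
  let ?M = "volume_measure A b f"
  note h = compatible_vol_density[OF b smooth_f]
  note M = volume_measure_has_densities[OF b smooth_f]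
  have Kb: "K \<in> sets borel" using P.compact_K by (simp add: compact_imp_closed borel_closed)
  have oK: "open (- K)" using P.compact_K by (simp add: compact_imp_closed open_Compl)
  have comp0: "comp V c y = 0" if c: "c \<in> A" and y: "y \<in> chart_img c" and K: "chart_inv c y \<notin> K" for c y
  proof -
    have "chart_deriv f c y (comp V c y) = 0" using chart_deriv_comp[where V=V, OF c y tan] V0[OF K] by simp
    then show ?thesis
      using linear_injective_0[OF linear_chart_deriv[OF smooth_f c y]] inj_chart_deriv[OF c y] by blast
  qed
  \<comment> \<open>The term d\<rho>(Z) as a function on the manifold: the chart integrals have
    different domains, and the functions can be added only after they are moved to a common
    one.\<close>
  define q where "q = (\<lambda>x z. if z \<in> chart_dom (chart_at A x) \<inter> W then
     chart_deriv (\<rho> x) (chart_at A x) (coords (chart_at A x) z) (comp V (chart_at A x) (coords (chart_at A x) z)) else 0)"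
  have main: "integrable ?M (q x) \<and> (\<integral>y. P.weight K x y * rate V (chart_at A x) y \<partial>lborel) = - (\<integral>z. q x z \<partial>?M)"
    if x: "x \<in> X" for x
  proof -
    define c where "c = chart_at A x"
    have c: "c \<in> A" unfolding c_def by (rule chart_at)
    define U where "U = coords c ` (chart_dom c \<inter> W)"
    define Z where "Z = comp V c"
    define v where "v = vol_density b f c"
    define r where "r = \<rho> x \<circ> chart_inv c"
    have oU: "open U" unfolding U_def by (rule P.open_W_img[OF c])
    have Ui: "U \<subseteq> chart_img c" by (auto simp: U_def)
    have Uiff: "y \<in> U \<longleftrightarrow> y \<in> chart_img c \<and> chart_inv c y \<in> W" for y
      unfolding U_def image_coords_eq[OF c, of "chart_dom c \<inter> W", simplified] using chart_inv_mem[OF c] by auto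
    \<comment> \<open>Q x bounds the support of \<rho> and K that of Z, so the product below has
      compact support inside U.\<close>
    define Q' where "Q' = coords c ` (Q x \<inter> K)"
    have QK: "Q x \<inter> K \<subseteq> chart_dom c" using P.Q_dom[of x] by (auto simp: c_def)
    have cQ': "compact Q'" unfolding Q'_def
      by (rule compact_image_coords[OF c QK compact_Int_closed[OF P.compact_Q]]) (simp add: P.compact_K compact_imp_closed)
    have Q'U: "Q' \<subseteq> U" unfolding Q'_def U_def using QK P.K_W by blast
    have Q'iff: "y \<in> Q' \<longleftrightarrow> y \<in> chart_img c \<and> chart_inv c y \<in> Q x \<and> chart_inv c y \<in> K" for y
      unfolding Q'_def image_coords_eq[OF c QK] by auto
    have rC: "Ck_on (Suc 0) r U" unfolding r_def U_def by (rule P.rho_C1[OF c])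
    have rD: "(r has_derivative frechet_derivative r (at y)) (at y)" if "y \<in> U" for y
      using rC that by (auto simp: frechet_derivative_works)
    have sv: "smooth_on (chart_img c) (\<lambda>y. v y * Z y $ k)" for k
      unfolding v_def Z_def by (rule smooth_on_mult[OF smooth_on_vol_density[OF c] smooth_on_vec_nth[OF smooth_comp[OF c V]]])
    define H where "H = (\<lambda>k y. indicator U y * (r y * (v y * Z y $ k)))"
    have HU: "Ck_on (Suc 0) (H k) U" for k
    proof -
      have "Ck_on (Suc 0) (\<lambda>y. r y * (v y * Z y $ k)) U"
        by (rule Ck_on_mult[OF oU rC Ck_on_subset[OF smooth_on_Ck[OF sv] Ui]])
      then show ?thesis by (subst Ck_on_cong[OF oU, of "H k" "\<lambda>y. r y * (v y * Z y $ k)"]) (simp_all add: H_def)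
    qed
    have H0: "H k y = 0" if "y \<notin> Q'" for k y
    proof (cases "y \<in> U")
      case True
      then have y: "y \<in> chart_img c" using Ui by blast
      then have "chart_inv c y \<notin> Q x \<or> chart_inv c y \<notin> K" using that Q'iff by blast
      then show ?thesis
      proof
        assume "chart_inv c y \<notin> Q x"
        then show ?thesis by (simp add: H_def r_def P.rho_outside)
      next
        assume "chart_inv c y \<notin> K"
        then show ?thesis by (simp add: H_def Z_def comp0[OF c y])
      qed
    qed (simp add: H_def)
    note IH = integral_frechet_derivative_compact_support[OF cQ' Q'U oU HU H0]
    define T where "T = (\<lambda>y. indicator U y * (v y * frechet_derivative r (at y) (Z y)))"
    \<comment> \<open>The product rule for the divergence of \<rho> Z times the density: \<rho>
      times the rate of change of the density, plus the density times d\<rho>(Z).\<close>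
    have pw: "(\<Sum>k\<in>UNIV. frechet_derivative (H k) (at y) (axis k 1)) = P.weight K x y * rate V c y + T y" for y
    proof (cases "y \<in> U")
      case True
      then have y: "y \<in> chart_img c" and yW: "chart_inv c y \<in> W" using Uiff by auto
      have "frechet_derivative (H k) (at y) (axis k 1) =
          r y * frechet_derivative (\<lambda>y. v y * Z y $ k) (at y) (axis k 1) + frechet_derivative r (at y) (axis k 1) * (v y * Z y $ k)" for k
      proof -
        have "((\<lambda>y. r y * (v y * Z y $ k)) has_derivative
            (\<lambda>w. r y * frechet_derivative (\<lambda>y. v y * Z y $ k) (at y) w + frechet_derivative r (at y) w * (v y * Z y $ k))) (at y)"
          by (rule has_derivative_mult[OF rD[OF True] smooth_on_has_derivative[OF sv y]])
        then have "(H k has_derivative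
            (\<lambda>w. r y * frechet_derivative (\<lambda>y. v y * Z y $ k) (at y) w + frechet_derivative r (at y) w * (v y * Z y $ k))) (at y)"
          by (rule has_derivative_transform_within_open[OF _ oU True]) (simp add: H_def)
        then show ?thesis by (simp add: frechet_derivative_apply)
      qed
      then have "(\<Sum>k\<in>UNIV. frechet_derivative (H k) (at y) (axis k 1)) =
          r y * (\<Sum>k\<in>UNIV. frechet_derivative (\<lambda>y. v y * Z y $ k) (at y) (axis k 1))
          + v y * (\<Sum>k\<in>UNIV. Z y $ k * frechet_derivative r (at y) (axis k 1))"
        by (simp add: sum.distrib sum_distrib_left mult_ac)
      also have "(\<Sum>k\<in>UNIV. frechet_derivative (\<lambda>y. v y * Z y $ k) (at y) (axis k 1)) = rate V c y"
        unfolding v_def Z_def by (rule rate_tangential[OF c y V tan, symmetric])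
      also have "(\<Sum>k\<in>UNIV. Z y $ k * frechet_derivative r (at y) (axis k 1)) = frechet_derivative r (at y) (Z y)"
        using linear_eq_axis[OF has_derivative_linear[OF rD[OF True]], of "Z y"] by simp
      \<comment> \<open>The weight contains the indicator of K and r does not; off the closed set K
        the velocity is locally zero, so the rate vanishes and both products agree.\<close>
      also have "r y * rate V c y = P.weight K x y * rate V c y"
      proof (cases "chart_inv c y \<in> K")
        case True
        then show ?thesis using y by (simp add: P.weight_def c_def[symmetric] r_def)
      next
        case False
        then have "rate V c y = 0" by (intro rate_zero[OF c y oK]) (auto simp: V0)
        then show ?thesis by simp
      qed
      finally show ?thesis using True by (simp add: T_def)
    next
      case False
      then have yQ: "y \<in> - Q'" using Q'U by blast
      have "open (- Q')" using cQ' by (simp add: compact_imp_closed open_Compl)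
      then have "(H k has_derivative (\<lambda>w. 0)) (at y)" for k
        by (rule has_derivative_transform_within_open[OF has_derivative_const[of 0] _ yQ]) (simp add: H0)
      from frechet_derivative_apply[OF this]
      have "frechet_derivative (H k) (at y) (axis k 1) = 0" for k by simp
      moreover have "P.weight K x y = 0"
        using False Uiff[of y] P.K_W by (auto simp: P.weight_def c_def[symmetric] indicator_def)
      ultimately show ?thesis using False by (simp add: T_def)
    qed
    have iS: "integrable lborel (\<lambda>y. \<Sum>k\<in>UNIV. frechet_derivative (H k) (at y) (axis k 1))"
      by (intro Bochner_Integration.integrable_sum IH(1))
    have zS: "(\<integral>y. (\<Sum>k\<in>UNIV. frechet_derivative (H k) (at y) (axis k 1)) \<partial>lborel) = 0"
      by (subst Bochner_Integration.integral_sum) (simp_all add: IH)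
    have ir: "integrable lborel (\<lambda>y. P.weight K x y * rate V c y)"
    proof (rule integrable_compact_support[OF P.compact_Q_img P.weight_measurable[OF Kb P.K_W] P.weight_bound[OF x P.K_W] P.weight_outside])
      have "smooth_on (chart_img c) (\<lambda>y. \<Sum>k\<in>UNIV. frechet_derivative (\<lambda>y. v y * Z y $ k) (at y) (axis k 1))"
        by (rule smooth_on_sum[OF open_chart_img[OF c] smooth_on_frechet_derivative[OF sv]])
      then have "smooth_on (chart_img c) (rate V c)"
        by (rule smooth_on_cong) (simp add: rate_tangential[OF c _ V tan] v_def Z_def)
      then show "continuous_on (coords (chart_at A x) ` Q x) (rate V c)"
        unfolding c_def by (rule continuous_on_subset[OF smooth_on_continuous_on P.Q_img_sub])
    qed
    have Te: "T y = (\<Sum>k\<in>UNIV. frechet_derivative (H k) (at y) (axis k 1)) - P.weight K x y * rate V c y" for y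
      using pw[of y] by simp
    have iT: "integrable lborel T" unfolding Te[abs_def] by (rule Bochner_Integration.integrable_diff[OF iS ir])
    have zT: "(\<integral>y. T y \<partial>lborel) = - (\<integral>y. P.weight K x y * rate V c y \<partial>lborel)"
      unfolding Te by (simp add: Bochner_Integration.integral_diff[OF iS ir] zS)
    have qT: "(\<lambda>y. (indicator (chart_img c) y * q x (chart_inv c y)) * vol_density b f c y) = T"
    proof (rule ext)
      fix y
      show "(indicator (chart_img c) y * q x (chart_inv c y)) * vol_density b f c y = T y"
      proof (cases "y \<in> chart_img c")
        case True
        then show ?thesis
          using Uiff[of y] chart_inv_mem[OF c True] coords_chart_inv[OF c True]
          by (auto simp: q_def T_def c_def[symmetric] v_def Z_def r_def chart_deriv_def indicator_def)
      next
        case False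
        then show ?thesis using Uiff[of y] by (simp add: T_def)
      qed
    qed
    have qm: "q x \<in> borel_measurable borel"
    proof -
      have "continuous_on U (\<lambda>y. \<Sum>k\<in>UNIV. Z y $ k * frechet_derivative r (at y) (axis k 1))"
      proof (intro continuous_on_sum continuous_on_mult)
        show "continuous_on U (\<lambda>y. Z y $ k)" for k
          unfolding Z_def by (rule continuous_on_subset[OF smooth_on_continuous_on[OF smooth_on_vec_nth[OF smooth_comp[OF c V]]] Ui])
        show "continuous_on U (\<lambda>y. frechet_derivative r (at y) (axis k 1))" for k using rC by simp
      qed
      then have "continuous_on U (\<lambda>y. frechet_derivative r (at y) (Z y))"
        by (rule continuous_on_eq) (use linear_eq_axis[OF has_derivative_linear[OF rD]] in simp)
      then have "continuous_on (chart_dom c \<inter> W) (\<lambda>z. frechet_derivative r (at (coords c z)) (Z (coords c z)))"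
        by (rule continuous_on_compose2[OF _ continuous_on_subset[OF continuous_on_coords[OF c]]]) (auto simp: U_def)
      then have "(\<lambda>z. indicator (chart_dom c \<inter> W) z *\<^sub>R frechet_derivative r (at (coords c z)) (Z (coords c z))) \<in> borel_measurable borel"
        by (intro borel_measurable_continuous_on_indicator) (use open_chart_dom[OF c] P.open_W in auto)
      moreover have "(\<lambda>z. indicator (chart_dom c \<inter> W) z *\<^sub>R frechet_derivative r (at (coords c z)) (Z (coords c z))) = q x"
        by (auto simp: q_def c_def[symmetric] r_def Z_def chart_deriv_def indicator_def fun_eq_iff)
      ultimately show ?thesis by simp
    qed
    have q0: "q x z = 0" if "z \<notin> chart_dom c" for z using that by (simp add: q_def c_def)
    note J = integral_in_chart[OF h M c qm q0, unfolded qT]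
    show ?thesis using J iT zT by (simp add: c_def)
  qed
  have "(\<Sum>x\<in>X. q x z) = 0" for z
  proof (cases "z \<in> K")
    case False
    have "q x z = 0" for x
    proof (cases "z \<in> chart_dom (chart_at A x) \<inter> W")
      case True
      let ?c = "chart_at A x"
      have m: "coords ?c z \<in> coords ?c ` (chart_dom ?c \<inter> W)" using True by blast
      have "(\<rho> x \<circ> chart_inv ?c) differentiable (at (coords ?c z))"
        using P.rho_C1[OF chart_at(1), of x x] m unfolding Ck_on.simps by blast
      then have l: "linear (chart_deriv (\<rho> x) ?c (coords ?c z))"
        unfolding chart_deriv_def frechet_derivative_works by (rule has_derivative_linear)
      have "comp V ?c (coords ?c z) = 0"
        by (rule comp0[OF chart_at(1)]) (use True False chart_inv_coords[OF chart_at(1)] in auto)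
      then show ?thesis using linear_0[OF l] by (simp add: q_def)
    qed (auto simp: q_def)
    then show ?thesis by simp
  next
    case True
    then have zW: "z \<in> W" using P.K_W by blast
    obtain w where w: "V z = tangent_map A f z w" using tan[of z] by blast
    let ?d = "chart_at A z"
    have m: "coords ?d z \<in> coords ?d ` (chart_dom ?d \<inter> W)" using chart_at(2) zW by blast
    have df: "(\<rho> x \<circ> chart_inv ?d) differentiable (at (coords ?d z))" for x
      using P.rho_C1[OF chart_at(1), of x z] m unfolding Ck_on.simps by blast
    \<comment> \<open>The chart value is independent of the chart: w is the vector with df(w) = V,
      unique because df is injective. Off the chart of x both sides are zero.\<close>
    have "q x z = tangent_map A (\<rho> x) z w" for x
    proof (cases "z \<in> chart_dom (chart_at A x)")
      case True
      let ?c = "chart_at A x"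
      have y: "coords ?c z \<in> chart_img ?c" using True by blast
      have "tangent_map A f z (to_chart_at ?c z (comp V ?c (coords ?c z))) = V z"
        using chart_deriv_tangent_map_smooth[OF smooth_f chart_at(1) True, of "comp V ?c (coords ?c z)"]
          chart_deriv_comp[where V=V, OF chart_at(1) y tan] chart_inv_coords[OF chart_at(1) True] by simp
      then have "to_chart_at ?c z (comp V ?c (coords ?c z)) = w"
        using inj_tangent_map_f[of z] unfolding w by (rule injD[rotated])
      then show ?thesis
        using chart_deriv_tangent_map[OF chart_at(1) True df[of x], of "comp V ?c (coords ?c z)"] True zW by (simp add: q_def)
    next
      case False
      then have "z \<notin> Q x" using P.Q_dom[of x] by blast
      then have "tangent_map A (\<rho> x) z = tangent_map A (\<lambda>_. 0) z"
        by (intro tangent_map_cong[of "- Q x"]) (use P.compact_Q[of x] P.rho_outside in \<open>auto simp: compact_imp_closed\<close>)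
      then show ?thesis using False by (simp add: q_def tangent_map_def o_def frechet_derivative_const)
    qed
    then have "(\<Sum>x\<in>X. q x z) = (\<Sum>x\<in>X. tangent_map A (\<rho> x) z w)" by simp
    also have "\<dots> = tangent_map A (\<lambda>z. \<Sum>x\<in>X. \<rho> x z) z w"
    proof -
      have "((\<lambda>y. \<Sum>x\<in>X. (\<rho> x \<circ> chart_inv ?d) y) has_derivative (\<lambda>v. \<Sum>x\<in>X. tangent_map A (\<rho> x) z v)) (at (coords ?d z))"
        unfolding tangent_map_def using df unfolding frechet_derivative_works by (intro has_derivative_sum) (simp add: o_def)
      then have "(((\<lambda>z. \<Sum>x\<in>X. \<rho> x z) \<circ> chart_inv ?d) has_derivative (\<lambda>v. \<Sum>x\<in>X. tangent_map A (\<rho> x) z v)) (at (coords ?d z))"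
        by (simp add: o_def)
      then show ?thesis unfolding tangent_map_def[of _ "\<lambda>z. \<Sum>x\<in>X. \<rho> x z"] by (simp add: frechet_derivative_apply)
    qed
    also have "tangent_map A (\<lambda>z. \<Sum>x\<in>X. \<rho> x z) z = tangent_map A (\<lambda>_. 1) z"
      by (rule tangent_map_cong[OF P.open_W zW P.rho_sum])
    also have "tangent_map A (\<lambda>_. 1 :: real) z w = 0" by (simp add: tangent_map_def o_def frechet_derivative_const)
    finally show ?thesis .
  qed
  then have "(\<integral>z. (\<Sum>x\<in>X. q x z) \<partial>?M) = 0" by simp
  then have "(\<Sum>x\<in>X. \<integral>z. q x z \<partial>?M) = 0"
    using Bochner_Integration.integral_sum[of X ?M q] main by simp
  moreover have "(\<Sum>x\<in>X. \<integral>y. P.weight K x y * rate V (chart_at A x) y \<partial>lborel) = - (\<Sum>x\<in>X. \<integral>z. q x z \<partial>?M)"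
    unfolding sum_negf[symmetric] by (rule sum.cong[OF refl]) (use main in blast)
  ultimately show ?thesis by simp
qed

end

text \<open>Both derivatives are integrals of a rate linear in the velocity, so they differ by the
  integral for a tangential field. The larger set K2 leaves room for a comparison variation whose
  support exceeds that of the first.\<close>

theorem (in nondegenerate_map) volume_derivative_normal_part:
  assumes F1: "variation A S1 f \<delta>1 K1 F1" and F2: "variation A S2 f \<delta>2 K2 F2" and K: "K1 \<subseteq> K2"
    and tan: "\<And>x. vector_derivative (\<lambda>t. F1 t x) (at 0) - vector_derivative (\<lambda>t. F2 t x) (at 0) \<in> range (tangent_map A f x)"
    and D: "((\<lambda>t. measure (volume_measure A b (F2 t)) K2) has_real_derivative D) (at 0)"
  shows "((\<lambda>t. measure (volume_measure A b (F1 t)) K1) has_real_derivative D) (at 0)"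
proof -
  interpret V1: volume_variation A b f S1 \<delta>1 K1 F1 by unfold_locales (rule F1)
  interpret V2: volume_variation A b f S2 \<delta>2 K2 F2 by unfold_locales (rule F2)
  obtain X W \<rho> Q where P: "C1_partition A K2 X W \<rho> Q" using C1_partition_exists[OF V2.compact_K] by blast
  interpret P: C1_partition A K2 X W \<rho> Q by (rule P)
  let ?c = "chart_at A"
  define V where "V = (\<lambda>x. V1.velocity x - V2.velocity x)"
  have sV: "smooth_map A V" unfolding V_def smooth_map_def
  proof
    fix c assume "c \<in> A"
    then show "smooth_on (chart_img c) ((\<lambda>x. V1.velocity x - V2.velocity x) \<circ> chart_inv c)"
      using smooth_on_diff[OF smooth_map_chart[OF V1.smooth_velocity] smooth_map_chart[OF V2.smooth_velocity]] by (simp add: o_def)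
  qed
  have V0: "V x = 0" if "x \<notin> K2" for x
    using V1.velocity_outside[of x] V2.velocity_outside[of x] that K by (auto simp: V_def)
  have K1b: "K1 \<in> sets borel" and K2b: "K2 \<in> sets borel" and oK1: "open (- K1)"
    using V1.compact_K V2.compact_K by (simp_all add: compact_imp_closed borel_closed open_Compl)
  have cont: "integrable lborel (\<lambda>y. P.weight K2 x y * rate U (?c x) y)" if x: "x \<in> X" and U: "smooth_map A U" for x and U :: "'m \<Rightarrow> 'e"
  proof (rule integrable_compact_support[OF P.compact_Q_img P.weight_measurable[OF K2b P.K_W] P.weight_bound[OF x P.K_W] P.weight_outside])
    have c: "?c x \<in> A" by (rule chart_at)
    have sg: "smooth_on (chart_img (?c x)) (gram b (?c x) f)" by (rule smooth_on_gram[OF b smooth_f c])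
    have sd: "smooth_on (chart_img (?c x)) (gram_dot U (?c x))"
    proof (intro smooth_on_vec open_chart_img c)
      show "smooth_on (chart_img (?c x)) (\<lambda>y. gram_dot U (?c x) y $ i $ j)" for i j
        using smooth_on_add[OF smooth_on_bilinear[OF bb smooth_on_chart_deriv[OF U c] smooth_on_chart_deriv[OF smooth_f c]]
            smooth_on_bilinear[OF bb smooth_on_chart_deriv[OF smooth_f c] smooth_on_chart_deriv[OF U c]]]
        by (simp add: gram_dot_def)
    qed
    have nth: "continuous_on (chart_img (?c x)) (\<lambda>y. h y $ i $ j)" if "smooth_on (chart_img (?c x)) h" for h :: "real ^ 'n \<Rightarrow> real ^ 'n ^ 'n" and i j
      by (rule smooth_on_continuous_on[OF smooth_on_vec_nth[OF smooth_on_vec_nth[OF that]]])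
    have "continuous_on (chart_img (?c x)) (\<lambda>y. det_deriv (gram b (?c x) f y) (gram_dot U (?c x) y))"
      unfolding det_deriv_def
      by (intro continuous_on_sum continuous_on_mult continuous_on_const continuous_on_prod nth sg sd)
    moreover have "continuous_on (chart_img (?c x)) (\<lambda>y. det (gram b (?c x) f y))"
      by (rule smooth_on_continuous_on[OF smooth_on_det[OF sg]])
    ultimately have "continuous_on (chart_img (?c x)) (rate U (?c x))"
      unfolding rate_def[abs_def] using det_gram_nonzero[OF c]
      by (intro continuous_on_mult continuous_on_divide continuous_on_sgn continuous_on_const continuous_on_real_sqrt continuous_on_rabs) auto
    then show "continuous_on (coords (?c x) ` Q x) (rate U (?c x))" by (rule continuous_on_subset[OF _ P.Q_img_sub])
  qed
  \<comment> \<open>Off K1 the first velocity vanishes locally and with it the rate, so both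
    variations can be integrated over K2 with the same weights.\<close>
  have w12: "P.weight K1 x y * rate V1.velocity (?c x) y = P.weight K2 x y * rate V1.velocity (?c x) y" for x y
  proof (cases "y \<in> chart_img (?c x) \<and> chart_inv (?c x) y \<notin> K1")
    case True
    then have "rate V1.velocity (?c x) y = 0"
      by (intro rate_zero[OF chart_at(1) _ oK1]) (auto simp: V1.velocity_outside)
    then show ?thesis by simp
  next
    case False
    then show ?thesis using K by (auto simp: P.weight_def indicator_def)
  qed
  have "(\<Sum>x\<in>X. \<integral>y. P.weight K1 x y * rate V1.velocity (?c x) y \<partial>lborel) - (\<Sum>x\<in>X. \<integral>y. P.weight K2 x y * rate V2.velocity (?c x) y \<partial>lborel)
      = (\<Sum>x\<in>X. \<integral>y. P.weight K2 x y * rate V (?c x) y \<partial>lborel)"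
    unfolding w12 sum_subtractf[symmetric]
  proof (rule sum.cong[OF refl])
    fix x assume x: "x \<in> X"
    have "(\<integral>y. P.weight K2 x y * rate V1.velocity (?c x) y \<partial>lborel) - (\<integral>y. P.weight K2 x y * rate V2.velocity (?c x) y \<partial>lborel)
      = (\<integral>y. P.weight K2 x y * rate V1.velocity (?c x) y - P.weight K2 x y * rate V2.velocity (?c x) y \<partial>lborel)"
      by (rule Bochner_Integration.integral_diff[symmetric, OF cont[OF x V1.smooth_velocity] cont[OF x V2.smooth_velocity]])
    also have "\<dots> = (\<integral>y. P.weight K2 x y * rate V (?c x) y \<partial>lborel)"
    proof (rule Bochner_Integration.integral_cong[OF refl])
      fix y
      show "P.weight K2 x y * rate V1.velocity (?c x) y - P.weight K2 x y * rate V2.velocity (?c x) y = P.weight K2 x y * rate V (?c x) y"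
      proof (cases "y \<in> chart_img (?c x)")
        case True
        then show ?thesis
          unfolding V_def rate_diff[OF V1.smooth_velocity V2.smooth_velocity chart_at(1) True] by (simp add: right_diff_distrib)
      qed (simp add: P.weight_def)
    qed
    finally show "(\<integral>y. P.weight K2 x y * rate V1.velocity (?c x) y \<partial>lborel) - (\<integral>y. P.weight K2 x y * rate V2.velocity (?c x) y \<partial>lborel)
      = (\<integral>y. P.weight K2 x y * rate V (?c x) y \<partial>lborel)" .
  qed
  also have "\<dots> = 0"
    by (rule tangential_integral[OF P sV _ V0]) (use tan in \<open>simp add: V_def V1.velocity_def V2.velocity_def\<close>)
  finally have e: "(\<Sum>x\<in>X. \<integral>y. P.weight K1 x y * rate V1.velocity (?c x) y \<partial>lborel) = (\<Sum>x\<in>X. \<integral>y. P.weight K2 x y * rate V2.velocity (?c x) y \<partial>lborel)"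
    by simp
  have "(\<Sum>x\<in>X. \<integral>y. P.weight K2 x y * rate V2.velocity (?c x) y \<partial>lborel) = D"
    by (rule DERIV_unique[OF V2.volume_derivative[OF P V2.compact_K subset_refl] D])
  then show ?thesis using V1.volume_derivative[OF P V1.compact_K K] by (simp only: e)
qed

section \<open>Normal variations\<close>

lemma eps_square_pos:
  assumes "\<bar>s\<bar> < 1"
  shows "0 < 1 + eps sf * s\<^sup>2"
proof -
  have "s\<^sup>2 < 1" using assms by (simp add: abs_square_less_1)
  then show ?thesis by (cases sf) (auto simp: add_pos_nonneg)
qed

lemma variation_mono:
  assumes "variation A S f \<delta> K F" "0 < \<delta>'" "\<delta>' \<le> \<delta>" "\<And>c. c \<in> A \<Longrightarrow> open (coords c ` chart_dom c)"
  shows "variation A S f \<delta>' K F"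
  unfolding variation_def
proof (intro conjI ballI allI impI)
  fix c assume c: "c \<in> A"
  show "smooth_on ({-\<delta>'<..<\<delta>'} \<times> coords c ` chart_dom c) (\<lambda>(t, y). F t (chart_inv c y))"
  proof (rule smooth_on_subset)
    show "smooth_on ({-\<delta><..<\<delta>} \<times> coords c ` chart_dom c) (\<lambda>(t, y). F t (chart_inv c y))"
      using assms(1) c unfolding variation_def by blast
    show "open ({-\<delta>'<..<\<delta>'} \<times> coords c ` chart_dom c)" by (intro open_Times assms(4) c) simp
  qed (use assms(3) in auto)
qed (use assms in \<open>auto simp: variation_def\<close>)

context hypersurface
begin

lemma hyper_frame_tangent: "hyper_frame sf (\<phi> x) (N x) (tangent_map A \<phi> x)"
  using gauss_frame_tangent by (rule gauss_frame.axioms(1))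

text \<open>Moves straight along the normal and projects radially back to the space form. A root
  replaces the trigonometric or hyperbolic functions of the normal geodesic and treats both space
  forms alike.\<close>

definition normal_push :: "('m \<Rightarrow> real) \<Rightarrow> real \<Rightarrow> 'm \<Rightarrow> real ^ ('n + 2)" where
  "normal_push h t x = (1 / sqrt (1 + eps sf * (t * h x)\<^sup>2)) *\<^sub>R (\<phi> x + (t * h x) *\<^sub>R N x)"

lemma normal_push_variation:
  assumes h: "smooth_map A h" and K: "compact K" "\<And>x. x \<notin> K \<Longrightarrow> h x = 0"
    and \<delta>: "0 < \<delta>" "\<And>t x. \<bar>t\<bar> < \<delta> \<Longrightarrow> \<bar>t * h x\<bar> < 1"
  shows "variation A (model_space sf) \<phi> \<delta> K (normal_push h)"
  unfolding variation_def
proof (intro conjI ballI allI impI)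
  show "normal_push h 0 = \<phi>" by (simp add: normal_push_def fun_eq_iff)
  show "normal_push h t x \<in> model_space sf" if "\<bar>t\<bar> < \<delta>" for t x
  proof -
    interpret F: hyper_frame sf "\<phi> x" "N x" "tangent_map A \<phi> x" by (rule hyper_frame_tangent)
    show ?thesis unfolding normal_push_def by (rule model_space_normalize[OF F.p F.p\<nu> F.\<nu>\<nu> \<delta>(2)[OF that]])
  qed
  show "normal_push h t x = \<phi> x" if "x \<notin> K" for t x using K(2)[OF that] by (simp add: normal_push_def)
  fix c assume c: "c \<in> A"
  let ?W = "{-\<delta><..<\<delta>} \<times> chart_img c"
  have W: "open ?W" by (intro open_Times open_chart_img c) simp
  have snd: "smooth_on ?W (\<lambda>z. (f \<circ> chart_inv c) (snd z))" if "smooth_map A f" for f :: "'m \<Rightarrow> 'e::euclidean_space"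
    by (rule smooth_on_compose[OF smooth_on_linear[OF W bounded_linear_snd] smooth_map_chart[OF that c]]) auto
  have s: "smooth_on ?W (\<lambda>z. fst z * (h \<circ> chart_inv c) (snd z))"
    by (rule smooth_on_mult[OF smooth_on_linear[OF W bounded_linear_fst] snd[OF h]])
  have q: "smooth_on ?W (\<lambda>z. 1 + eps sf * ((fst z * (h \<circ> chart_inv c) (snd z)) * (fst z * (h \<circ> chart_inv c) (snd z))))"
    by (rule smooth_on_add[OF smooth_on_const[OF W] smooth_on_mult[OF smooth_on_const[OF W] smooth_on_mult[OF s s]]])
  have pos: "0 < 1 + eps sf * ((fst z * (h \<circ> chart_inv c) (snd z)) * (fst z * (h \<circ> chart_inv c) (snd z)))" if "z \<in> ?W" for z
    using eps_square_pos[OF \<delta>(2)[of "fst z" "chart_inv c (snd z)"], of sf] that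
    by (auto simp: power2_eq_square)
  have sq: "smooth_on ?W (\<lambda>z. sqrt (1 + eps sf * ((fst z * (h \<circ> chart_inv c) (snd z)) * (fst z * (h \<circ> chart_inv c) (snd z)))))"
    by (rule smooth_on_sqrt[OF q pos])
  have r: "smooth_on ?W (\<lambda>z. 1 / sqrt (1 + eps sf * ((fst z * (h \<circ> chart_inv c) (snd z)) * (fst z * (h \<circ> chart_inv c) (snd z)))))"
  proof (rule smooth_on_divide[OF smooth_on_const[OF W] sq])
    show "sqrt (1 + eps sf * ((fst z * (h \<circ> chart_inv c) (snd z)) * (fst z * (h \<circ> chart_inv c) (snd z)))) \<noteq> 0" if "z \<in> ?W" for z
      using real_sqrt_gt_zero[OF pos[OF that]] by linarith
  qed
  have "smooth_on ?W (\<lambda>z. (\<phi> \<circ> chart_inv c) (snd z) + (fst z * (h \<circ> chart_inv c) (snd z)) *\<^sub>R (N \<circ> chart_inv c) (snd z))"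
    by (rule smooth_on_add[OF snd[OF smooth_phi] smooth_on_scaleR[OF s snd[OF smooth_N]]])
  from smooth_on_scaleR[OF r this]
  show "smooth_on ?W (\<lambda>(t, y). normal_push h t (chart_inv c y))"
    unfolding normal_push_def split_def power2_eq_square by simp
qed (use \<delta> K in auto)

text \<open>The normalising factor depends on t through its square, so it is stationary at
  0.\<close>

lemma normal_push_velocity: "((\<lambda>t. normal_push h t x) has_vector_derivative h x *\<^sub>R N x) (at 0)"
proof -
  have 1: "((\<lambda>t. 1 + eps sf * (t * h x)\<^sup>2) has_real_derivative 0) (at 0)"
    by (auto intro!: derivative_eq_intros)
  have "(sqrt has_real_derivative inverse (sqrt 1) / 2) (at 1)" by (rule DERIV_real_sqrt) simp
  then have "(sqrt has_real_derivative 1 / 2) (at (1 + eps sf * (0 * h x)\<^sup>2))" by simp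
  from DERIV_chain2[OF this 1] have "((\<lambda>t. sqrt (1 + eps sf * (t * h x)\<^sup>2)) has_real_derivative 0) (at 0)" by simp
  from DERIV_inverse_fun[OF this] have r: "((\<lambda>t. inverse (sqrt (1 + eps sf * (t * h x)\<^sup>2))) has_real_derivative 0) (at 0)"
    by simp
  have v: "((\<lambda>t. \<phi> x + (t * h x) *\<^sub>R N x) has_vector_derivative h x *\<^sub>R N x) (at 0)"
    by (auto intro!: derivative_eq_intros)
  from has_vector_derivative_scaleR[OF r v] show ?thesis
    by (simp add: normal_push_def[abs_def] inverse_eq_divide)
qed

text \<open>Injectivity of the differential is an open condition in time and position. Compactness
  of K gives a common time bound, and outside K nothing moves.\<close>

lemma immersion_variation_exists:
  assumes h: "smooth_map A h" and K: "compact K" "\<And>x. x \<notin> K \<Longrightarrow> h x = 0"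
  shows "\<exists>\<delta>. hyp_variation A sf \<phi> \<delta> K (normal_push h)"
proof -
  have "compact (h ` K)"
    by (rule compact_continuous_image[OF continuous_on_subset[OF smooth_map_continuous[OF h]] K(1)]) simp
  then have "bounded (h ` K)" by (rule compact_imp_bounded)
  then obtain B where B: "0 < B" "\<And>z. z \<in> h ` K \<Longrightarrow> norm z \<le> B" unfolding bounded_pos by blast
  have hB: "\<bar>h x\<bar> \<le> B" for x using B K(2)[of x] by (cases "x \<in> K") auto
  \<comment> \<open>With B a bound for the absolute value of h, this keeps |t h| below 1, where the
    radial projection is defined.\<close>
  define \<delta>0 where "\<delta>0 = 1 / B"
  have \<delta>0: "0 < \<delta>0" using B(1) by (simp add: \<delta>0_def)
  have small: "\<bar>t * h x\<bar> < 1" if "\<bar>t\<bar> < \<delta>0" for t x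
  proof -
    have "\<bar>t\<bar> * \<bar>h x\<bar> \<le> \<bar>t\<bar> * B" by (rule mult_left_mono[OF hB]) simp
    also have "\<dots> < 1" using that B(1) by (simp add: \<delta>0_def less_divide_eq)
    finally show ?thesis by (simp add: abs_mult)
  qed
  have var0: "variation A (model_space sf) \<phi> \<delta>0 K (normal_push h)"
    by (rule normal_push_variation[OF h K \<delta>0 small])
  have bi: "bilinear ((\<bullet>) :: real ^ ('n + 2) \<Rightarrow> _)"
    using bounded_bilinear_inner bilinear_conv_bounded_bilinear by blast
  \<comment> \<open>For the Euclidean inner product a nonzero Gram determinant means an injective
    differential, so the smoothness facts about Gram matrices of a variation apply to this
    question.\<close>
  interpret V: volume_variation A "(\<bullet>)" \<phi> "model_space sf" \<delta>0 K "normal_push h"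
  proof unfold_locales
    show "nondegenerate_metric A (\<bullet>) \<phi>"
      unfolding nondegenerate_metric_def
    proof (intro allI impI)
      fix x v assume "\<forall>w. tangent_map A \<phi> x v \<bullet> tangent_map A \<phi> x w = 0"
      then have "tangent_map A \<phi> x v = 0" using inner_eq_zero_iff by blast
      then show "v = 0"
        using linear_injective_0[OF linear_tangent_map[OF smooth_phi]] inj_tangent_phi by blast
    qed
  qed (use bi smooth_phi var0 in \<open>auto simp: inner_commute\<close>)
  have loc: "\<exists>\<eta> W. 0 < \<eta> \<and> open W \<and> x \<in> W \<and> (\<forall>t z. \<bar>t\<bar> < \<eta> \<longrightarrow> z \<in> W \<longrightarrow> inj (tangent_map A (normal_push h t) z))" for x
  proof -
    define c where "c = chart_at A x"
    have c: "c \<in> A" and x: "x \<in> chart_dom c" by (simp_all add: c_def chart_at)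
    have y: "coords c x \<in> chart_img c" using x by blast
    note sD = smooth_on_det[OF V.smooth_jG[OF c]]
    define Wn where "Wn = (V.I \<times> chart_img c) \<inter> (\<lambda>z. det (V.jG c z)) -` (- {0})"
    have oW: "open Wn" unfolding Wn_def
      by (rule continuous_open_preimage[OF smooth_on_continuous_on[OF sD] smooth_onD_open[OF sD]]) auto
    have "(0, coords c x) \<in> Wn"
      using V.zero_in_I y V.jG_gram[OF c V.zero_in_I y] V.det_gram_nonzero[OF c y] by (simp add: Wn_def V.F_0)
    then obtain A0 B0 where AB: "open A0" "open B0" "0 \<in> A0" "coords c x \<in> B0" "A0 \<times> B0 \<subseteq> Wn"
      using open_prod_elim[OF oW] by (metis mem_Sigma_iff)
    obtain \<eta> where \<eta>: "0 < \<eta>" "ball 0 \<eta> \<subseteq> A0" using AB openE by blast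
    define W where "W = chart_dom c \<inter> coords c -` B0"
    have "open W" unfolding W_def
      by (rule continuous_open_preimage[OF continuous_on_coords[OF c] open_chart_dom[OF c] AB(2)])
    moreover have "x \<in> W" using x AB(4) by (simp add: W_def)
    moreover have "inj (tangent_map A (normal_push h t) z)" if t: "\<bar>t\<bar> < \<eta>" and z: "z \<in> W" for t z
    proof -
      have zc: "z \<in> chart_dom c" using z by (simp add: W_def)
      have yc: "coords c z \<in> chart_img c" using zc by blast
      have "(t, coords c z) \<in> Wn"
        using AB(5) \<eta>(2) t z by (auto simp: W_def dist_real_def)
      then have tI: "t \<in> V.I" and D: "det (V.jG c (t, coords c z)) \<noteq> 0" by (auto simp: Wn_def)
      note sF = V.smooth_F[OF tI]
      have D': "det (form_matrix (\<lambda>v w. chart_deriv (normal_push h t) c (coords c z) v \<bullet> chart_deriv (normal_push h t) c (coords c z) w)) \<noteq> 0"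
        using D unfolding V.jG_gram[OF c tI yc] gram_form_matrix .
      have inj0: "v = 0" if "chart_deriv (normal_push h t) c (coords c z) v = 0" for v
      proof -
        have "\<forall>w. chart_deriv (normal_push h t) c (coords c z) v \<bullet> chart_deriv (normal_push h t) c (coords c z) w = 0"
          using that by simp
        then show ?thesis
          using D' unfolding det_form_matrix_nonzero[OF bilinear_pullback[OF bi linear_chart_deriv[OF sF c yc]]] by blast
      qed
      have "v = 0" if "tangent_map A (normal_push h t) z v = 0" for v
      proof -
        obtain v' where v': "v = to_chart_at c z v'" using surj_to_chart_at[OF c zc] by (rule surjE)
        then have "chart_deriv (normal_push h t) c (coords c z) v' = 0"
          using chart_deriv_tangent_map_smooth[OF sF c zc, of v'] that by simp
        then have "v' = 0" by (rule inj0)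
        then show ?thesis using v' linear_0[OF linear_to_chart_at[OF c zc]] by simp
      qed
      then show ?thesis using linear_injective_0[OF linear_tangent_map[OF sF]] by blast
    qed
    ultimately show ?thesis using \<eta>(1) by blast
  qed
  then obtain \<eta> W where eW: "\<And>x. 0 < \<eta> x" "\<And>x. open (W x)" "\<And>x. x \<in> W x"
    "\<And>x t z. \<bar>t\<bar> < \<eta> x \<Longrightarrow> z \<in> W x \<Longrightarrow> inj (tangent_map A (normal_push h t) z)" by metis
  have "K \<subseteq> (\<Union>x\<in>UNIV. W x)" using eW(3) by blast
  then obtain X where X: "X \<subseteq> UNIV" "finite X" "K \<subseteq> (\<Union>x\<in>X. W x)"
    by (rule compactE_image[OF K(1) eW(2)])
  \<comment> \<open>Finitely many of the local time bounds suffice by compactness; inserting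
    \<open>\<delta>0\<close> also covers an empty cover.\<close>
  define \<delta> where "\<delta> = Min (insert \<delta>0 (\<eta> ` X))"
  have d: "0 < \<delta>" unfolding \<delta>_def using X(2) \<delta>0 eW(1) by (subst Min_gr_iff) auto
  have d0: "\<delta> \<le> \<delta>0" unfolding \<delta>_def using X(2) by (intro Min_le) auto
  have dX: "\<delta> \<le> \<eta> x" if "x \<in> X" for x unfolding \<delta>_def using X(2) that by (intro Min_le) auto
  have "hyp_variation A sf \<phi> \<delta> K (normal_push h)"
  proof unfold_locales
    show "variation A (model_space sf) \<phi> \<delta> K (normal_push h)"
      by (rule variation_mono[OF var0 d d0 open_chart_img])
    fix t assume t: "\<bar>t\<bar> < \<delta>"
    have "t \<in> V.I" using t d0 by auto
    note sF = V.smooth_F[OF this]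
    have "inj (tangent_map A (normal_push h t) z)" for z
    proof (cases "z \<in> K")
      case True
      then obtain x where x: "x \<in> X" "z \<in> W x" using X(3) by blast
      then show ?thesis using eW(4)[of t x z] t dX[OF x(1)] by simp
    next
      case False
      have "open (- K)" using K(1) by (simp add: compact_imp_closed open_Compl)
      then have "tangent_map A (normal_push h t) z = tangent_map A \<phi> z"
        by (rule tangent_map_cong) (use False K(2) in \<open>auto simp: normal_push_def\<close>)
      then show ?thesis using inj_tangent_phi by simp
    qed
    then show "immersion A (normal_push h t)" using sF by (simp add: immersion_def)
  qed
  then show ?thesis by blast
qed

section \<open>The two implications\<close>

lemma nondegenerate_map_G:
  "nondegenerate_metric A (wedge_inner sf) G \<Longrightarrow> nondegenerate_map A (wedge_inner sf) G"
  by unfold_locales (simp_all add: bilinear_wedge_inner wedge_inner_commute smooth_G)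

lemma hamiltonian_minimal_imp_W_critical:
  assumes nd: "nondegenerate_metric A (wedge_inner sf) G" and min: "hamiltonian_minimal A sf G"
  shows "W_critical A sf \<phi>"
  unfolding W_critical_def
proof (intro allI impI)
  fix \<delta> K F
  assume "variation A (model_space sf) \<phi> \<delta> K F \<and> (\<forall>t. \<bar>t\<bar> < \<delta> \<longrightarrow> immersion A (F t))"
  then interpret V: hyp_variation A sf \<phi> \<delta> K F by unfold_locales auto
  have "K \<in> sets borel" using V.compact_K by (simp add: compact_imp_closed borel_closed)
  moreover have "((\<lambda>t. measure (volume_measure A (wedge_inner sf) (gauss_map A sf (F t))) K) has_real_derivative 0) (at 0)"
    using min V.hamiltonian_variation_G[OF nd] unfolding hamiltonian_minimal_def by blast
  ultimately show "((\<lambda>t. W_functional A sf K (F t)) has_real_derivative 0) (at 0)"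
    by (simp only: V.W_functional_derivative_iff)
qed

lemma W_critical_imp_hamiltonian_minimal:
  assumes imm: "immersion A G" and nd: "nondegenerate_metric A (wedge_inner sf) G" and crit: "W_critical A sf \<phi>"
  shows "hamiltonian_minimal A sf G"
  unfolding hamiltonian_minimal_def
proof (intro conjI allI impI)
  show "lagrangian_immersion A sf G" by (rule lagrangian_G[OF imm])
  show "nondegenerate_metric A (wedge_inner sf) G" by (rule nd)
  fix \<delta> K F
  assume HV: "hamiltonian_variation A sf G \<delta> K F"
  then obtain u :: "'m \<Rightarrow> real" and C where var: "variation A (geodesic_space sf) G \<delta> K F"
    and u: "smooth_map A u" and C: "compact C" "\<And>x. x \<notin> C \<Longrightarrow> u x = 0"
    and nc: "\<And>x. normal_component A (wedge_inner sf) G x (vector_derivative (\<lambda>t. F t x) (at 0)) =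
             J_structure sf (G x) (tangent_map A G x (metric_gradient A (wedge_inner sf) G u x))"
    unfolding hamiltonian_variation_def by blast
  interpret NM: nondegenerate_map A "wedge_inner sf" G by (rule nondegenerate_map_G[OF nd])
  have cK: "compact K" using var by (simp add: variation_def)
  \<comment> \<open>The normal speed whose Hamiltonian is u:
    \<open>- <h N, N> = - eps sf * h = u\<close>, as \<open>eps sf\<close> has square 1.\<close>
  define h where "h = (\<lambda>x. - eps sf * u x)"
  have sh: "smooth_map A h"
    unfolding smooth_map_def
  proof
    fix c assume c: "c \<in> A"
    have "smooth_on (chart_img c) (\<lambda>y. - eps sf * (u \<circ> chart_inv c) y)"
      by (rule smooth_on_mult[OF smooth_on_const[OF open_chart_img[OF c]] smooth_map_chart[OF u c]])
    then show "smooth_on (chart_img c) (h \<circ> chart_inv c)" by (simp add: h_def o_def)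
  qed
  \<comment> \<open>The comparison variation must be supported where u is, and its compact set must
    contain K for the comparison of the two volumes.\<close>
  have cKC: "compact (K \<union> C)" by (rule compact_Un[OF cK C(1)])
  have h0: "h x = 0" if "x \<notin> K \<union> C" for x using C(2)[of x] that by (simp add: h_def)
  obtain \<delta>' where "hyp_variation A sf \<phi> \<delta>' (K \<union> C) (normal_push h)"
    using immersion_variation_exists[OF sh cKC h0] by blast
  then interpret V: hyp_variation A sf \<phi> \<delta>' "K \<union> C" "normal_push h" .
  have "((\<lambda>t. W_functional A sf (K \<union> C) (normal_push h t)) has_real_derivative 0) (at 0)"
    using crit V.var V.imm unfolding W_critical_def by blast
  moreover have "K \<union> C \<in> sets borel" using cKC by (simp add: compact_imp_closed borel_closed)
  ultimately have D: "((\<lambda>t. measure (volume_measure A (wedge_inner sf) (gauss_map A sf (normal_push h t))) (K \<union> C)) has_real_derivative 0) (at 0)"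
    by (simp only: V.W_functional_derivative_iff)
  have ham: "V.hamiltonian = u"
  proof (rule ext)
    fix x
    interpret F: hyper_frame sf "\<phi> x" "N x" "tangent_map A \<phi> x" by (rule hyper_frame_tangent)
    have "V.velocity x = h x *\<^sub>R N x"
      unfolding V.velocity_def by (rule vector_derivative_at[OF normal_push_velocity])
    then have "V.hamiltonian x = - (h x * eps sf)"
      by (simp add: V.hamiltonian_def pinner_simps F.frame_simps)
    then show "V.hamiltonian x = u x" by (simp add: h_def mult.commute mult.left_commute[of "eps sf"] mult.assoc[symmetric])
  qed
  show "((\<lambda>t. measure (volume_measure A (wedge_inner sf) (F t)) K) has_real_derivative 0) (at 0)"
  proof (rule NM.volume_derivative_normal_part[OF var V.variation_G _ _ D])
    fix x
    let ?v1 = "vector_derivative (\<lambda>t. F t x) (at 0)" and ?v2 = "vector_derivative (\<lambda>t. gauss_map A sf (normal_push h t) x) (at 0)"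
    let ?nc = "normal_component A (wedge_inner sf) G x"
    \<comment> \<open>Both normal components are J applied to the image of the gradient of u under
      the differential of the Gauss map; so the two velocities differ by a tangential
      vector.\<close>
    have "?nc ?v1 = ?nc ?v2"
      unfolding nc V.normal_component_velocity[OF nd] ham ..
    moreover obtain a where "?v1 - ?nc ?v1 = tangent_map A G x a"
      using normal_component_in_range[OF bilinear_wedge_inner nd smooth_G, where V="?v1"] by blast
    moreover obtain b where "?v2 - ?nc ?v2 = tangent_map A G x b"
      using normal_component_in_range[OF bilinear_wedge_inner nd smooth_G, where V="?v2"] by blast
    ultimately have "?v1 - ?v2 = tangent_map A G x (a - b)"
      unfolding linear_diff[OF linear_tangent_map[OF smooth_G]] by (simp add: algebra_simps)
    then show "?v1 - ?v2 \<in> range (tangent_map A G x)" by blast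
  qed simp
qed

end

theorem corollary3p4:
  fixes A :: "('m::{t2_space,second_countable_topology}, 'n::finite) chart set"
    and sf :: space_form
    and \<phi> :: "'m \<Rightarrow> real ^ ('n + 2)"
  assumes "oriented_atlas A"
    and "immersed_hypersurface A sf \<phi>"
    and "immersion A (gauss_map A sf \<phi>)"
    and "nondegenerate_metric A (wedge_inner sf) (gauss_map A sf \<phi>)"
  shows "hamiltonian_minimal A sf (gauss_map A sf \<phi>) \<longleftrightarrow> W_critical A sf \<phi>"
proof -
  interpret hypersurface A sf \<phi> by unfold_locales (rule assms)+
  show ?thesis
    using hamiltonian_minimal_imp_W_critical W_critical_imp_hamiltonian_minimal assms by blast
qed

end
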